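(* Under the setup in the context, there is an isomorphism of $K$-algebras $\mathfrak R_{\mathrm{rk}}\cong\mathcal M_K$. Moreover, if the involution of $K$ is positive definite, then $\mathfrak R_{\mathrm{rk}}$, with the involution extending that of $\mathfrak R_\infty$, is a $*$-regular ring, $\Phi(\mathcal A)$ is a $*$-subalgebra of it (i.e. $\Phi$ is a $*$-homomorphism), and $\mathfrak R_{\mathrm{rk}}\cong\mathcal M_K$ as $*$-algebras over $K$.
   Context: Let $X$ be an infinite, totally disconnected, compact metrizable space, $T\colon X\to X$ a homeomorphism, $K$ a field with involution $\lambda\mapsto\bar\lambda$ (possibly the identity), $C_K(X)$ the $*$-algebra of locally constant functions $X\to K$, and $\mathcal A=C_K(X)\rtimes_T\mathbb Z$ the algebraic crossed product (finite sums $\sum f_it^i$, $tf=(f\circ T^{-1})t$, $(ft^i)^*=t^{-i}f^*$). Let $\mu$ be a full, ergodic, $T$-invariant Borel probability measure on $X$. Construction. Fix $y\in X$, a decreasing sequence of clopen sets $E_n$ with $\bigcap_nE_n=\{y\}$, and partitions $\mathcal P_n$ of $X\setminus E_n$ into finitely many nonempty pairwise disjoint clopen sets such that each member of $\mathcal P_{n+1}\cup\{E_{n+1}\}$ lies in a member of $\mathcal P_n\cup\{E_n\}$ and $\bigcup_n(\mathcal P_n\cup\{E_n\})$ generates the topology. $\mathcal A_n$ = unital $*$-subalgebra generated by $\{\chi_Zt:Z\in\mathcal P_n\}$; $\mathcal A_\infty=\bigcup_n\mathcal A_n$. $\mathcal V_n$ = set of nonempty $W=E_n\cap T^{-1}(Z_1)\cap\cdots\cap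 T^{-k+1}(Z_{k-1})\cap T^{-k}(E_n)$ ($Z_i\in\mathcal P_n$), $|W|=k$; $s_n=\chi_{X\setminus E_n}t$, $e_{ij}(W)=s_n^i\chi_W(s_n^* )^j$, $h_W=\sum_{l<|W|}\chi_{T^l(W)}$, $h_W\mathcal A_n\cong M_{|W|}(K)$ via $e_{ij}(W)\mapsto e_{ij}$. $\mathfrak R_n=\prod_{W\in\mathcal V_n}M_{|W|}(K)$ (conjugate-transpose involution in each factor), $\pi_n(a)=(h_Wa)_W$; $J(W,W')=\{j'\in\{0,\dots,|W'|-1\}:T^{j'}(W')\subseteq W\}$ and $j_n((a_W)_W)=(\sum_W\sum_{j'\in J(W,W')}\sum_{i,j}(a_W)_{ij}e_{i+j',j+j'})_{W'}$ (block-diagonal injective $*$-homomorphisms with $j_n\pi_n=\pi_{n+1}|_{\mathcal A_n}$). $\mathfrak R_\infty=\varinjlim(\mathfrak R_n,j_n)$ with embedding $\pi_\infty$ of $\mathcal A_\infty$; $\mathrm{rk}_{\mathfrak R_n}((x_W))=\sum_W\mu(W)\mathrm{Rk}(x_W)$ induce a rank function $\mathrm{rk}_{\mathfrak R_\infty}$, and $\mathfrak R_{\mathrm{rk}}$ is the completion of $\mathfrak R_\infty$ for the metric $\mathrm{rk}_{\mathfrak R_\infty}(x-y)$. $\Phi\colon\mathcal A\to\mathfrak R_{\mathrm{rk}}$ is the injective homomorphism extending $\pi_\infty$ with $\Phi(t)=\lim_n\pi_\infty(\chi_{X\setminus E_n}t)$. $\mathcal M_K$ (the von Neumann continuous factor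 over $K$) is the completion of $\varinjlim_nM_{2^n}(K)$ (connecting maps $x\mapsto\mathrm{diag}(x,x)$) with respect to the metric induced by its unique rank function (the limit of the normalized ranks $\mathrm{Rk}/2^n$), with the involution induced by the conjugate-transpose involutions. An involution on $K$ is positive definite if $\sum_{i=1}^n\bar x_ix_i=0$ implies all $x_i=0$. A $*$-regular ring is a von Neumann regular ring with an involution such that $x^*x=0$ implies $x=0$. *)

theory Defs
  imports "HOL-Probability.Probability" "Jordan_Normal_Form.DL_Rank"
begin

record ('a,'k) ralg =
  rcar  :: "'a set"
  radd  :: "'a \<Rightarrow> 'a \<Rightarrow> 'a"
  rmul  :: "'a \<Rightarrow> 'a \<Rightarrow> 'a"
  rsmul :: "'k \<Rightarrow> 'a \<Rightarrow> 'a"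
  rone  :: "'a"
  rzero :: "'a"
  rstar :: "'a \<Rightarrow> 'a"
  rrk   :: "'a \<Rightarrow> real"

definition rk_dist :: "('a,'k::ring_1) ralg \<Rightarrow> 'a \<Rightarrow> 'a \<Rightarrow> real" where
  "rk_dist R x y = rrk R (radd R x (rsmul R (-1) y))"

definition rk_cauchy :: "('a,'k::ring_1) ralg \<Rightarrow> (nat \<Rightarrow> 'a) \<Rightarrow> bool" where
  "rk_cauchy R s \<longleftrightarrow> (\<forall>k. s k \<in> rcar R) \<and>
     (\<forall>e>0. \<exists>N. \<forall>m\<ge>N. \<forall>n\<ge>N. rk_dist R (s m) (s n) < e)"

definition rk_equiv :: "('a,'k::ring_1) ralg \<Rightarrow> (nat \<Rightarrow> 'a) \<Rightarrow> (nat \<Rightarrow> 'a) \<Rightarrow> bool" where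
  "rk_equiv R s s' \<longleftrightarrow> (\<lambda>k. rk_dist R (s k) (s' k)) \<longlonglongrightarrow> 0"

definition rk_cls :: "('a,'k::ring_1) ralg \<Rightarrow> (nat \<Rightarrow> 'a) \<Rightarrow> (nat \<Rightarrow> 'a) set" where
  "rk_cls R s = {s'. rk_cauchy R s' \<and> rk_equiv R s s'}"

definition rep :: "'b set \<Rightarrow> 'b" where
  "rep A = (SOME s. s \<in> A)"

definition rk_completion :: "('a,'k::ring_1) ralg \<Rightarrow> ((nat \<Rightarrow> 'a) set, 'k) ralg" where
  "rk_completion R = \<lparr>
     rcar = {rk_cls R s | s. rk_cauchy R s},
     radd = (\<lambda>A B. rk_cls R (\<lambda>k. radd R (rep A k) (rep B k))),
     rmul = (\<lambda>A B. rk_cls R (\<lambda>k. rmul R (rep A k) (rep B k))),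
     rsmul = (\<lambda>c A. rk_cls R (\<lambda>k. rsmul R c (rep A k))),
     rone = rk_cls R (\<lambda>k. rone R),
     rzero = rk_cls R (\<lambda>k. rzero R),
     rstar = (\<lambda>A. rk_cls R (\<lambda>k. rstar R (rep A k))),
     rrk = (\<lambda>A. lim (\<lambda>k. rrk R (rep A k))) \<rparr>"

definition rk_embed :: "('a,'k::ring_1) ralg \<Rightarrow> 'a \<Rightarrow> (nat \<Rightarrow> 'a) set" where
  "rk_embed R x = rk_cls R (\<lambda>_. x)"

definition kalg_iso :: "('a,'k) ralg \<Rightarrow> ('b,'k) ralg \<Rightarrow> bool" where
  "kalg_iso R S \<longleftrightarrow> (\<exists>f. bij_betw f (rcar R) (rcar S) \<and>
     (\<forall>x\<in>rcar R. \<forall>y\<in>rcar R. f (radd R x y) = radd S (f x) (f y) \<and>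
                              f (rmul R x y) = rmul S (f x) (f y)) \<and>
     (\<forall>c. \<forall>x\<in>rcar R. f (rsmul R c x) = rsmul S c (f x)) \<and>
     f (rone R) = rone S)"

definition star_kalg_iso :: "('a,'k) ralg \<Rightarrow> ('b,'k) ralg \<Rightarrow> bool" where
  "star_kalg_iso R S \<longleftrightarrow> (\<exists>f. bij_betw f (rcar R) (rcar S) \<and>
     (\<forall>x\<in>rcar R. \<forall>y\<in>rcar R. f (radd R x y) = radd S (f x) (f y) \<and>
                              f (rmul R x y) = rmul S (f x) (f y)) \<and>
     (\<forall>c. \<forall>x\<in>rcar R. f (rsmul R c x) = rsmul S c (f x)) \<and>
     f (rone R) = rone S \<and>
     (\<forall>x\<in>rcar R. f (rstar R x) = rstar S (f x)))"

definition is_star_ring :: "('a,'k::ring_1) ralg \<Rightarrow> bool" where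
  "is_star_ring R \<longleftrightarrow>
     rone R \<in> rcar R \<and> rzero R \<in> rcar R \<and>
     (\<forall>x\<in>rcar R. \<forall>y\<in>rcar R. radd R x y \<in> rcar R \<and> rmul R x y \<in> rcar R) \<and>
     (\<forall>x\<in>rcar R. rsmul R (-1) x \<in> rcar R \<and> rstar R x \<in> rcar R) \<and>
     (\<forall>x\<in>rcar R. \<forall>y\<in>rcar R. \<forall>z\<in>rcar R.
        radd R (radd R x y) z = radd R x (radd R y z) \<and>
        rmul R (rmul R x y) z = rmul R x (rmul R y z) \<and>
        rmul R x (radd R y z) = radd R (rmul R x y) (rmul R x z) \<and>
        rmul R (radd R x y) z = radd R (rmul R x z) (rmul R y z)) \<and>
     (\<forall>x\<in>rcar R. \<forall>y\<in>rcar R. radd R x y = radd R y x) \<and>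
     (\<forall>x\<in>rcar R. radd R x (rzero R) = x \<and> radd R x (rsmul R (-1) x) = rzero R \<and>
                  rmul R (rone R) x = x \<and> rmul R x (rone R) = x) \<and>
     (\<forall>x\<in>rcar R. \<forall>y\<in>rcar R. rstar R (radd R x y) = radd R (rstar R x) (rstar R y) \<and>
                              rstar R (rmul R x y) = rmul R (rstar R y) (rstar R x)) \<and>
     (\<forall>x\<in>rcar R. rstar R (rstar R x) = x)"

definition star_regular :: "('a,'k::ring_1) ralg \<Rightarrow> bool" where
  "star_regular R \<longleftrightarrow> is_star_ring R \<and>
     (\<forall>x\<in>rcar R. \<exists>y\<in>rcar R. rmul R (rmul R x y) x = x) \<and>
     (\<forall>x\<in>rcar R. rmul R (rstar R x) x = rzero R \<longrightarrow> x = rzero R)"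

definition gen_star_subalg :: "('a,'k) ralg \<Rightarrow> 'a set \<Rightarrow> 'a set" where
  "gen_star_subalg R S = \<Inter>{B. B \<subseteq> rcar R \<and> S \<subseteq> B \<and> rone R \<in> B \<and>
      (\<forall>x\<in>B. \<forall>y\<in>B. radd R x y \<in> B \<and> rmul R x y \<in> B) \<and>
      (\<forall>c. \<forall>x\<in>B. rsmul R c x \<in> B) \<and> (\<forall>x\<in>B. rstar R x \<in> B)}"

definition mrank :: "'k::field mat \<Rightarrow> nat" where
  "mrank A = vec_space.rank (dim_row A) A"

definition ctrans :: "('k \<Rightarrow> 'k) \<Rightarrow> 'k mat \<Rightarrow> 'k mat" where
  "ctrans cj A = map_mat cj (transpose_mat A)"

text \<open>An element \<Sum> f_i t^i is represented by i \<mapsto> f_i.\<close>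

definition loc_const :: "('x::topological_space \<Rightarrow> 'k) \<Rightarrow> bool" where
  "loc_const f \<longleftrightarrow> (\<forall>x. \<exists>U. open U \<and> x \<in> U \<and> (\<forall>z\<in>U. f z = f x))"

definition Tpow :: "('x \<Rightarrow> 'x) \<Rightarrow> int \<Rightarrow> 'x \<Rightarrow> 'x" where
  "Tpow T i = (if 0 \<le> i then T ^^ nat i else (Hilbert_Choice.inv T) ^^ (nat (- i)))"

definition cp_mul :: "('x \<Rightarrow> 'x) \<Rightarrow> (int \<Rightarrow> 'x \<Rightarrow> 'k::field) \<Rightarrow> (int \<Rightarrow> 'x \<Rightarrow> 'k) \<Rightarrow> (int \<Rightarrow> 'x \<Rightarrow> 'k)" where
  "cp_mul T a b = (\<lambda>k x. \<Sum>i\<in>{i. a i \<noteq> (\<lambda>_. 0)}. a i x * b (k - i) (Tpow T (- i) x))"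

definition cp_star :: "('x \<Rightarrow> 'x) \<Rightarrow> ('k \<Rightarrow> 'k) \<Rightarrow> (int \<Rightarrow> 'x \<Rightarrow> 'k) \<Rightarrow> (int \<Rightarrow> 'x \<Rightarrow> 'k)" where
  "cp_star T cj a = (\<lambda>k x. cj (a (- k) (Tpow T (- k) x)))"

definition cp_alg :: "('x::topological_space \<Rightarrow> 'x) \<Rightarrow> ('k::field \<Rightarrow> 'k) \<Rightarrow> (int \<Rightarrow> 'x \<Rightarrow> 'k, 'k) ralg" where
  "cp_alg T cj = \<lparr>
     rcar = {a. finite {i. a i \<noteq> (\<lambda>_. 0)} \<and> (\<forall>i. loc_const (a i))},
     radd = (\<lambda>a b i x. a i x + b i x),
     rmul = cp_mul T,
     rsmul = (\<lambda>c a i x. c * a i x),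
     rone = (\<lambda>i x. if i = 0 then 1 else 0),
     rzero = (\<lambda>i x. 0),
     rstar = cp_star T cj,
     rrk = (\<lambda>_. 0) \<rparr>"

definition cp_chi :: "'x set \<Rightarrow> (int \<Rightarrow> 'x \<Rightarrow> 'k::field)" where
  "cp_chi S = (\<lambda>i x. if i = 0 \<and> x \<in> S then 1 else 0)"

definition cp_t :: "int \<Rightarrow> 'x \<Rightarrow> 'k::field" where
  "cp_t = (\<lambda>i x. if i = 1 then 1 else 0)"

definition cp_pow :: "('x \<Rightarrow> 'x) \<Rightarrow> (int \<Rightarrow> 'x \<Rightarrow> 'k::field) \<Rightarrow> nat \<Rightarrow> (int \<Rightarrow> 'x \<Rightarrow> 'k)" where
  "cp_pow T a m = (cp_mul T a ^^ m) (\<lambda>i x. if i = 0 then 1 else 0)"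

definition An :: "('x::topological_space \<Rightarrow> 'x) \<Rightarrow> ('k::field \<Rightarrow> 'k) \<Rightarrow> (nat \<Rightarrow> 'x set set) \<Rightarrow> nat \<Rightarrow> (int \<Rightarrow> 'x \<Rightarrow> 'k) set" where
  "An T cj P n = gen_star_subalg (cp_alg T cj) {cp_mul T (cp_chi Z) cp_t | Z. Z \<in> P n}"

definition is_Wrep :: "('x \<Rightarrow> 'x) \<Rightarrow> (nat \<Rightarrow> 'x set) \<Rightarrow> (nat \<Rightarrow> 'x set set) \<Rightarrow> nat \<Rightarrow> 'x set \<Rightarrow> nat \<Rightarrow> bool" where
  "is_Wrep T E P n W k \<longleftrightarrow> 1 \<le> k \<and> (\<exists>Z. (\<forall>i\<in>{1..<k}. Z i \<in> P n) \<and>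
      W = E n \<inter> (\<Inter>i\<in>{1..<k}. (T ^^ i) -` Z i) \<inter> (T ^^ k) -` E n)"

definition Vset :: "('x \<Rightarrow> 'x) \<Rightarrow> (nat \<Rightarrow> 'x set) \<Rightarrow> (nat \<Rightarrow> 'x set set) \<Rightarrow> nat \<Rightarrow> 'x set set" where
  "Vset T E P n = {W. W \<noteq> {} \<and> (\<exists>k. is_Wrep T E P n W k)}"

definition wlen :: "('x \<Rightarrow> 'x) \<Rightarrow> (nat \<Rightarrow> 'x set) \<Rightarrow> (nat \<Rightarrow> 'x set set) \<Rightarrow> nat \<Rightarrow> 'x set \<Rightarrow> nat" where
  "wlen T E P n W = (THE k. is_Wrep T E P n W k)"

definition s_el :: "('x \<Rightarrow> 'x) \<Rightarrow> (nat \<Rightarrow> 'x set) \<Rightarrow> nat \<Rightarrow> (int \<Rightarrow> 'x \<Rightarrow> 'k::field)" where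
  "s_el T E n = cp_mul T (cp_chi (- E n)) cp_t"

definition e_el :: "('x \<Rightarrow> 'x) \<Rightarrow> ('k::field \<Rightarrow> 'k) \<Rightarrow> (nat \<Rightarrow> 'x set) \<Rightarrow> nat \<Rightarrow> 'x set \<Rightarrow> nat \<Rightarrow> nat \<Rightarrow> (int \<Rightarrow> 'x \<Rightarrow> 'k)" where
  "e_el T cj E n W i j = cp_mul T (cp_mul T (cp_pow T (s_el T E n) i) (cp_chi W))
                            (cp_pow T (cp_star T cj (s_el T E n)) j)"

definition h_el :: "('x \<Rightarrow> 'x) \<Rightarrow> (nat \<Rightarrow> 'x set) \<Rightarrow> (nat \<Rightarrow> 'x set set) \<Rightarrow> nat \<Rightarrow> 'x set \<Rightarrow> (int \<Rightarrow> 'x \<Rightarrow> 'k::field)" where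
  "h_el T E P n W = (\<lambda>i x. \<Sum>l<wlen T E P n W. cp_chi ((T ^^ l) ` W) i x)"

text \<open>\<pi>_n(a) = (h_W a)_W, with h_W A_n identified with M_{|W|}(K) via e_ij(W) \<mapsto> e_ij.
  Off V_n the component is the empty matrix.\<close>
definition piN :: "('x \<Rightarrow> 'x) \<Rightarrow> ('k::field \<Rightarrow> 'k) \<Rightarrow> (nat \<Rightarrow> 'x set) \<Rightarrow> (nat \<Rightarrow> 'x set set) \<Rightarrow> nat \<Rightarrow> (int \<Rightarrow> 'x \<Rightarrow> 'k) \<Rightarrow> ('x set \<Rightarrow> 'k mat)" where
  "piN T cj E P n a = (\<lambda>W. if W \<in> Vset T E P n then
      (THE x. x \<in> carrier_mat (wlen T E P n W) (wlen T E P n W) \<and>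
         cp_mul T (h_el T E P n W) a =
           (\<lambda>i z. \<Sum>p<wlen T E P n W. \<Sum>q<wlen T E P n W. x $$ (p, q) * e_el T cj E n W p q i z))
      else 0\<^sub>m 0 0)"

definition Rn_car :: "('x \<Rightarrow> 'x) \<Rightarrow> (nat \<Rightarrow> 'x set) \<Rightarrow> (nat \<Rightarrow> 'x set set) \<Rightarrow> nat \<Rightarrow> ('x set \<Rightarrow> 'k::field mat) set" where
  "Rn_car T E P n = {x. \<forall>W. if W \<in> Vset T E P n
      then x W \<in> carrier_mat (wlen T E P n W) (wlen T E P n W) else x W = 0\<^sub>m 0 0}"

definition Jset :: "('x \<Rightarrow> 'x) \<Rightarrow> (nat \<Rightarrow> 'x set) \<Rightarrow> (nat \<Rightarrow> 'x set set) \<Rightarrow> nat \<Rightarrow> 'x set \<Rightarrow> 'x set \<Rightarrow> nat set" where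
  "Jset T E P n W W' = {j'. j' < wlen T E P (Suc n) W' \<and> (T ^^ j') ` W' \<subseteq> W}"

definition jmap :: "('x \<Rightarrow> 'x) \<Rightarrow> (nat \<Rightarrow> 'x set) \<Rightarrow> (nat \<Rightarrow> 'x set set) \<Rightarrow> nat \<Rightarrow> ('x set \<Rightarrow> 'k::field mat) \<Rightarrow> ('x set \<Rightarrow> 'k mat)" where
  "jmap T E P n x = (\<lambda>W'. if W' \<in> Vset T E P (Suc n) then
      mat (wlen T E P (Suc n) W') (wlen T E P (Suc n) W') (\<lambda>(p, q).
        \<Sum>W\<in>{W \<in> Vset T E P n. Jset T E P n W W' \<noteq> {}}. \<Sum>j'\<in>Jset T E P n W W'.
          (if j' \<le> p \<and> p < j' + wlen T E P n W \<and> j' \<le> q \<and> q < j' + wlen T E P n W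
           then x W $$ (p - j', q - j') else 0))
      else 0\<^sub>m 0 0)"

definition Rlift :: "('x \<Rightarrow> 'x) \<Rightarrow> (nat \<Rightarrow> 'x set) \<Rightarrow> (nat \<Rightarrow> 'x set set) \<Rightarrow> nat \<Rightarrow> nat \<times> ('x set \<Rightarrow> 'k::field mat) \<Rightarrow> ('x set \<Rightarrow> 'k mat)" where
  "Rlift T E P m p = snd (((\<lambda>(l, y). (Suc l, jmap T E P l y)) ^^ (m - fst p)) p)"

text \<open>R_\<infinity> = lim_{\<rightarrow>} (R_n, j_n), elements represented as pairs (n, x) with x \<in> R_n;
  the rank is rk_{R_n}((x_W)) = \<Sum>_W \<mu>(W) Rk(x_W).\<close>
definition Rinf :: "('x::topological_space \<Rightarrow> 'x) \<Rightarrow> ('k::field \<Rightarrow> 'k) \<Rightarrow> 'x measure \<Rightarrow> (nat \<Rightarrow> 'x set) \<Rightarrow> (nat \<Rightarrow> 'x set set) \<Rightarrow> (nat \<times> ('x set \<Rightarrow> 'k mat), 'k) ralg" where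
  "Rinf T cj M E P = \<lparr>
     rcar = {p. snd p \<in> Rn_car T E P (fst p)},
     radd = (\<lambda>p q. (max (fst p) (fst q),
               \<lambda>W. Rlift T E P (max (fst p) (fst q)) p W + Rlift T E P (max (fst p) (fst q)) q W)),
     rmul = (\<lambda>p q. (max (fst p) (fst q),
               \<lambda>W. Rlift T E P (max (fst p) (fst q)) p W * Rlift T E P (max (fst p) (fst q)) q W)),
     rsmul = (\<lambda>c p. (fst p, \<lambda>W. c \<cdot>\<^sub>m snd p W)),
     rone = (0, \<lambda>W. if W \<in> Vset T E P 0 then 1\<^sub>m (wlen T E P 0 W) else 0\<^sub>m 0 0),
     rzero = (0, \<lambda>W. if W \<in> Vset T E P 0 then 0\<^sub>m (wlen T E P 0 W) (wlen T E P 0 W) else 0\<^sub>m 0 0),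
     rstar = (\<lambda>p. (fst p, \<lambda>W. ctrans cj (snd p W))),
     rrk = (\<lambda>p. \<Sum>\<^sub>\<infinity>W\<in>Vset T E P (fst p). measure M W * real (mrank (snd p W))) \<rparr>"

definition Mlift :: "nat \<Rightarrow> nat \<times> 'k::field mat \<Rightarrow> 'k mat" where
  "Mlift m p = snd (((\<lambda>(l, A). (Suc l, four_block_mat A (0\<^sub>m (dim_row A) (dim_col A))
                                   (0\<^sub>m (dim_row A) (dim_col A)) A)) ^^ (m - fst p)) p)"

definition Minf :: "('k::field \<Rightarrow> 'k) \<Rightarrow> (nat \<times> 'k mat, 'k) ralg" where
  "Minf cj = \<lparr>
     rcar = {p. snd p \<in> carrier_mat (2 ^ fst p) (2 ^ fst p)},
     radd = (\<lambda>p q. (max (fst p) (fst q), Mlift (max (fst p) (fst q)) p + Mlift (max (fst p) (fst q)) q)),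
     rmul = (\<lambda>p q. (max (fst p) (fst q), Mlift (max (fst p) (fst q)) p * Mlift (max (fst p) (fst q)) q)),
     rsmul = (\<lambda>c p. (fst p, c \<cdot>\<^sub>m snd p)),
     rone = (0, 1\<^sub>m 1),
     rzero = (0, 0\<^sub>m 1 1),
     rstar = (\<lambda>p. (fst p, ctrans cj (snd p))),
     rrk = (\<lambda>p. real (mrank (snd p)) / 2 ^ fst p) \<rparr>"

definition MK :: "('k::field \<Rightarrow> 'k) \<Rightarrow> ((nat \<Rightarrow> nat \<times> 'k mat) set, 'k) ralg" where
  "MK cj = rk_completion (Minf cj)"

definition Rrk :: "('x::topological_space \<Rightarrow> 'x) \<Rightarrow> ('k::field \<Rightarrow> 'k) \<Rightarrow> 'x measure \<Rightarrow> (nat \<Rightarrow> 'x set) \<Rightarrow> (nat \<Rightarrow> 'x set set) \<Rightarrow> ((nat \<Rightarrow> nat \<times> ('x set \<Rightarrow> 'k mat)) set, 'k) ralg" where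
  "Rrk T cj M E P = rk_completion (Rinf T cj M E P)"

definition field_involution :: "('k::field \<Rightarrow> 'k) \<Rightarrow> bool" where
  "field_involution cj \<longleftrightarrow> (\<forall>a b. cj (a + b) = cj a + cj b \<and> cj (a * b) = cj a * cj b) \<and> (\<forall>a. cj (cj a) = a)"

definition pos_def_inv :: "('k::field \<Rightarrow> 'k) \<Rightarrow> bool" where
  "pos_def_inv cj \<longleftrightarrow> (\<forall>xs. (\<Sum>x\<leftarrow>xs. cj x * x) = 0 \<longrightarrow> (\<forall>x\<in>set xs. x = 0))"

definition clopen_set :: "'x::topological_space set \<Rightarrow> bool" where
  "clopen_set S \<longleftrightarrow> open S \<and> closed S"

end

theory Submission
  imports Defs
begin

text \<open>Both algebras are metric completions of direct limits of products of matrix algebras (the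
towers on one side, the algebras of size 2^l on the other). Ergodicity, through Garsia's maximal argument, shows
that for large m all level-m towers outside a set of small measure contain the level-n towers in almost the proportions
given by their measures. Hence a matrix algebra of size 2^l is cut into copies of the level-n towers in these
proportions, and almost all of a level-m tower is in turn cut into copies of such a matrix template. Alternating the
two packings gives block-diagonal maps that are *-homomorphisms up to corners of small rank and intertwine the connecting
maps up to summable errors; their limits are mutually inverse rank-preserving *-isomorphisms.

Regularity passes to the completion because inner inverses depend on the matrix in a Lipschitz way for the rank metric:
a Cauchy sequence admits a Cauchy sequence of inner inverses. For a positive definite involution the rank of x* x equals
that of x, so the involution stays proper in the limit. Finally the truncated shifts are isometries up to rank
mu (E n), so Phi t is unitary in the limit, and Phi is a *-homomorphism.\<close>

section \<open>Rank and adjoints of matrices\<close>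

text \<open>The obstacle is that no finite level of one side fits exactly into the other: there may
  be infinitely many towers and their weights need not be dyadic. A template of size 2^l therefore
  receives floor(2^l * weight) copies of each tower of a finite set, and what is left over becomes
  an unlabelled corner on which the maps vanish. Every map comes from a labelling of rows by
  positions inside blocks. Such maps respect sums, products and conjugate transposes exactly, so
  errors occur only in the unit, in the rank and in the comparison of consecutive stages. Two
  matrices that agree on Q x Q differ in rank by at most twice the number of rows outside Q; this
  turns each combinatorial loss into a rank distance. Maps are built only from the dyadic matrices
  to the towers. Packing towers into templates enters as density of the images, which makes the
  limiting isometry onto; its inverse is then taken. Surplus copies of a tower can be left out, so
  only a shortage of copies has to be controlled, by a one-sided ergodic estimate. The isomorphism
  of algebras is the one of *-algebras with the involution forgotten.\<close>

lemma mrank_add: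
  assumes "A \<in> carrier_mat n n" "B \<in> carrier_mat n n"
  shows "mrank (A + B) \<le> mrank A + mrank B"
  using vec_space.rank_subadditive[OF assms] assms by (simp add: mrank_def)

lemma mrank_zero [simp]: "mrank (0\<^sub>m n n) = 0"
  using vec_space.rank_0I by (simp add: mrank_def)

lemma mrank_le: "A \<in> carrier_mat n n \<Longrightarrow> mrank A \<le> n"
  using vec_space.rank_le_nc[of A n n] by (auto simp add: mrank_def)

lemma mrank_full:
  assumes "A \<in> carrier_mat n n" "det A \<noteq> 0"
  shows "mrank A = n"
  using vec_space.det_rank_iff[of A n] assms by (auto simp: mrank_def)

text \<open>Each column of \<open>A * B\<close> is \<open>A\<close> applied to a column of
  \<open>B\<close>, so the column space of the product is a subspace of the column space of
  \<open>A\<close>.\<close>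

lemma mrank_mult_left:
  fixes A :: "'a::field mat"
  assumes A: "A \<in> carrier_mat n n" and B: "B \<in> carrier_mat n n"
  shows "mrank (A * B) \<le> mrank A"
proof -
  interpret vec_space "TYPE('a)" n .
  have AB: "A * B \<in> carrier_mat n n" using A B by auto
  have sA: "set (cols A) \<subseteq> carrier_vec n" using A cols_dim by blast
  have sAB: "set (cols (A*B)) \<subseteq> carrier_vec n" using AB cols_dim by blast
  have sub: "set (cols (A * B)) \<subseteq> span (set (cols A))"
  proof
    fix v assume "v \<in> set (cols (A * B))"
    then obtain j where j: "j < n" "v = col (A * B) j"
      using AB by (auto simp: cols_def)
    have v: "v = A *\<^sub>v col B j" using j A B by (auto simp: col_mult2)
    have "col B j \<in> carrier_vec n" using B j by auto
    then have "A *\<^sub>v col B j \<in> span (set (cols A))"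
    proof -
      let ?c = "col B j"
      have "lincomb_list (($) ?c) (cols A) = mat_of_cols n (cols A) *\<^sub>v vec (length (cols A)) (($) ?c)"
        by (rule lincomb_list_as_mat_mult) (use sA in auto)
      also have "mat_of_cols n (cols A) = A" using A by (metis carrier_matD(1) mat_of_cols_cols)
      also have "vec (length (cols A)) (($) ?c) = ?c" using A B j by auto
      finally have "lincomb_list (($) ?c) (cols A) = A *\<^sub>v ?c" .
      then show ?thesis using span_list_as_span[OF sA] unfolding span_list_def by (metis (mono_tags, lifting) UNIV_I mem_Collect_eq in_span_listI span_list_def)
    qed
    then show "v \<in> span (set (cols A))" using v by simp
  qed
  have "span (set (cols (A*B))) \<subseteq> span (set (cols A))"
    using sub sA by (simp add: span_subsetI)
  then have "subspace class_ring (span (set (cols (A*B)))) (span_vs (set (cols A)))"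
    by (intro nested_subspaces span_is_subspace) (use sA sAB in auto)
  moreover have "vectorspace class_ring (span_vs (set (cols A)))"
    using span_is_subspace[OF sA] subspace_is_vs by blast
  ultimately have "vectorspace.dim class_ring (span_vs (set (cols (A*B)))) \<le> vectorspace.dim class_ring (span_vs (set (cols A)))"
    using vectorspace.subspace_dim[of class_ring "span_vs (set (cols A))" "span (set (cols (A*B)))"]
      fin_dim_span_cols[OF A] fin_dim_span_cols[OF AB] by auto
  then show ?thesis using A AB by (simp add: mrank_def rank_def)
qed

text \<open>Split off one column of \<open>I\<close> at a time: a matrix supported in a single
  column is an outer product, of rank at most one.\<close>

lemma mrank_le_card_cols:
  fixes A :: "'a::field mat"
  assumes "finite I" "A \<in> carrier_mat n n" "\<And>p q. p < n \<Longrightarrow> q < n \<Longrightarrow> q \<notin> I \<Longrightarrow> A $$ (p,q) = 0"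
  shows "mrank A \<le> card I"
  using assms
proof (induction I arbitrary: A rule: finite_induct)
  case empty
  then have "A = 0\<^sub>m n n" by (intro eq_matI) auto
  then show ?case by simp
next
  case (insert c I)
  define B where "B = mat n n (\<lambda>(p,q). if q = c then A $$ (p,q) else 0)"
  define C where "C = mat n n (\<lambda>(p,q). if q = c then 0 else A $$ (p,q))"
  have A: "A = B + C" using insert.prems by (intro eq_matI) (auto simp: B_def C_def)
  have B: "B \<in> carrier_mat n n" and C: "C \<in> carrier_mat n n" by (auto simp: B_def C_def)
  have "mrank C \<le> card I"
    by (rule insert.IH[OF C]) (use insert.prems in \<open>auto simp: C_def\<close>)
  moreover have "mrank B \<le> 1"
    using vec_space.rank_le_1_product_entries[OF B, of "\<lambda>p. A $$ (p,c)" "\<lambda>q. if q = c then 1 else 0"] B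
    by (auto simp: mrank_def B_def)
  ultimately show ?case using mrank_add[OF B C] insert.hyps A by simp
qed

definition diag01 :: "nat \<Rightarrow> nat set \<Rightarrow> 'a::field mat" where
  "diag01 n I = mat n n (\<lambda>(p,q). if p = q \<and> p \<in> I then 1 else 0)"

lemma diag01_carrier [simp]: "diag01 n I \<in> carrier_mat n n"
  and diag01_dim [simp]: "dim_row (diag01 n I) = n" "dim_col (diag01 n I) = n"
  by (auto simp: diag01_def)

lemma mult_diag01_index:
  assumes "A \<in> carrier_mat n n" "p < n" "q < n"
  shows "(A * diag01 n I) $$ (p,q) = (if q \<in> I then A $$ (p,q) else 0)"
    and "(diag01 n I * A) $$ (p,q) = (if p \<in> I then A $$ (p,q) else 0)"
proof -
  have "(A * diag01 n I) $$ (p,q) = (\<Sum>s = 0..<n. A $$ (p,s) * (if s = q \<and> s \<in> I then 1 else 0))"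
    using assms by (auto simp: diag01_def scalar_prod_def)
  also have "\<dots> = (\<Sum>s = 0..<n. if s = q then (if q \<in> I then A $$ (p,q) else 0) else 0)"
    by (rule sum.cong) auto
  finally show "(A * diag01 n I) $$ (p,q) = (if q \<in> I then A $$ (p,q) else 0)"
    using assms by simp
  have "(diag01 n I * A) $$ (p,q) = (\<Sum>s = 0..<n. (if p = s \<and> p \<in> I then 1 else 0) * A $$ (s,q))"
    using assms by (auto simp: diag01_def scalar_prod_def)
  also have "\<dots> = (\<Sum>s = 0..<n. if s = p then (if p \<in> I then A $$ (p,q) else 0) else 0)"
    by (rule sum.cong) auto
  finally show "(diag01 n I * A) $$ (p,q) = (if p \<in> I then A $$ (p,q) else 0)"
    using assms by simp
qed

lemma mrank_mult_diag01_le: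
  assumes "A \<in> carrier_mat n n" "finite I"
  shows "mrank (A * diag01 n I) \<le> card I"
  by (rule mrank_le_card_cols[OF assms(2)]) (use assms in \<open>auto simp: mult_diag01_index simp del: index_mult_mat(1)\<close>)

text \<open>The lower bound comes from the complement: \<open>Q\<close> has full rank and is the sum
  of its columns in \<open>I\<close> and the remaining ones, which contribute at most n - card
  I.\<close>

lemma mrank_mult_diag01:
  fixes Q :: "'a::field mat"
  assumes Q: "Q \<in> carrier_mat n n" "det Q \<noteq> 0" and I: "I \<subseteq> {..<n}"
  shows "mrank (Q * diag01 n I) = card I"
proof -
  have fin: "finite I" using I finite_subset by blast
  let ?J = "{..<n} - I"
  have eq: "Q = Q * diag01 n I + Q * diag01 n ?J"
    by (rule eq_matI) (use Q in \<open>auto simp: mult_diag01_index simp del: index_mult_mat(1)\<close>)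
  have c: "Q * diag01 n I \<in> carrier_mat n n" "Q * diag01 n ?J \<in> carrier_mat n n" using Q by auto
  have "n = mrank Q" using mrank_full[OF Q] by simp
  also have "\<dots> \<le> mrank (Q * diag01 n I) + mrank (Q * diag01 n ?J)"
    using mrank_add[OF c] eq by simp
  also have "\<dots> \<le> mrank (Q * diag01 n I) + card ?J"
    using mrank_mult_diag01_le[OF Q(1), of ?J] by simp
  also have "card ?J = n - card I" using I fin by (simp add: card_Diff_subset)
  finally have "card I \<le> mrank (Q * diag01 n I)"
    using card_mono[OF _ I] by simp
  then show ?thesis using mrank_mult_diag01_le[OF Q(1) fin] by simp
qed

lemma mrank_diag01:
  assumes "I \<subseteq> {..<n}"
  shows "mrank (diag01 n I :: 'a::field mat) = card I"
  using mrank_mult_diag01[of "1\<^sub>m n :: 'a mat" n I] assms by simp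

text \<open>Rank becomes a count of coordinates. \<open>U * A * V = diag01 n I\<close> bounds the
  rank of \<open>A\<close> from below by \<open>card I\<close>, the factorization through
  \<open>diag01 n I\<close> bounds it from above, and \<open>V * U\<close> is an inner inverse. The
  later rank computations use only these clauses. \<open>V\<close> is merely a selection of pivot
  columns and may be singular.\<close>

lemma rank_normal_form:
  fixes A :: "'a::field mat"
  assumes A: "A \<in> carrier_mat n n"
  obtains U V L R I where "U \<in> carrier_mat n n" "V \<in> carrier_mat n n" "L \<in> carrier_mat n n" "R \<in> carrier_mat n n"
    "I \<subseteq> {..<n}" "card I = mrank A" "U * A * V = diag01 n I" "A = L * diag01 n I * R" "A * (V * U) * A = A"
proof -
  obtain P Q where PQ: "gauss_jordan_single A = P * A" "P \<in> carrier_mat n n" "Q \<in> carrier_mat n n"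
    "P * Q = 1\<^sub>m n" "Q * P = 1\<^sub>m n"
    using gauss_jordan_single(4)[OF A refl] by blast
  define R where "R = P * A"
  have R: "R \<in> carrier_mat n n" using PQ A by (auto simp: R_def)
  have "row_echelon_form R" using gauss_jordan_single(3)[OF A refl] PQ(1) R_def by simp
  then obtain f where f: "pivot_fun R f n" using R by (auto simp: row_echelon_form_def)
  have "dim_row R = n" using R by auto
  note pv = pivot_funD[OF this f]
  define I where "I = {b. b < n \<and> f b < n}"
  \<comment> \<open>Column b of \<open>S\<close> is the unit vector at the pivot column
    \<open>f b\<close> of row b. A zero row has \<open>f b = n\<close>, out of range, and then
    column b vanishes.\<close>
  define S where "S = mat n n (\<lambda>(a,b). if a = f b then 1 else (0::'a))"
  have S: "S \<in> carrier_mat n n" by (auto simp: S_def)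
  have RS: "R * S = diag01 n I"
  proof (rule eq_matI)
    fix i j assume "i < dim_row (diag01 n I :: 'a mat)" "j < dim_col (diag01 n I :: 'a mat)"
    then have ij: "i < n" "j < n" by auto
    have "(R * S) $$ (i,j) = (\<Sum>a = 0..<n. R $$ (i,a) * (if a = f j then 1 else 0))"
      using R S ij by (auto simp: scalar_prod_def S_def)
    also have "\<dots> = (\<Sum>a = 0..<n. if a = f j then R $$ (i, f j) else 0)"
      by (rule sum.cong) auto
    also have "\<dots> = (if f j < n then R $$ (i, f j) else 0)" by simp
    also have "\<dots> = diag01 n I $$ (i,j)"
      using ij pv(4)[of j] pv(5)[of j i] by (auto simp: diag01_def I_def)
    finally show "(R * S) $$ (i,j) = diag01 n I $$ (i,j)" .
  qed (use R S in auto)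
  have DR: "diag01 n I * R = R"
  proof (rule eq_matI)
    fix i j assume "i < dim_row R" "j < dim_col R"
    then have ij: "i < n" "j < n" using R by auto
    show "(diag01 n I * R) $$ (i,j) = R $$ (i,j)"
      unfolding mult_diag01_index(2)[OF R ij]
      using pv(1)[OF ij(1)] pv(2)[of i j] ij by (auto simp: I_def)
  qed (use R in auto)
  have QR: "Q * R = A" unfolding R_def using PQ A
    by (simp add: assoc_mult_mat[of _ n n _ n _ n, symmetric])
  have AQ: "A = Q * diag01 n I * R"
    using assoc_mult_mat[OF PQ(3) diag01_carrier R, of I] DR QR by simp
  have I: "I \<subseteq> {..<n}" by (auto simp: I_def)
  have detQ: "det Q \<noteq> 0" using det_mult[OF PQ(2,3)] PQ(4) by auto
  have "A * S = Q * diag01 n I" using assoc_mult_mat[OF PQ(3) R S] QR RS by simp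
  then have "card I \<le> mrank A"
    using mrank_mult_diag01[OF PQ(3) detQ I] mrank_mult_left[OF A S] by simp
  moreover have "mrank A \<le> card I"
    using mrank_mult_left[of "Q * diag01 n I" n R] mrank_mult_diag01[OF PQ(3) detQ I] AQ PQ(3) R by auto
  ultimately have r: "card I = mrank A" by simp
  have "P * A * S = diag01 n I" using RS R_def by simp
  moreover have "A * (S * P) * A = A"
  proof -
    have "A * (S * P) * A = A * S * (P * A)" using A S PQ(2)
      by (simp add: assoc_mult_mat[of _ n n _ n _ n] mult_carrier_mat[of _ n n _ n])
    also have "\<dots> = Q * diag01 n I * R" using \<open>A * S = Q * diag01 n I\<close> R_def by simp
    finally show ?thesis using AQ by simp
  qed
  ultimately show thesis using that[OF PQ(2) S PQ(3) R I r _ AQ] by simp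
qed

lemma mrank_factor_le:
  fixes L :: "'a::field mat"
  assumes "L \<in> carrier_mat n n" "R \<in> carrier_mat n n" "finite I"
  shows "mrank (L * diag01 n I * R) \<le> card I"
  using mrank_mult_left[of "L * diag01 n I" n R] mrank_mult_diag01_le[OF assms(1,3)] assms by force

text \<open>The comparison of column spaces does not reach this side. The factorization of
  \<open>B\<close> through \<open>diag01 n I\<close> is multiplied by \<open>A\<close> on the left
  instead.\<close>

lemma mrank_mult_right:
  fixes A :: "'a::field mat"
  assumes A: "A \<in> carrier_mat n n" and B: "B \<in> carrier_mat n n"
  shows "mrank (A * B) \<le> mrank B"
proof -
  obtain L R I where h: "L \<in> carrier_mat n n" "R \<in> carrier_mat n n"
    "I \<subseteq> {..<n}" "card I = mrank B" "B = L * diag01 n I * R"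
    using rank_normal_form[OF B] by metis
  have "A * B = (A * L) * diag01 n I * R"
    using A h(1,2) by (subst h(5)) (simp add: assoc_mult_mat[of _ n n _ n _ n] mult_carrier_mat[of _ n n _ n])
  then show ?thesis using mrank_factor_le[of "A * L" n R I] A h finite_subset[OF h(3)] by auto
qed

lemma diag01_transpose [simp]: "transpose_mat (diag01 n I) = diag01 n I"
  by (rule eq_matI) (auto simp: diag01_def)

text \<open>Transposing a factorization through \<open>diag01 n I\<close> gives a factorization
  through the same idempotent, so the rank cannot grow; doing it twice gives equality.\<close>

lemma mrank_transpose:
  fixes A :: "'a::field mat"
  assumes A: "A \<in> carrier_mat n n"
  shows "mrank (transpose_mat A) = mrank A"
proof -
  have le: "mrank (transpose_mat B) \<le> mrank B" if B: "B \<in> carrier_mat n n" for B :: "'a mat"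
  proof -
    obtain L R I where h: "L \<in> carrier_mat n n" "R \<in> carrier_mat n n"
      "I \<subseteq> {..<n}" "card I = mrank B" "B = L * diag01 n I * R"
      using rank_normal_form[OF B] by metis
    have "transpose_mat B = transpose_mat R * diag01 n I * transpose_mat L"
      using h by (subst h(5), subst transpose_mult[of _ n n _ n], simp, simp)
         (subst transpose_mult[of _ n n _ n], auto intro!: assoc_mult_mat[symmetric])
    then show ?thesis using mrank_factor_le[of "transpose_mat R" n "transpose_mat L" I] h finite_subset[OF h(3)] by auto
  qed
  show ?thesis using le[OF A] le[of "transpose_mat A"] A by (auto intro: antisym)
qed

lemma field_involutionD:
  assumes "field_involution cj"
  shows "cj (a + b) = cj a + cj b" "cj (a * b) = cj a * cj b" "cj (cj a) = a" "cj 0 = 0" "cj 1 = 1" "cj (- a) = - cj a"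
proof -
  show ad: "cj (a + b) = cj a + cj b" for a b using assms by (simp add: field_involution_def)
  show mu: "cj (a * b) = cj a * cj b" for a b using assms by (simp add: field_involution_def)
  show iv: "cj (cj a) = a" for a using assms by (simp add: field_involution_def)
  show z: "cj 0 = 0" using ad[of 0 0] by (metis add.right_neutral add_left_imp_eq)
  have "cj 1 \<noteq> 0" using iv[of 1] z by force
  then show "cj 1 = 1" using mu[of 1 1] by simp
  show "cj (- a) = - cj a" using ad[of a "- a"] z by (simp add: eq_neg_iff_add_eq_0 add.commute)
qed

lemma cj_sum:
  assumes "field_involution cj"
  shows "cj (sum f S) = (\<Sum>x\<in>S. cj (f x))"
  by (induction S rule: infinite_finite_induct) (auto simp: field_involutionD[OF assms])

lemma ctrans_carrier [simp]: "ctrans cj A \<in> carrier_mat n m \<longleftrightarrow> A \<in> carrier_mat m n"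
  by (auto simp: ctrans_def)

lemma ctrans_index [simp]: "p < dim_col A \<Longrightarrow> q < dim_row A \<Longrightarrow> ctrans cj A $$ (p,q) = cj (A $$ (q,p))"
  by (auto simp: ctrans_def)

lemma ctrans_dim [simp]: "dim_row (ctrans cj A) = dim_col A" "dim_col (ctrans cj A) = dim_row A"
  by (auto simp: ctrans_def)

lemma ctrans_mult:
  assumes "field_involution cj" "A \<in> carrier_mat n n" "B \<in> carrier_mat n n"
  shows "ctrans cj (A * B) = ctrans cj B * ctrans cj A"
  by (rule eq_matI) (use assms(2,3) in \<open>auto simp: scalar_prod_def cj_sum[OF assms(1)] field_involutionD[OF assms(1)] mult.commute\<close>)

lemma ctrans_add:
  assumes "field_involution cj" "A \<in> carrier_mat n n" "B \<in> carrier_mat n n"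
  shows "ctrans cj (A + B) = ctrans cj A + ctrans cj B"
  by (rule eq_matI) (use assms(2,3) in \<open>auto simp: field_involutionD[OF assms(1)]\<close>)

lemma ctrans_ctrans [simp]:
  assumes "field_involution cj"
  shows "ctrans cj (ctrans cj A) = A"
  by (rule eq_matI) (auto simp: field_involutionD[OF assms])

text \<open>The involution fixes 0 and 1, hence \<open>diag01 n I\<close>, and the argument for the
  transpose carries over.\<close>

lemma mrank_ctrans:
  fixes A :: "'a::field mat"
  assumes cj: "field_involution cj" and A: "A \<in> carrier_mat n n"
  shows "mrank (ctrans cj A) = mrank A"
proof -
  have le: "mrank (ctrans cj B) \<le> mrank B" if B: "B \<in> carrier_mat n n" for B :: "'a mat"
  proof -
    obtain L R I where h: "L \<in> carrier_mat n n" "R \<in> carrier_mat n n"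
      "I \<subseteq> {..<n}" "card I = mrank B" "B = L * diag01 n I * R"
      using rank_normal_form[OF B] by metis
    have d: "ctrans cj (diag01 n I) = diag01 n I"
      by (rule eq_matI) (auto simp: diag01_def field_involutionD[OF cj])
    have "ctrans cj B = ctrans cj R * (diag01 n I * ctrans cj L)"
      using h by (subst h(5), subst ctrans_mult[OF cj, of _ n]) (auto simp: ctrans_mult[OF cj, of _ n] d)
    also have "\<dots> = ctrans cj R * diag01 n I * ctrans cj L"
      using h by (intro assoc_mult_mat[symmetric, of _ n n _ n _ n]) auto
    finally show ?thesis using mrank_factor_le[of "ctrans cj R" n "ctrans cj L" I] h finite_subset[OF h(3)] by auto
  qed
  show ?thesis using le[OF A] le[of "ctrans cj A"] A cj by (auto intro: antisym)
qed

lemma mrank_smult_le: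
  fixes A :: "'a::field mat"
  assumes A: "A \<in> carrier_mat n n"
  shows "mrank (c \<cdot>\<^sub>m A) \<le> mrank A"
proof -
  have "c \<cdot>\<^sub>m A = (c \<cdot>\<^sub>m 1\<^sub>m n) * A" using A by auto
  then show ?thesis using mrank_mult_right[of "c \<cdot>\<^sub>m 1\<^sub>m n" n A] A by auto
qed

lemma mrank_le_card_rows:
  fixes A :: "'a::field mat"
  assumes "finite I" "A \<in> carrier_mat n n" "\<And>p q. p < n \<Longrightarrow> q < n \<Longrightarrow> p \<notin> I \<Longrightarrow> A $$ (p,q) = 0"
  shows "mrank A \<le> card I"
  using mrank_le_card_cols[of I "transpose_mat A" n] mrank_transpose[of A n] assms by auto

text \<open>The main source of distance estimates: applied to a difference of two matrices that
  agree on the complement of \<open>I\<close> in both coordinates. The factor 2 is one for the rows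
  in \<open>I\<close> and one for the columns.\<close>

lemma mrank_le_card_cross:
  fixes A :: "'a::field mat"
  assumes "finite I" "A \<in> carrier_mat n n"
    "\<And>p q. p < n \<Longrightarrow> q < n \<Longrightarrow> p \<notin> I \<Longrightarrow> q \<notin> I \<Longrightarrow> A $$ (p,q) = 0"
  shows "mrank A \<le> 2 * card I"
proof -
  define B where "B = mat n n (\<lambda>(p,q). if p \<in> I then A $$ (p,q) else 0)"
  define C where "C = mat n n (\<lambda>(p,q). if p \<in> I then 0 else A $$ (p,q))"
  have A: "A = B + C" using assms by (intro eq_matI) (auto simp: B_def C_def)
  have B: "B \<in> carrier_mat n n" and C: "C \<in> carrier_mat n n" by (auto simp: B_def C_def)
  have "mrank B \<le> card I" by (rule mrank_le_card_rows[OF assms(1) B]) (auto simp: B_def)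
  moreover have "mrank C \<le> card I"
    by (rule mrank_le_card_cols[OF assms(1) C]) (use assms(3) in \<open>auto simp: C_def\<close>)
  ultimately show ?thesis using mrank_add[OF B C] A by simp
qed

declare minus_carrier_mat [simp]

lemma minus_mat_alt:
  fixes A :: "'a::field mat"
  assumes "A \<in> carrier_mat n m" "B \<in> carrier_mat n m"
  shows "A + (-1) \<cdot>\<^sub>m B = A - B"
  by (rule eq_matI) (use assms in auto)

lemma mrank_uminus:
  fixes A :: "'a::field mat"
  assumes A: "A \<in> carrier_mat n n"
  shows "mrank (- A) = mrank A"
proof -
  have u: "- B = (-1) \<cdot>\<^sub>m B" for B :: "'a mat" by (rule eq_matI) auto
  have "mrank (- A) \<le> mrank A" using mrank_smult_le[OF A, of "-1"] u[of A] by simp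
  moreover have "mrank (- (- A)) \<le> mrank (- A)" using mrank_smult_le[of "- A" n "-1"] A u[of "- A"] by simp
  ultimately show ?thesis by simp
qed

lemma mrank_minus_le:
  fixes A :: "'a::field mat"
  assumes "A \<in> carrier_mat n n" "B \<in> carrier_mat n n"
  shows "mrank (A - B) \<le> mrank A + mrank B"
  using mrank_add[of A n "- B"] mrank_uminus[of B n] assms by (simp add: add_uminus_minus_mat)

lemma mrank_minus_commute:
  fixes A :: "'a::field mat"
  assumes "A \<in> carrier_mat n n" "B \<in> carrier_mat n n"
  shows "mrank (A - B) = mrank (B - A)"
proof -
  have "A - B = - (B - A)" using assms by (intro eq_matI) auto
  then show ?thesis using mrank_uminus[of "B - A" n] assms by simp
qed

lemma mrank_minus_triangle:
  fixes A :: "'a::field mat"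
  assumes "A \<in> carrier_mat n n" "B \<in> carrier_mat n n" "C \<in> carrier_mat n n"
  shows "mrank (A - C) \<le> mrank (A - B) + mrank (B - C)"
proof -
  have "A - C = (A - B) + (B - C)" using assms by (intro eq_matI) auto
  then show ?thesis using mrank_add[of "A - B" n "B - C"] assms by simp
qed

lemma mrank_minus_mult:
  fixes A :: "'a::field mat"
  assumes "A \<in> carrier_mat n n" "B \<in> carrier_mat n n" "C \<in> carrier_mat n n" "D \<in> carrier_mat n n"
  shows "mrank (A * B - C * D) \<le> mrank (A - C) + mrank (B - D)"
proof -
  have "A * B - C * D = (A - C) * B + C * (B - D)"
    using assms by (intro eq_matI)
     (auto simp: minus_mult_distrib_mat[of _ n n _ _ n] mult_minus_distrib_mat[of _ n n _ n] simp del: index_mult_mat(1))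
  moreover have "mrank ((A - C) * B) \<le> mrank (A - C)" "mrank (C * (B - D)) \<le> mrank (B - D)"
    using mrank_mult_left[of "A - C" n B] mrank_mult_right[of C n "B - D"] assms by auto
  moreover have "mrank ((A - C) * B + C * (B - D)) \<le> mrank ((A - C) * B) + mrank (C * (B - D))"
    by (rule mrank_add[of _ n]) (use assms in auto)
  ultimately show ?thesis by simp
qed

lemma mrank_le_mrank_minus:
  fixes A :: "'a::field mat"
  assumes "A \<in> carrier_mat n n" "B \<in> carrier_mat n n"
  shows "mrank A \<le> mrank B + mrank (A - B)"
proof -
  have "A = B + (A - B)" using assms by (intro eq_matI) auto
  then show ?thesis using mrank_add[of B n "A - B"] assms by simp
qed

text \<open>If B is an inner inverse of A, then C - C B C has rank at most 2 rk (A - C), and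
  B + (1 - B C) H (1 - C B) is an inner inverse of C whenever H is one of C - C B C.\<close>

lemma inner_inverse_lipschitz:
  fixes A :: "'a::field mat"
  assumes A: "A \<in> carrier_mat n n" and B: "B \<in> carrier_mat n n" and C: "C \<in> carrier_mat n n"
    and ABA: "A * B * A = A"
  obtains B' where "B' \<in> carrier_mat n n" "C * B' * C = C" "mrank (B' - B) \<le> 2 * mrank (A - C)"
proof -
  define G where "G = C - C * B * C"
  have G: "G \<in> carrier_mat n n" using B C by (auto simp: G_def)
  have one: "1\<^sub>m n \<in> carrier_mat n n" by simp
  have CBC: "C * B * C \<in> carrier_mat n n" and ABC: "A * B * C \<in> carrier_mat n n"  and AB: "A * B \<in> carrier_mat n n"
    and BC: "B * C \<in> carrier_mat n n" and CB: "C * B \<in> carrier_mat n n"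
    using A B C by auto
  note as = assoc_mult_mat[of _ n n _ n _ n]
  \<comment> \<open>After expansion everything cancels by \<open>A * B * A = A\<close>. Both
    summands contain the factor \<open>C - A\<close>, which gives the constant 2.\<close>
  have "G = (C - A) * (1\<^sub>m n - B * C) - A * B * (C - A)"
  proof (rule eq_matI)
    fix i j assume "i < dim_row ((C - A) * (1\<^sub>m n - B * C) - A * B * (C - A))"
      "j < dim_col ((C - A) * (1\<^sub>m n - B * C) - A * B * (C - A))"
    then have ij: "i < n" "j < n" using A B C by auto
    have e: "(C - A) * (1\<^sub>m n - B * C) = C - A - (C * B * C - A * B * C)"
      using A B C by (simp add: mult_minus_distrib_mat[of _ n n _ n] minus_mult_distrib_mat[of _ n n _ _ n] as
         mult_carrier_mat[of _ n n _ n])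
    have e2: "A * B * (C - A) = A * B * C - A"
      using mult_minus_distrib_mat[OF AB C A] ABA by simp
    show "G $$ (i,j) = ((C - A) * (1\<^sub>m n - B * C) - A * B * (C - A)) $$ (i,j)"
      unfolding e e2 G_def using ij A C CBC ABC by (auto simp del: index_mult_mat(1))
  qed (use A B C in \<open>auto simp: G_def\<close>)
  moreover have "mrank ((C - A) * (1\<^sub>m n - B * C)) \<le> mrank (C - A)"
    by (rule mrank_mult_left[of _ n]) (use A B C in auto)
  moreover have "mrank (A * B * (C - A)) \<le> mrank (C - A)"
    by (rule mrank_mult_right[of _ n]) (use A B C in auto)
  moreover have "mrank ((C - A) * (1\<^sub>m n - B * C) - A * B * (C - A)) \<le> mrank ((C - A) * (1\<^sub>m n - B * C)) + mrank (A * B * (C - A))"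
    by (rule mrank_minus_le[of _ n]) (use A B C in auto)
  ultimately have rG: "mrank G \<le> 2 * mrank (A - C)" using mrank_minus_commute[OF A C] by simp
  obtain U V where UV: "U \<in> carrier_mat n n" "V \<in> carrier_mat n n" "G * (V * U) * G = G"
    using rank_normal_form[OF G] by metis
  define X where "X = V * U"
  have X: "X \<in> carrier_mat n n" and GXG: "G * X * G = G" using UV by (auto simp: X_def)
  \<comment> \<open>An arbitrary inner inverse \<open>X\<close> of \<open>G\<close> may have large
    rank. \<open>X * G * X\<close> is still an inner inverse of \<open>G\<close>, and its rank is at
    most that of \<open>G\<close>.\<close>
  define H where "H = X * G * X"
  have H: "H \<in> carrier_mat n n" using X G by (auto simp: H_def)
  have XG: "X * G \<in> carrier_mat n n" using X G by auto
  have "mrank H \<le> mrank (X * G)" unfolding H_def by (rule mrank_mult_left[OF XG X])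
  then have rH: "mrank H \<le> mrank G" using mrank_mult_right[OF X G] by linarith
  have GHG: "G * H * G = G"
  proof -
    have "G * H * G = (G * X * G) * X * G" unfolding H_def using X G
      by (simp add: as mult_carrier_mat[of _ n n _ n])
    then show ?thesis using GXG by simp
  qed
  define K where "K = (1\<^sub>m n - B * C) * H * (1\<^sub>m n - C * B)"
  have K: "K \<in> carrier_mat n n" using H B C by (auto simp: K_def)
  \<comment> \<open>Both flanking products equal the defect \<open>G\<close>, so the correction
    \<open>K\<close> satisfies \<open>C * K * C = G * H * G = G\<close>, exactly what
    \<open>B\<close> fails to supply.\<close>
  have L1: "C * (1\<^sub>m n - B * C) = G" unfolding G_def using B C
    by (simp add: mult_minus_distrib_mat[of _ n n _ n] as mult_carrier_mat[of _ n n _ n])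
  have L2: "(1\<^sub>m n - C * B) * C = G" unfolding G_def using B C
    by (simp add: minus_mult_distrib_mat[of _ n n _ _ n] as mult_carrier_mat[of _ n n _ n])
  have c1: "1\<^sub>m n - B * C \<in> carrier_mat n n" "1\<^sub>m n - C * B \<in> carrier_mat n n" using B C by auto
  have "C * K * C = (C * (1\<^sub>m n - B * C)) * H * ((1\<^sub>m n - C * B) * C)"
    unfolding K_def using C H c1 by (simp add: as mult_carrier_mat[of _ n n _ n])
  then have CKC: "C * K * C = G" using L1 L2 GHG by simp
  have "C * (B + K) * C = C * B * C + C * K * C"
    using B C K by (simp add: mult_add_distrib_mat[of _ n n _ n] add_mult_distrib_mat[of _ n n _ _ n] mult_carrier_mat[of _ n n _ n])
  also have "\<dots> = C" unfolding CKC G_def using CBC C by (intro eq_matI) (auto simp del: index_mult_mat(1))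
  finally have "C * (B + K) * C = C" .
  moreover have "mrank (B + K - B) \<le> 2 * mrank (A - C)"
  proof -
    have "B + K - B = K" using B K by (intro eq_matI) auto
    moreover have "mrank K \<le> mrank ((1\<^sub>m n - B * C) * H)" unfolding K_def
      by (rule mrank_mult_left[of _ n]) (use c1 H in auto)
    moreover have "mrank ((1\<^sub>m n - B * C) * H) \<le> mrank H"
      by (rule mrank_mult_right[of _ n]) (use c1 H in auto)
    ultimately show ?thesis using rG rH by simp
  qed
  ultimately show thesis using that[of "B + K"] B K by auto
qed

lemma pos_def_sum_zero:
  assumes "pos_def_inv cj" "finite S" "(\<Sum>s\<in>S. cj (f s) * f s) = 0" "s \<in> S"
  shows "f s = 0"
proof -
  obtain xs where xs: "set xs = S" "distinct xs" using finite_distinct_list[OF assms(2)] by blast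
  have "(\<Sum>x\<leftarrow>map f xs. cj x * x) = 0"
    using assms(3) xs by (simp add: sum_list_distinct_conv_sum_set o_def)
  then have "\<forall>x\<in>set (map f xs). x = 0" using assms(1) unfolding pos_def_inv_def by blast
  then show ?thesis using xs assms(4) by auto
qed

text \<open>With C = A* A and an inner inverse \<open>G\<close> of C, the matrix X = A (1 - G C)
  satisfies X* X = 0. Positive definiteness forces X = 0, so A = A G C factors through C and its
  rank is at most that of C.\<close>

lemma mrank_ctrans_mult_self:
  fixes A :: "'a::field mat"
  assumes cj: "field_involution cj" and pd: "pos_def_inv cj" and A: "A \<in> carrier_mat n n"
  shows "mrank (ctrans cj A * A) = mrank A"
proof (rule antisym)
  note as = assoc_mult_mat[of _ n n _ n _ n]
  define C where "C = ctrans cj A * A"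
  have C: "C \<in> carrier_mat n n" using A by (auto simp: C_def)
  obtain U V where UV: "U \<in> carrier_mat n n" "V \<in> carrier_mat n n" "C * (V * U) * C = C"
    using rank_normal_form[OF C] by metis
  define G where "G = V * U"
  have G: "G \<in> carrier_mat n n" and CGC: "C * G * C = C" using UV by (auto simp: G_def)
  define Y where "Y = 1\<^sub>m n - G * C"
  have Y: "Y \<in> carrier_mat n n" using G C by (auto simp: Y_def)
  have CY: "C * Y = 0\<^sub>m n n"
  proof -
    have "C * Y = C - C * G * C" unfolding Y_def using C G
      by (simp add: mult_minus_distrib_mat[of _ n n _ n] as mult_carrier_mat[of _ n n _ n])
    then show ?thesis using CGC C by auto
  qed
  define X where "X = A * Y"
  have X: "X \<in> carrier_mat n n" using A Y by (auto simp: X_def)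
  have "ctrans cj X * X = ctrans cj Y * (C * Y)"
    unfolding X_def C_def ctrans_mult[OF cj A Y] using A Y by (simp add: as mult_carrier_mat[of _ n n _ n])
  also have "\<dots> = 0\<^sub>m n n" using CY Y by simp
  finally have XX: "ctrans cj X * X = 0\<^sub>m n n" .
  \<comment> \<open>The diagonal entry at (j,j) of X* X is the sum of \<open>cj x * x\<close> over
    column j, to which positive definiteness applies.\<close>
  have "X = 0\<^sub>m n n"
  proof (rule eq_matI)
    fix i j assume "i < dim_row (0\<^sub>m n n :: 'a mat)" "j < dim_col (0\<^sub>m n n :: 'a mat)"
    then have ij: "i < n" "j < n" by auto
    have "(ctrans cj X * X) $$ (j,j) = (\<Sum>s\<in>{0..<n}. cj (X $$ (s,j)) * X $$ (s,j))"
      using X ij by (auto simp: scalar_prod_def)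
    then have "(\<Sum>s\<in>{0..<n}. cj (X $$ (s,j)) * X $$ (s,j)) = 0" using XX ij by simp
    then show "X $$ (i,j) = 0\<^sub>m n n $$ (i,j)" using pos_def_sum_zero[OF pd, of "{0..<n}" "\<lambda>s. X $$ (s,j)" i] ij by simp
  qed (use X in auto)
  then have "A - A * (G * C) = 0\<^sub>m n n" unfolding X_def Y_def using A G C
    by (simp add: mult_minus_distrib_mat[of _ n n _ n] mult_carrier_mat[of _ n n _ n])
  then have "A = A * (G * C)"
    using A G C by (metis (no_types, lifting) add_uminus_minus_mat carrier_matD(1) carrier_matD(2) eq_matI index_minus_mat(1) index_mult_mat(2) index_mult_mat(3) index_zero_mat(1) right_minus_eq)
  also have "\<dots> = A * G * C" using A G C by (simp add: as)
  finally have "mrank A \<le> mrank C" using mrank_mult_right[of "A * G" n C] A G C by (metis mult_carrier_mat)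
  then show "mrank A \<le> mrank (ctrans cj A * A)" by (simp add: C_def)
  show "mrank (ctrans cj A * A) \<le> mrank A" by (rule mrank_mult_right[of _ n]) (use A in auto)
qed

section \<open>Block-diagonal matrices\<close>

text \<open>A common form for all block-diagonal embeddings. The rows of a block need not be
  consecutive, and rows labelled \<open>None\<close> form a corner where the matrix is zero; towers
  inside towers and templates inside towers are both instances.\<close>

definition blk :: "nat \<Rightarrow> (nat \<Rightarrow> ('b \<times> nat) option) \<Rightarrow> ('b \<Rightarrow> 'a mat) \<Rightarrow> 'a::field mat" where
  "blk N lab x = mat N N (\<lambda>(p,q). case lab p of None \<Rightarrow> 0 | Some (b,i) \<Rightarrow>
     (case lab q of None \<Rightarrow> 0 | Some (b',i') \<Rightarrow> if b = b' then x b $$ (i,i') else 0))"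

text \<open>The last clause, that a block which occurs at all occurs completely, makes
  \<open>blk\<close> multiplicative: the inner sum of a matrix product then runs over a whole
  block.\<close>

definition blk_ok :: "nat \<Rightarrow> ('b \<Rightarrow> nat) \<Rightarrow> (nat \<Rightarrow> ('b \<times> nat) option) \<Rightarrow> bool" where
  "blk_ok N sz lab \<longleftrightarrow>
     (\<forall>p<N. \<forall>b i. lab p = Some (b,i) \<longrightarrow> i < sz b) \<and>
     (\<forall>p<N. \<forall>q<N. lab p \<noteq> None \<longrightarrow> lab p = lab q \<longrightarrow> p = q) \<and>
     (\<forall>p<N. \<forall>b i i'. lab p = Some (b,i) \<longrightarrow> i' < sz b \<longrightarrow> (\<exists>q<N. lab q = Some (b,i')))"

definition blks :: "nat \<Rightarrow> (nat \<Rightarrow> ('b \<times> nat) option) \<Rightarrow> 'b set" where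
  "blks N lab = {b. \<exists>p<N. \<exists>i. lab p = Some (b,i)}"

lemma blk_carrier [simp]: "blk N lab x \<in> carrier_mat N N"
  and blk_dim [simp]: "dim_row (blk N lab x) = N" "dim_col (blk N lab x) = N"
  by (auto simp: blk_def)

lemma finite_blks: "finite (blks N lab)"
proof -
  have "blks N lab \<subseteq> (\<lambda>p. fst (the (lab p))) ` {..<N}"
    by (force simp: blks_def)
  then show ?thesis using finite_subset by blast
qed

lemma blk_index:
  assumes "p < N" "q < N"
  shows "blk N lab x $$ (p,q) = (case lab p of None \<Rightarrow> 0 | Some (b,i) \<Rightarrow>
     (case lab q of None \<Rightarrow> 0 | Some (b',i') \<Rightarrow> if b = b' then x b $$ (i,i') else 0))"
  using assms by (simp add: blk_def)

lemma blk_bij: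
  assumes ok: "blk_ok N sz lab" and b: "b \<in> blks N lab"
  shows "bij_betw (\<lambda>s. snd (the (lab s))) {s. s < N \<and> (\<exists>k. lab s = Some (b,k))} {..<sz b}"
proof (rule bij_betwI')
  fix s t assume s: "s \<in> {s. s < N \<and> (\<exists>k. lab s = Some (b,k))}" and t: "t \<in> {s. s < N \<and> (\<exists>k. lab s = Some (b,k))}"
  then obtain k k' where "lab s = Some (b,k)" "lab t = Some (b,k')" "s < N" "t < N" by auto
  then show "snd (the (lab s)) = snd (the (lab t)) \<longleftrightarrow> s = t"
    using ok unfolding blk_ok_def by auto
next
  fix s assume "s \<in> {s. s < N \<and> (\<exists>k. lab s = Some (b,k))}"
  then show "snd (the (lab s)) \<in> {..<sz b}" using ok unfolding blk_ok_def by auto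
next
  fix k assume "k \<in> {..<sz b}"
  then obtain q where "q < N" "lab q = Some (b,k)"
    using ok b unfolding blk_ok_def blks_def by blast
  then show "\<exists>s\<in>{s. s < N \<and> (\<exists>k. lab s = Some (b,k))}. k = snd (the (lab s))"
    by (intro bexI[of _ q]) auto
qed

lemma blk_mult:
  assumes ok: "blk_ok N sz lab"
    and x: "\<And>b. b \<in> blks N lab \<Longrightarrow> x b \<in> carrier_mat (sz b) (sz b)"
    and y: "\<And>b. b \<in> blks N lab \<Longrightarrow> y b \<in> carrier_mat (sz b) (sz b)"
  shows "blk N lab x * blk N lab y = blk N lab (\<lambda>b. x b * y b)"
proof (rule eq_matI)
  fix p q assume "p < dim_row (blk N lab (\<lambda>b. x b * y b))" "q < dim_col (blk N lab (\<lambda>b. x b * y b))"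
  then have pq: "p < N" "q < N" by auto
  have e: "(blk N lab x * blk N lab y) $$ (p,q) = (\<Sum>s\<in>{0..<N}. blk N lab x $$ (p,s) * blk N lab y $$ (s,q))"
    using pq by (auto simp: scalar_prod_def)
  show "(blk N lab x * blk N lab y) $$ (p,q) = blk N lab (\<lambda>b. x b * y b) $$ (p,q)"
  proof (cases "lab p")
    case None
    then show ?thesis unfolding e using pq by (auto simp: blk_index)
  next
    case (Some bi)
    then obtain b i where lp: "lab p = Some (b,i)" by (cases bi) auto
    have b: "b \<in> blks N lab" using lp pq by (auto simp: blks_def)
    have i: "i < sz b" using ok lp pq by (auto simp: blk_ok_def)
    let ?C = "{s. s < N \<and> (\<exists>k. lab s = Some (b,k))}"
    \<comment> \<open>Only rows in the block of \<open>p\<close> contribute; they are reindexed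
      below by their position inside that block.\<close>
    have e2: "(\<Sum>s\<in>{0..<N}. blk N lab x $$ (p,s) * blk N lab y $$ (s,q)) =
          (\<Sum>s\<in>?C. blk N lab x $$ (p,s) * blk N lab y $$ (s,q))"
      by (rule sum.mono_neutral_right) (use pq lp in \<open>auto simp: blk_index split: option.splits\<close>)
    show ?thesis
    proof (cases "\<exists>i'. lab q = Some (b,i')")
      case True
      then obtain i' where lq: "lab q = Some (b,i')" by blast
      have i': "i' < sz b" using ok lq pq by (auto simp: blk_ok_def)
      have "(\<Sum>s\<in>?C. blk N lab x $$ (p,s) * blk N lab y $$ (s,q)) =
          (\<Sum>s\<in>?C. (\<lambda>k. x b $$ (i,k) * y b $$ (k,i')) (snd (the (lab s))))"
        by (rule sum.cong) (use pq lp lq in \<open>auto simp: blk_index\<close>)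
      also have "\<dots> = (\<Sum>k\<in>{..<sz b}. x b $$ (i,k) * y b $$ (k,i'))"
        by (rule sum.reindex_bij_betw[OF blk_bij[OF ok b]])
      also have "\<dots> = (x b * y b) $$ (i,i')" using x[OF b] y[OF b] i i'
        by (auto simp: scalar_prod_def atLeast0LessThan)
      finally show ?thesis unfolding e e2 using pq lp lq by (simp add: blk_index)
    next
      case False
      have "(\<Sum>s\<in>?C. blk N lab x $$ (p,s) * blk N lab y $$ (s,q)) = 0"
        by (rule sum.neutral) (use pq lp False in \<open>auto simp: blk_index split: option.splits\<close>)
      then show ?thesis unfolding e e2 using pq lp False by (auto simp: blk_index split: option.splits)
    qed
  qed
qed auto

lemma blk_add:
  assumes ok: "blk_ok N sz lab"
    and x: "\<And>b. b \<in> blks N lab \<Longrightarrow> x b \<in> carrier_mat (sz b) (sz b)"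
    and y: "\<And>b. b \<in> blks N lab \<Longrightarrow> y b \<in> carrier_mat (sz b) (sz b)"
  shows "blk N lab (\<lambda>b. x b + y b) = blk N lab x + blk N lab y"
proof (rule eq_matI)
  fix p q assume "p < dim_row (blk N lab x + blk N lab y)" "q < dim_col (blk N lab x + blk N lab y)"
  then have pq: "p < N" "q < N" by auto
  have *: "i < dim_row (y b) \<and> i < dim_col (y b)" if "lab p = Some (b,i) \<or> lab q = Some (b,i)" for b i
  proof -
    have "b \<in> blks N lab" "i < sz b" using that pq ok by (auto simp: blks_def blk_ok_def)
    then show ?thesis using y[of b] by auto
  qed
  show "blk N lab (\<lambda>b. x b + y b) $$ (p,q) = (blk N lab x + blk N lab y) $$ (p,q)"
    using pq * by (auto simp: blk_index split: option.splits)
qed auto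

lemma blk_smult:
  assumes ok: "blk_ok N sz lab"
    and x: "\<And>b. b \<in> blks N lab \<Longrightarrow> x b \<in> carrier_mat (sz b) (sz b)"
  shows "blk N lab (\<lambda>b. c \<cdot>\<^sub>m x b) = c \<cdot>\<^sub>m blk N lab x"
proof (rule eq_matI)
  fix p q assume "p < dim_row (c \<cdot>\<^sub>m blk N lab x)" "q < dim_col (c \<cdot>\<^sub>m blk N lab x)"
  then have pq: "p < N" "q < N" by auto
  have *: "i < dim_row (x b) \<and> i < dim_col (x b)" if "lab p = Some (b,i) \<or> lab q = Some (b,i)" for b i
  proof -
    have "b \<in> blks N lab" "i < sz b" using that pq ok by (auto simp: blks_def blk_ok_def)
    then show ?thesis using x[of b] by auto
  qed
  show "blk N lab (\<lambda>b. c \<cdot>\<^sub>m x b) $$ (p,q) = (c \<cdot>\<^sub>m blk N lab x) $$ (p,q)"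
    using pq * by (auto simp: blk_index split: option.splits)
qed auto

lemma blk_ctrans:
  assumes cj: "field_involution cj" and ok: "blk_ok N sz lab"
    and x: "\<And>b. b \<in> blks N lab \<Longrightarrow> x b \<in> carrier_mat (sz b) (sz b)"
  shows "blk N lab (\<lambda>b. ctrans cj (x b)) = ctrans cj (blk N lab x)"
proof (rule eq_matI)
  fix p q assume "p < dim_row (ctrans cj (blk N lab x))" "q < dim_col (ctrans cj (blk N lab x))"
  then have pq: "p < N" "q < N" by auto
  have *: "i < dim_row (x b) \<and> i < dim_col (x b)" if "lab p = Some (b,i) \<or> lab q = Some (b,i)" for b i
  proof -
    have "b \<in> blks N lab" "i < sz b" using that pq ok by (auto simp: blks_def blk_ok_def)
    then show ?thesis using x[of b] by auto
  qed
  show "blk N lab (\<lambda>b. ctrans cj (x b)) $$ (p,q) = ctrans cj (blk N lab x) $$ (p,q)"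
    using pq * by (auto simp: blk_index field_involutionD[OF cj] split: option.splits)
qed auto

lemma blk_cong:
  assumes "\<And>b. b \<in> blks N lab \<Longrightarrow> x b = y b"
  shows "blk N lab x = blk N lab y"
proof (rule eq_matI)
  fix p q assume "p < dim_row (blk N lab y)" "q < dim_col (blk N lab y)"
  then have pq: "p < N" "q < N" by auto
  have "x b = y b" if "lab p = Some (b,i)" for b i
    by (rule assms) (use that pq in \<open>auto simp: blks_def\<close>)
  then show "blk N lab x $$ (p,q) = blk N lab y $$ (p,q)"
    using pq by (auto simp: blk_index split: option.splits)
qed auto

text \<open>Assembles the normal forms of the blocks into a normal form of the whole matrix.\<close>

lemma blk_diag01:
  assumes ok: "blk_ok N sz lab"
  shows "(blk N lab (\<lambda>b. diag01 (sz b) (I b)) :: 'c::field mat) = diag01 N {p. p < N \<and> (\<exists>b i. lab p = Some (b,i) \<and> i \<in> I b)}"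
proof (rule eq_matI)
  fix p q assume "p < dim_row (diag01 N {p. p < N \<and> (\<exists>b i. lab p = Some (b,i) \<and> i \<in> I b)} :: 'c mat)"
     "q < dim_col (diag01 N {p. p < N \<and> (\<exists>b i. lab p = Some (b,i) \<and> i \<in> I b)} :: 'c mat)"
  then have pq: "p < N" "q < N" by auto
  have "lab p = Some (b,i) \<Longrightarrow> i < sz b" "lab q = Some (b,i) \<Longrightarrow> i < sz b"
    "lab p = Some (b,i) \<Longrightarrow> lab q = Some (b,i) \<Longrightarrow> p = q" for b i using ok pq by (auto simp: blk_ok_def)
  then show "blk N lab (\<lambda>b. diag01 (sz b) (I b)) $$ (p,q) =
     (diag01 N {p. p < N \<and> (\<exists>b i. lab p = Some (b,i) \<and> i \<in> I b)} :: 'c mat) $$ (p,q)"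
    using pq by (auto simp: blk_index diag01_def split: option.splits)
qed auto

text \<open>Multiplying by the block-diagonal matrices of the factors \<open>U\<close>,
  \<open>V\<close> and \<open>L\<close>, \<open>R\<close> of all blocks identifies the rank with a
  number of labelled rows, which is then counted block by block.\<close>

lemma mrank_blk:
  assumes ok: "blk_ok N sz lab"
    and x: "\<And>b. b \<in> blks N lab \<Longrightarrow> x b \<in> carrier_mat (sz b) (sz b)"
  shows "mrank (blk N lab x) = (\<Sum>b\<in>blks N lab. mrank (x b))"
proof -
  let ?B = "blks N lab"
  have "\<exists>U V L R I. U \<in> carrier_mat (sz b) (sz b) \<and> V \<in> carrier_mat (sz b) (sz b) \<and> L \<in> carrier_mat (sz b) (sz b)
     \<and> R \<in> carrier_mat (sz b) (sz b) \<and> I \<subseteq> {..<sz b} \<and> card I = mrank (x b) \<and> U * x b * V = diag01 (sz b) I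
     \<and> x b = L * diag01 (sz b) I * R" if "b \<in> ?B" for b
    using rank_normal_form[OF x[OF that]] by metis
  then obtain U V L R I where h: "\<And>b. b \<in> ?B \<Longrightarrow> U b \<in> carrier_mat (sz b) (sz b) \<and> V b \<in> carrier_mat (sz b) (sz b) \<and> L b \<in> carrier_mat (sz b) (sz b)
     \<and> R b \<in> carrier_mat (sz b) (sz b) \<and> I b \<subseteq> {..<sz b} \<and> card (I b) = mrank (x b) \<and> U b * x b * V b = diag01 (sz b) (I b)
     \<and> x b = L b * diag01 (sz b) (I b) * R b"
    by metis
  define J where "J = {p. p < N \<and> (\<exists>b i. lab p = Some (b,i) \<and> i \<in> I b)}"
  have J: "J \<subseteq> {..<N}" by (auto simp: J_def)
  have "blk N lab U * blk N lab x * blk N lab V = blk N lab (\<lambda>b. U b * x b * V b)"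
    by (subst blk_mult[OF ok], use h x in blast, use h x in blast, subst blk_mult[OF ok])
       (use h x in \<open>auto intro!: mult_carrier_mat\<close>)
  also have "\<dots> = blk N lab (\<lambda>b. diag01 (sz b) (I b))"
    by (rule blk_cong) (use h in blast)
  also have "\<dots> = diag01 N J" unfolding J_def by (rule blk_diag01[OF ok])
  finally have e1: "blk N lab U * blk N lab x * blk N lab V = diag01 N J" .
  have "blk N lab L * diag01 N J * blk N lab R = blk N lab (\<lambda>b. L b * diag01 (sz b) (I b) * R b)"
    unfolding J_def blk_diag01[OF ok, symmetric]
    by (subst blk_mult[OF ok], use h x in blast, simp, subst blk_mult[OF ok])
       (use h x in \<open>auto intro!: mult_carrier_mat\<close>)
  also have "\<dots> = blk N lab x" by (rule blk_cong) (use h in metis)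
  finally have e2: "blk N lab L * diag01 N J * blk N lab R = blk N lab x" .
  have "mrank (blk N lab x) = card J"
  proof (rule antisym)
    show "mrank (blk N lab x) \<le> card J"
      using mrank_factor_le[of "blk N lab L" N "blk N lab R" J] e2 finite_subset[OF J] by simp
    have "card J = mrank (blk N lab U * blk N lab x * blk N lab V)" unfolding e1 by (rule mrank_diag01[OF J, symmetric])
    also have "\<dots> \<le> mrank (blk N lab U * blk N lab x)" by (rule mrank_mult_left[of _ N]) (auto intro!: mult_carrier_mat)
    also have "\<dots> \<le> mrank (blk N lab x)" by (rule mrank_mult_right[of _ N]) auto
    finally show "card J \<le> mrank (blk N lab x)" .
  qed
  also have "J = (\<Union>b\<in>?B. {s. s < N \<and> (\<exists>i\<in>I b. lab s = Some (b,i))})"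
    by (auto simp: J_def blks_def)
  also have "card \<dots> = (\<Sum>b\<in>?B. card {s. s < N \<and> (\<exists>i\<in>I b. lab s = Some (b,i))})"
    by (rule card_UN_disjoint) (auto simp: finite_blks)
  also have "\<dots> = (\<Sum>b\<in>?B. mrank (x b))"
  proof (rule sum.cong[OF refl])
    fix b assume b: "b \<in> ?B"
    have card_Ib: "card (I b) = mrank (x b)" using h[OF b] by blast
    have "(\<lambda>s. snd (the (lab s))) ` {s. s < N \<and> (\<exists>i\<in>I b. lab s = Some (b,i))} = I b"
    proof (intro equalityI subsetI)
      fix i assume i: "i \<in> I b"
      then have "i < sz b" using h[OF b] by auto
      then obtain q where "q < N" "lab q = Some (b,i)" using ok b unfolding blk_ok_def blks_def by blast
      then show "i \<in> (\<lambda>s. snd (the (lab s))) ` {s. s < N \<and> (\<exists>i\<in>I b. lab s = Some (b,i))}"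
        using i by (intro image_eqI[of _ _ q]) auto
    qed auto
    then have "bij_betw (\<lambda>s. snd (the (lab s))) {s. s < N \<and> (\<exists>i\<in>I b. lab s = Some (b,i))} (I b)"
      by (intro bij_betw_subset[OF blk_bij[OF ok b]]) auto
    from bij_betw_same_card[OF this] show "card {s. s < N \<and> (\<exists>i\<in>I b. lab s = Some (b,i))} = mrank (x b)"
      using card_Ib by simp
  qed
  finally show ?thesis .
qed

lemma card_labelled:
  assumes ok: "blk_ok N sz lab"
  shows "card {p. p < N \<and> lab p \<noteq> None} = (\<Sum>b\<in>blks N lab. sz b)"
proof -
  have "{p. p < N \<and> lab p \<noteq> None} = (\<Union>b\<in>blks N lab. {s. s < N \<and> (\<exists>k. lab s = Some (b,k))})"
    by (auto simp: blks_def)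
  also have "card \<dots> = (\<Sum>b\<in>blks N lab. card {s. s < N \<and> (\<exists>k. lab s = Some (b,k))})"
    by (rule card_UN_disjoint) (auto simp: finite_blks)
  also have "\<dots> = (\<Sum>b\<in>blks N lab. sz b)"
    by (rule sum.cong[OF refl]) (use bij_betw_same_card[OF blk_bij[OF ok]] in simp)
  finally show ?thesis .
qed

section \<open>Completions of rank algebras\<close>

text \<open>The laws are demanded only up to rank distance zero. Elements of the direct limits are
  pairs of a level and a value without a quotient, so the two sides of a ring law may be different
  pairs. The completion turns distance zero into equality.\<close>

locale rank_alg =
  fixes R :: "('a,'k::field) ralg"
  assumes car_one: "rone R \<in> rcar R" and car_zero: "rzero R \<in> rcar R"
    and car_add: "x \<in> rcar R \<Longrightarrow> y \<in> rcar R \<Longrightarrow> radd R x y \<in> rcar R"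
    and car_mul: "x \<in> rcar R \<Longrightarrow> y \<in> rcar R \<Longrightarrow> rmul R x y \<in> rcar R"
    and car_smul: "x \<in> rcar R \<Longrightarrow> rsmul R c x \<in> rcar R"
    and car_star: "x \<in> rcar R \<Longrightarrow> rstar R x \<in> rcar R"
    and d_ge0: "x \<in> rcar R \<Longrightarrow> y \<in> rcar R \<Longrightarrow> 0 \<le> rk_dist R x y"
    and d_refl: "x \<in> rcar R \<Longrightarrow> rk_dist R x x = 0"
    and d_sym: "x \<in> rcar R \<Longrightarrow> y \<in> rcar R \<Longrightarrow> rk_dist R x y = rk_dist R y x"
    and d_tri: "x \<in> rcar R \<Longrightarrow> y \<in> rcar R \<Longrightarrow> z \<in> rcar R \<Longrightarrow> rk_dist R x z \<le> rk_dist R x y + rk_dist R y z"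
    and d_add: "x \<in> rcar R \<Longrightarrow> y \<in> rcar R \<Longrightarrow> x' \<in> rcar R \<Longrightarrow> y' \<in> rcar R \<Longrightarrow>
       rk_dist R (radd R x x') (radd R y y') \<le> rk_dist R x y + rk_dist R x' y'"
    and d_mul: "x \<in> rcar R \<Longrightarrow> y \<in> rcar R \<Longrightarrow> x' \<in> rcar R \<Longrightarrow> y' \<in> rcar R \<Longrightarrow>
       rk_dist R (rmul R x x') (rmul R y y') \<le> rk_dist R x y + rk_dist R x' y'"
    and d_smul: "x \<in> rcar R \<Longrightarrow> y \<in> rcar R \<Longrightarrow> rk_dist R (rsmul R c x) (rsmul R c y) \<le> rk_dist R x y"
    and d_star: "x \<in> rcar R \<Longrightarrow> y \<in> rcar R \<Longrightarrow> rk_dist R (rstar R x) (rstar R y) \<le> rk_dist R x y"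
    and d_rk: "x \<in> rcar R \<Longrightarrow> y \<in> rcar R \<Longrightarrow> \<bar>rrk R x - rrk R y\<bar> \<le> rk_dist R x y"
    and rk_zero: "rrk R (rzero R) = 0"
    and l_add_assoc: "x \<in> rcar R \<Longrightarrow> y \<in> rcar R \<Longrightarrow> z \<in> rcar R \<Longrightarrow>
       rk_dist R (radd R (radd R x y) z) (radd R x (radd R y z)) = 0"
    and l_mul_assoc: "x \<in> rcar R \<Longrightarrow> y \<in> rcar R \<Longrightarrow> z \<in> rcar R \<Longrightarrow>
       rk_dist R (rmul R (rmul R x y) z) (rmul R x (rmul R y z)) = 0"
    and l_distl: "x \<in> rcar R \<Longrightarrow> y \<in> rcar R \<Longrightarrow> z \<in> rcar R \<Longrightarrow>
       rk_dist R (rmul R x (radd R y z)) (radd R (rmul R x y) (rmul R x z)) = 0"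
    and l_distr: "x \<in> rcar R \<Longrightarrow> y \<in> rcar R \<Longrightarrow> z \<in> rcar R \<Longrightarrow>
       rk_dist R (rmul R (radd R x y) z) (radd R (rmul R x z) (rmul R y z)) = 0"
    and l_comm: "x \<in> rcar R \<Longrightarrow> y \<in> rcar R \<Longrightarrow> rk_dist R (radd R x y) (radd R y x) = 0"
    and l_zero: "x \<in> rcar R \<Longrightarrow> rk_dist R (radd R x (rzero R)) x = 0"
    and l_neg: "x \<in> rcar R \<Longrightarrow> rk_dist R (radd R x (rsmul R (-1) x)) (rzero R) = 0"
    and l_onel: "x \<in> rcar R \<Longrightarrow> rk_dist R (rmul R (rone R) x) x = 0"
    and l_oner: "x \<in> rcar R \<Longrightarrow> rk_dist R (rmul R x (rone R)) x = 0"
    and l_star_add: "x \<in> rcar R \<Longrightarrow> y \<in> rcar R \<Longrightarrow>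
       rk_dist R (rstar R (radd R x y)) (radd R (rstar R x) (rstar R y)) = 0"
    and l_star_mul: "x \<in> rcar R \<Longrightarrow> y \<in> rcar R \<Longrightarrow>
       rk_dist R (rstar R (rmul R x y)) (rmul R (rstar R y) (rstar R x)) = 0"
    and l_star_star: "x \<in> rcar R \<Longrightarrow> rk_dist R (rstar R (rstar R x)) x = 0"
begin

abbreviation "cau \<equiv> rk_cauchy R"
abbreviation "cl \<equiv> rk_cls R"
abbreviation "Cp \<equiv> rk_completion R"
abbreviation "dd \<equiv> rk_dist R"

lemma cau_car: "cau s \<Longrightarrow> s k \<in> rcar R" by (simp add: rk_cauchy_def)

lemma cauI_le:
  assumes "\<And>k. s k \<in> rcar R"
    and "\<And>m n. dd (s m) (s n) \<le> f m n"
    and "\<And>e. e > 0 \<Longrightarrow> \<exists>N::nat. \<forall>m\<ge>N. \<forall>n\<ge>N. f m n < (e::real)"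
  shows "cau s"
  unfolding rk_cauchy_def using assms by (meson order.strict_trans1)

lemma cau_const: "x \<in> rcar R \<Longrightarrow> cau (\<lambda>_. x)"
  by (simp add: rk_cauchy_def d_refl)

lemma cau_add: assumes "cau s" "cau t" shows "cau (\<lambda>k. radd R (s k) (t k))"
proof (rule cauI_le[where f = "\<lambda>m n. dd (s m) (s n) + dd (t m) (t n)"])
  fix e :: real assume "e > 0"
  then have "e/2 > 0" by simp
  then obtain N1 N2 where "\<forall>m\<ge>N1. \<forall>n\<ge>N1. dd (s m) (s n) < e/2" "\<forall>m\<ge>N2. \<forall>n\<ge>N2. dd (t m) (t n) < e/2"
    using assms unfolding rk_cauchy_def by blast
  then have "\<forall>m\<ge>max N1 N2. \<forall>n\<ge>max N1 N2. dd (s m) (s n) + dd (t m) (t n) < e"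
    by (smt (verit, best) field_sum_of_halves max.bounded_iff)
  then show "\<exists>N. \<forall>m\<ge>N. \<forall>n\<ge>N. dd (s m) (s n) + dd (t m) (t n) < e" by blast
qed (use assms in \<open>auto simp: cau_car car_add d_add\<close>)

lemma cau_mul: assumes "cau s" "cau t" shows "cau (\<lambda>k. rmul R (s k) (t k))"
proof (rule cauI_le[where f = "\<lambda>m n. dd (s m) (s n) + dd (t m) (t n)"])
  fix e :: real assume "e > 0"
  then have "e/2 > 0" by simp
  then obtain N1 N2 where "\<forall>m\<ge>N1. \<forall>n\<ge>N1. dd (s m) (s n) < e/2" "\<forall>m\<ge>N2. \<forall>n\<ge>N2. dd (t m) (t n) < e/2"
    using assms unfolding rk_cauchy_def by blast
  then have "\<forall>m\<ge>max N1 N2. \<forall>n\<ge>max N1 N2. dd (s m) (s n) + dd (t m) (t n) < e"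
    by (smt (verit, best) field_sum_of_halves max.bounded_iff)
  then show "\<exists>N. \<forall>m\<ge>N. \<forall>n\<ge>N. dd (s m) (s n) + dd (t m) (t n) < e" by blast
qed (use assms in \<open>auto simp: cau_car car_mul d_mul\<close>)

lemma cau_smul: assumes "cau s" shows "cau (\<lambda>k. rsmul R c (s k))"
  by (rule cauI_le[where f = "\<lambda>m n. dd (s m) (s n)"])
     (use assms in \<open>auto simp: cau_car car_smul d_smul rk_cauchy_def\<close>)

lemma cau_star: assumes "cau s" shows "cau (\<lambda>k. rstar R (s k))"
  by (rule cauI_le[where f = "\<lambda>m n. dd (s m) (s n)"])
     (use assms in \<open>auto simp: cau_car car_star d_star rk_cauchy_def\<close>)

lemma equiv_le:
  assumes "\<And>k. s k \<in> rcar R" "\<And>k. t k \<in> rcar R" "\<And>k. dd (s k) (t k) \<le> f k" "f \<longlonglongrightarrow> 0"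
  shows "rk_equiv R s t"
  unfolding rk_equiv_def
  by (rule tendsto_sandwich[OF _ _ tendsto_const assms(4)]) (use assms in \<open>auto simp: d_ge0\<close>)

lemma equiv_refl: "(\<And>k. s k \<in> rcar R) \<Longrightarrow> rk_equiv R s s"
  by (rule equiv_le[where f = "\<lambda>_. 0"]) (auto simp: d_refl)

lemma equiv_sym: "(\<And>k. s k \<in> rcar R) \<Longrightarrow> (\<And>k. t k \<in> rcar R) \<Longrightarrow> rk_equiv R s t \<Longrightarrow> rk_equiv R t s"
  by (rule equiv_le[where f = "\<lambda>k. dd (s k) (t k)"]) (auto simp: d_sym rk_equiv_def)

lemma equiv_trans:
  assumes "\<And>k. s k \<in> rcar R" "\<And>k. t k \<in> rcar R" "\<And>k. u k \<in> rcar R" "rk_equiv R s t" "rk_equiv R t u"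
  shows "rk_equiv R s u"
  by (rule equiv_le[where f = "\<lambda>k. dd (s k) (t k) + dd (t k) (u k)"])
     (use assms tendsto_add_zero in \<open>auto simp: d_tri rk_equiv_def\<close>)

lemma cls_eq_iff:
  assumes "cau s" "cau t"
  shows "cl s = cl t \<longleftrightarrow> rk_equiv R s t"
proof
  assume "cl s = cl t"
  moreover have "t \<in> cl t" using assms equiv_refl cau_car by (auto simp: rk_cls_def)
  ultimately show "rk_equiv R s t" by (auto simp: rk_cls_def)
next
  assume "rk_equiv R s t"
  then show "cl s = cl t" unfolding rk_cls_def
    using assms equiv_trans equiv_sym cau_car by (intro Collect_cong) (metis (no_types, lifting))
qed

lemma cls_eqI:
  assumes "cau s" "cau t" "\<And>k. dd (s k) (t k) = 0"
  shows "cl s = cl t"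
  using assms by (auto simp: cls_eq_iff rk_equiv_def)

lemma in_Cp: "cau s \<Longrightarrow> cl s \<in> rcar Cp"
  by (auto simp: rk_completion_def)

lemma Cp_cases:
  assumes "A \<in> rcar Cp" obtains s where "cau s" "A = cl s"
  using assms by (auto simp: rk_completion_def)

lemma rep_in: assumes "cau s" shows "cau (rep (cl s))" "rk_equiv R s (rep (cl s))"
proof -
  have "s \<in> cl s" using assms equiv_refl cau_car by (auto simp: rk_cls_def)
  then have "rep (cl s) \<in> cl s" unfolding rep_def by (rule someI[where P = "\<lambda>u. u \<in> cl s"])
  then show "cau (rep (cl s))" "rk_equiv R s (rep (cl s))" by (auto simp: rk_cls_def)
qed

text \<open>\<open>rk_completion\<close> computes with representatives picked by \<open>rep\<close>.
  Because the operations are Lipschitz for the rank distance, any other Cauchy representative gives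
  the same class; the same holds for the next three operations.\<close>

lemma Cp_add: assumes "cau s" "cau t" shows "radd Cp (cl s) (cl t) = cl (\<lambda>k. radd R (s k) (t k))"
proof -
  have "rk_equiv R (\<lambda>k. radd R (rep (cl s) k) (rep (cl t) k)) (\<lambda>k. radd R (s k) (t k))"
  proof (rule equiv_le[where f = "\<lambda>k. dd (s k) (rep (cl s) k) + dd (t k) (rep (cl t) k)"])
    show "(\<lambda>k. dd (s k) (rep (cl s) k) + dd (t k) (rep (cl t) k)) \<longlonglongrightarrow> 0"
      using rep_in[OF assms(1)] rep_in[OF assms(2)] tendsto_add_zero by (auto simp: rk_equiv_def)
    fix k
    have c: "s k \<in> rcar R" "t k \<in> rcar R" "rep (cl s) k \<in> rcar R" "rep (cl t) k \<in> rcar R"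
      using assms rep_in cau_car by auto
    show "dd (radd R (rep (cl s) k) (rep (cl t) k)) (radd R (s k) (t k)) \<le> dd (s k) (rep (cl s) k) + dd (t k) (rep (cl t) k)"
      using d_add[OF c(3,1,4,2)] d_sym c by metis
  qed (use assms rep_in cau_car in \<open>auto simp: car_add\<close>)
  then show ?thesis using cls_eq_iff assms rep_in(1) cau_add by (auto simp: rk_completion_def)
qed

lemma Cp_mul: assumes "cau s" "cau t" shows "rmul Cp (cl s) (cl t) = cl (\<lambda>k. rmul R (s k) (t k))"
proof -
  have "rk_equiv R (\<lambda>k. rmul R (rep (cl s) k) (rep (cl t) k)) (\<lambda>k. rmul R (s k) (t k))"
  proof (rule equiv_le[where f = "\<lambda>k. dd (s k) (rep (cl s) k) + dd (t k) (rep (cl t) k)"])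
    show "(\<lambda>k. dd (s k) (rep (cl s) k) + dd (t k) (rep (cl t) k)) \<longlonglongrightarrow> 0"
      using rep_in[OF assms(1)] rep_in[OF assms(2)] tendsto_add_zero by (auto simp: rk_equiv_def)
    fix k
    have c: "s k \<in> rcar R" "t k \<in> rcar R" "rep (cl s) k \<in> rcar R" "rep (cl t) k \<in> rcar R"
      using assms rep_in cau_car by auto
    show "dd (rmul R (rep (cl s) k) (rep (cl t) k)) (rmul R (s k) (t k)) \<le> dd (s k) (rep (cl s) k) + dd (t k) (rep (cl t) k)"
      using d_mul[OF c(3,1,4,2)] d_sym c by metis
  qed (use assms rep_in cau_car in \<open>auto simp: car_mul\<close>)
  then show ?thesis using cls_eq_iff assms rep_in(1) cau_mul by (auto simp: rk_completion_def)
qed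

lemma Cp_smul: assumes "cau s" shows "rsmul Cp c (cl s) = cl (\<lambda>k. rsmul R c (s k))"
proof -
  have "rk_equiv R (\<lambda>k. rsmul R c (rep (cl s) k)) (\<lambda>k. rsmul R c (s k))"
  proof (rule equiv_le[where f = "\<lambda>k. dd (s k) (rep (cl s) k)"])
    fix k
    have c: "s k \<in> rcar R" "rep (cl s) k \<in> rcar R"
      using assms rep_in cau_car by auto
    show "dd (rsmul R c (rep (cl s) k)) (rsmul R c (s k)) \<le> dd (s k) (rep (cl s) k)"
      using d_smul[OF c(2,1)] d_sym c by metis
  qed (use assms rep_in cau_car in \<open>auto simp: car_smul rk_equiv_def\<close>)
  then show ?thesis using cls_eq_iff assms rep_in(1) cau_smul by (auto simp: rk_completion_def)
qed

lemma Cp_star: assumes "cau s" shows "rstar Cp (cl s) = cl (\<lambda>k. rstar R (s k))"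
proof -
  have "rk_equiv R (\<lambda>k. rstar R (rep (cl s) k)) (\<lambda>k. rstar R (s k))"
  proof (rule equiv_le[where f = "\<lambda>k. dd (s k) (rep (cl s) k)"])
    fix k
    have c: "s k \<in> rcar R" "rep (cl s) k \<in> rcar R"
      using assms rep_in cau_car by auto
    show "dd (rstar R (rep (cl s) k)) (rstar R (s k)) \<le> dd (s k) (rep (cl s) k)"
      using d_star[OF c(2,1)] d_sym c by metis
  qed (use assms rep_in cau_car in \<open>auto simp: car_star rk_equiv_def\<close>)
  then show ?thesis using cls_eq_iff assms rep_in(1) cau_star by (auto simp: rk_completion_def)
qed

lemma Cp_one: "rone Cp = cl (\<lambda>_. rone R)" and Cp_zero: "rzero Cp = cl (\<lambda>_. rzero R)"
  by (auto simp: rk_completion_def)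

text \<open>The rank of the completion is defined by \<open>lim\<close>; the limit exists, and does
  not depend on the representative, because the rank is 1-Lipschitz.\<close>

lemma Cp_rk:
  assumes "cau s"
  shows "(\<lambda>k. rrk R (s k)) \<longlonglongrightarrow> rrk Cp (cl s)"
proof -
  let ?t = "rep (cl s)"
  have t: "cau ?t" "rk_equiv R s ?t" using rep_in[OF assms] by auto
  have "Cauchy (\<lambda>k. rrk R (?t k))"
  proof (rule CauchyI)
    fix e :: real assume "e > 0"
    then obtain N where "\<forall>m\<ge>N. \<forall>n\<ge>N. dd (?t m) (?t n) < e" using t(1) unfolding rk_cauchy_def by blast
    then have "\<forall>m\<ge>N. \<forall>n\<ge>N. norm (rrk R (?t m) - rrk R (?t n)) < e"
      using d_rk cau_car[OF t(1)] by (metis order.strict_trans1 real_norm_def)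
    then show "\<exists>N. \<forall>m\<ge>N. \<forall>n\<ge>N. norm (rrk R (?t m) - rrk R (?t n)) < e" by blast
  qed
  then have l: "(\<lambda>k. rrk R (?t k)) \<longlonglongrightarrow> rrk Cp (cl s)"
    by (simp add: rk_completion_def Cauchy_convergent_iff convergent_LIMSEQ_iff)
  have "(\<lambda>k. rrk R (s k) - rrk R (?t k)) \<longlonglongrightarrow> 0"
    by (rule Lim_null_comparison[OF _ t(2)[unfolded rk_equiv_def]])
       (use d_rk cau_car t(1) assms in auto)
  from tendsto_add[OF this l] show ?thesis by simp
qed

lemma Cp_star_ring: "is_star_ring Cp"
  unfolding is_star_ring_def
proof (intro conjI ballI)
  show "rone Cp \<in> rcar Cp" "rzero Cp \<in> rcar Cp"
    unfolding Cp_one Cp_zero by (auto intro!: in_Cp cau_const car_one car_zero)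
next
  fix x y assume "x \<in> rcar Cp" "y \<in> rcar Cp"
  then obtain s t where [simp]: "cau s" "x = cl s" "cau t" "y = cl t" by (metis Cp_cases)
  have [simp]: "s k \<in> rcar R" "t k \<in> rcar R" for k by (auto simp: cau_car)
  note [simp] = Cp_add Cp_mul Cp_star Cp_smul cau_add cau_mul cau_smul cau_star in_Cp
  show "radd Cp x y \<in> rcar Cp" "rmul Cp x y \<in> rcar Cp" by auto
  show "radd Cp x y = radd Cp y x" by simp (rule cls_eqI; simp add: l_comm car_mul car_add car_star car_smul)
  show "rstar Cp (radd Cp x y) = radd Cp (rstar Cp x) (rstar Cp y)" by simp (rule cls_eqI; simp add: l_star_add car_mul car_add car_star car_smul)
  show "rstar Cp (rmul Cp x y) = rmul Cp (rstar Cp y) (rstar Cp x)" by simp (rule cls_eqI; simp add: l_star_mul car_mul car_add car_star car_smul)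
  fix z assume "z \<in> rcar Cp"
  then obtain u where [simp]: "cau u" "z = cl u" by (metis Cp_cases)
  have [simp]: "u k \<in> rcar R" for k by (auto simp: cau_car)
  show "radd Cp (radd Cp x y) z = radd Cp x (radd Cp y z)" by simp (rule cls_eqI; simp add: l_add_assoc car_mul car_add car_star car_smul)
  show "rmul Cp (rmul Cp x y) z = rmul Cp x (rmul Cp y z)" by simp (rule cls_eqI; simp add: l_mul_assoc car_mul car_add car_star car_smul)
  show "rmul Cp x (radd Cp y z) = radd Cp (rmul Cp x y) (rmul Cp x z)" by simp (rule cls_eqI; simp add: l_distl car_mul car_add car_star car_smul)
  show "rmul Cp (radd Cp x y) z = radd Cp (rmul Cp x z) (rmul Cp y z)" by simp (rule cls_eqI; simp add: l_distr car_mul car_add car_star car_smul)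
next
  fix x assume "x \<in> rcar Cp"
  then obtain s where [simp]: "cau s" "x = cl s" by (metis Cp_cases)
  have [simp]: "s k \<in> rcar R" for k by (auto simp: cau_car)
  note [simp] = Cp_add Cp_mul Cp_star Cp_smul Cp_one Cp_zero cau_add cau_mul cau_smul cau_star in_Cp
     cau_const car_one car_zero
  show "rsmul Cp (-1) x \<in> rcar Cp" "rstar Cp x \<in> rcar Cp" by auto
  show "radd Cp x (rzero Cp) = x" by simp (rule cls_eqI; simp add: l_zero car_mul car_add car_star car_smul)
  show "radd Cp x (rsmul Cp (-1) x) = rzero Cp" by simp (rule cls_eqI; simp add: l_neg car_mul car_add car_star car_smul)
  show "rmul Cp (rone Cp) x = x" by simp (rule cls_eqI; simp add: l_onel car_mul car_add car_star car_smul)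
  show "rmul Cp x (rone Cp) = x" by simp (rule cls_eqI; simp add: l_oner car_mul car_add car_star car_smul)
  show "rstar Cp (rstar Cp x) = x" by simp (rule cls_eqI; simp add: l_star_star car_mul car_add car_star car_smul)
qed

text \<open>Needs an argument because x + (-1) 0 and x are in general different elements, related
  only by distance zero.\<close>

lemma d_zero: assumes x: "x \<in> rcar R" shows "dd x (rzero R) = rrk R x"
proof -
  let ?z = "rzero R"
  have nz: "rsmul R (-1) ?z \<in> rcar R" by (simp add: car_smul car_zero)
  have "dd (rsmul R (-1) ?z) ?z = 0"
  proof -
    have "dd (radd R ?z (rsmul R (-1) ?z)) ?z = 0" using l_neg car_zero by blast
    moreover have "dd (radd R (rsmul R (-1) ?z) ?z) (rsmul R (-1) ?z) = 0" using l_zero nz by blast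
    moreover have "dd (radd R (rsmul R (-1) ?z) ?z) (radd R ?z (rsmul R (-1) ?z)) = 0" using l_comm nz car_zero by blast
    ultimately show ?thesis
      using d_tri[of "rsmul R (-1) ?z" "radd R (rsmul R (-1) ?z) ?z" ?z]
        d_tri[of "radd R (rsmul R (-1) ?z) ?z" "radd R ?z (rsmul R (-1) ?z)" ?z]
        d_ge0[of "rsmul R (-1) ?z" ?z] d_sym[of "rsmul R (-1) ?z" "radd R (rsmul R (-1) ?z) ?z"]
        nz car_zero car_add by simp
  qed
  then have "dd (radd R x (rsmul R (-1) ?z)) (radd R x ?z) = 0"
    using d_add[of x x "rsmul R (-1) ?z" ?z] d_ge0[of "radd R x (rsmul R (-1) ?z)" "radd R x ?z"] x nz car_zero car_add d_refl by simp
  then have "dd (radd R x (rsmul R (-1) ?z)) x = 0"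
    using d_tri[of "radd R x (rsmul R (-1) ?z)" "radd R x ?z" x] l_zero[OF x] d_ge0[of "radd R x (rsmul R (-1) ?z)" x] x nz car_zero car_add by simp
  then have "\<bar>rrk R (radd R x (rsmul R (-1) ?z)) - rrk R x\<bar> \<le> 0"
    using d_rk[of "radd R x (rsmul R (-1) ?z)" x] x nz car_add by simp
  then show ?thesis by (simp add: rk_dist_def)
qed

text \<open>Geometric steps are wanted where a second sequence is chosen recursively, each term
  close to the preceding one: its errors then have a finite sum.\<close>

lemma cauchy_fast_subseq:
  assumes "cau s"
  obtains f :: "nat \<Rightarrow> nat" where "strict_mono f" "\<And>k. dd (s (f (Suc k))) (s (f k)) \<le> (1/2)^k" "cau (s \<circ> f)" "cl (s \<circ> f) = cl s"
proof -
  have "\<forall>k. \<exists>N. \<forall>m\<ge>N. \<forall>n\<ge>N. dd (s m) (s n) < (1/2::real)^k"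
    using assms unfolding rk_cauchy_def by simp
  then obtain N where N: "\<And>k m n. m \<ge> N k \<Longrightarrow> n \<ge> N k \<Longrightarrow> dd (s m) (s n) < (1/2::real)^k" by metis
  \<comment> \<open>The sum ensures \<open>f k \<ge> N k\<close>; the summand \<open>k\<close> makes
    \<open>f\<close> strictly increasing.\<close>
  define f where "f k = (\<Sum>i\<le>k. N i) + k" for k
  have f: "strict_mono f" unfolding f_def by (auto simp: strict_mono_Suc_iff)
  have fN: "f k \<ge> N k" for k unfolding f_def using member_le_sum[of k "{..k}" N] by simp
  have fk: "f k \<ge> k" for k by (simp add: f_def)
  have step: "dd (s (f (Suc k))) (s (f k)) \<le> (1/2)^k" for k
  proof -
    have "f (Suc k) \<ge> f k" using f by (simp add: strict_mono_less_eq)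
    then show ?thesis using N[of k "f (Suc k)" "f k"] fN[of k] by simp
  qed
  have c: "cau (s \<circ> f)" unfolding rk_cauchy_def
  proof (intro conjI allI impI)
    show "(s \<circ> f) k \<in> rcar R" for k using assms by (simp add: cau_car)
    fix e :: real assume "e > 0"
    then obtain N0 where N0: "\<forall>m\<ge>N0. \<forall>n\<ge>N0. dd (s m) (s n) < e" using assms unfolding rk_cauchy_def by blast
    show "\<exists>N. \<forall>m\<ge>N. \<forall>n\<ge>N. dd ((s \<circ> f) m) ((s \<circ> f) n) < e"
      by (rule exI[of _ N0]) (use N0 fk in \<open>auto intro: order_trans\<close>)
  qed
  have "rk_equiv R (s \<circ> f) s" unfolding rk_equiv_def
  proof (rule LIMSEQ_I)
    fix e :: real assume "e > 0"
    then obtain N0 where N0: "\<forall>m\<ge>N0. \<forall>n\<ge>N0. dd (s m) (s n) < e" using assms unfolding rk_cauchy_def by blast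
    show "\<exists>no. \<forall>n\<ge>no. norm (dd ((s \<circ> f) n) (s n) - 0) < e"
      by (rule exI[of _ N0]) (use N0 fk d_ge0 cau_car[OF assms] in \<open>auto intro: order_trans\<close>)
  qed
  then have "cl (s \<circ> f) = cl s" using cls_eq_iff c assms by simp
  then show thesis using that f step c by blast
qed

lemma cau_fastI:
  assumes car: "\<And>k. t k \<in> rcar R" and step: "\<And>k. dd (t (Suc k)) (t k) \<le> B * (1/2)^k" and B: "B \<ge> 0"
  shows "cau t"
proof (rule cauI_le[where f = "\<lambda>m n. 2 * B * (1/2)^(min m n)"])
  \<comment> \<open>Stated as a difference of two tails so that the induction on \<open>n\<close>
    closes.\<close>
  have le: "dd (t m) (t n) \<le> 2 * B * (1/2)^m - 2 * B * (1/2)^n" if "m \<le> n" for m n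
    using that
  proof (induction rule: dec_induct)
    case base then show ?case using car by (simp add: d_refl)
  next
    case (step n)
    have "dd (t m) (t (Suc n)) \<le> dd (t m) (t n) + dd (t n) (t (Suc n))" by (simp add: d_tri car)
    also have "\<dots> \<le> (2 * B * (1/2)^m - 2 * B * (1/2)^n) + B * (1/2)^n"
      using step(3) assms(2)[of n] d_sym[OF car car, of n "Suc n"] by simp
    finally show ?case by simp
  qed
  show "dd (t m) (t n) \<le> 2 * B * (1/2)^(min m n)" for m n
  proof (cases "m \<le> n")
    case True
    have "0 \<le> 2 * B * (1/2)^n" using B by simp
    then show ?thesis using le[OF True] True by (simp add: min_def)
  next
    case False
    have "0 \<le> 2 * B * (1/2)^m" using B by simp
    then show ?thesis using le[of n m] False d_sym[OF car car, of m n] by (simp add: min_def)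
  qed
  fix e :: real assume e: "e > 0"
  have "(\<lambda>n. 2 * B * (1/2)^n) \<longlonglongrightarrow> 2 * B * 0" by (intro tendsto_intros LIMSEQ_power_zero) auto
  then have "\<forall>\<^sub>F n in sequentially. 2 * B * (1/2)^n < e" using e by (auto dest: order_tendstoD(2))
  then obtain N where "\<forall>n\<ge>N. 2 * B * (1/2)^n < e" by (auto simp: eventually_sequentially)
  then show "\<exists>N. \<forall>m\<ge>N. \<forall>n\<ge>N. 2 * B * (1/2)^(min m n) < e"
    by (intro exI[of _ N]) auto
qed (use car in auto)

text \<open>Follow a fast Cauchy sequence: \<open>Inv_lip\<close> moves an inner inverse of one term
  to an inner inverse of the next at a cost proportional to the step, so the inverses form a Cauchy
  sequence. \<open>Inv\<close> is left abstract because an inner inverse in a direct limit may live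
  at a higher level than the element.\<close>

lemma Cp_regular:
  fixes Inv :: "'a \<Rightarrow> 'a \<Rightarrow> bool"
  assumes Inv_car: "\<And>x b. Inv x b \<Longrightarrow> b \<in> rcar R"
    and Inv_eq: "\<And>x b. x \<in> rcar R \<Longrightarrow> Inv x b \<Longrightarrow> dd (rmul R (rmul R x b) x) x = 0"
    and Inv_ex: "\<And>x. x \<in> rcar R \<Longrightarrow> \<exists>b. Inv x b"
    and Inv_lip: "\<And>x y b. x \<in> rcar R \<Longrightarrow> y \<in> rcar R \<Longrightarrow> Inv x b \<Longrightarrow> \<exists>b'. Inv y b' \<and> dd b' b \<le> 2 * dd x y"
    and A: "A \<in> rcar Cp"
  shows "\<exists>B\<in>rcar Cp. rmul Cp (rmul Cp A B) A = A"
proof -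
  obtain s0 where s0: "cau s0" "A = cl s0" using A by (rule Cp_cases)
  obtain f where f: "\<And>k. dd (s0 (f (Suc k))) (s0 (f k)) \<le> (1/2)^k" "cau (s0 \<circ> f)" "cl (s0 \<circ> f) = cl s0"
    using cauchy_fast_subseq[OF s0(1)] by metis
  define s where "s = s0 \<circ> f"
  have s: "cau s" "A = cl s" and sd: "\<And>k. dd (s (Suc k)) (s k) \<le> (1/2)^k"
    using f s0 by (auto simp: s_def)
  have car: "s k \<in> rcar R" for k using s(1) by (rule cau_car)
  have "\<exists>t. Inv (s 0) (t 0) \<and> (\<forall>k. Inv (s (Suc k)) (t (Suc k)) \<and> dd (t (Suc k)) (t k) \<le> 2 * dd (s k) (s (Suc k)))"
  proof -
    have "\<exists>t. \<forall>n. (Inv (s n) (t n)) \<and> (dd (t (Suc n)) (t n) \<le> 2 * dd (s n) (s (Suc n)))"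
      by (rule dependent_nat_choice) (use Inv_ex car Inv_lip in auto)
    then show ?thesis by blast
  qed
  then obtain t where t0: "Inv (s 0) (t 0)" and tS: "\<And>k. Inv (s (Suc k)) (t (Suc k))"
    and td: "\<And>k. dd (t (Suc k)) (t k) \<le> 2 * dd (s k) (s (Suc k))" by blast
  have I: "Inv (s k) (t k)" for k using t0 tS by (cases k) auto
  have tc: "t k \<in> rcar R" for k using I Inv_car by blast
  have "dd (t (Suc k)) (t k) \<le> 2 * (1/2)^k" for k
    using td[of k] sd[of k] d_sym[OF car car, of k "Suc k"] by simp
  then have "cau t" using cau_fastI[of t 2] tc by simp
  then have "rmul Cp (rmul Cp A (cl t)) A = A"
    using s cau_mul Inv_eq[OF car I] by (simp add: Cp_mul) (rule cls_eqI; simp)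
  then show ?thesis using in_Cp[OF \<open>cau t\<close>] by blast
qed

text \<open>If x* x tends to zero in rank, then so does x, because its rank is bounded by that of x*
  x.\<close>

lemma Cp_proper:
  assumes pd: "\<And>x. x \<in> rcar R \<Longrightarrow> rrk R x \<le> rrk R (rmul R (rstar R x) x)"
    and A: "A \<in> rcar Cp" "rmul Cp (rstar Cp A) A = rzero Cp"
  shows "A = rzero Cp"
proof -
  obtain s where s: "cau s" "A = cl s" using A(1) by (rule Cp_cases)
  have car: "s k \<in> rcar R" for k using s(1) by (rule cau_car)
  have "cl (\<lambda>k. rmul R (rstar R (s k)) (s k)) = cl (\<lambda>_. rzero R)"
    using A(2) s by (simp add: Cp_star Cp_mul cau_star Cp_zero)
  then have "rk_equiv R (\<lambda>k. rmul R (rstar R (s k)) (s k)) (\<lambda>_. rzero R)"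
    using cls_eq_iff s cau_mul cau_star cau_const car_zero by blast
  then have l: "(\<lambda>k. dd (rmul R (rstar R (s k)) (s k)) (rzero R)) \<longlonglongrightarrow> 0" by (simp add: rk_equiv_def)
  have "rk_equiv R s (\<lambda>_. rzero R)"
  proof (rule equiv_le[OF car car_zero _ l])
    show "dd (s k) (rzero R) \<le> dd (rmul R (rstar R (s k)) (s k)) (rzero R)" for k
      using pd[OF car] car by (simp add: d_zero car_mul car_star)
  qed
  then show ?thesis using s cls_eq_iff cau_const car_zero by (auto simp: Cp_zero)
qed

end

text \<open>The common shape of \<open>Rlift\<close> and \<open>Mlift\<close>, so that both direct
  limits are instances of one construction. It is a genuine lift only for levels from
  \<open>fst p\<close> on; below, truncated subtraction returns \<open>snd p\<close>.\<close>

definition lim_lift :: "(nat \<Rightarrow> 'a \<Rightarrow> 'a) \<Rightarrow> nat \<Rightarrow> nat \<times> 'a \<Rightarrow> 'a" where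
  "lim_lift j m p = snd (((\<lambda>(l, y). (Suc l, j l y)) ^^ (m - fst p)) p)"

lemma lim_lift_pair: "((\<lambda>(l, y). (Suc l, j l y)) ^^ k) p = (fst p + k, lim_lift j (fst p + k) p)"
proof -
  have "fst (((\<lambda>(l, y). (Suc l, j l y)) ^^ k) p) = fst p + k"
    by (induction k) (auto simp: case_prod_beta)
  then show ?thesis by (simp add: lim_lift_def prod_eq_iff)
qed

lemma lim_lift_Suc: "fst p \<le> m \<Longrightarrow> lim_lift j (Suc m) p = j m (lim_lift j m p)"
proof -
  assume "fst p \<le> m"
  then obtain k where k: "m = fst p + k" using le_Suc_ex by blast
  have "lim_lift j (Suc m) p = snd (((\<lambda>(l, y). (Suc l, j l y)) ^^ Suc k) p)"
    by (simp add: lim_lift_def k Suc_diff_le)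
  also have "\<dots> = j m (lim_lift j m p)" by (simp add: lim_lift_pair k)
  finally show ?thesis .
qed

lemma lim_lift_self [simp]: "lim_lift j (fst p) p = snd p" "lim_lift j n (n, x) = x"
  by (auto simp: lim_lift_def)

lemma lim_lift_lift:
  assumes "fst p \<le> k" "k \<le> m"
  shows "lim_lift j m (k, lim_lift j k p) = lim_lift j m p"
  using assms(2) by (induction rule: dec_induct) (use assms(1) in \<open>auto simp: lim_lift_Suc\<close>)

section \<open>Direct limits\<close>

text \<open>At a fixed level the ring laws are true equalities; they weaken to distance zero only in
  the limit. \<open>inv_ex\<close> and \<open>inv_lip\<close> carry the Lipschitz choice of inner
  inverses from matrices to the limit.\<close>

locale rank_system =
  fixes C :: "nat \<Rightarrow> 'a set" and ad mu :: "'a \<Rightarrow> 'a \<Rightarrow> 'a" and sm :: "'k::field \<Rightarrow> 'a \<Rightarrow> 'a"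
    and on ze :: "nat \<Rightarrow> 'a" and sr :: "'a \<Rightarrow> 'a" and rk :: "nat \<Rightarrow> 'a \<Rightarrow> real" and j :: "nat \<Rightarrow> 'a \<Rightarrow> 'a"
  assumes C_one: "on n \<in> C n" and C_zero: "ze n \<in> C n"
    and C_add: "x \<in> C n \<Longrightarrow> y \<in> C n \<Longrightarrow> ad x y \<in> C n"
    and C_mul: "x \<in> C n \<Longrightarrow> y \<in> C n \<Longrightarrow> mu x y \<in> C n"
    and C_smul: "x \<in> C n \<Longrightarrow> sm c x \<in> C n"
    and C_star: "x \<in> C n \<Longrightarrow> sr x \<in> C n"
    and C_j: "x \<in> C n \<Longrightarrow> j n x \<in> C (Suc n)"
    and j_add: "x \<in> C n \<Longrightarrow> y \<in> C n \<Longrightarrow> j n (ad x y) = ad (j n x) (j n y)"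
    and j_mul: "x \<in> C n \<Longrightarrow> y \<in> C n \<Longrightarrow> j n (mu x y) = mu (j n x) (j n y)"
    and j_smul: "x \<in> C n \<Longrightarrow> j n (sm c x) = sm c (j n x)"
    and j_star: "x \<in> C n \<Longrightarrow> j n (sr x) = sr (j n x)"
    and j_one: "j n (on n) = on (Suc n)"
    and j_zero: "j n (ze n) = ze (Suc n)"
    and j_rk: "x \<in> C n \<Longrightarrow> rk (Suc n) (j n x) = rk n x"
    and r_add_assoc: "x \<in> C n \<Longrightarrow> y \<in> C n \<Longrightarrow> z \<in> C n \<Longrightarrow> ad (ad x y) z = ad x (ad y z)"
    and r_add_comm: "x \<in> C n \<Longrightarrow> y \<in> C n \<Longrightarrow> ad x y = ad y x"
    and r_zero: "x \<in> C n \<Longrightarrow> ad x (ze n) = x"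
    and r_neg: "x \<in> C n \<Longrightarrow> ad x (sm (-1) x) = ze n"
    and r_mul_assoc: "x \<in> C n \<Longrightarrow> y \<in> C n \<Longrightarrow> z \<in> C n \<Longrightarrow> mu (mu x y) z = mu x (mu y z)"
    and r_onel: "x \<in> C n \<Longrightarrow> mu (on n) x = x" and r_oner: "x \<in> C n \<Longrightarrow> mu x (on n) = x"
    and r_distl: "x \<in> C n \<Longrightarrow> y \<in> C n \<Longrightarrow> z \<in> C n \<Longrightarrow> mu x (ad y z) = ad (mu x y) (mu x z)"
    and r_distr: "x \<in> C n \<Longrightarrow> y \<in> C n \<Longrightarrow> z \<in> C n \<Longrightarrow> mu (ad x y) z = ad (mu x z) (mu y z)"
    and r_star_add: "x \<in> C n \<Longrightarrow> y \<in> C n \<Longrightarrow> sr (ad x y) = ad (sr x) (sr y)"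
    and r_star_mul: "x \<in> C n \<Longrightarrow> y \<in> C n \<Longrightarrow> sr (mu x y) = mu (sr y) (sr x)"
    and r_star_star: "x \<in> C n \<Longrightarrow> sr (sr x) = x"
    and rk_ge0: "x \<in> C n \<Longrightarrow> 0 \<le> rk n x"
    and rk_ze: "rk n (ze n) = 0"
    and D_sym: "x \<in> C n \<Longrightarrow> y \<in> C n \<Longrightarrow> rk n (ad x (sm (-1) y)) = rk n (ad y (sm (-1) x))"
    and D_tri: "x \<in> C n \<Longrightarrow> y \<in> C n \<Longrightarrow> z \<in> C n \<Longrightarrow>
       rk n (ad x (sm (-1) z)) \<le> rk n (ad x (sm (-1) y)) + rk n (ad y (sm (-1) z))"
    and D_add: "x \<in> C n \<Longrightarrow> y \<in> C n \<Longrightarrow> x' \<in> C n \<Longrightarrow> y' \<in> C n \<Longrightarrow>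
       rk n (ad (ad x x') (sm (-1) (ad y y'))) \<le> rk n (ad x (sm (-1) y)) + rk n (ad x' (sm (-1) y'))"
    and D_mul: "x \<in> C n \<Longrightarrow> y \<in> C n \<Longrightarrow> x' \<in> C n \<Longrightarrow> y' \<in> C n \<Longrightarrow>
       rk n (ad (mu x x') (sm (-1) (mu y y'))) \<le> rk n (ad x (sm (-1) y)) + rk n (ad x' (sm (-1) y'))"
    and D_smul: "x \<in> C n \<Longrightarrow> y \<in> C n \<Longrightarrow> rk n (ad (sm c x) (sm (-1) (sm c y))) \<le> rk n (ad x (sm (-1) y))"
    and D_star: "x \<in> C n \<Longrightarrow> y \<in> C n \<Longrightarrow> rk n (ad (sr x) (sm (-1) (sr y))) \<le> rk n (ad x (sm (-1) y))"
    and D_rk: "x \<in> C n \<Longrightarrow> y \<in> C n \<Longrightarrow> rk n x \<le> rk n y + rk n (ad x (sm (-1) y))"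
    and inv_ex: "x \<in> C n \<Longrightarrow> \<exists>b\<in>C n. mu (mu x b) x = x"
    and inv_lip: "x \<in> C n \<Longrightarrow> y \<in> C n \<Longrightarrow> b \<in> C n \<Longrightarrow> mu (mu x b) x = x \<Longrightarrow>
       \<exists>b'\<in>C n. mu (mu y b') y = y \<and> rk n (ad b' (sm (-1) b)) \<le> 2 * rk n (ad x (sm (-1) y))"
begin

abbreviation "lft \<equiv> lim_lift j"

definition lim_alg :: "(nat \<times> 'a, 'k) ralg" where
  "lim_alg = \<lparr>
     rcar = {p. snd p \<in> C (fst p)},
     radd = (\<lambda>p q. (max (fst p) (fst q), ad (lft (max (fst p) (fst q)) p) (lft (max (fst p) (fst q)) q))),
     rmul = (\<lambda>p q. (max (fst p) (fst q), mu (lft (max (fst p) (fst q)) p) (lft (max (fst p) (fst q)) q))),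
     rsmul = (\<lambda>c p. (fst p, sm c (snd p))),
     rone = (0, on 0),
     rzero = (0, ze 0),
     rstar = (\<lambda>p. (fst p, sr (snd p))),
     rrk = (\<lambda>p. rk (fst p) (snd p)) \<rparr>"

abbreviation "L \<equiv> lim_alg"

lemma lim_alg_sel [simp]:
  "p \<in> rcar L \<longleftrightarrow> snd p \<in> C (fst p)"
  "radd L p q = (max (fst p) (fst q), ad (lft (max (fst p) (fst q)) p) (lft (max (fst p) (fst q)) q))"
  "rmul L p q = (max (fst p) (fst q), mu (lft (max (fst p) (fst q)) p) (lft (max (fst p) (fst q)) q))"
  "rsmul L c p = (fst p, sm c (snd p))"
  "rone L = (0, on 0)" "rzero L = (0, ze 0)"
  "rstar L p = (fst p, sr (snd p))"
  "rrk L p = rk (fst p) (snd p)"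
  by (auto simp: lim_alg_def)

lemma lft_C:
  assumes "p \<in> rcar L" "fst p \<le> m" shows "lft m p \<in> C m"
  using assms(2) by (induction rule: dec_induct) (use assms(1) in \<open>auto simp: lim_lift_Suc C_j\<close>)

lemma lft_rk:
  assumes "p \<in> rcar L" "fst p \<le> m" shows "rk m (lft m p) = rk (fst p) (snd p)"
  using assms(2) by (induction rule: dec_induct) (use assms(1) in \<open>auto simp: lim_lift_Suc j_rk lft_C\<close>)

lemma lft_add:
  assumes "p \<in> rcar L" "q \<in> rcar L" "fst p \<le> m" "fst q \<le> m"
  shows "lft m (radd L p q) = ad (lft m p) (lft m q)"
proof -
  have "max (fst p) (fst q) \<le> m" using assms by simp
  then show ?thesis
  proof (induction rule: dec_induct)
    case base then show ?case by simp
  next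
    case (step n)
    then show ?case using assms(1,2) by (simp add: lim_lift_Suc j_add lft_C)
  qed
qed

lemma lft_mul:
  assumes "p \<in> rcar L" "q \<in> rcar L" "fst p \<le> m" "fst q \<le> m"
  shows "lft m (rmul L p q) = mu (lft m p) (lft m q)"
proof -
  have "max (fst p) (fst q) \<le> m" using assms by simp
  then show ?thesis
  proof (induction rule: dec_induct)
    case base then show ?case by simp
  next
    case (step n)
    then show ?case using assms(1,2) by (simp add: lim_lift_Suc j_mul lft_C)
  qed
qed

lemma lft_smul:
  assumes "p \<in> rcar L" "fst p \<le> m"
  shows "lft m (rsmul L c p) = sm c (lft m p)"
  using assms(2) by (induction rule: dec_induct) (use assms(1) in \<open>auto simp: lim_lift_Suc j_smul lft_C\<close>)

lemma lft_star:
  assumes "p \<in> rcar L" "fst p \<le> m"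
  shows "lft m (rstar L p) = sr (lft m p)"
  using assms(2) by (induction rule: dec_induct) (use assms(1) in \<open>auto simp: lim_lift_Suc j_star lft_C\<close>)

lemma lft_one: "lft m (rone L) = on m"
  by (induction m) (auto simp: lim_lift_Suc j_one)

lemma lft_zero: "lft m (rzero L) = ze m"
  by (induction m) (auto simp: lim_lift_Suc j_zero)

lemma car_ops:
  assumes "p \<in> rcar L" "q \<in> rcar L"
  shows "radd L p q \<in> rcar L" "rmul L p q \<in> rcar L" "rsmul L c p \<in> rcar L" "rstar L p \<in> rcar L"
  using assms by (auto simp: C_add C_mul C_smul C_star lft_C)

lemma car_one_zero: "rone L \<in> rcar L" "rzero L \<in> rcar L"
  by (auto simp: C_one C_zero)

lemma fst_ops: "fst (radd L p q) = max (fst p) (fst q)" "fst (rmul L p q) = max (fst p) (fst q)"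
  "fst (rsmul L c p) = fst p" "fst (rstar L p) = fst p" "fst (rone L) = 0" "fst (rzero L) = 0"
  by auto

declare car_one_zero [simp] car_ops(1,2) [simp] car_ops(3,4)[OF _ car_one_zero(1), simp]

declare lim_alg_sel [simp del]
declare fst_ops [simp] lft_add [simp] lft_mul [simp] lft_smul [simp] lft_star [simp] lft_one [simp] lft_zero [simp] lft_C [simp]

text \<open>The connecting maps preserve rank, so a distance may be computed at any common level.
  Every inequality in the limit is thereby reduced to one level.\<close>

lemma dist_lft:
  assumes "p \<in> rcar L" "q \<in> rcar L" "fst p \<le> m" "fst q \<le> m"
  shows "rk_dist L p q = rk m (ad (lft m p) (sm (-1) (lft m q)))"
proof -
  have "rk_dist L p q = rrk L (radd L p (rsmul L (-1) q))" by (simp only: rk_dist_def)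
  also have "\<dots> = rk m (lft m (radd L p (rsmul L (-1) q)))"
    using lft_rk[of "radd L p (rsmul L (-1) q)" m] assms by (simp add: lim_alg_sel(8))
  also have "\<dots> = rk m (ad (lft m p) (sm (-1) (lft m q)))"
    using assms by simp
  finally show ?thesis .
qed

lemma D_refl: "x \<in> C n \<Longrightarrow> rk n (ad x (sm (-1) x)) = 0"
  by (simp add: r_neg rk_ze)

lemma eqvI:
  assumes "p \<in> rcar L" "q \<in> rcar L" "fst p \<le> m" "fst q \<le> m" "lft m p = lft m q"
  shows "rk_dist L p q = 0"
  using dist_lft[OF assms(1-4)] assms lft_C by (auto simp: D_refl)

lemma rank_alg_lim_alg: "rank_alg lim_alg"
proof
  show o: "rone L \<in> rcar L" and z: "rzero L \<in> rcar L" by auto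
  show "rrk L (rzero L) = 0" by (simp add: rk_ze lim_alg_sel)
  fix x assume x: "x \<in> rcar L"
  have sx: "snd x \<in> C (fst x)" using x by (simp add: lim_alg_sel)
  show s: "rsmul L c x \<in> rcar L" for c using x car_ops by blast
  show st: "rstar L x \<in> rcar L" using x car_ops by blast
  show "rk_dist L x x = 0" by (rule eqvI[of _ _ "fst x"]) (use x sx in auto)
  show "rk_dist L (radd L x (rzero L)) x = 0"
    by (rule eqvI[of _ _ "fst x"]) (use x sx z in \<open>auto simp: r_zero\<close>)
  show "rk_dist L (radd L x (rsmul L (-1) x)) (rzero L) = 0"
    by (rule eqvI[of _ _ "fst x"]) (use x sx z s in \<open>auto simp: r_neg\<close>)
  show "rk_dist L (rmul L (rone L) x) x = 0"
    by (rule eqvI[of _ _ "fst x"]) (use x sx o in \<open>auto simp: r_onel\<close>)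
  show "rk_dist L (rmul L x (rone L)) x = 0"
    by (rule eqvI[of _ _ "fst x"]) (use x sx o in \<open>auto simp: r_oner\<close>)
  show "rk_dist L (rstar L (rstar L x)) x = 0"
    by (rule eqvI[of _ _ "fst x"]) (use x sx st in \<open>auto simp: r_star_star\<close>)
  fix y assume y: "y \<in> rcar L"
  show "radd L x y \<in> rcar L" "rmul L x y \<in> rcar L" using x y car_ops by blast+
  have sty: "rstar L y \<in> rcar L" using y car_ops by blast
  let ?m = "max (fst x) (fst y)"
  have X: "lft ?m x \<in> C ?m" and Y: "lft ?m y \<in> C ?m" using x y by auto
  have d: "rk_dist L x y = rk ?m (ad (lft ?m x) (sm (-1) (lft ?m y)))" by (rule dist_lft) (use x y in auto)
  have d': "rk_dist L y x = rk ?m (ad (lft ?m y) (sm (-1) (lft ?m x)))" by (rule dist_lft) (use x y in auto)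
  show "0 \<le> rk_dist L x y" unfolding d using X Y by (simp add: rk_ge0 C_add C_smul)
  show "rk_dist L x y = rk_dist L y x" unfolding d d' using X Y by (rule D_sym)
  show "rk_dist L (rsmul L c x) (rsmul L c y) \<le> rk_dist L x y" for c
    unfolding d using x y X Y by (subst dist_lft[of _ _ ?m]) (auto simp: D_smul[OF X Y])
  show "rk_dist L (rstar L x) (rstar L y) \<le> rk_dist L x y"
    unfolding d using x y X Y by (subst dist_lft[of _ _ ?m]) (auto simp: D_star[OF X Y])
  have "rrk L x = rk ?m (lft ?m x)" "rrk L y = rk ?m (lft ?m y)" using lft_rk[OF x, of ?m] lft_rk[OF y, of ?m] by (auto simp: lim_alg_sel)
  then show "\<bar>rrk L x - rrk L y\<bar> \<le> rk_dist L x y"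
    using D_rk[OF X Y] D_rk[OF Y X] D_sym[OF X Y] d by (simp add: abs_le_iff)
  show "rk_dist L (radd L x y) (radd L y x) = 0"
    by (rule eqvI[of _ _ ?m]) (use x y r_add_comm[OF X Y] in auto)
  show "rk_dist L (rstar L (radd L x y)) (radd L (rstar L x) (rstar L y)) = 0"
    by (rule eqvI[of _ _ ?m]) (use x y st sty r_star_add[OF X Y] in auto)
  show "rk_dist L (rstar L (rmul L x y)) (rmul L (rstar L y) (rstar L x)) = 0"
    by (rule eqvI[of _ _ ?m]) (use x y st sty r_star_mul[OF X Y] in auto)
  fix z assume z: "z \<in> rcar L"
  let ?k = "max (max (fst x) (fst y)) (fst z)"
  have X3: "lft ?k x \<in> C ?k" and Y3: "lft ?k y \<in> C ?k" and Z3: "lft ?k z \<in> C ?k" using x y z by auto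
  have c: "radd L x y \<in> rcar L" "radd L y z \<in> rcar L" "rmul L x y \<in> rcar L" "rmul L y z \<in> rcar L" "rmul L x z \<in> rcar L"
    using x y z car_ops by blast+
  have le: "fst x \<le> ?k" "fst y \<le> ?k" "fst z \<le> ?k" by auto
  show "rk_dist L x z \<le> rk_dist L x y + rk_dist L y z"
    using D_tri[OF X3 Y3 Z3] dist_lft[OF x z le(1,3)] dist_lft[OF x y le(1,2)] dist_lft[OF y z le(2,3)] by simp
  show "rk_dist L (radd L (radd L x y) z) (radd L x (radd L y z)) = 0"
    by (rule eqvI[of _ _ ?k]) (use x y z c r_add_assoc[OF X3 Y3 Z3] in auto)
  show "rk_dist L (rmul L (rmul L x y) z) (rmul L x (rmul L y z)) = 0"
    by (rule eqvI[of _ _ ?k]) (use x y z c r_mul_assoc[OF X3 Y3 Z3] in auto)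
  show "rk_dist L (rmul L x (radd L y z)) (radd L (rmul L x y) (rmul L x z)) = 0"
    by (rule eqvI[of _ _ ?k]) (use x y z c r_distl[OF X3 Y3 Z3] in auto)
  show "rk_dist L (rmul L (radd L x y) z) (radd L (rmul L x z) (rmul L y z)) = 0"
    by (rule eqvI[of _ _ ?k]) (use x y z c r_distr[OF X3 Y3 Z3] in auto)
next
  fix x y x' y' assume h: "x \<in> rcar L" "y \<in> rcar L" "x' \<in> rcar L" "y' \<in> rcar L"
  let ?k = "max (max (fst x) (fst y)) (max (fst x') (fst y'))"
  have C4: "lft ?k x \<in> C ?k" "lft ?k y \<in> C ?k" "lft ?k x' \<in> C ?k" "lft ?k y' \<in> C ?k" using h by auto
  have le: "fst x \<le> ?k" "fst y \<le> ?k" "fst x' \<le> ?k" "fst y' \<le> ?k" by auto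
  have c: "radd L x x' \<in> rcar L" "radd L y y' \<in> rcar L" "rmul L x x' \<in> rcar L" "rmul L y y' \<in> rcar L"
    using h car_ops by blast+
  show "rk_dist L (radd L x x') (radd L y y') \<le> rk_dist L x y + rk_dist L x' y'"
    unfolding dist_lft[OF h(1,2) le(1,2)] dist_lft[OF h(3,4) le(3,4)]
    using h C4 by (subst dist_lft[OF c(1,2), of ?k]) (auto simp: D_add[OF C4])
  show "rk_dist L (rmul L x x') (rmul L y y') \<le> rk_dist L x y + rk_dist L x' y'"
    unfolding dist_lft[OF h(1,2) le(1,2)] dist_lft[OF h(3,4) le(3,4)]
    using h C4 by (subst dist_lft[OF c(3,4), of ?k]) (auto simp: D_mul[OF C4])
qed

text \<open>The abstract scheme for completions, with inner inverses that are allowed to sit at a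
  level above that of the element.\<close>

lemma completion_regular:
  assumes "A \<in> rcar (rk_completion L)"
  shows "\<exists>B\<in>rcar (rk_completion L). rmul (rk_completion L) (rmul (rk_completion L) A B) A = A"
proof -
  interpret ra: rank_alg L by (rule rank_alg_lim_alg)
  \<comment> \<open>The equation is required literally at the level of \<open>b\<close>, where the
    Lipschitz choice is available; in the limit algebra it gives distance zero.\<close>
  define Inv where "Inv x b \<longleftrightarrow> b \<in> rcar L \<and> fst x \<le> fst b \<and>
     mu (mu (lft (fst b) x) (snd b)) (lft (fst b) x) = lft (fst b) x" for x b
  show ?thesis
  proof (rule ra.Cp_regular[where Inv = Inv, OF _ _ _ _ assms])
    show "Inv x b \<Longrightarrow> b \<in> rcar L" for x b by (simp add: Inv_def)
    show "rk_dist L (rmul L (rmul L x b) x) x = 0" if x: "x \<in> rcar L" and i: "Inv x b" for x b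
    proof (rule eqvI[of _ _ "fst b"])
      have b: "b \<in> rcar L" "fst x \<le> fst b" using i by (auto simp: Inv_def)
      have c: "rmul L x b \<in> rcar L" using x b car_ops by blast
      show "rmul L (rmul L x b) x \<in> rcar L" using x c car_ops by blast
      show "x \<in> rcar L" by fact
      show "fst (rmul L (rmul L x b) x) \<le> fst b" "fst x \<le> fst b" using b by auto
      show "lft (fst b) (rmul L (rmul L x b) x) = lft (fst b) x"
        using x b c i by (auto simp: Inv_def)
    qed
    show "\<exists>b. Inv x b" if x: "x \<in> rcar L" for x
    proof -
      obtain b where "b \<in> C (fst x)" "mu (mu (snd x) b) (snd x) = snd x" using inv_ex x by (auto simp: lim_alg_sel)
      then have "Inv x (fst x, b)" by (auto simp: Inv_def lim_alg_sel)
      then show ?thesis by blast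
    qed
    show "\<exists>b'. Inv y b' \<and> rk_dist L b' b \<le> 2 * rk_dist L x y"
      if x: "x \<in> rcar L" and y: "y \<in> rcar L" and i: "Inv x b" for x y b
    proof -
      have b: "b \<in> rcar L" "fst x \<le> fst b" using i by (auto simp: Inv_def)
      \<comment> \<open>\<open>b\<close> is raised to a level that also contains \<open>y\<close>.
        The lift is multiplicative, so it remains an inner inverse of the lifted
        \<open>x\<close>.\<close>
      let ?m = "max (fst b) (fst y)"
      have le: "fst x \<le> ?m" "fst b \<le> ?m" "fst y \<le> ?m" using b by auto
      have cs: "lft ?m x \<in> C ?m" "lft ?m y \<in> C ?m" "lft ?m b \<in> C ?m" using x y b by auto
      have c: "rmul L x b \<in> rcar L" using x b car_ops by blast
      have "mu (mu (lft ?m x) (lft ?m b)) (lft ?m x) = lft ?m (rmul L (rmul L x b) x)"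
        using x b c le by auto
      also have "rmul L (rmul L x b) x = (fst b, lft (fst b) x)"
        using i b x by (auto simp: Inv_def lim_alg_sel)
      also have "lft ?m (fst b, lft (fst b) x) = lft ?m x" using b by (intro lim_lift_lift) auto
      finally obtain b' where b': "b' \<in> C ?m" "mu (mu (lft ?m y) b') (lft ?m y) = lft ?m y"
        "rk ?m (ad b' (sm (-1) (lft ?m b))) \<le> 2 * rk ?m (ad (lft ?m x) (sm (-1) (lft ?m y)))"
        using inv_lip[OF cs(1,2,3)] by blast
      have "Inv y (?m, b')" using b' by (auto simp: Inv_def lim_alg_sel)
      moreover have "rk_dist L (?m, b') b \<le> 2 * rk_dist L x y"
        using b' dist_lft[of "(?m, b')" b ?m] dist_lft[OF x y le(1,3)] b le by (simp add: lim_alg_sel(1))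
      ultimately show ?thesis by blast
    qed
  qed
qed

end

section \<open>Isomorphisms of completions by approximate intertwining\<close>

lemma star_kalg_iso_sym:
  assumes iso: "star_kalg_iso S R"
    and cl: "\<And>x y. x \<in> rcar S \<Longrightarrow> y \<in> rcar S \<Longrightarrow> radd S x y \<in> rcar S \<and> rmul S x y \<in> rcar S"
    "\<And>c x. x \<in> rcar S \<Longrightarrow> rsmul S c x \<in> rcar S" "\<And>x. x \<in> rcar S \<Longrightarrow> rstar S x \<in> rcar S" "rone S \<in> rcar S"
  shows "star_kalg_iso R S"
proof -
  obtain f where f: "bij_betw f (rcar S) (rcar R)"
     "\<And>x y. x \<in> rcar S \<Longrightarrow> y \<in> rcar S \<Longrightarrow> f (radd S x y) = radd R (f x) (f y) \<and> f (rmul S x y) = rmul R (f x) (f y)"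
     "\<And>c x. x \<in> rcar S \<Longrightarrow> f (rsmul S c x) = rsmul R c (f x)" "f (rone S) = rone R"
     "\<And>x. x \<in> rcar S \<Longrightarrow> f (rstar S x) = rstar R (f x)"
    using iso unfolding star_kalg_iso_def by blast
  let ?g = "inv_into (rcar S) f"
  have g: "?g (f x) = x" if "x \<in> rcar S" for x using f(1) that by (simp add: bij_betw_def inv_into_f_f)
  have ex: "\<exists>x\<in>rcar S. y = f x" if "y \<in> rcar R" for y using f(1) that by (auto simp: bij_betw_def)
  show ?thesis unfolding star_kalg_iso_def
  proof (intro exI[of _ ?g] conjI ballI allI)
    show "bij_betw ?g (rcar R) (rcar S)" using f(1) by (rule bij_betw_inv_into)
    show "?g (rone R) = rone S" using f(4) g cl(4) by metis
    fix x y assume "x \<in> rcar R" "y \<in> rcar R"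
    then obtain a b where ab: "a \<in> rcar S" "x = f a" "b \<in> rcar S" "y = f b" using ex by metis
    show "?g (radd R x y) = radd S (?g x) (?g y)" using ab f(2) g cl by metis
    show "?g (rmul R x y) = rmul S (?g x) (?g y)" using ab f(2) g cl by metis
  next
    fix x c assume "x \<in> rcar R"
    then obtain a where ab: "a \<in> rcar S" "x = f a" using ex by metis
    show "?g (rsmul R c x) = rsmul S c (?g x)" using ab f(3) g cl by metis
  next
    fix x assume "x \<in> rcar R"
    then obtain a where ab: "a \<in> rcar S" "x = f a" using ex by metis
    show "?g (rstar R x) = rstar S (?g x)" using ab f(5) g cl by metis
  qed
qed

text \<open>The maps \<open>ps K\<close> are compatible with the operations up to distance zero,
  nearly preserve unit and rank, and change by at most (1/2)^K from one stage to the next. They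
  converge to a homomorphism between the completions. Since distance is the rank of a difference,
  control of rank makes the limit isometric and so injective; \<open>ps_dense\<close> together with
  completeness makes it onto.\<close>

lemma approx_intertwining:
  fixes S :: "('a,'k::field) ralg" and R :: "('b,'k) ralg"
    and Dm :: "nat \<Rightarrow> 'a set" and ps :: "nat \<Rightarrow> 'a \<Rightarrow> 'b"
  assumes S: "rank_alg S" and R: "rank_alg R"
    and Dm_sub: "\<And>K. Dm K \<subseteq> rcar S" and Dm_mono: "\<And>K. Dm K \<subseteq> Dm (Suc K)"
    and Dm_un: "\<And>x. x \<in> rcar S \<Longrightarrow> \<exists>K. x \<in> Dm K"
    and Dm_one: "\<And>K. rone S \<in> Dm K"
    and Dm_add: "\<And>K x y. x \<in> Dm K \<Longrightarrow> y \<in> Dm K \<Longrightarrow> radd S x y \<in> Dm K"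
    and Dm_mul: "\<And>K x y. x \<in> Dm K \<Longrightarrow> y \<in> Dm K \<Longrightarrow> rmul S x y \<in> Dm K"
    and Dm_smul: "\<And>K c x. x \<in> Dm K \<Longrightarrow> rsmul S c x \<in> Dm K"
    and Dm_star: "\<And>K x. x \<in> Dm K \<Longrightarrow> rstar S x \<in> Dm K"
    and ps_car: "\<And>K x. x \<in> Dm K \<Longrightarrow> ps K x \<in> rcar R"
    and ps_add: "\<And>K x y. x \<in> Dm K \<Longrightarrow> y \<in> Dm K \<Longrightarrow> rk_dist R (ps K (radd S x y)) (radd R (ps K x) (ps K y)) = 0"
    and ps_mul: "\<And>K x y. x \<in> Dm K \<Longrightarrow> y \<in> Dm K \<Longrightarrow> rk_dist R (ps K (rmul S x y)) (rmul R (ps K x) (ps K y)) = 0"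
    and ps_smul: "\<And>K c x. x \<in> Dm K \<Longrightarrow> rk_dist R (ps K (rsmul S c x)) (rsmul R c (ps K x)) = 0"
    and ps_star: "\<And>K x. x \<in> Dm K \<Longrightarrow> rk_dist R (ps K (rstar S x)) (rstar R (ps K x)) = 0"
    and ps_rk: "\<And>K x. x \<in> Dm K \<Longrightarrow> \<bar>rrk R (ps K x) - rrk S x\<bar> \<le> (1/2)^K"
    and ps_one: "\<And>K. rk_dist R (ps K (rone S)) (rone R) \<le> (1/2)^K"
    and ps_step: "\<And>K x. x \<in> Dm K \<Longrightarrow> rk_dist R (ps K x) (ps (Suc K) x) \<le> (1/2)^K"
    and ps_dense: "\<And>r K0 e. r \<in> rcar R \<Longrightarrow> e > 0 \<Longrightarrow> \<exists>K\<ge>K0. \<exists>x\<in>Dm K. rk_dist R (ps K x) r < e"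
  shows "star_kalg_iso (rk_completion R) (rk_completion S)"
proof -
  interpret S: rank_alg S by (rule S)
  interpret R: rank_alg R by (rule R)
  have mono: "x \<in> Dm K'" if "x \<in> Dm K" "K \<le> K'" for x K K'
    using that(2) by (induction rule: dec_induct) (use that(1) Dm_mono in auto)
  \<comment> \<open>The stage used for the k-th term: late enough for an error of order (1/2)^k and
    late enough for \<open>x\<close> to lie in the domain.\<close>
  define kap where "kap k x = (LEAST K. k \<le> K \<and> x \<in> Dm K)" for k x
  have ex: "\<exists>K. k \<le> K \<and> x \<in> Dm K" if "x \<in> rcar S" for k x
    using Dm_un[OF that] mono by (meson max.cobounded1 max.cobounded2)
  have kap: "k \<le> kap k x" "x \<in> Dm (kap k x)" if "x \<in> rcar S" for k x
    using LeastI_ex[OF ex[OF that, of k]] by (auto simp: kap_def)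
  have kap_le: "kap k x \<le> K" if "k \<le> K" "x \<in> Dm K" for k x K
    unfolding kap_def by (rule Least_le) (use that in auto)
  have l1: "R.dd (ps K x) (ps K' x) \<le> 2 * (1/2)^K - 2 * (1/2)^K'" if "x \<in> Dm K" "K \<le> K'" for x K K'
    using that(2)
  proof (induction rule: dec_induct)
    case base then show ?case using that(1) by (simp add: R.d_refl ps_car)
  next
    case (step n)
    have n: "x \<in> Dm n" "x \<in> Dm (Suc n)" using mono[OF that(1), of n] mono[OF that(1), of "Suc n"] step by auto
    have "R.dd (ps K x) (ps (Suc n) x) \<le> R.dd (ps K x) (ps n x) + R.dd (ps n x) (ps (Suc n) x)"
      by (intro R.d_tri ps_car n that(1))
    also have "\<dots> \<le> (2 * (1/2)^K - 2 * (1/2)^n) + (1/2)^n" using step ps_step[OF n(1)] by simp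
    finally show ?case by simp
  qed
  define h where "h k x = ps (kap k x) x" for k x
  have h_car: "h k x \<in> rcar R" if "x \<in> rcar S" for k x using kap[OF that] ps_car by (auto simp: h_def)
  have l2: "R.dd (h k x) (ps K x) \<le> 2 * (1/2)^k" if "k \<le> K" "x \<in> Dm K" for k K x
  proof -
    have x: "x \<in> rcar S" using that Dm_sub by blast
    have "R.dd (h k x) (ps K x) \<le> 2 * (1/2)^(kap k x) - 2 * (1/2)^K"
      unfolding h_def by (rule l1) (use kap[OF x] kap_le that in auto)
    also have "\<dots> \<le> 2 * (1/2)^(kap k x)" by simp
    also have "\<dots> \<le> 2 * (1/2)^k" using kap(1)[OF x] by (simp add: power_decreasing)
    finally show ?thesis .
  qed
  \<comment> \<open>Additivity and scalar compatibility hold up to distance zero, so the distance of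
    the images is the rank of the image of the difference, and \<open>ps_rk\<close> applies.\<close>
  have l3: "\<bar>R.dd (ps K x) (ps K y) - S.dd x y\<bar> \<le> (1/2)^K" if x: "x \<in> Dm K" and y: "y \<in> Dm K" for x y K
  proof -
    let ?ny = "rsmul S (-1) y" and ?z = "radd S x (rsmul S (-1) y)"
    have d: "?ny \<in> Dm K" "?z \<in> Dm K" using x y Dm_add Dm_smul by auto
    have c: "ps K x \<in> rcar R" "ps K y \<in> rcar R" "ps K ?ny \<in> rcar R" "ps K ?z \<in> rcar R"
      "rsmul R (-1) (ps K y) \<in> rcar R" "radd R (ps K x) (ps K ?ny) \<in> rcar R"
      "radd R (ps K x) (rsmul R (-1) (ps K y)) \<in> rcar R"
      using x y d ps_car R.car_smul R.car_add by auto
    have "R.dd (ps K ?z) (radd R (ps K x) (ps K ?ny)) = 0" using ps_add[OF x d(1)] .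
    moreover have "R.dd (radd R (ps K x) (ps K ?ny)) (radd R (ps K x) (rsmul R (-1) (ps K y))) \<le> 0"
      using R.d_add[OF c(1,1,3,5)] ps_smul[OF y, of "-1"] R.d_refl[OF c(1)] by simp
    ultimately have "R.dd (ps K ?z) (radd R (ps K x) (rsmul R (-1) (ps K y))) \<le> 0"
      using R.d_tri[OF c(4,6,7)] by simp
    then have "rrk R (ps K ?z) = R.dd (ps K x) (ps K y)"
      using R.d_rk[OF c(4,7)] by (simp add: rk_dist_def)
    then show ?thesis using ps_rk[OF d(2)] by (simp add: rk_dist_def)
  qed
  \<comment> \<open>Compare at a common stage \<open>K\<close>: by \<open>l2\<close> the passage
    costs 2 * (1/2)^k and 2 * (1/2)^k', and \<open>l3\<close> costs (1/2)^K, which is at most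
    (1/2)^k.\<close>
  have l4: "\<bar>R.dd (h k x) (h k' y) - S.dd x y\<bar> \<le> 3 * (1/2)^k + 3 * (1/2)^k'"
    if x: "x \<in> rcar S" and y: "y \<in> rcar S" for x y k k'
  proof -
    define K where "K = max (kap k x) (kap k' y)"
    have K: "k \<le> K" "k' \<le> K" "x \<in> Dm K" "y \<in> Dm K"
      using kap[OF x, of k] kap[OF y, of k'] mono by (auto simp: K_def intro: mono)
    have c: "h k x \<in> rcar R" "h k' y \<in> rcar R" "ps K x \<in> rcar R" "ps K y \<in> rcar R" using h_car x y ps_car K by auto
    have "(1/2::real)^K \<le> (1/2)^k" "(0::real) \<le> (1/2)^k'" using K by (simp_all add: power_decreasing)
    then show ?thesis
      using l2[OF K(1,3)] l2[OF K(2,4)] l3[OF K(3,4)]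
        R.d_tri[OF c(1,3,2)] R.d_tri[OF c(3,4,2)] R.d_tri[OF c(3,1,4)] R.d_tri[OF c(1,2,4)]
        R.d_sym[OF c(1,3)] R.d_sym[OF c(2,4)] unfolding abs_le_iff by linarith
  qed
  \<comment> \<open>Diagonal choice: the k-th term is mapped with stage at least \<open>k\<close>,
    so all errors vanish along the sequence.\<close>
  define G where "G s k = h k (s k)" for s k
  have pw: "\<exists>N. \<forall>k\<ge>N. C * (1/2::real)^k < e" if "e > 0" for e C :: real
  proof -
    have "(\<lambda>n. C * (1/2)^n) \<longlonglongrightarrow> C * 0" by (intro tendsto_intros LIMSEQ_power_zero) auto
    then have "\<forall>\<^sub>F n in sequentially. C * (1/2)^n < e" using that by (auto dest: order_tendstoD(2))
    then show ?thesis by (auto simp: eventually_sequentially)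
  qed
  have pw0: "(\<lambda>k. C * (1/2::real)^k) \<longlonglongrightarrow> 0" for C :: real
  proof -
    have "(\<lambda>n. C * (1/2)^n) \<longlonglongrightarrow> C * 0" by (intro tendsto_intros LIMSEQ_power_zero) auto
    then show ?thesis by simp
  qed
  have G_cau: "R.cau (G s)" if s: "S.cau s" for s
  proof (rule R.cauI_le[where f = "\<lambda>m n. S.dd (s m) (s n) + (3 * (1/2)^m + 3 * (1/2)^n)"])
    show "G s k \<in> rcar R" for k using S.cau_car[OF s] h_car by (simp add: G_def)
    show "R.dd (G s m) (G s n) \<le> S.dd (s m) (s n) + (3 * (1/2)^m + 3 * (1/2)^n)" for m n
      using l4[OF S.cau_car[OF s] S.cau_car[OF s], of m m n n] by (simp add: G_def)
    fix e :: real assume e: "e > 0"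
    then have "e/3 > 0" by simp
    then obtain N1 where N1: "\<forall>m\<ge>N1. \<forall>n\<ge>N1. S.dd (s m) (s n) < e/3" using s unfolding rk_cauchy_def by blast
    obtain N2 where N2: "\<forall>k\<ge>N2. 3 * (1/2::real)^k < e/3" using pw[OF \<open>e/3>0\<close>] by blast
    show "\<exists>N. \<forall>m\<ge>N. \<forall>n\<ge>N. S.dd (s m) (s n) + (3 * (1/2)^m + 3 * (1/2)^n) < e"
    proof (intro exI[of _ "max N1 N2"] allI impI)
      fix m n assume "m \<ge> max N1 N2" "n \<ge> max N1 N2"
      then have "S.dd (s m) (s n) < e/3" "3 * (1/2::real)^m < e/3" "3 * (1/2::real)^n < e/3" using N1 N2 by auto
      then show "S.dd (s m) (s n) + (3 * (1/2)^m + 3 * (1/2)^n) < e" by linarith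
    qed
  qed
  have G_equiv: "rk_equiv R (G s) (G t) \<longleftrightarrow> rk_equiv S s t" if s: "S.cau s" and t: "S.cau t" for s t
  proof -
    have le: "\<bar>R.dd (G s k) (G t k) - S.dd (s k) (t k)\<bar> \<le> 6 * (1/2)^k" for k
      using l4[OF S.cau_car[OF s] S.cau_car[OF t], of k k k k] by (simp add: G_def)
    have "(\<lambda>k. R.dd (G s k) (G t k) - S.dd (s k) (t k)) \<longlonglongrightarrow> 0"
      by (rule Lim_null_comparison[OF _ pw0[of 6]]) (use le in auto)
    from tendsto_add[OF this, of "\<lambda>k. S.dd (s k) (t k)" 0] tendsto_diff[OF _ this, of "\<lambda>k. R.dd (G s k) (G t k)" 0]
    show ?thesis unfolding rk_equiv_def by auto
  qed
  define F where "F A = R.cl (G (rep A))" for A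
  have F_cl: "F (S.cl s) = R.cl (G s)" if s: "S.cau s" for s
    unfolding F_def using S.rep_in[OF s] G_equiv[OF s S.rep_in(1)[OF s]] R.cls_eq_iff[OF G_cau[OF s] G_cau[OF S.rep_in(1)[OF s]]] by simp
  \<comment> \<open>Treats sum and product together. At a common stage the map is compatible with
    the operation; replacing \<open>ps K\<close> by \<open>h k\<close> costs 2 * (1/2)^k for each
    argument and for the result, in total 6.\<close>
  have F_op2: "F (S.cl (\<lambda>k. opS (s k) (t k))) = opC (F (S.cl s)) (F (S.cl t))"
    if s: "S.cau s" and t: "S.cau t" and cauop: "S.cau (\<lambda>k. opS (s k) (t k))"
      and opC: "\<And>s t. R.cau s \<Longrightarrow> R.cau t \<Longrightarrow> opC (R.cl s) (R.cl t) = R.cl (\<lambda>k. opR (s k) (t k)) \<and> R.cau (\<lambda>k. opR (s k) (t k))"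
      and Dop: "\<And>K x y. x \<in> Dm K \<Longrightarrow> y \<in> Dm K \<Longrightarrow> opS x y \<in> Dm K"
      and car: "\<And>x y. x \<in> rcar R \<Longrightarrow> y \<in> rcar R \<Longrightarrow> opR x y \<in> rcar R"
      and psop: "\<And>K x y. x \<in> Dm K \<Longrightarrow> y \<in> Dm K \<Longrightarrow> R.dd (ps K (opS x y)) (opR (ps K x) (ps K y)) = 0"
      and dop: "\<And>x y x' y'. x \<in> rcar R \<Longrightarrow> y \<in> rcar R \<Longrightarrow> x' \<in> rcar R \<Longrightarrow> y' \<in> rcar R \<Longrightarrow>
           R.dd (opR x x') (opR y y') \<le> R.dd x y + R.dd x' y'" for s t opS opR opC
  proof -
    have "rk_equiv R (G (\<lambda>k. opS (s k) (t k))) (\<lambda>k. opR (G s k) (G t k))"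
    proof (rule R.equiv_le[OF _ _ _ pw0[of 6]])
      fix k
      let ?x = "s k" and ?y = "t k" and ?z = "opS (s k) (t k)"
      have xy: "?x \<in> rcar S" "?y \<in> rcar S" "?z \<in> rcar S" using S.cau_car s t cauop by auto
      define K where "K = max (kap k ?x) (max (kap k ?y) (kap k ?z))"
      have K: "k \<le> K" "?x \<in> Dm K" "?y \<in> Dm K"
        using kap[OF xy(1), of k] kap[OF xy(2), of k] by (auto simp: K_def intro: mono)
      have Kz: "?z \<in> Dm K" using K Dop by auto
      have c: "h k ?x \<in> rcar R" "h k ?y \<in> rcar R" "h k ?z \<in> rcar R" "ps K ?x \<in> rcar R" "ps K ?y \<in> rcar R" "ps K ?z \<in> rcar R"
        using h_car xy ps_car K Kz by auto
      have c2: "opR (h k ?x) (h k ?y) \<in> rcar R" "opR (ps K ?x) (ps K ?y) \<in> rcar R" using car c by auto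
      show "G (\<lambda>k. opS (s k) (t k)) k \<in> rcar R" "opR (G s k) (G t k) \<in> rcar R" using c c2 by (auto simp: G_def)
      have "R.dd (h k ?z) (opR (h k ?x) (h k ?y)) \<le> 6 * (1/2)^k"
        using R.d_tri[OF c(3,6) c2(1)] R.d_tri[OF c(6) c2(2,1)] psop[OF K(2,3)] l2[OF K(1) Kz]
          dop[OF c(4,1,5,2)] l2[OF K(1,2)] l2[OF K(1,3)] R.d_sym[OF c(1,4)] R.d_sym[OF c(2,5)] by simp
      then show "R.dd (G (\<lambda>k. opS (s k) (t k)) k) (opR (G s k) (G t k)) \<le> 6 * (1/2)^k" by (simp add: G_def)
    qed
    then show ?thesis using F_cl[OF s] F_cl[OF t] F_cl[OF cauop] opC[OF G_cau[OF s] G_cau[OF t]] R.cls_eq_iff G_cau[OF cauop] by simp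
  qed
  have F_op1: "F (S.cl (\<lambda>k. opS (s k))) = opC (F (S.cl s))"
    if s: "S.cau s" and cauop: "S.cau (\<lambda>k. opS (s k))"
      and opC: "\<And>s. R.cau s \<Longrightarrow> opC (R.cl s) = R.cl (\<lambda>k. opR (s k)) \<and> R.cau (\<lambda>k. opR (s k))"
      and Dop: "\<And>K x. x \<in> Dm K \<Longrightarrow> opS x \<in> Dm K"
      and car: "\<And>x. x \<in> rcar R \<Longrightarrow> opR x \<in> rcar R"
      and psop: "\<And>K x. x \<in> Dm K \<Longrightarrow> R.dd (ps K (opS x)) (opR (ps K x)) = 0"
      and dop: "\<And>x y. x \<in> rcar R \<Longrightarrow> y \<in> rcar R \<Longrightarrow> R.dd (opR x) (opR y) \<le> R.dd x y" for s opS opR opC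
  proof -
    have "rk_equiv R (G (\<lambda>k. opS (s k))) (\<lambda>k. opR (G s k))"
    proof (rule R.equiv_le[OF _ _ _ pw0[of 4]])
      fix k
      let ?x = "s k" and ?z = "opS (s k)"
      have xy: "?x \<in> rcar S" "?z \<in> rcar S" using S.cau_car s cauop by auto
      define K where "K = kap k ?x"
      have K: "k \<le> K" "?x \<in> Dm K"
        using kap[OF xy(1), of k] by (auto simp: K_def)
      have Kz: "?z \<in> Dm K" using K Dop by auto
      have c: "h k ?x \<in> rcar R" "h k ?z \<in> rcar R" "ps K ?x \<in> rcar R" "ps K ?z \<in> rcar R"
        using h_car xy ps_car K Kz by auto
      have c2: "opR (h k ?x) \<in> rcar R" "opR (ps K ?x) \<in> rcar R" using car c by auto
      show "G (\<lambda>k. opS (s k)) k \<in> rcar R" "opR (G s k) \<in> rcar R" using c c2 by (auto simp: G_def)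
      have "R.dd (h k ?z) (opR (h k ?x)) \<le> 4 * (1/2)^k"
        using R.d_tri[OF c(2,4) c2(1)] R.d_tri[OF c(4) c2(2,1)] psop[OF K(2)] l2[OF K(1) Kz]
          dop[OF c(3,1)] l2[OF K(1,2)] R.d_sym[OF c(1,3)] by simp
      then show "R.dd (G (\<lambda>k. opS (s k)) k) (opR (G s k)) \<le> 4 * (1/2)^k" by (simp add: G_def)
    qed
    then show ?thesis using F_cl[OF s] F_cl[OF cauop] opC[OF G_cau[OF s]] R.cls_eq_iff G_cau[OF cauop] by simp
  qed
  have "star_kalg_iso S.Cp R.Cp"
    unfolding star_kalg_iso_def
  proof (intro exI[of _ F] conjI ballI allI)
    show "bij_betw F (rcar S.Cp) (rcar R.Cp)"
    proof (rule bij_betwI')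
      fix A B assume "A \<in> rcar S.Cp" "B \<in> rcar S.Cp"
      then obtain s t where st: "S.cau s" "A = S.cl s" "S.cau t" "B = S.cl t" by (metis S.Cp_cases)
      show "F A = F B \<longleftrightarrow> A = B"
        using st F_cl G_equiv R.cls_eq_iff S.cls_eq_iff G_cau by metis
    next
      fix A assume "A \<in> rcar S.Cp"
      then show "F A \<in> rcar R.Cp" by (metis S.Cp_cases F_cl G_cau R.in_Cp)
    next
      fix B assume "B \<in> rcar R.Cp"
      then obtain r where r: "R.cau r" "B = R.cl r" by (metis R.Cp_cases)
      \<comment> \<open>A preimage of the class of \<open>r\<close> is found termwise: the k-th term
        is approximated by a value of a stage at least \<open>k\<close>, with error below
        (1/2)^k.\<close>
      have "\<exists>x. \<exists>K\<ge>k. x \<in> Dm K \<and> R.dd (ps K x) (r k) < (1/2)^k" for k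
        using ps_dense[OF R.cau_car[OF r(1), of k], where e = "(1/2)^k" and ?K0.0 = k] by auto
      then obtain s where s: "\<And>k. \<exists>K\<ge>k. s k \<in> Dm K \<and> R.dd (ps K (s k)) (r k) < (1/2)^k" by metis
      have sc: "s k \<in> rcar S" for k using s[of k] Dm_sub by blast
      have rc: "r k \<in> rcar R" for k using R.cau_car[OF r(1)] .
      have near: "R.dd (h k (s k)) (r k) \<le> 3 * (1/2)^k" for k
      proof -
        obtain K where K: "k \<le> K" "s k \<in> Dm K" "R.dd (ps K (s k)) (r k) < (1/2)^k" using s by blast
        show ?thesis using R.d_tri[OF h_car[OF sc[of k], of k] ps_car[OF K(2)] rc[of k]] l2[OF K(1,2)] K(3) by simp
      qed
      have cs: "S.cau s"
      proof (rule S.cauI_le[where f = "\<lambda>m n. R.dd (r m) (r n) + (6 * (1/2)^m + 6 * (1/2)^n)"])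
        show "s k \<in> rcar S" for k by (rule sc)
        show "S.dd (s m) (s n) \<le> R.dd (r m) (r n) + (6 * (1/2)^m + 6 * (1/2)^n)" for m n
          using l4[OF sc[of m] sc[of n], of m n] near[of m] near[of n]
            R.d_tri[OF h_car[OF sc[of m], of m] rc[of m] h_car[OF sc[of n], of n]] R.d_tri[OF rc[of m] rc[of n] h_car[OF sc[of n], of n]]
            R.d_sym[OF h_car[OF sc[of n], of n] rc[of n]] unfolding abs_le_iff by linarith
        fix e :: real assume e: "e > 0"
        then have "e/3 > 0" by simp
        then obtain N1 where N1: "\<forall>m\<ge>N1. \<forall>n\<ge>N1. R.dd (r m) (r n) < e/3" using r(1) unfolding rk_cauchy_def by blast
        obtain N2 where N2: "\<forall>k\<ge>N2. 6 * (1/2::real)^k < e/3" using pw[OF \<open>e/3>0\<close>] by blast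
        show "\<exists>N. \<forall>m\<ge>N. \<forall>n\<ge>N. R.dd (r m) (r n) + (6 * (1/2)^m + 6 * (1/2)^n) < e"
        proof (intro exI[of _ "max N1 N2"] allI impI)
          fix m n assume "m \<ge> max N1 N2" "n \<ge> max N1 N2"
          then have "R.dd (r m) (r n) < e/3" "6 * (1/2::real)^m < e/3" "6 * (1/2::real)^n < e/3" using N1 N2 by auto
          then show "R.dd (r m) (r n) + (6 * (1/2)^m + 6 * (1/2)^n) < e" by linarith
        qed
      qed
      have "rk_equiv R (G s) r"
        by (rule R.equiv_le[OF _ rc _ pw0[of 3]]) (use near h_car sc in \<open>auto simp: G_def\<close>)
      then have "B = F (S.cl s)" using F_cl[OF cs] R.cls_eq_iff[OF G_cau[OF cs] r(1)] r(2) by simp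
      then show "\<exists>x\<in>rcar S.Cp. B = F x" using S.in_Cp[OF cs] by blast
    qed
    show "F (rone S.Cp) = rone R.Cp"
    proof -
      have c: "S.cau (\<lambda>_. rone S)" "R.cau (\<lambda>_. rone R)" by (auto intro: S.cau_const R.cau_const S.car_one R.car_one)
      have "rk_equiv R (G (\<lambda>_. rone S)) (\<lambda>_. rone R)"
      proof (rule R.equiv_le[OF _ _ _ pw0[of 3]])
        fix k
        show "G (\<lambda>_. rone S) k \<in> rcar R" "rone R \<in> rcar R" using h_car S.car_one R.car_one by (auto simp: G_def)
        show "R.dd (G (\<lambda>_. rone S) k) (rone R) \<le> 3 * (1/2)^k"
          using R.d_tri[OF h_car[OF S.car_one] ps_car[OF Dm_one] R.car_one, of k k] l2[OF le_refl Dm_one, of k] ps_one[of k]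
          by (simp add: G_def)
      qed
      then show ?thesis using F_cl[OF c(1)] R.cls_eq_iff[OF G_cau[OF c(1)] c(2)] by (simp add: S.Cp_one R.Cp_one)
    qed
    fix A B assume "A \<in> rcar S.Cp" "B \<in> rcar S.Cp"
    then obtain s t where st: "S.cau s" "A = S.cl s" "S.cau t" "B = S.cl t" by (metis S.Cp_cases)
    show "F (radd S.Cp A B) = radd R.Cp (F A) (F B)"
      unfolding st S.Cp_add[OF st(1,3)]
      by (rule F_op2[where opR = "radd R" and opS = "radd S" and opC = "radd R.Cp", OF st(1,3) S.cau_add[OF st(1,3)]]) (auto simp: R.Cp_add R.cau_add Dm_add R.car_add ps_add R.d_add)
    show "F (rmul S.Cp A B) = rmul R.Cp (F A) (F B)"
      unfolding st S.Cp_mul[OF st(1,3)]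
      by (rule F_op2[where opR = "rmul R" and opS = "rmul S" and opC = "rmul R.Cp", OF st(1,3) S.cau_mul[OF st(1,3)]]) (auto simp: R.Cp_mul R.cau_mul Dm_mul R.car_mul ps_mul R.d_mul)
  next
    fix A c assume "A \<in> rcar S.Cp"
    then obtain s where st: "S.cau s" "A = S.cl s" by (metis S.Cp_cases)
    show "F (rsmul S.Cp c A) = rsmul R.Cp c (F A)"
      unfolding st S.Cp_smul[OF st(1)]
      by (rule F_op1[where opR = "rsmul R c" and opS = "rsmul S c" and opC = "rsmul R.Cp c", OF st(1) S.cau_smul[OF st(1)]]) (auto simp: R.Cp_smul R.cau_smul Dm_smul R.car_smul ps_smul R.d_smul)
  next
    fix A assume "A \<in> rcar S.Cp"
    then obtain s where st: "S.cau s" "A = S.cl s" by (metis S.Cp_cases)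
    show "F (rstar S.Cp A) = rstar R.Cp (F A)"
      unfolding st S.Cp_star[OF st(1)]
      by (rule F_op1[where opR = "rstar R" and opS = "rstar S" and opC = "rstar R.Cp", OF st(1) S.cau_star[OF st(1)]]) (auto simp: R.Cp_star R.cau_star Dm_star R.car_star ps_star R.d_star)
  qed
  then show ?thesis
  proof (rule star_kalg_iso_sym)
    show "rsmul S.Cp c x \<in> rcar S.Cp" if "x \<in> rcar S.Cp" for c x
      using that by (metis S.Cp_cases S.Cp_smul S.cau_smul S.in_Cp)
  qed (use S.Cp_star_ring in \<open>auto simp: is_star_ring_def\<close>)
qed

section \<open>Rank inequalities for differences written as A + (-1) B\<close>

lemma mD_sym:
  fixes A :: "'a::field mat"
  assumes "A \<in> carrier_mat n n" "B \<in> carrier_mat n n"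
  shows "mrank (A + (-1) \<cdot>\<^sub>m B) = mrank (B + (-1) \<cdot>\<^sub>m A)"
  using mrank_minus_commute[OF assms] minus_mat_alt assms by metis

lemma mD_tri:
  fixes A :: "'a::field mat"
  assumes "A \<in> carrier_mat n n" "B \<in> carrier_mat n n" "C \<in> carrier_mat n n"
  shows "mrank (A + (-1) \<cdot>\<^sub>m C) \<le> mrank (A + (-1) \<cdot>\<^sub>m B) + mrank (B + (-1) \<cdot>\<^sub>m C)"
  using mrank_minus_triangle[OF assms] minus_mat_alt[OF assms(1,3)] minus_mat_alt[OF assms(1,2)] minus_mat_alt[OF assms(2,3)] by simp

lemma mD_add:
  fixes A :: "'a::field mat"
  assumes "A \<in> carrier_mat n n" "B \<in> carrier_mat n n" "A' \<in> carrier_mat n n" "B' \<in> carrier_mat n n"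
  shows "mrank ((A + A') + (-1) \<cdot>\<^sub>m (B + B')) \<le> mrank (A + (-1) \<cdot>\<^sub>m B) + mrank (A' + (-1) \<cdot>\<^sub>m B')"
proof -
  have "(A + A') + (-1) \<cdot>\<^sub>m (B + B') = (A + (-1) \<cdot>\<^sub>m B) + (A' + (-1) \<cdot>\<^sub>m B')"
    using assms by (intro eq_matI) auto
  then show ?thesis using mrank_add[of "A + (-1) \<cdot>\<^sub>m B" n "A' + (-1) \<cdot>\<^sub>m B'"] assms by simp
qed

lemma mD_mul:
  fixes A :: "'a::field mat"
  assumes "A \<in> carrier_mat n n" "B \<in> carrier_mat n n" "A' \<in> carrier_mat n n" "B' \<in> carrier_mat n n"
  shows "mrank ((A * A') + (-1) \<cdot>\<^sub>m (B * B')) \<le> mrank (A + (-1) \<cdot>\<^sub>m B) + mrank (A' + (-1) \<cdot>\<^sub>m B')"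
  using mrank_minus_mult[OF assms(1,3,2,4)] minus_mat_alt[of "A * A'" n n "B * B'"]
    minus_mat_alt[OF assms(1,2)] minus_mat_alt[OF assms(3,4)] assms by simp

lemma mD_smul:
  fixes A :: "'a::field mat"
  assumes "A \<in> carrier_mat n n" "B \<in> carrier_mat n n"
  shows "mrank (c \<cdot>\<^sub>m A + (-1) \<cdot>\<^sub>m (c \<cdot>\<^sub>m B)) \<le> mrank (A + (-1) \<cdot>\<^sub>m B)"
proof -
  have "c \<cdot>\<^sub>m A + (-1) \<cdot>\<^sub>m (c \<cdot>\<^sub>m B) = c \<cdot>\<^sub>m (A + (-1) \<cdot>\<^sub>m B)"
    using assms by (intro eq_matI) (auto simp: algebra_simps)
  then show ?thesis using mrank_smult_le[of "A + (-1) \<cdot>\<^sub>m B" n c] assms by simp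
qed

lemma cj_diff: "field_involution cj \<Longrightarrow> cj (a - b) = cj a - cj b"
  using field_involutionD(1)[of cj a "- b"] field_involutionD(6)[of cj b] by simp

lemma mD_star:
  fixes A :: "'a::field mat"
  assumes cj: "field_involution cj" and "A \<in> carrier_mat n n" "B \<in> carrier_mat n n"
  shows "mrank (ctrans cj A + (-1) \<cdot>\<^sub>m ctrans cj B) \<le> mrank (A + (-1) \<cdot>\<^sub>m B)"
proof -
  have "ctrans cj A + (-1) \<cdot>\<^sub>m ctrans cj B = ctrans cj (A + (-1) \<cdot>\<^sub>m B)"
    using assms by (intro eq_matI) (auto simp: cj_diff)
  then show ?thesis using mrank_ctrans[OF cj, of "A + (-1) \<cdot>\<^sub>m B" n] assms by simp
qed

lemma mD_rk:
  fixes A :: "'a::field mat"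
  assumes "A \<in> carrier_mat n n" "B \<in> carrier_mat n n"
  shows "mrank A \<le> mrank B + mrank (A + (-1) \<cdot>\<^sub>m B)"
  using mrank_le_mrank_minus[OF assms] minus_mat_alt[OF assms] by simp

lemma m_inv_ex:
  fixes A :: "'a::field mat"
  assumes "A \<in> carrier_mat n n"
  shows "\<exists>B\<in>carrier_mat n n. A * B * A = A"
  by (rule rank_normal_form[OF assms]) (metis mult_carrier_mat)

lemma m_inv_lip:
  fixes A :: "'a::field mat"
  assumes "A \<in> carrier_mat n n" "C \<in> carrier_mat n n" "B \<in> carrier_mat n n" "A * B * A = A"
  shows "\<exists>B'\<in>carrier_mat n n. C * B' * C = C \<and> mrank (B' + (-1) \<cdot>\<^sub>m B) \<le> 2 * mrank (A + (-1) \<cdot>\<^sub>m C)"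
  by (rule inner_inverse_lipschitz[OF assms(1,3,2,4)]) (use assms minus_mat_alt in metis)

lemma m_neg: "A \<in> carrier_mat n n \<Longrightarrow> A + (-1) \<cdot>\<^sub>m A = (0\<^sub>m n n :: 'a::field mat)"
  by (intro eq_matI) auto

section \<open>The dyadic matrix system\<close>

definition dbl :: "'a::field mat \<Rightarrow> 'a mat" where
  "dbl A = four_block_mat A (0\<^sub>m (dim_row A) (dim_col A)) (0\<^sub>m (dim_row A) (dim_col A)) A"

text \<open>The labelling of a diagonal of consecutive equal copies. It writes doubling, and all its
  iterates, as a single \<open>blk\<close>, whose algebraic and rank properties are then
  available.\<close>

definition mlab :: "nat \<Rightarrow> nat \<Rightarrow> (nat \<times> nat) option" where
  "mlab l p = Some (p div 2^l, p mod 2^l)"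

lemma mlab_ok:
  assumes "l \<le> m"
  shows "blk_ok (2^m) (\<lambda>_. 2^l) (mlab l)"
  unfolding blk_ok_def
proof (intro conjI allI impI)
  fix p b i assume "p < 2^m" "mlab l p = Some (b,i)"
  then show "i < 2^l" by (auto simp: mlab_def)
next
  fix p q assume "mlab l p = mlab l q"
  then show "p = q" unfolding mlab_def by (metis option.inject prod.inject div_mult_mod_eq)
next
  fix p b i i' :: nat assume p: "p < 2^m" "mlab l p = Some (b,i)" "i' < 2^l"
  have b: "b = p div 2^l" using p by (simp add: mlab_def)
  have "p < 2^(m-l) * 2^l" using p(1) assms by (simp flip: power_add)
  then have "b < 2^(m-l)" unfolding b by (simp add: less_mult_imp_div_less)
  then have "(b + 1) * 2^l \<le> 2^(m-l) * 2^l" by (intro mult_right_mono) auto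
  then have "b * 2^l + i' < 2^m" using p(3) assms by (simp flip: power_add)
  moreover have "mlab l (b * 2^l + i') = Some (b, i')" using p(3) by (simp add: mlab_def)
  ultimately show "\<exists>q<2^m. mlab l q = Some (b, i')" by blast
qed

lemma blks_mlab:
  assumes "l \<le> m" shows "blks (2^m) (mlab l) = {..<2^(m-l)}"
proof (intro equalityI subsetI)
  fix b assume "b \<in> blks (2^m) (mlab l)"
  then obtain p where p: "p < 2^m" "b = p div 2^l" by (auto simp: blks_def mlab_def)
  have "p < 2^(m-l) * 2^l" using p(1) assms by (simp flip: power_add)
  then show "b \<in> {..<2^(m-l)}" unfolding p by (simp add: less_mult_imp_div_less)
next
  fix b :: nat assume "b \<in> {..<2^(m-l)}"
  then have "b * 2^l < 2^(m-l) * 2^l" by simp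
  then have "b * 2^l < 2^m" using assms by (simp flip: power_add)
  moreover have "mlab l (b * 2^l) = Some (b, 0)" by (simp add: mlab_def)
  ultimately show "b \<in> blks (2^m) (mlab l)" unfolding blks_def by blast
qed

lemma dbl_blk:
  assumes "A \<in> carrier_mat (2^n) (2^n)"
  shows "dbl A = blk (2^Suc n) (mlab n) (\<lambda>_. A)"
proof (rule eq_matI)
  fix p q assume "p < dim_row (blk (2^Suc n) (mlab n) (\<lambda>_. A))" "q < dim_col (blk (2^Suc n) (mlab n) (\<lambda>_. A))"
  then have pq: "p < 2^Suc n" "q < 2^Suc n" by auto
  have dv: "r div 2^n = (if r < 2^n then 0 else 1)" "r mod 2^n = (if r < 2^n then r else r - 2^n)" if "r < 2^Suc n" for r :: nat
    using that by (auto simp: div_nat_eqI le_mod_geq)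
  show "dbl A $$ (p,q) = blk (2^Suc n) (mlab n) (\<lambda>_. A) $$ (p,q)"
    unfolding dbl_def blk_index[OF pq] mlab_def dv[OF pq(1)] dv[OF pq(2)]
    using pq assms by (subst index_mat_four_block) (auto simp: carrier_matD)
qed (use assms in \<open>auto simp: dbl_def\<close>)

lemma Mlift_eq: "Mlift m p = lim_lift (\<lambda>_. dbl) m p"
  by (simp add: Mlift_def lim_lift_def dbl_def)

text \<open>Copies of copies are copies: dividing with remainder by 2^m and then by 2^n is the same
  as dividing by 2^n at once.\<close>

lemma lim_lift_dbl:
  assumes A: "A \<in> carrier_mat (2^n) (2^n)" and "n \<le> m"
  shows "lim_lift (\<lambda>_. dbl) m (n, A) = blk (2^m) (mlab n) (\<lambda>_. A)"
  using assms(2)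
proof (induction rule: dec_induct)
  case base
  show ?case
    by (rule eq_matI) (use A in \<open>auto simp: blk_index mlab_def\<close>)
next
  case (step m)
  have "lim_lift (\<lambda>_. dbl) (Suc m) (n, A) = dbl (blk (2^m) (mlab n) (\<lambda>_. A))"
    using step by (simp add: lim_lift_Suc)
  also have "\<dots> = blk (2^Suc m) (mlab m) (\<lambda>_. blk (2^m) (mlab n) (\<lambda>_. A))"
    by (rule dbl_blk) simp
  also have "\<dots> = blk (2^Suc m) (mlab n) (\<lambda>_. A)"
  proof (rule eq_matI)
    fix p q assume "p < dim_row (blk (2^Suc m) (mlab n) (\<lambda>_. A))" "q < dim_col (blk (2^Suc m) (mlab n) (\<lambda>_. A))"
    then have pq: "p < 2^Suc m" "q < 2^Suc m" by auto
    have pw: "(2::nat)^m = 2^n * 2^(m-n)" using step by (simp flip: power_add)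
    have a: "r div 2^m = (r div 2^n) div 2^(m-n)" "(r mod 2^m) div 2^n = (r div 2^n) mod 2^(m-n)"
      "(r mod 2^m) mod 2^n = r mod 2^n" for r :: nat
      unfolding pw by (auto simp: div_mult2_eq mod_mult2_eq)
    \<comment> \<open>Two rows share a copy of size 2^n exactly if they share the larger copy of
      size 2^m and the same subcopy inside it.\<close>
    have b: "p div 2^n = q div 2^n \<longleftrightarrow> p div 2^m = q div 2^m \<and> (p mod 2^m) div 2^n = (q mod 2^m) div 2^n"
      unfolding a by (metis div_mult_mod_eq)
    show "blk (2^Suc m) (mlab m) (\<lambda>_. blk (2^m) (mlab n) (\<lambda>_. A)) $$ (p,q) = blk (2^Suc m) (mlab n) (\<lambda>_. A) $$ (p,q)"
      unfolding blk_index[OF pq] using b by (auto simp: mlab_def blk_index a(3))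
  qed auto
  finally show ?case .
qed

definition Mrk :: "nat \<Rightarrow> 'a::field mat \<Rightarrow> real" where
  "Mrk n A = real (mrank A) / 2^n"

lemma dbl_carrier: "A \<in> carrier_mat (2^n) (2^n) \<Longrightarrow> dbl A \<in> carrier_mat (2^Suc n) (2^Suc n)"
  by (simp add: dbl_blk)

lemma rank_system_M:
  assumes cj: "field_involution (cj :: 'k::field \<Rightarrow> 'k)"
  shows "rank_system (\<lambda>n. carrier_mat (2^n) (2^n)) (+) (*) (\<cdot>\<^sub>m) (\<lambda>n. 1\<^sub>m (2^n)) (\<lambda>n. 0\<^sub>m (2^n) (2^n))
    (ctrans cj) Mrk (\<lambda>_. dbl)"
proof
  fix n :: nat and x y z x' y' b :: "'k mat" and c :: 'k
  let ?N = "2^n :: nat"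
  show "1\<^sub>m ?N \<in> carrier_mat ?N ?N" "0\<^sub>m ?N ?N \<in> carrier_mat ?N ?N" by auto
  show "Mrk n (0\<^sub>m ?N ?N) = 0" by (simp add: Mrk_def)
  have ok: "blk_ok (2^Suc n) (\<lambda>_. 2^n) (mlab n)" by (rule mlab_ok) simp
  show "dbl (1\<^sub>m ?N) = 1\<^sub>m (2^Suc n)"
    unfolding dbl_def by (rule eq_matI) auto
  show "dbl (0\<^sub>m ?N ?N) = 0\<^sub>m (2^Suc n) (2^Suc n)"
    unfolding dbl_def by (rule eq_matI) auto
  assume x: "x \<in> carrier_mat ?N ?N"
  show "c \<cdot>\<^sub>m x \<in> carrier_mat ?N ?N" "ctrans cj x \<in> carrier_mat ?N ?N" using x by auto
  show "dbl x \<in> carrier_mat (2^Suc n) (2^Suc n)" using x by (rule dbl_carrier)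
  show "dbl (c \<cdot>\<^sub>m x) = c \<cdot>\<^sub>m dbl x" using x blk_smult[OF ok, of "\<lambda>_. x" c] by (simp add: dbl_blk[of _ n])
  show "dbl (ctrans cj x) = ctrans cj (dbl x)" using x blk_ctrans[OF cj ok, of "\<lambda>_. x"] by (simp add: dbl_blk[of _ n])
  show "Mrk (Suc n) (dbl x) = Mrk n x"
    using mrank_blk[OF ok, of "\<lambda>_. x"] x blks_mlab[of n "Suc n"] by (simp add: dbl_blk[of _ n] Mrk_def)
  show "x + 0\<^sub>m ?N ?N = x" "x + (-1) \<cdot>\<^sub>m x = 0\<^sub>m ?N ?N" "1\<^sub>m ?N * x = x" "x * 1\<^sub>m ?N = x" "ctrans cj (ctrans cj x) = x"
    using x cj by (auto simp: m_neg)
  show "0 \<le> Mrk n x" by (simp add: Mrk_def)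
  show "\<exists>b\<in>carrier_mat ?N ?N. x * b * x = x" using x by (rule m_inv_ex)
  assume y: "y \<in> carrier_mat ?N ?N"
  show "x + y \<in> carrier_mat ?N ?N" "x * y \<in> carrier_mat ?N ?N" using x y by auto
  show "dbl (x + y) = dbl x + dbl y" using x y blk_add[OF ok, of "\<lambda>_. x" "\<lambda>_. y"] by (simp add: dbl_blk[of _ n])
  show "dbl (x * y) = dbl x * dbl y" using x y blk_mult[OF ok, of "\<lambda>_. x" "\<lambda>_. y"] by (simp add: dbl_blk[of _ n])
  show "x + y = y + x" using x y by (rule comm_add_mat)
  show "ctrans cj (x + y) = ctrans cj x + ctrans cj y" using cj x y by (rule ctrans_add)
  show "ctrans cj (x * y) = ctrans cj y * ctrans cj x" using cj x y by (rule ctrans_mult)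
  show "Mrk n (x + (-1) \<cdot>\<^sub>m y) = Mrk n (y + (-1) \<cdot>\<^sub>m x)" using mD_sym[OF x y] by (simp add: Mrk_def)
  show "Mrk n (c \<cdot>\<^sub>m x + (-1) \<cdot>\<^sub>m (c \<cdot>\<^sub>m y)) \<le> Mrk n (x + (-1) \<cdot>\<^sub>m y)" using mD_smul[OF x y, of c]
    by (simp add: Mrk_def divide_right_mono)
  show "Mrk n (ctrans cj x + (-1) \<cdot>\<^sub>m ctrans cj y) \<le> Mrk n (x + (-1) \<cdot>\<^sub>m y)" using mD_star[OF cj x y]
    by (simp add: Mrk_def divide_right_mono)
  show "Mrk n x \<le> Mrk n y + Mrk n (x + (-1) \<cdot>\<^sub>m y)" using mD_rk[OF x y]
    by (simp add: Mrk_def divide_right_mono flip: add_divide_distrib of_nat_add)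
  show "\<exists>b'\<in>carrier_mat ?N ?N. y * b' * y = y \<and> Mrk n (b' + (-1) \<cdot>\<^sub>m b) \<le> 2 * Mrk n (x + (-1) \<cdot>\<^sub>m y)"
    if bb: "b \<in> carrier_mat ?N ?N" "x * b * x = x"
  proof -
    obtain b' where b': "b' \<in> carrier_mat ?N ?N" "y * b' * y = y" "mrank (b' + (-1) \<cdot>\<^sub>m b) \<le> 2 * mrank (x + (-1) \<cdot>\<^sub>m y)"
      using m_inv_lip[OF x y bb] by blast
    have "real (mrank (b' + (-1) \<cdot>\<^sub>m b)) \<le> 2 * real (mrank (x + (-1) \<cdot>\<^sub>m y))" using b'(3) by linarith
    then show ?thesis using b' by (intro bexI[of _ b']) (auto simp: Mrk_def divide_right_mono)
  qed
  assume z: "z \<in> carrier_mat ?N ?N"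
  show "x + y + z = x + (y + z)" "x * y * z = x * (y * z)" using x y z by auto
  show "x * (y + z) = x * y + x * z" using x y z by (rule mult_add_distrib_mat)
  show "(x + y) * z = x * z + y * z" using x y z by (rule add_mult_distrib_mat)
  show "Mrk n (x + (-1) \<cdot>\<^sub>m z) \<le> Mrk n (x + (-1) \<cdot>\<^sub>m y) + Mrk n (y + (-1) \<cdot>\<^sub>m z)"
    using mD_tri[OF x y z] by (simp add: Mrk_def divide_right_mono flip: add_divide_distrib of_nat_add)
next
  fix n :: nat and x y x' y' :: "'k mat"
  let ?N = "2^n :: nat"
  assume x: "x \<in> carrier_mat ?N ?N" "y \<in> carrier_mat ?N ?N" "x' \<in> carrier_mat ?N ?N" "y' \<in> carrier_mat ?N ?N"
  show "Mrk n (x + x' + (-1) \<cdot>\<^sub>m (y + y')) \<le> Mrk n (x + (-1) \<cdot>\<^sub>m y) + Mrk n (x' + (-1) \<cdot>\<^sub>m y')"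
    using mD_add[OF x] by (simp add: Mrk_def divide_right_mono flip: add_divide_distrib of_nat_add)
  show "Mrk n (x * x' + (-1) \<cdot>\<^sub>m (y * y')) \<le> Mrk n (x + (-1) \<cdot>\<^sub>m y) + Mrk n (x' + (-1) \<cdot>\<^sub>m y')"
    using mD_mul[OF x] by (simp add: Mrk_def divide_right_mono flip: add_divide_distrib of_nat_add)
qed

lemma Minf_eq_lim_alg:
  assumes cj: "field_involution cj"
  shows "Minf cj = rank_system.lim_alg (\<lambda>n. carrier_mat (2^n) (2^n)) (+) (*) (\<cdot>\<^sub>m) (\<lambda>n. 1\<^sub>m (2^n)) (\<lambda>n. 0\<^sub>m (2^n) (2^n))
    (ctrans cj) Mrk (\<lambda>_. dbl)"
  unfolding rank_system.lim_alg_def[OF rank_system_M[OF cj]] Minf_def Mlift_eq Mrk_def by simp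

lemma blk_okD:
  assumes "blk_ok N sz lab" "p < N" "lab p = Some (b,i)"
  shows "i < sz b" "i' < sz b \<Longrightarrow> \<exists>q<N. lab q = Some (b,i')" "q < N \<Longrightarrow> lab q = Some (b,i) \<Longrightarrow> p = q"
proof -
  show "i < sz b" using assms unfolding blk_ok_def by blast
  show "i' < sz b \<Longrightarrow> \<exists>q<N. lab q = Some (b,i')" using assms unfolding blk_ok_def by blast
  show "q < N \<Longrightarrow> lab q = Some (b,i) \<Longrightarrow> p = q" using assms unfolding blk_ok_def by (metis option.distinct(1))
qed

section \<open>Tower systems\<close>

text \<open>The combinatorial data behind the limit of the R_n, freed from dynamics. In the tower
  \<open>W'\<close> of level \<open>m\<close>, \<open>st n m W' p\<close> is the row where the
  level-n block containing row \<open>p\<close> starts, and \<open>ty n m W' b\<close> is the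
  level-n tower that the block starting at \<open>b\<close> copies. \<open>wsum\<close> says that
  the towers fill the space, and \<open>balance\<close> that the weight of a tower is the total
  weight of its copies one level up.\<close>

locale tower_system =
  fixes cj :: "'k::field \<Rightarrow> 'k" and V :: "nat \<Rightarrow> 'w set" and sz :: "nat \<Rightarrow> 'w \<Rightarrow> nat" and wt :: "'w \<Rightarrow> real"
    and st :: "nat \<Rightarrow> nat \<Rightarrow> 'w \<Rightarrow> nat \<Rightarrow> nat" and ty :: "nat \<Rightarrow> nat \<Rightarrow> 'w \<Rightarrow> nat \<Rightarrow> 'w"
  assumes cj: "field_involution cj"
    and wt_pos: "W \<in> V n \<Longrightarrow> 0 < wt W"
    and sz_pos: "W \<in> V n \<Longrightarrow> 0 < sz n W"
    and wsum: "((\<lambda>W. wt W * real (sz n W)) has_sum 1) (V n)"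
    and tower_ok: "n \<le> m \<Longrightarrow> W' \<in> V m \<Longrightarrow>
       blk_ok (sz m W') (\<lambda>b. sz n (ty n m W' b)) (\<lambda>p. Some (st n m W' p, p - st n m W' p))"
    and st_le: "n \<le> m \<Longrightarrow> W' \<in> V m \<Longrightarrow> p < sz m W' \<Longrightarrow> st n m W' p \<le> p"
    and ty_V: "n \<le> m \<Longrightarrow> W' \<in> V m \<Longrightarrow> p < sz m W' \<Longrightarrow> ty n m W' (st n m W' p) \<in> V n"
    and st_refl: "W \<in> V n \<Longrightarrow> p < sz n W \<Longrightarrow> st n n W p = 0"
    and ty_refl: "W \<in> V n \<Longrightarrow> ty n n W 0 = W"
    and st_comp: "n \<le> m \<Longrightarrow> W \<in> V (Suc m) \<Longrightarrow> p < sz (Suc m) W \<Longrightarrow>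
       st n (Suc m) W p = st m (Suc m) W p + st n m (ty m (Suc m) W (st m (Suc m) W p)) (p - st m (Suc m) W p)"
    and ty_comp: "n \<le> m \<Longrightarrow> W \<in> V (Suc m) \<Longrightarrow> p < sz (Suc m) W \<Longrightarrow>
       ty n (Suc m) W (st n (Suc m) W p) =
       ty n m (ty m (Suc m) W (st m (Suc m) W p)) (st n m (ty m (Suc m) W (st m (Suc m) W p)) (p - st m (Suc m) W p))"
    and balance: "W \<in> V n \<Longrightarrow>
       ((\<lambda>W'. wt W' * real (card {b. (\<exists>p<sz (Suc n) W'. b = st n (Suc n) W' p) \<and> ty n (Suc n) W' b = W})) has_sum wt W) (V (Suc n))"
begin

definition tlab :: "nat \<Rightarrow> nat \<Rightarrow> 'w \<Rightarrow> nat \<Rightarrow> (nat \<times> nat) option" where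
  "tlab n m W' p = Some (st n m W' p, p - st n m W' p)"

definition cnt :: "nat \<Rightarrow> nat \<Rightarrow> 'w \<Rightarrow> 'w \<Rightarrow> nat" where
  "cnt n m W W' = card {b. (\<exists>p<sz m W'. b = st n m W' p) \<and> ty n m W' b = W}"

lemma blks_tlab: "blks (sz m W') (tlab n m W') = {b. \<exists>p<sz m W'. b = st n m W' p}"
  by (auto simp: blks_def tlab_def)

lemma tlab_ok: "n \<le> m \<Longrightarrow> W' \<in> V m \<Longrightarrow> blk_ok (sz m W') (\<lambda>b. sz n (ty n m W' b)) (tlab n m W')"
  using tower_ok unfolding tlab_def .

definition TC :: "nat \<Rightarrow> ('w \<Rightarrow> 'k mat) set" where
  "TC n = {x. \<forall>W. if W \<in> V n then x W \<in> carrier_mat (sz n W) (sz n W) else x W = 0\<^sub>m 0 0}"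

definition tj :: "nat \<Rightarrow> nat \<Rightarrow> ('w \<Rightarrow> 'k mat) \<Rightarrow> ('w \<Rightarrow> 'k mat)" where
  "tj n m x = (\<lambda>W'. if W' \<in> V m then blk (sz m W') (tlab n m W') (\<lambda>b. x (ty n m W' b)) else 0\<^sub>m 0 0)"

definition trk :: "nat \<Rightarrow> ('w \<Rightarrow> 'k mat) \<Rightarrow> real" where
  "trk n x = (\<Sum>\<^sub>\<infinity>W\<in>V n. wt W * real (mrank (x W)))"

definition tone :: "nat \<Rightarrow> 'w \<Rightarrow> 'k mat" where
  "tone n = (\<lambda>W. if W \<in> V n then 1\<^sub>m (sz n W) else 0\<^sub>m 0 0)"

definition tzero :: "nat \<Rightarrow> 'w \<Rightarrow> 'k mat" where
  "tzero n = (\<lambda>W. if W \<in> V n then 0\<^sub>m (sz n W) (sz n W) else 0\<^sub>m 0 0)"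

lemma TC_I: "(\<And>W. W \<in> V n \<Longrightarrow> x W \<in> carrier_mat (sz n W) (sz n W)) \<Longrightarrow> (\<And>W. W \<notin> V n \<Longrightarrow> x W = 0\<^sub>m 0 0) \<Longrightarrow> x \<in> TC n"
  by (auto simp: TC_def)

lemma TC_D: "x \<in> TC n \<Longrightarrow> W \<in> V n \<Longrightarrow> x W \<in> carrier_mat (sz n W) (sz n W)"
  "x \<in> TC n \<Longrightarrow> W \<notin> V n \<Longrightarrow> x W = 0\<^sub>m 0 0"
proof -
  assume "x \<in> TC n"
  then have "if W \<in> V n then x W \<in> carrier_mat (sz n W) (sz n W) else x W = 0\<^sub>m 0 0" by (auto simp: TC_def)
  then show "W \<in> V n \<Longrightarrow> x W \<in> carrier_mat (sz n W) (sz n W)" "W \<notin> V n \<Longrightarrow> x W = 0\<^sub>m 0 0" by auto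
qed

lemma TC_eqI: "x \<in> TC n \<Longrightarrow> y \<in> TC n \<Longrightarrow> (\<And>W. W \<in> V n \<Longrightarrow> x W = y W) \<Longrightarrow> x = y"
  by (rule ext) (metis TC_D(2))

lemma TC_ops:
  assumes "x \<in> TC n" "y \<in> TC n"
  shows "(\<lambda>W. x W + y W) \<in> TC n" "(\<lambda>W. x W * y W) \<in> TC n" "(\<lambda>W. c \<cdot>\<^sub>m x W) \<in> TC n" "(\<lambda>W. ctrans cj (x W)) \<in> TC n"
proof -
  have z: "c \<cdot>\<^sub>m (0\<^sub>m 0 0 :: 'k mat) = 0\<^sub>m 0 0" "ctrans cj (0\<^sub>m 0 0 :: 'k mat) = 0\<^sub>m 0 0" by (auto intro!: eq_matI)
  note d = TC_D[OF assms(1)] TC_D[OF assms(2)]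
  show "(\<lambda>W. x W + y W) \<in> TC n" by (rule TC_I) (use d in auto)
  show "(\<lambda>W. x W * y W) \<in> TC n" by (rule TC_I) (use d in \<open>auto intro!: mult_carrier_mat\<close>)
  show "(\<lambda>W. c \<cdot>\<^sub>m x W) \<in> TC n" by (rule TC_I) (use d z in auto)
  show "(\<lambda>W. ctrans cj (x W)) \<in> TC n" by (rule TC_I) (use d z in auto)
qed

text \<open>\<open>V n\<close> may be infinite. Every sum that occurs is dominated by tower heights,
  whose weighted sum is 1.\<close>

lemma wsummable:
  assumes "\<And>W. W \<in> V n \<Longrightarrow> 0 \<le> f W" "\<And>W. W \<in> V n \<Longrightarrow> f W \<le> K * real (sz n W)"
  shows "(\<lambda>W. wt W * f W) summable_on V n"
proof (rule summable_on_comparison_test)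
  have "(\<lambda>W. wt W * real (sz n W)) summable_on V n" using wsum has_sum_imp_summable by blast
  then show "(\<lambda>W. K * (wt W * real (sz n W))) summable_on V n" by (rule summable_on_cmult_right)
  fix W assume W: "W \<in> V n"
  show "wt W * f W \<le> K * (wt W * real (sz n W))"
    using mult_left_mono[OF assms(2)[OF W], of "wt W"] wt_pos[OF W] by (simp add: mult_ac)
  show "0 \<le> wt W * f W" using assms(1)[OF W] wt_pos[OF W] by simp
qed

lemma wsummable_rk:
  assumes "x \<in> TC n" shows "(\<lambda>W. wt W * real (mrank (x W))) summable_on V n"
  by (rule wsummable[where K = 1]) (use mrank_le[OF TC_D(1)[OF assms]] in auto)

lemma trk_mono2:
  assumes "x \<in> TC n" "y \<in> TC n" "z \<in> TC n"
    "\<And>W. W \<in> V n \<Longrightarrow> mrank (x W) \<le> mrank (y W) + mrank (z W)"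
  shows "trk n x \<le> trk n y + trk n z"
proof -
  have "trk n x \<le> (\<Sum>\<^sub>\<infinity>W\<in>V n. wt W * real (mrank (y W)) + wt W * real (mrank (z W)))"
    unfolding trk_def
  proof (rule infsum_mono)
    fix W assume W: "W \<in> V n"
    have "real (mrank (x W)) \<le> real (mrank (y W)) + real (mrank (z W))" using assms(4)[OF W] by linarith
    then show "wt W * real (mrank (x W)) \<le> wt W * real (mrank (y W)) + wt W * real (mrank (z W))"
      using wt_pos[OF W] by (simp flip: distrib_left)
  qed (use assms wsummable_rk in \<open>auto intro!: summable_on_add\<close>)
  also have "\<dots> = trk n y + trk n z" unfolding trk_def by (rule infsum_add) (use assms wsummable_rk in auto)
  finally show ?thesis .
qed

lemma trk_mono1:
  assumes "x \<in> TC n" "y \<in> TC n"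
    "\<And>W. W \<in> V n \<Longrightarrow> mrank (x W) \<le> mrank (y W)"
  shows "trk n x \<le> trk n y"
  unfolding trk_def
  by (rule infsum_mono) (use assms wsummable_rk in \<open>auto intro!: mult_left_mono less_imp_le[OF wt_pos[of _ n]]\<close>)

lemma trk_le_wsum:
  assumes "x \<in> TC n" "\<And>W. W \<in> V n \<Longrightarrow> real (mrank (x W)) \<le> f W" "(\<lambda>W. wt W * f W) summable_on V n"
  shows "trk n x \<le> (\<Sum>\<^sub>\<infinity>W\<in>V n. wt W * f W)"
  unfolding trk_def
  by (rule infsum_mono) (use assms wsummable_rk in \<open>auto intro!: mult_left_mono less_imp_le[OF wt_pos[of _ n]]\<close>)

lemma trk_nonneg: "0 \<le> trk n x"
  unfolding trk_def by (rule infsum_nonneg) (auto simp: less_imp_le[OF wt_pos])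

lemma in_blks_ty:
  assumes "n \<le> m" "W' \<in> V m" "b \<in> blks (sz m W') (tlab n m W')"
  shows "ty n m W' b \<in> V n"
  using assms ty_V by (auto simp: blks_tlab)

lemma TC_ty:
  assumes "x \<in> TC n" "n \<le> m" "W' \<in> V m" "b \<in> blks (sz m W') (tlab n m W')"
  shows "x (ty n m W' b) \<in> carrier_mat (sz n (ty n m W' b)) (sz n (ty n m W' b))"
  using TC_D(1)[OF assms(1)] in_blks_ty[OF assms(2-4)] by blast

lemma tj_C: "tj n m x \<in> TC m"
  by (rule TC_I) (auto simp: tj_def)

lemma tj_hom:
  assumes x: "x \<in> TC n" and y: "y \<in> TC n" and nm: "n \<le> m"
  shows "tj n m (\<lambda>W. x W + y W) = (\<lambda>W. tj n m x W + tj n m y W)"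
    "tj n m (\<lambda>W. x W * y W) = (\<lambda>W. tj n m x W * tj n m y W)"
    "tj n m (\<lambda>W. c \<cdot>\<^sub>m x W) = (\<lambda>W. c \<cdot>\<^sub>m tj n m x W)"
    "tj n m (\<lambda>W. ctrans cj (x W)) = (\<lambda>W. ctrans cj (tj n m x W))"
    "tj n m (tone n) = tone m" "tj n m (tzero n) = tzero m"
proof -
  show "tj n m (\<lambda>W. x W + y W) = (\<lambda>W. tj n m x W + tj n m y W)"
  proof (rule TC_eqI[OF tj_C TC_ops(1)[OF tj_C tj_C]])
    fix W assume W: "W \<in> V m"
    show "tj n m (\<lambda>W. x W + y W) W = tj n m x W + tj n m y W"
      using W blk_add[OF tlab_ok[OF nm W] TC_ty[OF x nm W] TC_ty[OF y nm W]] by (simp add: tj_def)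
  qed
  show "tj n m (\<lambda>W. x W * y W) = (\<lambda>W. tj n m x W * tj n m y W)"
  proof (rule TC_eqI[OF tj_C TC_ops(2)[OF tj_C tj_C]])
    fix W assume W: "W \<in> V m"
    show "tj n m (\<lambda>W. x W * y W) W = tj n m x W * tj n m y W"
      using W blk_mult[OF tlab_ok[OF nm W] TC_ty[OF x nm W] TC_ty[OF y nm W]] by (simp add: tj_def)
  qed
  show "tj n m (\<lambda>W. c \<cdot>\<^sub>m x W) = (\<lambda>W. c \<cdot>\<^sub>m tj n m x W)"
  proof (rule TC_eqI[OF tj_C TC_ops(3)[OF tj_C tj_C]])
    fix W assume W: "W \<in> V m"
    show "tj n m (\<lambda>W. c \<cdot>\<^sub>m x W) W = c \<cdot>\<^sub>m tj n m x W"
      using W blk_smult[OF tlab_ok[OF nm W] TC_ty[OF x nm W]] by (simp add: tj_def)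
  qed
  show "tj n m (\<lambda>W. ctrans cj (x W)) = (\<lambda>W. ctrans cj (tj n m x W))"
  proof (rule TC_eqI[OF tj_C TC_ops(4)[OF tj_C tj_C]])
    fix W assume W: "W \<in> V m"
    show "tj n m (\<lambda>W. ctrans cj (x W)) W = ctrans cj (tj n m x W)"
      using W blk_ctrans[OF cj tlab_ok[OF nm W] TC_ty[OF x nm W]] by (simp add: tj_def)
  qed
  have one: "blk (sz m W') (tlab n m W') (\<lambda>b. tone n (ty n m W' b)) = 1\<^sub>m (sz m W')" if W': "W' \<in> V m" for W'
  proof -
    have "blk (sz m W') (tlab n m W') (\<lambda>b. tone n (ty n m W' b)) =
          blk (sz m W') (tlab n m W') (\<lambda>b. diag01 (sz n (ty n m W' b)) UNIV)"
      by (rule blk_cong) (auto simp: tone_def in_blks_ty[OF nm W'] diag01_def one_mat_def)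
    also have "\<dots> = diag01 (sz m W') {p. p < sz m W' \<and> (\<exists>b i. tlab n m W' p = Some (b, i) \<and> i \<in> UNIV)}"
      by (rule blk_diag01[OF tlab_ok[OF nm W']])
    also have "\<dots> = 1\<^sub>m (sz m W')" by (rule eq_matI) (auto simp: diag01_def tlab_def)
    finally show ?thesis .
  qed
  then show "tj n m (tone n) = tone m" by (auto simp: tj_def tone_def)
  have "blk (sz m W') (tlab n m W') (\<lambda>b. tzero n (ty n m W' b)) = 0\<^sub>m (sz m W') (sz m W')" if W': "W' \<in> V m" for W'
  proof -
    have "blk (sz m W') (tlab n m W') (\<lambda>b. tzero n (ty n m W' b)) =
          blk (sz m W') (tlab n m W') (\<lambda>b. diag01 (sz n (ty n m W' b)) {})"
      by (rule blk_cong) (auto simp: tzero_def in_blks_ty[OF nm W'] diag01_def zero_mat_def)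
    also have "\<dots> = diag01 (sz m W') {p. p < sz m W' \<and> (\<exists>b i. tlab n m W' p = Some (b, i) \<and> i \<in> {})}"
      by (rule blk_diag01[OF tlab_ok[OF nm W']])
    also have "\<dots> = 0\<^sub>m (sz m W') (sz m W')" by (rule eq_matI) (auto simp: diag01_def)
    finally show ?thesis .
  qed
  then show "tj n m (tzero n) = tzero m" by (auto simp: tj_def tzero_def)
qed

text \<open>Although \<open>V n\<close> may be infinite, only finitely many of its towers occur in
  \<open>W'\<close>. The form \<open>has_sum\<close> prepares the interchange of summation that
  follows.\<close>

lemma mrank_tj:
  assumes x: "x \<in> TC n" and nm: "n \<le> m" and W': "W' \<in> V m"
  shows "((\<lambda>W. real (cnt n m W W') * real (mrank (x W))) has_sum real (mrank (tj n m x W'))) (V n)"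
proof (rule has_sum_finite_neutralI)
  let ?B = "blks (sz m W') (tlab n m W')" and ?t = "ty n m W'"
  have fin: "finite ?B" by (rule finite_blks)
  show "finite (?t ` ?B)" using fin by simp
  show "?t ` ?B \<subseteq> V n" using in_blks_ty[OF nm W'] by auto
  show "real (cnt n m W W') * real (mrank (x W)) = 0" if "W \<in> V n - ?t ` ?B" for W
  proof -
    have "{b. (\<exists>p<sz m W'. b = st n m W' p) \<and> ?t b = W} = {}" using that by (auto simp: blks_tlab)
    then show ?thesis by (simp add: cnt_def)
  qed
  have "mrank (tj n m x W') = (\<Sum>b\<in>?B. mrank (x (?t b)))"
    using mrank_blk[OF tlab_ok[OF nm W'] TC_ty[OF x nm W']] W' by (simp add: tj_def)
  also have "\<dots> = (\<Sum>W\<in>?t ` ?B. \<Sum>b\<in>{b\<in>?B. ?t b = W}. mrank (x (?t b)))"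
    by (rule sum.image_gen[OF fin])
  also have "\<dots> = (\<Sum>W\<in>?t ` ?B. cnt n m W W' * mrank (x W))"
  proof (rule sum.cong[OF refl])
    fix W
    have "(\<Sum>b\<in>{b\<in>?B. ?t b = W}. mrank (x (?t b))) = (\<Sum>b\<in>{b\<in>?B. ?t b = W}. mrank (x W))" by (rule sum.cong) auto
    also have "\<dots> = cnt n m W W' * mrank (x W)" by (simp add: cnt_def blks_tlab)
    finally show "(\<Sum>b\<in>{b\<in>?B. ?t b = W}. mrank (x (?t b))) = cnt n m W W' * mrank (x W)" .
  qed
  finally show "real (mrank (tj n m x W')) = (\<Sum>W\<in>?t ` ?B. real (cnt n m W W') * real (mrank (x W)))" by simp
qed

text \<open>Sum the nonnegative terms wt W' * cnt * rank over pairs of towers in both orders: over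
  \<open>W'\<close> first \<open>balance\<close> gives the rank at level n, over \<open>W\<close>
  first \<open>mrank_tj\<close> gives the rank one level up.\<close>

lemma trk_tj_Suc:
  assumes x: "x \<in> TC n" shows "trk (Suc n) (tj n (Suc n) x) = trk n x"
proof -
  define F where "F = (\<lambda>(W,W'). wt W' * (real (cnt n (Suc n) W W') * real (mrank (x W))))"
  have inner: "((\<lambda>W'. F (W,W')) has_sum wt W * real (mrank (x W))) (V (Suc n))" if "W \<in> V n" for W
    using has_sum_cmult_left[OF balance[OF that], of "real (mrank (x W))"] by (simp add: F_def cnt_def mult_ac)
  have sm: "F summable_on (V n \<times> V (Suc n))"
    by (rule summable_on_SigmaI[OF inner wsummable_rk[OF x]]) (auto simp: F_def less_imp_le[OF wt_pos])
  have tot: "(F has_sum trk n x) (V n \<times> V (Suc n))"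
    unfolding trk_def by (rule has_sum_SigmaI[OF inner has_sum_infsum[OF wsummable_rk[OF x]] sm])
  have "((\<lambda>W'. wt W' * real (mrank (tj n (Suc n) x W'))) has_sum trk n x) (V (Suc n))"
  proof (rule has_sum_SigmaD)
    show "((\<lambda>(x,y). F (y,x)) has_sum trk n x) (V (Suc n) \<times> V n)" using tot has_sum_swap by blast
    fix W' assume "W' \<in> V (Suc n)"
    then show "((\<lambda>W. (case (W', W) of (x,y) \<Rightarrow> F (y,x))) has_sum wt W' * real (mrank (tj n (Suc n) x W'))) (V n)"
      using has_sum_cmult_right[OF mrank_tj[OF x, of "Suc n" W'], of "wt W'"] by (simp add: F_def)
  qed
  then show ?thesis unfolding trk_def by (simp add: infsumI)
qed

lemma rank_system_T:
  "rank_system TC (\<lambda>x y W. x W + y W) (\<lambda>x y W. x W * y W) (\<lambda>c x W. c \<cdot>\<^sub>m x W) tone tzero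
    (\<lambda>x W. ctrans cj (x W)) trk (\<lambda>n. tj n (Suc n))"
proof
  fix n :: nat and x y z b :: "'w \<Rightarrow> 'k mat" and c :: 'k
  show "tone n \<in> TC n" and z: "tzero n \<in> TC n" by (auto simp: TC_def tone_def tzero_def)
  show "trk n (tzero n) = 0" unfolding trk_def by (rule infsum_0) (auto simp: tzero_def)
  show "tj n (Suc n) (tone n) = tone (Suc n)" "tj n (Suc n) (tzero n) = tzero (Suc n)"
    using tj_hom(5,6)[OF z z, of "Suc n"] by auto
  assume x: "x \<in> TC n"
  note dx = TC_D(1)[OF x]
  show s: "(\<lambda>W. c \<cdot>\<^sub>m x W) \<in> TC n" and str: "(\<lambda>W. ctrans cj (x W)) \<in> TC n" for c using TC_ops[OF x x] by auto
  show "tj n (Suc n) x \<in> TC (Suc n)" by (rule tj_C)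
  show "tj n (Suc n) (\<lambda>W. c \<cdot>\<^sub>m x W) = (\<lambda>W. c \<cdot>\<^sub>m tj n (Suc n) x W)"
    "tj n (Suc n) (\<lambda>W. ctrans cj (x W)) = (\<lambda>W. ctrans cj (tj n (Suc n) x W))" using tj_hom(3,4)[OF x x, of "Suc n"] by auto
  show "trk (Suc n) (tj n (Suc n) x) = trk n x" using x by (rule trk_tj_Suc)
  show "0 \<le> trk n x" by (rule trk_nonneg)
  show "(\<lambda>W. x W + tzero n W) = x"
    by (rule TC_eqI[OF TC_ops(1)[OF x z] x]) (simp add: tzero_def right_add_zero_mat[OF dx])
  show "(\<lambda>W. x W + (-1) \<cdot>\<^sub>m x W) = tzero n"
    by (rule TC_eqI[OF TC_ops(1)[OF x s] z]) (simp add: tzero_def m_neg[OF dx])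
  have o: "tone n \<in> TC n" by (auto simp: TC_def tone_def)
  show "(\<lambda>W. tone n W * x W) = x"
    by (rule TC_eqI[OF TC_ops(2)[OF o x] x]) (simp add: tone_def left_mult_one_mat[OF dx])
  show "(\<lambda>W. x W * tone n W) = x"
    by (rule TC_eqI[OF TC_ops(2)[OF x o] x]) (simp add: tone_def right_mult_one_mat[OF dx])
  show "(\<lambda>W. ctrans cj (ctrans cj (x W))) = x" using cj by simp
  show "\<exists>b\<in>TC n. (\<lambda>W. x W * b W * x W) = x"
  proof -
    have "\<exists>B. W \<in> V n \<longrightarrow> B \<in> carrier_mat (sz n W) (sz n W) \<and> x W * B * x W = x W" for W
      using m_inv_ex[OF dx[of W]] by blast
    then obtain B where B: "\<And>W. W \<in> V n \<Longrightarrow> B W \<in> carrier_mat (sz n W) (sz n W) \<and> x W * B W * x W = x W" by metis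
    define b where "b = (\<lambda>W. if W \<in> V n then B W else 0\<^sub>m 0 0)"
    have b: "b \<in> TC n" using B by (auto simp: TC_def b_def)
    have "(\<lambda>W. x W * b W * x W) = x"
      by (rule TC_eqI[OF TC_ops(2)[OF TC_ops(2)[OF x b] x] x]) (use B in \<open>auto simp: b_def\<close>)
    then show ?thesis using b by blast
  qed
  assume y: "y \<in> TC n"
  note dy = TC_D(1)[OF y]
  have sy: "(\<lambda>W. c \<cdot>\<^sub>m y W) \<in> TC n" and stry: "(\<lambda>W. ctrans cj (y W)) \<in> TC n" for c using TC_ops[OF y y] by auto
  have xy: "(\<lambda>W. x W + (-1) \<cdot>\<^sub>m y W) \<in> TC n" using TC_ops(1)[OF x sy] .
  have yx: "(\<lambda>W. y W + (-1) \<cdot>\<^sub>m x W) \<in> TC n" using TC_ops(1)[OF y s] .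
  show "(\<lambda>W. x W + y W) \<in> TC n" "(\<lambda>W. x W * y W) \<in> TC n" using TC_ops[OF x y] by auto
  show "tj n (Suc n) (\<lambda>W. x W + y W) = (\<lambda>W. tj n (Suc n) x W + tj n (Suc n) y W)"
    "tj n (Suc n) (\<lambda>W. x W * y W) = (\<lambda>W. tj n (Suc n) x W * tj n (Suc n) y W)" using tj_hom(1,2)[OF x y, of "Suc n"] by auto
  show "(\<lambda>W. x W + y W) = (\<lambda>W. y W + x W)"
    by (rule TC_eqI[OF TC_ops(1)[OF x y] TC_ops(1)[OF y x]]) (rule comm_add_mat[OF dx dy])
  show "(\<lambda>W. ctrans cj (x W + y W)) = (\<lambda>W. ctrans cj (x W) + ctrans cj (y W))"
    by (rule TC_eqI[OF TC_ops(4)[OF TC_ops(1)[OF x y] x] TC_ops(1)[OF str stry]]) (rule ctrans_add[OF cj dx dy])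
  show "(\<lambda>W. ctrans cj (x W * y W)) = (\<lambda>W. ctrans cj (y W) * ctrans cj (x W))"
    by (rule TC_eqI[OF TC_ops(4)[OF TC_ops(2)[OF x y] x] TC_ops(2)[OF stry str]]) (rule ctrans_mult[OF cj dx dy])
  show "trk n (\<lambda>W. x W + (-1) \<cdot>\<^sub>m y W) = trk n (\<lambda>W. y W + (-1) \<cdot>\<^sub>m x W)"
    unfolding trk_def by (rule infsum_cong) (use mD_sym[OF dx dy] in simp)
  show "trk n (\<lambda>W. c \<cdot>\<^sub>m x W + (-1) \<cdot>\<^sub>m (c \<cdot>\<^sub>m y W)) \<le> trk n (\<lambda>W. x W + (-1) \<cdot>\<^sub>m y W)"
    by (rule trk_mono1[OF TC_ops(1)[OF s TC_ops(3)[OF sy sy]] xy]) (use mD_smul[OF dx dy] in simp)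
  show "trk n (\<lambda>W. ctrans cj (x W) + (-1) \<cdot>\<^sub>m ctrans cj (y W)) \<le> trk n (\<lambda>W. x W + (-1) \<cdot>\<^sub>m y W)"
    by (rule trk_mono1[OF TC_ops(1)[OF str TC_ops(3)[OF stry stry]] xy]) (use mD_star[OF cj dx dy] in simp)
  show "trk n x \<le> trk n y + trk n (\<lambda>W. x W + (-1) \<cdot>\<^sub>m y W)"
    by (rule trk_mono2[OF x y xy]) (use mD_rk[OF dx dy] in simp)
  show "\<exists>b'\<in>TC n. (\<lambda>W. y W * b' W * y W) = y \<and> trk n (\<lambda>W. b' W + (-1) \<cdot>\<^sub>m b W) \<le> 2 * trk n (\<lambda>W. x W + (-1) \<cdot>\<^sub>m y W)"
    if b: "b \<in> TC n" and xbx: "(\<lambda>W. x W * b W * x W) = x"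
  proof -
    have xb: "x W * b W * x W = x W" for W using fun_cong[OF xbx, of W] .
    \<comment> \<open>The inner inverse is corrected in each tower separately; the constant 2 is the
      same everywhere and so passes to the weighted sum.\<close>
    have "\<exists>B. W \<in> V n \<longrightarrow> B \<in> carrier_mat (sz n W) (sz n W) \<and> y W * B * y W = y W \<and>
        mrank (B + (-1) \<cdot>\<^sub>m b W) \<le> 2 * mrank (x W + (-1) \<cdot>\<^sub>m y W)" for W
      using m_inv_lip[OF dx[of W] dy[of W] TC_D(1)[OF b, of W] xb] by blast
    then obtain B where B: "\<And>W. W \<in> V n \<Longrightarrow> B W \<in> carrier_mat (sz n W) (sz n W) \<and> y W * B W * y W = y W \<and>
        mrank (B W + (-1) \<cdot>\<^sub>m b W) \<le> 2 * mrank (x W + (-1) \<cdot>\<^sub>m y W)" by metis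
    define b' where "b' = (\<lambda>W. if W \<in> V n then B W else 0\<^sub>m 0 0)"
    have b': "b' \<in> TC n" using B by (auto simp: TC_def b'_def)
    have "(\<lambda>W. y W * b' W * y W) = y"
      by (rule TC_eqI[OF TC_ops(2)[OF TC_ops(2)[OF y b'] y] y]) (use B in \<open>auto simp: b'_def\<close>)
    moreover have "trk n (\<lambda>W. b' W + (-1) \<cdot>\<^sub>m b W) \<le> trk n (\<lambda>W. x W + (-1) \<cdot>\<^sub>m y W) + trk n (\<lambda>W. x W + (-1) \<cdot>\<^sub>m y W)"
      by (rule trk_mono2[OF TC_ops(1)[OF b' TC_ops(3)[OF b b]] xy xy]) (use B in \<open>simp add: b'_def flip: mult_2\<close>)
    ultimately show ?thesis using b' by auto
  qed
  assume z: "z \<in> TC n"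
  note dz = TC_D(1)[OF z]
  have sz': "(\<lambda>W. (-1) \<cdot>\<^sub>m z W) \<in> TC n" using TC_ops[OF z z] by auto
  show "(\<lambda>W. x W + y W + z W) = (\<lambda>W. x W + (y W + z W))"
    by (rule TC_eqI[OF TC_ops(1)[OF TC_ops(1)[OF x y] z] TC_ops(1)[OF x TC_ops(1)[OF y z]]]) (rule assoc_add_mat[OF dx dy dz])
  show "(\<lambda>W. x W * y W * z W) = (\<lambda>W. x W * (y W * z W))"
    by (rule TC_eqI[OF TC_ops(2)[OF TC_ops(2)[OF x y] z] TC_ops(2)[OF x TC_ops(2)[OF y z]]]) (rule assoc_mult_mat[OF dx dy dz])
  show "(\<lambda>W. x W * (y W + z W)) = (\<lambda>W. x W * y W + x W * z W)"
    by (rule TC_eqI[OF TC_ops(2)[OF x TC_ops(1)[OF y z]] TC_ops(1)[OF TC_ops(2)[OF x y] TC_ops(2)[OF x z]]])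
       (rule mult_add_distrib_mat[OF dx dy dz])
  show "(\<lambda>W. (x W + y W) * z W) = (\<lambda>W. x W * z W + y W * z W)"
    by (rule TC_eqI[OF TC_ops(2)[OF TC_ops(1)[OF x y] z] TC_ops(1)[OF TC_ops(2)[OF x z] TC_ops(2)[OF y z]]])
       (rule add_mult_distrib_mat[OF dx dy dz])
  show "trk n (\<lambda>W. x W + (-1) \<cdot>\<^sub>m z W) \<le> trk n (\<lambda>W. x W + (-1) \<cdot>\<^sub>m y W) + trk n (\<lambda>W. y W + (-1) \<cdot>\<^sub>m z W)"
    by (rule trk_mono2[OF TC_ops(1)[OF x sz'] xy TC_ops(1)[OF y sz']]) (use mD_tri[OF dx dy dz] in simp)
next
  fix n :: nat and x y x' y' :: "'w \<Rightarrow> 'k mat"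
  assume h: "x \<in> TC n" "y \<in> TC n" "x' \<in> TC n" "y' \<in> TC n"
  note d = TC_D(1)[OF h(1)] TC_D(1)[OF h(2)] TC_D(1)[OF h(3)] TC_D(1)[OF h(4)]
  have sy: "(\<lambda>W. (-1) \<cdot>\<^sub>m y W) \<in> TC n" "(\<lambda>W. (-1) \<cdot>\<^sub>m y' W) \<in> TC n" using TC_ops(3)[OF h(2,2)] TC_ops(3)[OF h(4,4)] by auto
  show "trk n (\<lambda>W. x W + x' W + (-1) \<cdot>\<^sub>m (y W + y' W)) \<le> trk n (\<lambda>W. x W + (-1) \<cdot>\<^sub>m y W) + trk n (\<lambda>W. x' W + (-1) \<cdot>\<^sub>m y' W)"
    by (rule trk_mono2[OF TC_ops(1)[OF TC_ops(1)[OF h(1,3)] TC_ops(3)[OF TC_ops(1)[OF h(2,4)] h(1)]] TC_ops(1)[OF h(1) sy(1)] TC_ops(1)[OF h(3) sy(2)]])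
       (use mD_add[OF d] in simp)
  show "trk n (\<lambda>W. x W * x' W + (-1) \<cdot>\<^sub>m (y W * y' W)) \<le> trk n (\<lambda>W. x W + (-1) \<cdot>\<^sub>m y W) + trk n (\<lambda>W. x' W + (-1) \<cdot>\<^sub>m y' W)"
    by (rule trk_mono2[OF TC_ops(1)[OF TC_ops(2)[OF h(1,3)] TC_ops(3)[OF TC_ops(2)[OF h(2,4)] h(1)]] TC_ops(1)[OF h(1) sy(1)] TC_ops(1)[OF h(3) sy(2)]])
       (use mD_mul[OF d] in simp)
qed

text \<open>Blocks of level n inside blocks of level m inside a tower are the level-n blocks of that
  tower. Hence the iterated one-step maps equal the direct map \<open>tj n m\<close>.\<close>

lemma lim_lift_tj:
  assumes x: "x \<in> TC n" and nm: "n \<le> m"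
  shows "lim_lift (\<lambda>n. tj n (Suc n)) m (n, x) = tj n m x"
  using nm
proof (induction rule: dec_induct)
  case base
  have "x W = blk (sz n W) (tlab n n W) (\<lambda>b. x (ty n n W b))" if W: "W \<in> V n" for W
    by (rule eq_matI) (use TC_D(1)[OF x W] st_refl[OF W] ty_refl[OF W] in \<open>auto simp: blk_index tlab_def\<close>)
  then show ?case using TC_D(2)[OF x] by (auto simp: tj_def)
next
  case (step m)
  have "lim_lift (\<lambda>n. tj n (Suc n)) (Suc m) (n, x) = tj m (Suc m) (tj n m x)"
    using step by (simp add: lim_lift_Suc)
  also have "\<dots> = tj n (Suc m) x"
  proof (rule TC_eqI[OF tj_C tj_C])
    fix W assume W: "W \<in> V (Suc m)"
    let ?N = "sz (Suc m) W"
    show "tj m (Suc m) (tj n m x) W = tj n (Suc m) x W"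
    proof (rule eq_matI)
      fix p q assume "p < dim_row (tj n (Suc m) x W)" "q < dim_col (tj n (Suc m) x W)"
      then have pq: "p < ?N" "q < ?N" using W by (auto simp: tj_def)
      let ?b = "st m (Suc m) W p" and ?c = "st m (Suc m) W q"
      let ?W' = "ty m (Suc m) W ?b"
      have W': "?W' \<in> V m" using ty_V[OF _ W pq(1), of m] by simp
      have ok: "blk_ok ?N (\<lambda>b. sz m (ty m (Suc m) W b)) (tlab m (Suc m) W)" by (rule tlab_ok[OF _ W]) simp
      have bnd: "p - ?b < sz m ?W'" using ok pq(1) by (auto simp: blk_ok_def tlab_def)
      have bnd2: "q - ?c < sz m (ty m (Suc m) W ?c)" using ok pq(2) by (auto simp: blk_ok_def tlab_def)
      have le: "?b \<le> p" "?c \<le> q" using st_le[OF _ W] pq by auto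
      have L: "tj m (Suc m) (tj n m x) W $$ (p,q) = (if ?b = ?c then tj n m x ?W' $$ (p - ?b, q - ?c) else 0)"
        using W pq by (simp add: tj_def blk_index tlab_def)
      have R: "tj n (Suc m) x W $$ (p,q) = (if st n (Suc m) W p = st n (Suc m) W q then
          x (ty n (Suc m) W (st n (Suc m) W p)) $$ (p - st n (Suc m) W p, q - st n (Suc m) W q) else 0)"
        using W pq by (simp add: tj_def blk_index tlab_def)
      note sp = st_comp[OF step(1) W pq(1)] and sq = st_comp[OF step(1) W pq(2)] and tp = ty_comp[OF step(1) W pq(1)]
      show "tj m (Suc m) (tj n m x) W $$ (p,q) = tj n (Suc m) x W $$ (p,q)"
      proof (cases "?b = ?c")
        case True
        have "tj n m x ?W' $$ (p - ?b, q - ?c) = (if st n m ?W' (p - ?b) = st n m ?W' (q - ?c) then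
            x (ty n m ?W' (st n m ?W' (p - ?b))) $$ (p - ?b - st n m ?W' (p - ?b), q - ?c - st n m ?W' (q - ?c)) else 0)"
          using W' bnd bnd2 True by (simp add: tj_def blk_index tlab_def)
        then show ?thesis unfolding L R sp sq tp[unfolded sp] using True by (auto simp: diff_diff_left)
      next
        case False
        \<comment> \<open>If \<open>p\<close> and \<open>q\<close> lay in one level-n block starting
          at r, then r would belong to the level-m blocks of both, and these would have the same
          start.\<close>
        have "st n (Suc m) W p \<noteq> st n (Suc m) W q"
        proof
          assume eq: "st n (Suc m) W p = st n (Suc m) W q"
          have i1: "st n m ?W' (p - ?b) \<le> p - ?b" using st_le[OF step(1) W' bnd] .
          have W'': "ty m (Suc m) W ?c \<in> V m" using ty_V[OF _ W pq(2), of m] by simp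
          have i2: "st n m (ty m (Suc m) W ?c) (q - ?c) \<le> q - ?c" using st_le[OF step(1) W'' bnd2] .
          define r where "r = st n (Suc m) W p"
          have r1: "r < ?N" "r - ?b < sz m ?W'" "?b \<le> r" using i1 sp le pq(1) bnd by (auto simp: r_def)
          have r2: "r - ?c < sz m (ty m (Suc m) W ?c)" "?c \<le> r" using i2 sq eq le bnd2 by (auto simp: r_def)
          obtain r' where r': "r' < ?N" "st m (Suc m) W r' = ?b" "r' - ?b = r - ?b"
            using blk_okD(2)[OF ok pq(1) _ r1(2)] by (auto simp: tlab_def)
          obtain r'' where r'': "r'' < ?N" "st m (Suc m) W r'' = ?c" "r'' - ?c = r - ?c"
            using blk_okD(2)[OF ok pq(2) _ r2(1)] by (auto simp: tlab_def)
          have "r' = r" using st_le[OF _ W r'(1), of m] r' r1(3) by simp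
          moreover have "r'' = r" using st_le[OF _ W r''(1), of m] r'' r2(2) by simp
          ultimately show False using r'(2) r''(2) False by simp
        qed
        then show ?thesis unfolding L R using False by simp
      qed
    qed (use W in \<open>auto simp: tj_def\<close>)
  qed
  finally show ?case .
qed

end

section \<open>Packing towers into templates\<close>

text \<open>A placement \<open>h\<close>, sending index i of copy s to a row, is turned into the row
  labelling that \<open>blk\<close> expects; rows not hit stay unlabelled.\<close>

definition plab :: "(nat \<times> nat) set \<Rightarrow> (nat \<Rightarrow> nat \<Rightarrow> nat) \<Rightarrow> nat \<Rightarrow> (nat \<times> nat) option" where
  "plab D h p = (if p \<in> (\<lambda>(s,i). h s i) ` D then Some (inv_into D (\<lambda>(s,i). h s i) p) else None)"

lemma plab_eq:
  assumes "inj_on (\<lambda>(s,i). h s i) D" "(s,i) \<in> D"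
  shows "plab D h (h s i) = Some (s,i)"
  using inv_into_f_f[OF assms] assms(2) by (force simp: plab_def)

lemma plab_Some:
  assumes "plab D h p = Some (s,i)" shows "(s,i) \<in> D" "h s i = p"
proof -
  have p: "p \<in> (\<lambda>(s,i). h s i) ` D" and e: "inv_into D (\<lambda>(s,i). h s i) p = (s,i)"
    using assms by (auto simp: plab_def split: if_splits)
  show "(s,i) \<in> D" using inv_into_into[OF p] e by simp
  show "h s i = p" using f_inv_into_f[OF p] e by simp
qed

lemma plab_blk_ok:
  assumes inj: "inj_on (\<lambda>(s,i). h s i) ({..<M} \<times> {..<L})" and rng: "(\<lambda>(s,i). h s i) ` ({..<M} \<times> {..<L}) \<subseteq> {..<N}"
  shows "blk_ok N (\<lambda>_. L) (plab ({..<M} \<times> {..<L}) h)"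
  unfolding blk_ok_def
proof (intro conjI allI impI)
  let ?D = "{..<M} \<times> {..<L}"
  fix p b i assume "plab ?D h p = Some (b,i)"
  then show "i < L" using plab_Some by fastforce
next
  let ?D = "{..<M} \<times> {..<L}"
  fix p q assume "plab ?D h p \<noteq> None" "plab ?D h p = plab ?D h q"
  then show "p = q" by (metis not_None_eq plab_Some(2) surj_pair)
next
  let ?D = "{..<M} \<times> {..<L}"
  fix p b i i' assume "plab ?D h p = Some (b,i)" "i' < L"
  then have d: "(b,i') \<in> ?D" using plab_Some(1) by fastforce
  then have "h b i' < N" using rng by auto
  then show "\<exists>q<N. plab ?D h q = Some (b,i')" using plab_eq[OF inj d] by blast
qed

lemma plab_blks:
  assumes inj: "inj_on (\<lambda>(s,i). h s i) ({..<M} \<times> {..<L})" and rng: "(\<lambda>(s,i). h s i) ` ({..<M} \<times> {..<L}) \<subseteq> {..<N}"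
    and L: "0 < L"
  shows "blks N (plab ({..<M} \<times> {..<L}) h) = {..<M}"
proof (intro equalityI subsetI)
  fix b assume "b \<in> blks N (plab ({..<M} \<times> {..<L}) h)"
  then obtain p i where "plab ({..<M} \<times> {..<L}) h p = Some (b,i)" by (auto simp: blks_def)
  then show "b \<in> {..<M}" using plab_Some(1) by fastforce
next
  fix b assume "b \<in> {..<M}"
  then have d: "(b,0) \<in> {..<M} \<times> {..<L}" using L by auto
  then have "h b 0 < N" using rng by auto
  then show "b \<in> blks N (plab ({..<M} \<times> {..<L}) h)" using plab_eq[OF inj d] by (auto simp: blks_def)
qed

text \<open>Used to assign rows to those template indices that carry no piece of a tower; their
  images are irrelevant as long as they are distinct.\<close>

lemma inj_on_extend:
  assumes fin: "finite A" "finite B" and sub: "A' \<subseteq> A" and inj: "inj_on f A'" and im: "f ` A' \<subseteq> B" and le: "card A \<le> card B"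
  obtains g where "inj_on g A" "g ` A \<subseteq> B" "\<And>x. x \<in> A' \<Longrightarrow> g x = f x"
proof -
  have fA': "finite A'" using fin sub finite_subset by blast
  have "card (A - A') = card A - card A'" using card_Diff_subset[OF fA' sub] .
  also have "\<dots> \<le> card B - card A'" using le by simp
  also have "\<dots> = card (B - f ` A')" using card_Diff_subset[of "f ` A'" B] im fA' card_image[OF inj] by simp
  finally obtain k where k: "k ` (A - A') \<subseteq> B - f ` A'" "inj_on k (A - A')"
    using inj_on_iff_card_le[of "A - A'" "B - f ` A'"] fin by (metis finite_Diff)
  define g where "g x = (if x \<in> A' then f x else k x)" for x
  have "inj_on g A"
  proof (rule inj_onI)
    fix x y assume "x \<in> A" "y \<in> A" "g x = g y"
    then show "x = y" using k inj unfolding g_def inj_on_def by (auto split: if_splits)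
  qed
  moreover have "g ` A \<subseteq> B" using k im by (auto simp: g_def)
  ultimately show thesis using that[of g] by (simp add: g_def)
qed

text \<open>\<open>small\<close> makes the loss of less than one template per tower negligible.
  \<open>deviation\<close> bounds, in the mean, by how much \<open>W'\<close> falls short of its
  expected number wt W * sz m W' of copies of \<open>W\<close>; an excess is harmless and is cut off
  by \<open>max 0\<close>.\<close>

locale ergodic_tower_system = tower_system cj V sz wt st ty
  for cj :: "'k::field \<Rightarrow> 'k" and V :: "nat \<Rightarrow> 'w set" and sz wt st ty +
  assumes small: "(\<lambda>m. \<Sum>\<^sub>\<infinity>W\<in>V m. wt W) \<longlonglongrightarrow> 0"
    and deviation: "W \<in> V n \<Longrightarrow>
      (\<lambda>m. \<Sum>\<^sub>\<infinity>W'\<in>V m. wt W' * max 0 (wt W * real (sz m W') - real (cnt n m W W'))) \<longlonglongrightarrow> 0"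
begin

text \<open>Each tower \<open>W\<close> holds \<open>mm W\<close> disjoint copies of a template of
  size 2^l, with index i of copy s in row \<open>g W s i\<close>.\<close>

definition place :: "nat \<Rightarrow> nat \<Rightarrow> ('w \<Rightarrow> nat) \<Rightarrow> ('w \<Rightarrow> nat \<Rightarrow> nat \<Rightarrow> nat) \<Rightarrow> bool" where
  "place n l mm g \<longleftrightarrow> (\<forall>W\<in>V n. inj_on (\<lambda>(s,i). g W s i) ({..<mm W} \<times> {..<2^l}) \<and>
     (\<lambda>(s,i). g W s i) ` ({..<mm W} \<times> {..<2^l}) \<subseteq> {..<sz n W})"

text \<open>The measure of the part of the space covered by template copies; 1 - \<open>pwt\<close>
  is the weight of the corner where \<open>phi\<close> vanishes.\<close>

definition pwt :: "nat \<Rightarrow> nat \<Rightarrow> ('w \<Rightarrow> nat) \<Rightarrow> real" where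
  "pwt n l mm = (\<Sum>\<^sub>\<infinity>W\<in>V n. wt W * (real (mm W) * 2^l))"

definition phi :: "nat \<Rightarrow> nat \<Rightarrow> ('w \<Rightarrow> nat) \<Rightarrow> ('w \<Rightarrow> nat \<Rightarrow> nat \<Rightarrow> nat) \<Rightarrow> 'k mat \<Rightarrow> 'w \<Rightarrow> 'k mat" where
  "phi n l mm g A = (\<lambda>W. if W \<in> V n then blk (sz n W) (plab ({..<mm W} \<times> {..<2^l}) (g W)) (\<lambda>_. A) else 0\<^sub>m 0 0)"

lemma place_le:
  assumes "place n l mm g" "W \<in> V n" shows "mm W * 2^l \<le> sz n W"
proof -
  have "card ((\<lambda>(s,i). g W s i) ` ({..<mm W} \<times> {..<2^l})) \<le> card {..<sz n W}"
    by (rule card_mono) (use assms in \<open>auto simp: place_def\<close>)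
  then show ?thesis using assms card_image[of "\<lambda>(s,i). g W s i" "{..<mm W} \<times> {..<2^l}"] by (auto simp: place_def card_cartesian_product)
qed

lemma pwt_summable:
  assumes "place n l mm g" shows "(\<lambda>W. wt W * (real (mm W) * 2^l)) summable_on V n"
proof (rule wsummable[where K = 1])
  fix W assume "W \<in> V n"
  from place_le[OF assms this] have "real (mm W * 2^l) \<le> real (sz n W)" by linarith
  then show "real (mm W) * 2^l \<le> 1 * real (sz n W)" by simp
qed auto

lemma pwt_le_1: assumes "place n l mm g" shows "pwt n l mm \<le> 1"
proof -
  have "pwt n l mm \<le> (\<Sum>\<^sub>\<infinity>W\<in>V n. wt W * real (sz n W))"
    unfolding pwt_def
  proof (rule infsum_mono[OF pwt_summable[OF assms]])
    show "(\<lambda>W. wt W * real (sz n W)) summable_on V n" using wsum has_sum_imp_summable by blast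
    fix W assume W: "W \<in> V n"
    from place_le[OF assms this] have "real (mm W * 2^l) \<le> real (sz n W)" by linarith
    then show "wt W * (real (mm W) * 2^l) \<le> wt W * real (sz n W)" using wt_pos[OF W] by (intro mult_left_mono) auto
  qed
  also have "\<dots> = 1" using wsum by (rule infsumI)
  finally show ?thesis .
qed

context
  fixes n l mm g assumes pl: "place n l mm g"
begin

lemma phi_ok: "W \<in> V n \<Longrightarrow> blk_ok (sz n W) (\<lambda>_. 2^l) (plab ({..<mm W} \<times> {..<2^l}) (g W))"
  using pl by (intro plab_blk_ok) (auto simp: place_def)

lemma phi_C: "phi n l mm g A \<in> TC n" by (rule TC_I) (auto simp: phi_def)

lemma phi_hom:
  assumes A: "A \<in> carrier_mat (2^l) (2^l)" and B: "B \<in> carrier_mat (2^l) (2^l)"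
  shows "phi n l mm g (A + B) = (\<lambda>W. phi n l mm g A W + phi n l mm g B W)"
    "phi n l mm g (A * B) = (\<lambda>W. phi n l mm g A W * phi n l mm g B W)"
    "phi n l mm g (c \<cdot>\<^sub>m A) = (\<lambda>W. c \<cdot>\<^sub>m phi n l mm g A W)"
    "phi n l mm g (ctrans cj A) = (\<lambda>W. ctrans cj (phi n l mm g A W))"
proof -
  show "phi n l mm g (A + B) = (\<lambda>W. phi n l mm g A W + phi n l mm g B W)"
    by (rule TC_eqI[OF phi_C TC_ops(1)[OF phi_C phi_C]]) (use blk_add[OF phi_ok, of _ "\<lambda>_. A" "\<lambda>_. B"] A B in \<open>simp add: phi_def\<close>)
  show "phi n l mm g (A * B) = (\<lambda>W. phi n l mm g A W * phi n l mm g B W)"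
    by (rule TC_eqI[OF phi_C TC_ops(2)[OF phi_C phi_C]]) (use blk_mult[OF phi_ok, of _ "\<lambda>_. A" "\<lambda>_. B"] A B in \<open>simp add: phi_def\<close>)
  show "phi n l mm g (c \<cdot>\<^sub>m A) = (\<lambda>W. c \<cdot>\<^sub>m phi n l mm g A W)"
    by (rule TC_eqI[OF phi_C TC_ops(3)[OF phi_C phi_C]]) (use blk_smult[OF phi_ok, of _ "\<lambda>_. A"] A in \<open>simp add: phi_def\<close>)
  show "phi n l mm g (ctrans cj A) = (\<lambda>W. ctrans cj (phi n l mm g A W))"
    by (rule TC_eqI[OF phi_C TC_ops(4)[OF phi_C phi_C]]) (use blk_ctrans[OF cj phi_ok, of _ "\<lambda>_. A"] A in \<open>simp add: phi_def\<close>)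
qed

text \<open>A tower receives \<open>mm W\<close> copies of \<open>A\<close>, so \<open>phi\<close>
  scales the normalized rank by exactly the covered measure.\<close>

lemma phi_rk:
  assumes A: "A \<in> carrier_mat (2^l) (2^l)"
  shows "trk n (phi n l mm g A) = pwt n l mm * (real (mrank A) / 2^l)"
proof -
  have "mrank (phi n l mm g A W) = mm W * mrank A" if W: "W \<in> V n" for W
    using mrank_blk[OF phi_ok[OF W], of "\<lambda>_. A"] A W pl plab_blks[of "g W" "mm W" "2^l" "sz n W"]
    by (simp add: phi_def place_def)
  then have "trk n (phi n l mm g A) = (\<Sum>\<^sub>\<infinity>W\<in>V n. wt W * (real (mm W) * 2^l) * (real (mrank A) / 2^l))"
    unfolding trk_def by (intro infsum_cong) simp
  also have "\<dots> = pwt n l mm * (real (mrank A) / 2^l)" unfolding pwt_def by (rule infsum_cmult_left')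
  finally show ?thesis .
qed

lemma phi_rk_approx:
  assumes A: "A \<in> carrier_mat (2^l) (2^l)" and e: "1 - e \<le> pwt n l mm"
  shows "\<bar>trk n (phi n l mm g A) - Mrk l A\<bar> \<le> e"
proof -
  have r: "0 \<le> Mrk l A" "Mrk l A \<le> 1" using mrank_le[OF A] by (auto simp: Mrk_def divide_le_eq)
  have "trk n (phi n l mm g A) - Mrk l A = (pwt n l mm - 1) * Mrk l A"
    unfolding phi_rk[OF A] Mrk_def by (simp add: left_diff_distrib diff_divide_distrib)
  moreover have "\<bar>(pwt n l mm - 1) * Mrk l A\<bar> \<le> e * 1"
    unfolding abs_mult by (rule mult_mono) (use r e pwt_le_1[OF pl] in auto)
  ultimately show ?thesis by simp
qed

end

text \<open>In each tower the difference is supported on rows and columns outside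
  \<open>Q W\<close>, so its rank is at most twice their number. Integrating uses that the weighted
  heights sum to 1.\<close>

lemma trk_agree:
  assumes x: "x \<in> TC n" and y: "y \<in> TC n"
    and Q: "\<And>W. W \<in> V n \<Longrightarrow> Q W \<subseteq> {..<sz n W}"
    and agree: "\<And>W p q. W \<in> V n \<Longrightarrow> p \<in> Q W \<Longrightarrow> q \<in> Q W \<Longrightarrow> x W $$ (p,q) = y W $$ (p,q)"
  shows "trk n (\<lambda>W. x W + (-1) \<cdot>\<^sub>m y W) \<le> 2 * (1 - (\<Sum>\<^sub>\<infinity>W\<in>V n. wt W * real (card (Q W))))"
proof -
  have cQ: "card (Q W) \<le> sz n W" if "W \<in> V n" for W using card_mono[OF _ Q[OF that]] by simp
  have s1: "(\<lambda>W. wt W * real (card (Q W))) summable_on V n"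
    by (rule wsummable[where K = 1]) (use cQ in auto)
  have s0: "(\<lambda>W. wt W * real (sz n W)) summable_on V n" using wsum has_sum_imp_summable by blast
  have s2: "(\<lambda>W. wt W * (2 * (real (sz n W) - real (card (Q W))))) summable_on V n"
    by (rule wsummable[where K = 2]) (use cQ in auto)
  have "trk n (\<lambda>W. x W + (-1) \<cdot>\<^sub>m y W) \<le> (\<Sum>\<^sub>\<infinity>W\<in>V n. wt W * (2 * (real (sz n W) - real (card (Q W)))))"
  proof (rule trk_le_wsum[OF _ _ s2])
    show "(\<lambda>W. x W + (-1) \<cdot>\<^sub>m y W) \<in> TC n" using TC_ops(1)[OF x TC_ops(3)[OF y y]] .
    fix W assume W: "W \<in> V n"
    note d = TC_D(1)[OF x W] TC_D(1)[OF y W]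
    have "mrank (x W + (-1) \<cdot>\<^sub>m y W) \<le> 2 * card ({..<sz n W} - Q W)"
      by (rule mrank_le_card_cross[of _ _ "sz n W"]) (use d agree[OF W] in auto)
    also have "card ({..<sz n W} - Q W) = sz n W - card (Q W)"
      using Q[OF W] by (simp add: card_Diff_subset finite_subset)
    finally show "real (mrank (x W + (-1) \<cdot>\<^sub>m y W)) \<le> 2 * (real (sz n W) - real (card (Q W)))"
      using cQ[OF W] by (simp add: of_nat_diff[symmetric] del: of_nat_diff)
  qed
  also have "\<dots> = 2 * (1 - (\<Sum>\<^sub>\<infinity>W\<in>V n. wt W * real (card (Q W))))"
  proof -
    have "(\<Sum>\<^sub>\<infinity>W\<in>V n. wt W * (2 * (real (sz n W) - real (card (Q W))))) + (\<Sum>\<^sub>\<infinity>W\<in>V n. 2 * (wt W * real (card (Q W))))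
        = (\<Sum>\<^sub>\<infinity>W\<in>V n. wt W * (2 * (real (sz n W) - real (card (Q W)))) + 2 * (wt W * real (card (Q W))))"
      by (rule infsum_add[symmetric]) (use s1 s2 in \<open>auto intro!: summable_on_cmult_right\<close>)
    also have "\<dots> = (\<Sum>\<^sub>\<infinity>W\<in>V n. 2 * (wt W * real (sz n W)))" by (rule infsum_cong) (simp add: algebra_simps)
    also have "\<dots> = 2 * 1" unfolding infsum_cmult_right' using wsum by (simp add: infsumI)
    finally show ?thesis by (simp add: infsum_cmult_right')
  qed
  finally show ?thesis .
qed

lemma tj_index:
  assumes "W' \<in> V m" "p < sz m W'" "q < sz m W'"
  shows "tj n m x W' $$ (p,q) = (if st n m W' p = st n m W' q then x (ty n m W' (st n m W' p)) $$ (p - st n m W' p, q - st n m W' q) else 0)"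
  using assms by (simp add: tj_def blk_index tlab_def)

lemma block_cell:
  assumes nm: "n \<le> m" and W': "W' \<in> V m" and b: "\<exists>p<sz m W'. b = st n m W' p" and i: "i < sz n (ty n m W' b)"
  shows "b + i < sz m W'" "st n m W' (b + i) = b"
proof -
  obtain p where p: "p < sz m W'" "b = st n m W' p" using b by blast
  have "tlab n m W' p = Some (b, p - b)" using p by (simp add: tlab_def)
  from blk_okD(2)[OF tlab_ok[OF nm W'] p(1) this i]
  obtain q where q: "q < sz m W'" "st n m W' q = b" "q - b = i" by (auto simp: tlab_def)
  moreover have "b \<le> q" using st_le[OF nm W' q(1)] q(2) by simp
  ultimately have "q = b + i" by simp
  then show "b + i < sz m W'" "st n m W' (b + i) = b" using q by auto
qed

text \<open>Packs \<open>N\<close> templates of size 2^l' into the tower \<open>W'\<close>. Each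
  template uses \<open>q W\<close> copies of every \<open>W\<close> in \<open>F\<close>; the s-th
  piece of size 2^l in the r-th copy of \<open>W\<close> sits in the template at slot
  \<open>sg (W,r,s)\<close>. The hypothesis \<open>N1\<close> supplies enough copies of each
  \<open>W\<close>, and the final count measures the rows where the template structure and the tower
  structure match.\<close>

lemma one_tower:
  assumes nm: "n \<le> m" and W': "W' \<in> V m" and pl: "place n l mm g" and F: "finite F" "F \<subseteq> V n" and ll: "l \<le> l'"
    and sg: "inj_on sg {(W,r,s). W \<in> F \<and> r < q W \<and> s < mm W}"
      "\<And>W r s. W \<in> F \<Longrightarrow> r < q W \<Longrightarrow> s < mm W \<Longrightarrow> sg (W,r,s) < (2::nat)^(l'-l)"
    and N1: "\<And>W. W \<in> F \<Longrightarrow> N * q W \<le> cnt n m W W'" and N2: "N * 2^l' \<le> sz m W'"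
  obtains h bl where "inj_on (\<lambda>(t,u). h t u) ({..<N} \<times> {..<2^l'})" "(\<lambda>(t,u). h t u) ` ({..<N} \<times> {..<2^l'}) \<subseteq> {..<sz m W'}"
    "\<And>t W r s i. t < N \<Longrightarrow> W \<in> F \<Longrightarrow> r < q W \<Longrightarrow> s < mm W \<Longrightarrow> i < 2^l \<Longrightarrow>
        h t (sg (W,r,s) * 2^l + i) = bl W (t * q W + r) + g W s i \<and> sg (W,r,s) * 2^l + i < 2^l' \<and>
        bl W (t * q W + r) + g W s i < sz m W' \<and> st n m W' (bl W (t * q W + r) + g W s i) = bl W (t * q W + r) \<and>
        ty n m W' (bl W (t * q W + r)) = W"
    "\<And>t W r t2 W2 r2. t < N \<Longrightarrow> W \<in> F \<Longrightarrow> r < q W \<Longrightarrow> t2 < N \<Longrightarrow> W2 \<in> F \<Longrightarrow> r2 < q W2 \<Longrightarrow>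
        bl W (t * q W + r) = bl W2 (t2 * q W2 + r2) \<longleftrightarrow> t = t2 \<and> W = W2 \<and> r = r2"
    "card ((\<lambda>(t,W,r,s,i). bl W (t * q W + r) + g W s i) ` {(t,W,r,s,i). t < N \<and> W \<in> F \<and> r < q W \<and> s < mm W \<and> i < (2::nat)^l}) =
        N * (\<Sum>W\<in>F. q W * (mm W * 2^l))"
proof -
  let ?B = "\<lambda>W. {b. (\<exists>p<sz m W'. b = st n m W' p) \<and> ty n m W' b = W}"
  have finB: "finite (?B W)" for W by (rule finite_subset[of _ "st n m W' ` {..<sz m W'}"]) auto
  \<comment> \<open>Number \<open>N * q W\<close> distinct occurrences of \<open>W\<close> in
    \<open>W'\<close>; the t-th template owns those numbered \<open>t * q W + r\<close> with
    \<open>r < q W\<close>.\<close>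
  have "\<forall>W\<in>F. \<exists>f. f ` {..<N * q W} \<subseteq> ?B W \<and> inj_on f {..<N * q W}"
  proof
    fix W assume "W \<in> F"
    from N1[OF this] show "\<exists>f. f ` {..<N * q W} \<subseteq> ?B W \<and> inj_on f {..<N * q W}"
      using inj_on_iff_card_le[of "{..<N * q W}" "?B W"] finB by (auto simp: cnt_def)
  qed
  from bchoice[OF this] obtain bl where bl0: "\<forall>W\<in>F. bl W ` {..<N * q W} \<subseteq> ?B W \<and> inj_on (bl W) {..<N * q W}" ..
  have bl: "bl W ` {..<N * q W} \<subseteq> ?B W" "inj_on (bl W) {..<N * q W}" if "W \<in> F" for W
    using bl0 that by blast+
  have lt: "t * q W + r < N * q W" if "t < N" "r < q W" for t W r
  proof -
    have "t * q W + r < (t + 1) * q W" using that by simp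
    also have "\<dots> \<le> N * q W" using that by (intro mult_right_mono) auto
    finally show ?thesis .
  qed
  have blB: "(\<exists>p<sz m W'. bl W k = st n m W' p) \<and> ty n m W' (bl W k) = W" if "W \<in> F" "k < N * q W" for W k
    using bl(1)[OF that(1)] that(2) by blast
  have bleq: "bl W (t * q W + r) = bl W2 (t2 * q W2 + r2) \<longleftrightarrow> t = t2 \<and> W = W2 \<and> r = r2"
    if "t < N" "W \<in> F" "r < q W" "t2 < N" "W2 \<in> F" "r2 < q W2" for t W r t2 W2 r2
  proof
    assume e: "bl W (t * q W + r) = bl W2 (t2 * q W2 + r2)"
    have "W = W2" using blB[OF that(2) lt[OF that(1,3)]] blB[OF that(5) lt[OF that(4,6)]] e by metis
    moreover have "t * q W + r = t2 * q W + r2"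
      using inj_onD[OF bl(2)[OF that(2)] e[folded \<open>W = W2\<close>]] lt[OF that(1,3)] lt[of t2 r2 W] that \<open>W = W2\<close> by auto
    then have "(t * q W + r) div q W = (t2 * q W + r2) div q W" "(t * q W + r) mod q W = (t2 * q W + r2) mod q W" by auto
    then have "t = t2 \<and> r = r2" using that \<open>W = W2\<close> by auto
    ultimately show "t = t2 \<and> W = W2 \<and> r = r2" by simp
  qed simp
  \<comment> \<open>Each index tuple is seen from two sides: \<open>cell\<close> is its row in the
    tower, \<open>ix\<close> its place in a template. Both are injective, which determines
    \<open>h\<close> on the used template indices.\<close>
  define AA where "AA = {(t,W,r,s,i). t < N \<and> W \<in> F \<and> r < q W \<and> s < mm W \<and> i < (2::nat)^l}"
  define cell where "cell = (\<lambda>(t,W,r,s,i). bl W (t * q W + r) + g W s i)"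
  define ix where "ix = (\<lambda>(t::nat,W,r,s,i). (t, sg (W,r,s) * 2^l + i))"
  have gs: "g W s i < sz n W" if "W \<in> F" "s < mm W" "i < 2^l" for W s i
    using pl that F by (auto simp: place_def)
  have cb: "cell (t,W,r,s,i) < sz m W'" "st n m W' (cell (t,W,r,s,i)) = bl W (t * q W + r)" if "(t,W,r,s,i) \<in> AA" for t W r s i
  proof -
    have h: "t < N" "W \<in> F" "r < q W" "s < mm W" "i < 2^l" using that by (auto simp: AA_def)
    note b = blB[OF h(2) lt[OF h(1,3)]]
    show "cell (t,W,r,s,i) < sz m W'" "st n m W' (cell (t,W,r,s,i)) = bl W (t * q W + r)"
      using block_cell[OF nm W' conjunct1[OF b], of "g W s i"] gs[OF h(2,4,5)] b by (auto simp: cell_def)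
  qed
  have cinj: "inj_on cell AA"
  proof (rule inj_onI)
    fix a1 a2 assume a12: "a1 \<in> AA" "a2 \<in> AA" "cell a1 = cell a2"
    obtain t W r s i where a1: "a1 = (t,W,r,s,i)" by (cases a1)
    obtain t2 W2 r2 s2 i2 where a2: "a2 = (t2,W2,r2,s2,i2)" by (cases a2)
    note a = a12(1,2)[unfolded a1 a2] and e = a12(3)[unfolded a1 a2]
    have "bl W (t * q W + r) = bl W2 (t2 * q W2 + r2)" using cb(2)[OF a(1)] cb(2)[OF a(2)] e by simp
    then have w: "t = t2 \<and> W = W2 \<and> r = r2" using bleq[of t W r t2 W2 r2] a by (auto simp: AA_def)
    then have "g W s i = g W s2 i2" using e by (simp add: cell_def)
    moreover have "inj_on (\<lambda>(s,i). g W s i) ({..<mm W} \<times> {..<2^l})" using pl a F by (auto simp: place_def AA_def)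
    ultimately have "s = s2 \<and> i = i2" using a w by (auto simp: AA_def inj_on_def)
    then show "a1 = a2" using w a1 a2 by simp
  qed
  have iinj: "inj_on ix AA"
  proof (rule inj_onI)
    fix a1 a2 assume a12: "a1 \<in> AA" "a2 \<in> AA" "ix a1 = ix a2"
    obtain t W r s i where a1: "a1 = (t,W,r,s,i)" by (cases a1)
    obtain t2 W2 r2 s2 i2 where a2: "a2 = (t2,W2,r2,s2,i2)" by (cases a2)
    note a = a12(1,2)[unfolded a1 a2] and e = a12(3)[unfolded a1 a2]
    have e1: "t = t2" "sg (W,r,s) * 2^l + i = sg (W2,r2,s2) * 2^l + i2" using e by (auto simp: ix_def)
    have i: "i < 2^l" "i2 < 2^l" using a by (auto simp: AA_def)
    have "(sg (W,r,s) * 2^l + i) div 2^l = (sg (W2,r2,s2) * 2^l + i2) div 2^l" "(sg (W,r,s) * 2^l + i) mod 2^l = (sg (W2,r2,s2) * 2^l + i2) mod 2^l"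
      using e1(2) by auto
    then have "sg (W,r,s) = sg (W2,r2,s2)" "i = i2" using i by auto
    then show "a1 = a2" unfolding a1 a2
      using e1(1) inj_onD[OF sg(1), of "(W,r,s)" "(W2,r2,s2)"] a by (auto simp: AA_def)
  qed
  have isub: "ix ` AA \<subseteq> {..<N} \<times> {..<2^l'}"
  proof (rule image_subsetI)
    fix a1 assume a1: "a1 \<in> AA"
    obtain t' W r s i where e: "a1 = (t',W,r,s,i)" by (cases a1)
    note a = a1[unfolded e]
    have h: "t' < N" "W \<in> F" "r < q W" "s < mm W" "i < 2^l" using a by (auto simp: AA_def)
    have "sg (W,r,s) + 1 \<le> 2^(l'-l)" using sg(2)[OF h(2,3,4)] by simp
    then have "(sg (W,r,s) + 1) * 2^l \<le> 2^(l'-l) * 2^l" by (rule mult_right_mono) simp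
    also have "\<dots> = 2^l'" using ll by (simp flip: power_add)
    finally show "ix a1 \<in> {..<N} \<times> {..<2^l'}" using e h by (auto simp: ix_def)
  qed
  have inj': "inj_on (cell \<circ> inv_into AA ix) (ix ` AA)"
    by (rule comp_inj_on) (use cinj iinj in \<open>auto simp: inj_on_inv_into inv_into_image_cancel\<close>)
  have im': "(cell \<circ> inv_into AA ix) ` (ix ` AA) \<subseteq> {..<sz m W'}"
    using iinj cb by (auto simp: inv_into_f_f)
  \<comment> \<open>Template indices without a piece are sent to free rows; \<open>N2\<close>
    guarantees enough room.\<close>
  obtain k where k: "inj_on k ({..<N} \<times> {..<2^l'})" "k ` ({..<N} \<times> {..<2^l'}) \<subseteq> {..<sz m W'}"
     "\<And>x. x \<in> ix ` AA \<Longrightarrow> k x = (cell \<circ> inv_into AA ix) x"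
    using inj_on_extend[OF _ _ isub inj' im'] N2 by (auto simp: card_cartesian_product)
  define h where "h t u = k (t,u)" for t u
  have heq: "(\<lambda>(t,u). h t u) = k" by (auto simp: h_def)
  show thesis
  proof (rule that[of h bl])
    show "inj_on (\<lambda>(t,u). h t u) ({..<N} \<times> {..<2^l'})" "(\<lambda>(t,u). h t u) ` ({..<N} \<times> {..<2^l'}) \<subseteq> {..<sz m W'}"
      unfolding heq using k by auto
    show "bl W (t * q W + r) = bl W2 (t2 * q W2 + r2) \<longleftrightarrow> t = t2 \<and> W = W2 \<and> r = r2"
      if "t < N" "W \<in> F" "r < q W" "t2 < N" "W2 \<in> F" "r2 < q W2" for t W r t2 W2 r2 using bleq that by blast
    have "AA = (SIGMA t:{..<N}. SIGMA W:F. {..<q W} \<times> {..<mm W} \<times> {..<2^l})" by (auto simp: AA_def)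
    then have "card AA = N * (\<Sum>W\<in>F. q W * (mm W * 2^l))" using F(1) by (simp add: card_SigmaI card_cartesian_product)
    then show "card ((\<lambda>(t,W,r,s,i). bl W (t * q W + r) + g W s i) ` {(t,W,r,s,i). t < N \<and> W \<in> F \<and> r < q W \<and> s < mm W \<and> i < (2::nat)^l}) =
        N * (\<Sum>W\<in>F. q W * (mm W * 2^l))"
      using card_image[OF cinj] unfolding cell_def AA_def by simp
    fix t W r s i assume h: "t < N" "W \<in> F" "r < q W" "s < mm W" "i < (2::nat)^l"
    then have a: "(t,W,r,s,i) \<in> AA" by (auto simp: AA_def)
    have "h t (sg (W,r,s) * 2^l + i) = k (ix (t,W,r,s,i))" by (simp add: h_def ix_def)
    also have "\<dots> = cell (t,W,r,s,i)" using k(3)[OF imageI[OF a]] inv_into_f_f[OF iinj a] by simp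
    finally have 1: "h t (sg (W,r,s) * 2^l + i) = bl W (t * q W + r) + g W s i" by (simp add: cell_def)
    have 2: "sg (W,r,s) * 2^l + i < 2^l'" using isub imageI[OF a, of ix] by (auto simp: ix_def)
    show "h t (sg (W,r,s) * 2^l + i) = bl W (t * q W + r) + g W s i \<and> sg (W,r,s) * 2^l + i < 2^l' \<and>
        bl W (t * q W + r) + g W s i < sz m W' \<and> st n m W' (bl W (t * q W + r) + g W s i) = bl W (t * q W + r) \<and>
        ty n m W' (bl W (t * q W + r)) = W"
      using 1 2 cb[OF a] blB[OF h(2) lt[OF h(1,3)]] by (auto simp: cell_def)
  qed
qed

end

lemma has_sum_finite_sum:
  fixes f :: "'i \<Rightarrow> 'a \<Rightarrow> real"
  assumes "finite F" "\<And>i. i \<in> F \<Longrightarrow> (f i has_sum g i) A"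
  shows "((\<lambda>x. \<Sum>i\<in>F. f i x) has_sum (\<Sum>i\<in>F. g i)) A"
  using assms by (induction F rule: finite_induct) (auto intro!: has_sum_add)

context ergodic_tower_system
begin

lemma wt_summable: "wt summable_on V m"
  using wsummable[of m "\<lambda>_. 1" 1] sz_pos[of _ m] by (simp add: Suc_leI)

text \<open>Blocks of level n are packed into templates of size 2^l', each template containing the level-n
  towers with multiplicities proportional to their weights; ergodicity guarantees that most towers
  of a high level m can be filled by such templates up to a small proportion.\<close>

lemma next_stage:
  assumes pl: "place n l mm g" and e: "1 - e \<le> pwt n l mm" and z: "0 < z" "z \<le> 1"
  obtains m l' mm' g' where "n < m" "l < l'" "place m l' mm' g'" "1 - z \<le> pwt m l' mm'"
    "\<And>A. A \<in> carrier_mat (2^l) (2^l) \<Longrightarrow>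
      trk m (\<lambda>W. phi m l' mm' g' (blk (2^l') (mlab l) (\<lambda>_. A)) W + (-1) \<cdot>\<^sub>m tj n m (phi n l mm g A) W) \<le> 2 * (e + 2 * z)"
    "\<And>x. x \<in> TC n \<Longrightarrow> \<exists>B\<in>carrier_mat (2^l') (2^l').
      trk m (\<lambda>W. phi m l' mm' g' B W + (-1) \<cdot>\<^sub>m tj n m x W) \<le> 2 * (e + 2 * z)"
proof -
  let ?f = "\<lambda>W. wt W * (real (mm W) * 2^l)"
  \<comment> \<open>Only finitely many towers can be served by one template; the omitted ones cover
    measure at most z/2.\<close>
  obtain F where F: "finite F" "F \<subseteq> V n" and dF: "dist (sum ?f F) (pwt n l mm) \<le> z/2"
    using infsum_finite_approximation[OF pwt_summable[OF pl], of "z/2"] z unfolding pwt_def by auto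
  have sF: "1 - e - z/2 \<le> sum ?f F" using dF e unfolding dist_real_def by linarith
  have sF1: "sum ?f F \<le> 1"
  proof -
    have "sum ?f F \<le> pwt n l mm" unfolding pwt_def
      by (rule finite_sum_le_infsum[OF pwt_summable[OF pl] F]) (auto simp: less_imp_le[OF wt_pos])
    then show ?thesis using pwt_le_1[OF pl] by simp
  qed
  define c where "c = (\<Sum>W\<in>F. real (mm W) * 2^l)"
  have c0: "0 \<le> c" by (auto simp: c_def intro: sum_nonneg)
  \<comment> \<open>\<open>c\<close> bounds the number of template rows lost by rounding the
    multiplicities down; a template of size 2^l' makes this at most a fraction z/2.\<close>
  obtain k where k: "2 * c / z < 2^k" using real_arch_pow[of 2 "2 * c / z"] by auto
  define l' where "l' = max k (Suc l)"
  have ll: "l < l'" by (simp add: l'_def)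
  have "2 * c / z < 2^l'" using less_le_trans[OF k power_increasing[of k l' "2::real"]] by (simp add: l'_def)
  then have cl: "c / 2^l' \<le> z/2" using z by (simp add: field_simps)
  \<comment> \<open>The weight of \<open>W\<close> is the expected density of its copies, so a
    template of length 2^l' should contain about 2^l' * wt W of them.\<close>
  define q where "q W = nat \<lfloor>2^l' * wt W\<rfloor>" for W
  have q1: "real (q W) \<le> 2^l' * wt W" and q2: "2^l' * wt W - 1 \<le> real (q W)" if "W \<in> F" for W
  proof -
    have "0 \<le> 2^l' * wt W" using wt_pos[of W n] F that by (simp add: less_imp_le subset_iff)
    then show "real (q W) \<le> 2^l' * wt W" unfolding q_def by (simp add: of_nat_floor)
    show "2^l' * wt W - 1 \<le> real (q W)" unfolding q_def using \<open>0 \<le> 2^l' * wt W\<close> by linarith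
  qed
  define cc where "cc = (\<Sum>W\<in>F. q W * (mm W * 2^l))"
  have cc_up: "real cc \<le> 2^l'"
  proof -
    have "real cc = (\<Sum>W\<in>F. real (q W) * (real (mm W) * 2^l))" by (simp add: cc_def)
    also have "\<dots> \<le> (\<Sum>W\<in>F. 2^l' * wt W * (real (mm W) * 2^l))" by (intro sum_mono mult_right_mono q1) auto
    also have "\<dots> = 2^l' * sum ?f F" by (simp add: sum_distrib_left mult_ac)
    also have "\<dots> \<le> 2^l' * 1" using sF1 by (intro mult_left_mono) auto
    finally show ?thesis by simp
  qed
  \<comment> \<open>The filled fraction of a template. It misses 1 by at most e + z: e from the
    given placement, z/2 from truncation to \<open>F\<close>, z/2 from rounding.\<close>
  define kap where "kap = real cc / 2^l'"
  have kap1: "kap \<le> 1" using cc_up by (simp add: kap_def divide_le_eq)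
  have kap0: "1 - e - z \<le> kap"
  proof -
    have "2^l' * sum ?f F - c = (\<Sum>W\<in>F. (2^l' * wt W - 1) * (real (mm W) * 2^l))"
      unfolding c_def sum_distrib_left sum_subtractf[symmetric] by (rule sum.cong) (auto simp: algebra_simps)
    also have "\<dots> \<le> (\<Sum>W\<in>F. real (q W) * (real (mm W) * 2^l))" by (intro sum_mono mult_right_mono q2) auto
    also have "\<dots> = real cc" by (simp add: cc_def)
    finally have "(2^l' * sum ?f F - c) / 2^l' \<le> kap" unfolding kap_def by (rule divide_right_mono) simp
    then have "sum ?f F - c / 2^l' \<le> kap" by (simp add: diff_divide_distrib)
    then show ?thesis using sF cl by linarith
  qed
  \<comment> \<open>The pieces of size 2^l that one template must hold. They fit into its aligned
    slots of that size, so doubling a matrix from 2^l to 2^l' puts one copy of it into each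
    slot.\<close>
  define SS where "SS = {(W,r,s). W \<in> F \<and> r < q W \<and> s < mm W}"
  have SS: "SS = (SIGMA W:F. {..<q W} \<times> {..<mm W})" by (auto simp: SS_def)
  have "card SS = (\<Sum>W\<in>F. q W * mm W)" unfolding SS using F(1) by (simp add: card_SigmaI card_cartesian_product)
  then have "card SS * 2^l = cc" unfolding cc_def by (simp only: sum_distrib_right mult.assoc)
  moreover have "real cc \<le> real (2^l')" using cc_up by simp
  then have "cc \<le> 2^(l'-l) * 2^l" unfolding of_nat_le_iff using ll by (simp flip: power_add)
  ultimately have "card SS * 2^l \<le> 2^(l'-l) * 2^l" by simp
  then have "card SS \<le> 2^(l'-l)" by simp
  moreover have finSS: "finite SS" unfolding SS using F(1) by auto
  ultimately obtain sg where sg: "sg ` SS \<subseteq> {..<(2::nat)^(l'-l)}" "inj_on sg SS"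
    using inj_on_iff_card_le[of SS "{..<(2::nat)^(l'-l)}"] by auto
  define del where "del = z/2"
  have del: "0 < del" "del < 1" using z by (auto simp: del_def)
  define dv where "dv m W = (\<Sum>\<^sub>\<infinity>W'\<in>V m. wt W' * max 0 (wt W * real (sz m W') - real (cnt n m W W')))" for m W
  \<comment> \<open>The first sum bounds the measure covered by towers with too few copies, by
    Markov's inequality; the second is the loss of at most 2^l' rows per tower. The level
    \<open>m\<close> makes both together less than z/2.\<close>
  have "(\<lambda>m. (\<Sum>W\<in>F. dv m W / (del * wt W)) + 2^l' * (\<Sum>\<^sub>\<infinity>W\<in>V m. wt W)) \<longlonglongrightarrow> (\<Sum>W\<in>F. 0 / (del * wt W)) + 2^l' * 0"
  proof (intro tendsto_intros small)
    fix W assume W: "W \<in> F"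
    then have Wn: "W \<in> V n" using F(2) by blast
    show "del * wt W \<noteq> 0" using del wt_pos[OF Wn] by simp
    show "(\<lambda>m. dv m W) \<longlonglongrightarrow> 0" unfolding dv_def by (rule deviation[OF Wn])
  qed
  then have "(\<lambda>m. (\<Sum>W\<in>F. dv m W / (del * wt W)) + 2^l' * (\<Sum>\<^sub>\<infinity>W\<in>V m. wt W)) \<longlonglongrightarrow> 0" by simp
  then have "\<forall>\<^sub>F m in sequentially. (\<Sum>W\<in>F. dv m W / (del * wt W)) + 2^l' * (\<Sum>\<^sub>\<infinity>W\<in>V m. wt W) < z/2"
    by (rule order_tendstoD(2)) (use z in simp)
  then have "\<forall>\<^sub>F m in sequentially. (\<Sum>W\<in>F. dv m W / (del * wt W)) + 2^l' * (\<Sum>\<^sub>\<infinity>W\<in>V m. wt W) < z/2 \<and> n < m"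
    using eventually_gt_at_top[of n] by (rule eventually_conj)
  then obtain m where m: "(\<Sum>W\<in>F. dv m W / (del * wt W)) + 2^l' * (\<Sum>\<^sub>\<infinity>W\<in>V m. wt W) < z/2" "n < m"
    by (auto simp: eventually_sequentially)
  have nm: "n \<le> m" using m by simp
  \<comment> \<open>A tower that is short of copies of some \<open>W\<close> in \<open>F\<close>
    receives no template; a good one is filled up to the fraction 1 - \<open>del\<close> of its
    height, for which its copies suffice.\<close>
  define good where "good W' \<longleftrightarrow> (\<forall>W\<in>F. (1 - del) * wt W * real (sz m W') \<le> real (cnt n m W W'))" for W'
  define N where "N W' = (if good W' then nat \<lfloor>(1 - del) * real (sz m W') / 2^l'\<rfloor> else 0)" for W'
  have Nup: "real (N W') * 2^l' \<le> (1 - del) * real (sz m W')" for W'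
  proof (cases "good W'")
    case True
    have "0 \<le> (1 - del) * real (sz m W') / 2^l'" using del by simp
    then have "real (N W') \<le> (1 - del) * real (sz m W') / 2^l'" using True by (simp add: N_def of_nat_floor)
    then show ?thesis by (simp add: field_simps)
  next
    case False
    then show ?thesis using del by (simp add: N_def)
  qed
  have N2: "N W' * 2^l' \<le> sz m W'" for W'
  proof -
    have "(1 - del) * real (sz m W') \<le> 1 * real (sz m W')" using del by (intro mult_right_mono) auto
    then have "real (N W' * 2^l') \<le> real (sz m W')" using Nup[of W'] by simp
    then show ?thesis by linarith
  qed
  have N1: "N W' * q W \<le> cnt n m W W'" if "W \<in> F" for W W'
  proof (cases "good W'")
    case True
    have "real (N W') * real (q W) \<le> real (N W') * (2^l' * wt W)" by (rule mult_left_mono[OF q1[OF that]]) simp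
    also have "\<dots> = (real (N W') * 2^l') * wt W" by simp
    also have "\<dots> \<le> (1 - del) * real (sz m W') * wt W"
      by (rule mult_right_mono[OF Nup]) (use wt_pos[of W n] F that in \<open>auto simp: less_imp_le subset_iff\<close>)
    also have "\<dots> \<le> real (cnt n m W W')" using True that by (simp add: good_def mult_ac)
    finally show ?thesis by (simp flip: of_nat_mult)
  next
    case False
    then show ?thesis by (simp add: N_def)
  qed
  define PP where "PP W' h bl \<longleftrightarrow> inj_on (\<lambda>(t,u). h t u) ({..<N W'} \<times> {..<2^l'}) \<and> (\<lambda>(t,u). h t u) ` ({..<N W'} \<times> {..<2^l'}) \<subseteq> {..<sz m W'} \<and>
    (\<forall>t W r s i. t < N W' \<longrightarrow> W \<in> F \<longrightarrow> r < q W \<longrightarrow> s < mm W \<longrightarrow> i < 2^l \<longrightarrow>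
        h t (sg (W,r,s) * 2^l + i) = bl W (t * q W + r) + g W s i \<and> sg (W,r,s) * 2^l + i < 2^l' \<and>
        bl W (t * q W + r) + g W s i < sz m W' \<and> st n m W' (bl W (t * q W + r) + g W s i) = bl W (t * q W + r) \<and>
        ty n m W' (bl W (t * q W + r)) = W) \<and>
    (\<forall>t W r t2 W2 r2. t < N W' \<longrightarrow> W \<in> F \<longrightarrow> r < q W \<longrightarrow> t2 < N W' \<longrightarrow> W2 \<in> F \<longrightarrow> r2 < q W2 \<longrightarrow>
        (bl W (t * q W + r) = bl W2 (t2 * q W2 + r2) \<longleftrightarrow> t = t2 \<and> W = W2 \<and> r = r2)) \<and>
    card ((\<lambda>(t,W,r,s,i). bl W (t * q W + r) + g W s i) ` {(t,W,r,s,i). t < N W' \<and> W \<in> F \<and> r < q W \<and> s < mm W \<and> i < (2::nat)^l}) =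
        N W' * cc" for W' and h :: "nat \<Rightarrow> nat \<Rightarrow> nat" and bl :: "'w \<Rightarrow> nat \<Rightarrow> nat"
  have "\<forall>W'\<in>V m. \<exists>hb. PP W' (fst hb) (snd hb)"
  proof
    fix W' assume W': "W' \<in> V m"
    have sg2: "sg (W,r,s) < 2^(l'-l)" if "W \<in> F" "r < q W" "s < mm W" for W r s
      using sg(1) that by (auto simp: SS_def)
    obtain h bl where "PP W' h bl"
    proof (rule one_tower[OF nm W' pl F less_imp_le[OF ll] sg(2)[unfolded SS_def] sg2 N1[of _ W'] N2[of W']])
      fix h bl
      assume a: "inj_on (\<lambda>(t,u). h t u) ({..<N W'} \<times> {..<2^l'})" "(\<lambda>(t,u). h t u) ` ({..<N W'} \<times> {..<2^l'}) \<subseteq> {..<sz m W'}"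
        "\<And>t W r s i. t < N W' \<Longrightarrow> W \<in> F \<Longrightarrow> r < q W \<Longrightarrow> s < mm W \<Longrightarrow> i < 2^l \<Longrightarrow>
        h t (sg (W,r,s) * 2^l + i) = bl W (t * q W + r) + g W s i \<and> sg (W,r,s) * 2^l + i < 2^l' \<and>
        bl W (t * q W + r) + g W s i < sz m W' \<and> st n m W' (bl W (t * q W + r) + g W s i) = bl W (t * q W + r) \<and>
        ty n m W' (bl W (t * q W + r)) = W"
        "\<And>t W r t2 W2 r2. t < N W' \<Longrightarrow> W \<in> F \<Longrightarrow> r < q W \<Longrightarrow> t2 < N W' \<Longrightarrow> W2 \<in> F \<Longrightarrow> r2 < q W2 \<Longrightarrow>
        bl W (t * q W + r) = bl W2 (t2 * q W2 + r2) \<longleftrightarrow> t = t2 \<and> W = W2 \<and> r = r2"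
        "card ((\<lambda>(t,W,r,s,i). bl W (t * q W + r) + g W s i) ` {(t,W,r,s,i). t < N W' \<and> W \<in> F \<and> r < q W \<and> s < mm W \<and> i < (2::nat)^l}) =
        N W' * (\<Sum>W\<in>F. q W * (mm W * 2^l))"
      assume th: "\<And>h bl. PP W' h bl \<Longrightarrow> thesis"
      show thesis
        by (rule th[of h bl], unfold PP_def cc_def, intro conjI allI impI a)
    qed
    then show "\<exists>hb. PP W' (fst hb) (snd hb)" by (intro exI[of _ "(h, bl)"]) simp
  qed
  from bchoice[OF this] obtain hb where hb: "\<forall>W'\<in>V m. PP W' (fst (hb W')) (snd (hb W'))" ..
  define h where "h W' = fst (hb W')" for W'
  define bl where "bl W' = snd (hb W')" for W'
  have PP: "PP W' (h W') (bl W')" if "W' \<in> V m" for W' using hb that by (simp add: h_def bl_def)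
  have inj: "inj_on (\<lambda>(t,u). h W' t u) ({..<N W'} \<times> {..<2^l'})" if "W' \<in> V m" for W'
    by (rule PP[OF that, unfolded PP_def, THEN conjunct1])
  have pl': "place m l' N h" unfolding place_def
    using inj PP[unfolded PP_def, THEN conjunct2, THEN conjunct1] by simp
  have cellp: "h W' t (sg (W,r,s) * 2^l + i) = bl W' W (t * q W + r) + g W s i" "sg (W,r,s) * 2^l + i < 2^l'"
        "bl W' W (t * q W + r) + g W s i < sz m W'" "st n m W' (bl W' W (t * q W + r) + g W s i) = bl W' W (t * q W + r)"
        "ty n m W' (bl W' W (t * q W + r)) = W"
    if "W' \<in> V m" "t < N W'" "W \<in> F" "r < q W" "s < mm W" "i < 2^l" for W' t W r s i
    using PP[OF that(1), unfolded PP_def, THEN conjunct2, THEN conjunct2, THEN conjunct1, rule_format, OF that(2-6)] by blast+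
  have bleq: "bl W' W (t * q W + r) = bl W' W2 (t2 * q W2 + r2) \<longleftrightarrow> t = t2 \<and> W = W2 \<and> r = r2"
    if "W' \<in> V m" "t < N W'" "W \<in> F" "r < q W" "t2 < N W'" "W2 \<in> F" "r2 < q W2" for W' t W r t2 W2 r2
    by (rule PP[OF that(1), unfolded PP_def, THEN conjunct2, THEN conjunct2, THEN conjunct2, THEN conjunct1, rule_format, OF that(2-7)])
  define AA where "AA W' = {(t,W,r,s,i). t < N W' \<and> W \<in> F \<and> r < q W \<and> s < mm W \<and> i < (2::nat)^l}" for W'
  \<comment> \<open>The rows on which the old placement inside copies of level-n towers and the new
    templates agree.\<close>
  define Q where "Q W' = (\<lambda>(t,W,r,s,i). bl W' W (t * q W + r) + g W s i) ` AA W'" for W'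
  have cardQ: "card (Q W') = N W' * cc" if "W' \<in> V m" for W'
    unfolding Q_def AA_def
    by (rule PP[OF that, unfolded PP_def, THEN conjunct2, THEN conjunct2, THEN conjunct2, THEN conjunct2])
  have Qsub: "Q W' \<subseteq> {..<sz m W'}" if "W' \<in> V m" for W'
    using cellp(3)[OF that] by (auto simp: Q_def AA_def)
  have Qcases: "\<exists>t W r s i. t < N W' \<and> W \<in> F \<and> r < q W \<and> s < mm W \<and> i < 2^l \<and> p = bl W' W (t * q W + r) + g W s i"
    if "p \<in> Q W'" for p W'
  proof -
    obtain a where a: "a \<in> AA W'" "p = (case a of (t,W,r,s,i) \<Rightarrow> bl W' W (t * q W + r) + g W s i)"
      using \<open>p \<in> Q W'\<close> unfolding Q_def by (rule imageE)
    obtain t W r s i where "a = (t,W,r,s,i)" by (cases a)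
    with a show ?thesis by (intro exI[of _ t] exI[of _ W] exI[of _ r] exI[of _ s] exI[of _ i]) (simp add: AA_def)
  qed
  have pwt': "1 - z \<le> pwt m l' N"
  proof -
    let ?u = "\<lambda>W' W. max 0 (wt W * real (sz m W') - real (cnt n m W W')) / (del * wt W)"
    \<comment> \<open>In a good tower only \<open>del\<close> of the height and one incomplete
      template are lost. In a bad tower the height itself is at most shortage / (del * wt W) for the
      offending \<open>W\<close>.\<close>
    have pw: "(1 - del) * real (sz m W') \<le> real (N W') * 2^l' + ((\<Sum>W\<in>F. ?u W' W) + 2^l')" for W'
    proof (cases "good W'")
      case True
      have "(1 - del) * real (sz m W') / 2^l' - 1 \<le> real (N W')" using True by (simp add: N_def) linarith
      then have "((1 - del) * real (sz m W') / 2^l' - 1) * 2^l' \<le> real (N W') * 2^l'" by (rule mult_right_mono) simp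
      also have "((1 - del) * real (sz m W') / 2^l' - 1) * 2^l' = (1 - del) * real (sz m W') - 2^l'"
        by (simp add: field_simps)
      finally have "(1 - del) * real (sz m W') - 2^l' \<le> real (N W') * 2^l'" .
      moreover have "0 \<le> (\<Sum>W\<in>F. ?u W' W)"
        by (intro sum_nonneg divide_nonneg_nonneg) (use del wt_pos[of _ n] F in \<open>auto simp: less_imp_le subset_iff\<close>)
      ultimately show ?thesis by linarith
    next
      case False
      then obtain W where W: "W \<in> F" "real (cnt n m W W') < (1 - del) * wt W * real (sz m W')" by (auto simp: good_def not_le)
      have wp: "0 < wt W" using W F wt_pos by blast
      have "del * wt W * real (sz m W') \<le> max 0 (wt W * real (sz m W') - real (cnt n m W W'))"
        using W(2) by (simp add: left_diff_distrib max_def)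
      then have "real (sz m W') \<le> ?u W' W" using wp del by (simp add: field_simps)
      also have "\<dots> \<le> (\<Sum>W\<in>F. ?u W' W)"
        by (rule member_le_sum[OF W(1)]) (use del wt_pos[of _ n] F in \<open>auto simp: less_imp_le subset_iff intro!: divide_nonneg_nonneg\<close>)
      finally have "real (sz m W') \<le> (\<Sum>W\<in>F. ?u W' W)" .
      moreover have "(1 - del) * real (sz m W') \<le> 1 * real (sz m W')" using del by (intro mult_right_mono) auto
      moreover have "(0::real) \<le> 2^l'" "0 \<le> real (N W') * 2^l'" by auto
      ultimately show ?thesis by linarith
    qed
    have s_sz: "(\<lambda>W. wt W * real (sz m W)) summable_on V m" using wsum has_sum_imp_summable by blast
    have s_N: "(\<lambda>W. wt W * (real (N W) * 2^l')) summable_on V m" by (rule pwt_summable[OF pl'])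
    have s_d: "(\<lambda>W'. wt W' * max 0 (wt W * real (sz m W') - real (cnt n m W W'))) summable_on V m" if "W \<in> F" for W
      by (rule wsummable[where K = "wt W"]) (use that F wt_pos[of W n] in \<open>auto simp: less_imp_le subset_iff\<close>)
    have "((\<lambda>W'. \<Sum>W\<in>F. wt W' * max 0 (wt W * real (sz m W') - real (cnt n m W W')) * (1 / (del * wt W))) has_sum
        (\<Sum>W\<in>F. dv m W * (1 / (del * wt W)))) (V m)"
      unfolding dv_def by (intro has_sum_finite_sum has_sum_cmult_left has_sum_infsum s_d F(1))
    then have hs_u: "((\<lambda>W'. wt W' * (\<Sum>W\<in>F. ?u W' W)) has_sum (\<Sum>W\<in>F. dv m W / (del * wt W))) (V m)"
      by (simp add: sum_distrib_left)
    note s_u = has_sum_imp_summable[OF hs_u] and i_u = infsumI[OF hs_u]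
    have s_w: "(\<lambda>W'. wt W' * 2^l') summable_on V m" by (intro summable_on_cmult_left wt_summable)
    have "(1 - del) * 1 = (\<Sum>\<^sub>\<infinity>W'\<in>V m. (1 - del) * (wt W' * real (sz m W')))"
      unfolding infsum_cmult_right' using wsum by (simp add: infsumI)
    also have "\<dots> \<le> (\<Sum>\<^sub>\<infinity>W'\<in>V m. wt W' * (real (N W') * 2^l') + (wt W' * (\<Sum>W\<in>F. ?u W' W) + wt W' * 2^l'))"
    proof (rule infsum_mono)
      show "(\<lambda>W'. (1 - del) * (wt W' * real (sz m W'))) summable_on V m" using s_sz by (rule summable_on_cmult_right)
      show "(\<lambda>W'. wt W' * (real (N W') * 2^l') + (wt W' * (\<Sum>W\<in>F. ?u W' W) + wt W' * 2^l')) summable_on V m"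
        by (intro summable_on_add s_N s_u s_w)
      fix W' assume "W' \<in> V m"
      then have "wt W' * ((1 - del) * real (sz m W')) \<le> wt W' * (real (N W') * 2^l' + ((\<Sum>W\<in>F. ?u W' W) + 2^l'))"
        by (intro mult_left_mono pw less_imp_le[OF wt_pos])
      then show "(1 - del) * (wt W' * real (sz m W')) \<le> wt W' * (real (N W') * 2^l') + (wt W' * (\<Sum>W\<in>F. ?u W' W) + wt W' * 2^l')"
        by (simp only: distrib_left mult_ac)
    qed
    also have "\<dots> = pwt m l' N + ((\<Sum>W\<in>F. dv m W / (del * wt W)) + (\<Sum>\<^sub>\<infinity>W'\<in>V m. wt W') * 2^l')"
      unfolding pwt_def by (subst infsum_add, rule s_N, intro summable_on_add s_u s_w, subst infsum_add, rule s_u, rule s_w)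
         (simp add: i_u infsum_cmult_left')
    finally show ?thesis using m(1) by (simp add: del_def mult.commute)
  qed
  \<comment> \<open>\<open>Q\<close> covers measure \<open>pwt m l' N * kap\<close>, which is at
    least 1 - e - 2 * z; the factor 2 is that of \<open>trk_agree\<close>.\<close>
  have close: "trk m (\<lambda>W. a W + (-1) \<cdot>\<^sub>m b W) \<le> 2 * (e + 2 * z)"
    if a: "a \<in> TC m" and b: "b \<in> TC m"
      and ag: "\<And>W' p p'. W' \<in> V m \<Longrightarrow> p \<in> Q W' \<Longrightarrow> p' \<in> Q W' \<Longrightarrow> a W' $$ (p,p') = b W' $$ (p,p')" for a b
  proof -
    have "trk m (\<lambda>W. a W + (-1) \<cdot>\<^sub>m b W) \<le> 2 * (1 - (\<Sum>\<^sub>\<infinity>W\<in>V m. wt W * real (card (Q W))))"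
      using a b Qsub ag by (rule trk_agree)
    also have "(\<Sum>\<^sub>\<infinity>W\<in>V m. wt W * real (card (Q W))) = (\<Sum>\<^sub>\<infinity>W\<in>V m. (wt W * (real (N W) * 2^l')) * kap)"
      by (rule infsum_cong) (simp add: cardQ kap_def)
    also have "\<dots> = pwt m l' N * kap" unfolding pwt_def by (rule infsum_cmult_left')
    finally have le: "trk m (\<lambda>W. a W + (-1) \<cdot>\<^sub>m b W) \<le> 2 * (1 - pwt m l' N * kap)" .
    have "(1 - pwt m l' N) * kap \<le> (1 - pwt m l' N) * 1"
      using pwt_le_1[OF pl'] kap1 by (intro mult_left_mono) auto
    then have "kap - (1 - pwt m l' N) \<le> pwt m l' N * kap" by (simp add: left_diff_distrib)
    then have "1 - e - 2 * z \<le> pwt m l' N * kap" using kap0 pwt' by linarith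
    then have "2 * (1 - pwt m l' N * kap) \<le> 2 * (e + 2 * z)" by simp
    with le show ?thesis by (rule order_trans)
  qed
  have phi_ix: "phi m l' N h X W' $$ (bl W' W (t * q W + r) + g W s i, bl W' W2 (t2 * q W2 + r2) + g W2 s2 i2) =
      (if t = t2 then X $$ (sg (W,r,s) * 2^l + i, sg (W2,r2,s2) * 2^l + i2) else 0)"
    if v: "W' \<in> V m" "t < N W'" "W \<in> F" "r < q W" "s < mm W" "i < 2^l" "t2 < N W'" "W2 \<in> F" "r2 < q W2" "s2 < mm W2" "i2 < 2^l"
    for X W' t W r s i t2 W2 r2 s2 i2
  proof -
    note c1 = cellp[OF v(1-6)] and c2 = cellp[OF v(1,7-11)]
    have l1: "plab ({..<N W'} \<times> {..<2^l'}) (h W') (bl W' W (t * q W + r) + g W s i) = Some (t, sg (W,r,s) * 2^l + i)"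
      using plab_eq[OF inj[OF v(1)], of t "sg (W,r,s) * 2^l + i"] c1 v by simp
    have l2: "plab ({..<N W'} \<times> {..<2^l'}) (h W') (bl W' W2 (t2 * q W2 + r2) + g W2 s2 i2) = Some (t2, sg (W2,r2,s2) * 2^l + i2)"
      using plab_eq[OF inj[OF v(1)], of t2 "sg (W2,r2,s2) * 2^l + i2"] c2 v by simp
    show ?thesis using v(1) c1(3) c2(3) by (simp add: phi_def blk_index l1 l2)
  qed
  have tj_ix: "tj n m x W' $$ (bl W' W (t * q W + r) + g W s i, bl W' W2 (t2 * q W2 + r2) + g W2 s2 i2) =
      (if t = t2 \<and> W = W2 \<and> r = r2 then x W $$ (g W s i, g W2 s2 i2) else 0)"
    if v: "W' \<in> V m" "t < N W'" "W \<in> F" "r < q W" "s < mm W" "i < 2^l" "t2 < N W'" "W2 \<in> F" "r2 < q W2" "s2 < mm W2" "i2 < 2^l"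
    for x W' t W r s i t2 W2 r2 s2 i2
  proof -
    note c1 = cellp[OF v(1-6)] and c2 = cellp[OF v(1,7-11)]
    show ?thesis unfolding tj_index[OF v(1) c1(3) c2(3)] c1(4) c2(4) c1(5) bleq[OF v(1-4,7-9)] by simp
  qed
  show thesis
  proof (rule that[OF m(2) ll pl' pwt'])
    fix A :: "'k mat" assume A: "A \<in> carrier_mat (2^l) (2^l)"
    show "trk m (\<lambda>W. phi m l' N h (blk (2^l') (mlab l) (\<lambda>_. A)) W + (-1) \<cdot>\<^sub>m tj n m (phi n l mm g A) W) \<le> 2 * (e + 2 * z)"
    proof (rule close[OF phi_C[OF pl'] tj_C])
      fix W' p p' assume W': "W' \<in> V m" and p: "p \<in> Q W'" and p': "p' \<in> Q W'"
      obtain t W r s i where a: "t < N W'" "W \<in> F" "r < q W" "s < mm W" "i < 2^l" "p = bl W' W (t * q W + r) + g W s i"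
        using Qcases[OF p] by blast
      obtain t2 W2 r2 s2 i2 where b: "t2 < N W'" "W2 \<in> F" "r2 < q W2" "s2 < mm W2" "i2 < 2^l" "p' = bl W' W2 (t2 * q W2 + r2) + g W2 s2 i2"
        using Qcases[OF p'] by blast
      have u: "sg (W,r,s) * 2^l + i < 2^l'" "sg (W2,r2,s2) * 2^l + i2 < 2^l'"
        using cellp(2)[OF W' a(1-5)] cellp(2)[OF W' b(1-5)] by auto
      have X: "blk (2^l') (mlab l) (\<lambda>_. A) $$ (sg (W,r,s) * 2^l + i, sg (W2,r2,s2) * 2^l + i2) =
          (if sg (W,r,s) = sg (W2,r2,s2) then A $$ (i,i2) else 0)"
        using u a(5) b(5) by (simp add: blk_index mlab_def)
      \<comment> \<open>\<open>sg\<close> is injective, so two template indices lie in the same slot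
        exactly if they come from the same piece of the same copy. On \<open>Q\<close> both matrices
        then show the same entry of \<open>A\<close>, or zero.\<close>
      have sgeq: "sg (W,r,s) = sg (W2,r2,s2) \<longleftrightarrow> W = W2 \<and> r = r2 \<and> s = s2"
        using inj_onD[OF sg(2), of "(W,r,s)" "(W2,r2,s2)"] a b by (auto simp: SS_def)
      have Y: "phi n l mm g A W $$ (g W s i, g W s2 i2) = (if s = s2 then A $$ (i,i2) else 0)" if "W = W2"
      proof -
        have WV: "W \<in> V n" using a F by blast
        have ij: "inj_on (\<lambda>(s,i). g W s i) ({..<mm W} \<times> {..<2^l})" and rg: "(\<lambda>(s,i). g W s i) ` ({..<mm W} \<times> {..<2^l}) \<subseteq> {..<sz n W}"
          using pl WV by (auto simp: place_def)
        have d: "(s,i) \<in> {..<mm W} \<times> {..<2^l}" "(s2,i2) \<in> {..<mm W} \<times> {..<2^l}" using a b that by auto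
        have "g W s i < sz n W" "g W s2 i2 < sz n W" using rg d by auto
        then show ?thesis using WV plab_eq[OF ij d(1)] plab_eq[OF ij d(2)] by (simp add: phi_def blk_index)
      qed
      show "phi m l' N h (blk (2^l') (mlab l) (\<lambda>_. A)) W' $$ (p,p') = tj n m (phi n l mm g A) W' $$ (p,p')"
        unfolding a(6) b(6) phi_ix[OF W' a(1-5) b(1-5)] tj_ix[OF W' a(1-5) b(1-5)] X sgeq using Y by auto
    qed
  next
    fix x assume x: "x \<in> TC n"
    define dec where "dec v = (if v \<in> sg ` SS then Some (inv_into SS sg v) else None)" for v
    have dec: "dec (sg (W,r,s)) = Some (W,r,s)" if "W \<in> F" "r < q W" "s < mm W" for W r s
    proof -
      have "(W,r,s) \<in> SS" using that by (simp add: SS_def)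
      then show ?thesis using inv_into_f_f[OF sg(2)] by (simp add: dec_def)
    qed
    \<comment> \<open>The template matrix that imitates \<open>x\<close>: for each copy of
      \<open>W\<close> it carries the compression of \<open>x W\<close> to the rows covered by the
      placement \<open>g\<close>. \<open>dec\<close> reads off which piece a slot holds.\<close>
    define B where "B = mat (2^l') (2^l') (\<lambda>(u,u'). case dec (u div 2^l) of None \<Rightarrow> 0 | Some (W,r,s) \<Rightarrow>
       (case dec (u' div 2^l) of None \<Rightarrow> 0 | Some (W2,r2,s2) \<Rightarrow>
          if W = W2 \<and> r = r2 then x W $$ (g W s (u mod 2^l), g W2 s2 (u' mod 2^l)) else 0))"
    have B: "B \<in> carrier_mat (2^l') (2^l')" by (simp add: B_def)
    have "trk m (\<lambda>W. phi m l' N h B W + (-1) \<cdot>\<^sub>m tj n m x W) \<le> 2 * (e + 2 * z)"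
    proof (rule close[OF phi_C[OF pl'] tj_C])
      fix W' p p' assume W': "W' \<in> V m" and p: "p \<in> Q W'" and p': "p' \<in> Q W'"
      obtain t W r s i where a: "t < N W'" "W \<in> F" "r < q W" "s < mm W" "i < 2^l" "p = bl W' W (t * q W + r) + g W s i"
        using Qcases[OF p] by blast
      obtain t2 W2 r2 s2 i2 where b: "t2 < N W'" "W2 \<in> F" "r2 < q W2" "s2 < mm W2" "i2 < 2^l" "p' = bl W' W2 (t2 * q W2 + r2) + g W2 s2 i2"
        using Qcases[OF p'] by blast
      have u: "sg (W,r,s) * 2^l + i < 2^l'" "sg (W2,r2,s2) * 2^l + i2 < 2^l'"
        using cellp(2)[OF W' a(1-5)] cellp(2)[OF W' b(1-5)] by auto
      have X: "B $$ (sg (W,r,s) * 2^l + i, sg (W2,r2,s2) * 2^l + i2) =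
          (if W = W2 \<and> r = r2 then x W $$ (g W s i, g W2 s2 i2) else 0)"
        using u a(5) b(5) dec[OF a(2-4)] dec[OF b(2-4)] by (simp add: B_def)
      show "phi m l' N h B W' $$ (p,p') = tj n m x W' $$ (p,p')"
        unfolding a(6) b(6) phi_ix[OF W' a(1-5) b(1-5)] tj_ix[OF W' a(1-5) b(1-5)] X by auto
    qed
    then show "\<exists>B\<in>carrier_mat (2^l') (2^l'). trk m (\<lambda>W. phi m l' N h B W + (-1) \<cdot>\<^sub>m tj n m x W) \<le> 2 * (e + 2 * z)"
      using B by blast
  qed
qed

end

section \<open>The intertwining of towers and dyadic matrices\<close>

context ergodic_tower_system
begin

interpretation T: rank_system TC "\<lambda>x y W. x W + y W" "\<lambda>x y W. x W * y W" "\<lambda>c x W. c \<cdot>\<^sub>m x W" tone tzero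
    "\<lambda>x W. ctrans cj (x W)" trk "\<lambda>n. tj n (Suc n)"
  by (rule rank_system_T)

text \<open>The start of the recursion has no error: templates of size 1 fill every row of every
  tower of level 0.\<close>

lemma first_stage: "place 0 0 (sz 0) (\<lambda>W s i. s)" "pwt 0 0 (sz 0) = 1"
proof -
  show "place 0 0 (sz 0) (\<lambda>W s i. s)" by (auto simp: place_def inj_on_def)
  show "pwt 0 0 (sz 0) = 1" using infsumI[OF wsum[of 0]] by (simp add: pwt_def)
qed

text \<open>The image of the unit is the projection onto the labelled rows, which differs from the
  unit only in the uncovered corner.\<close>

lemma phi_one_close:
  assumes pl: "place n l mm g" and e: "1 - e \<le> pwt n l mm"
  shows "trk n (\<lambda>W. phi n l mm g (1\<^sub>m (2^l)) W + (-1) \<cdot>\<^sub>m tone n W) \<le> 2 * e"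
proof -
  let ?lab = "\<lambda>W. plab ({..<mm W} \<times> {..<2^l}) (g W)"
  let ?Q = "\<lambda>W. {p. p < sz n W \<and> ?lab W p \<noteq> None}"
  have cQ: "card (?Q W) = mm W * 2^l" if W: "W \<in> V n" for W
    using card_labelled[OF phi_ok[OF pl W]] plab_blks[of "g W" "mm W" "2^l" "sz n W"] pl W by (simp add: place_def)
  have to: "tone n \<in> TC n" by (auto simp: TC_def tone_def)
  have "trk n (\<lambda>W. phi n l mm g (1\<^sub>m (2^l)) W + (-1) \<cdot>\<^sub>m tone n W) \<le> 2 * (1 - (\<Sum>\<^sub>\<infinity>W\<in>V n. wt W * real (card (?Q W))))"
  proof (rule trk_agree[OF phi_C[OF pl] to])
    fix W p q assume W: "W \<in> V n" and p: "p \<in> ?Q W" and q: "q \<in> ?Q W"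
    obtain b i b' i' where l: "?lab W p = Some (b,i)" "?lab W q = Some (b',i')" using p q by auto
    have "i < 2^l" "i' < 2^l" using plab_Some(1)[OF l(1)] plab_Some(1)[OF l(2)] by auto
    moreover have "p = q \<longleftrightarrow> b = b' \<and> i = i'"
    proof
      assume "p = q" with l show "b = b' \<and> i = i'" by simp
    next
      assume "b = b' \<and> i = i'" with plab_Some(2)[OF l(1)] plab_Some(2)[OF l(2)] show "p = q" by simp
    qed
    ultimately show "phi n l mm g (1\<^sub>m (2^l)) W $$ (p,q) = tone n W $$ (p,q)"
      using W p q l by (auto simp: phi_def tone_def blk_index)
  qed auto
  also have "(\<Sum>\<^sub>\<infinity>W\<in>V n. wt W * real (card (?Q W))) = pwt n l mm"
    unfolding pwt_def by (rule infsum_cong) (simp add: cQ del: not_None_eq)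
  finally show ?thesis using e by simp
qed

theorem tower_completion_iso: "star_kalg_iso (rk_completion T.lim_alg) (MK cj)"
proof -
  interpret M: rank_system "\<lambda>n. carrier_mat (2^n) (2^n)" "(+)" "(*)" "(\<cdot>\<^sub>m)" "\<lambda>n. 1\<^sub>m (2^n)" "\<lambda>n. 0\<^sub>m (2^n) (2^n)"
    "ctrans cj" Mrk "\<lambda>_. dbl" by (rule rank_system_M[OF cj])
  \<comment> \<open>\<open>K \<le> n\<close> and \<open>K \<le> l\<close> make the stages cofinal on
    both sides. The defect (1/2)^(K+4), with z = (1/2)^(K+5) in the next step, keeps the error 2 *
    (e + 2 * z) below (1/2)^K.\<close>
  define P where "P K s \<longleftrightarrow> (case s of (n,l,mm,g) \<Rightarrow> place n l mm g \<and> 1 - (1/2)^(K+4) \<le> pwt n l mm \<and> K \<le> n \<and> K \<le> l)"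
    for K :: nat and s
  define Q where "Q K s s' \<longleftrightarrow> (case s of (n,l,mm,g) \<Rightarrow> case s' of (m,l',mm',g') \<Rightarrow> n < m \<and> l < l' \<and>
     (\<forall>A\<in>carrier_mat (2^l) (2^l).
      trk m (\<lambda>W. phi m l' mm' g' (blk (2^l') (mlab l) (\<lambda>_. A)) W + (-1) \<cdot>\<^sub>m tj n m (phi n l mm g A) W) \<le> (1/2)^K) \<and>
     (\<forall>x\<in>TC n. \<exists>B\<in>carrier_mat (2^l') (2^l').
      trk m (\<lambda>W. phi m l' mm' g' B W + (-1) \<cdot>\<^sub>m tj n m x W) \<le> (1/2)^K))" for K :: nat and s s'
  have "\<exists>f. \<forall>K. P K (f K) \<and> Q K (f K) (f (Suc K))"
  proof (rule dependent_nat_choice)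
    show "\<exists>s. P 0 s" using first_stage by (intro exI[of _ "(0, 0, sz 0, \<lambda>W s i. s)"]) (simp add: P_def)
    fix s K assume "P K s"
    moreover obtain n l mm g where s: "s = (n,l,mm,g)" by (cases s)
    ultimately have pl: "place n l mm g" "1 - (1/2)^(K+4) \<le> pwt n l mm" "K \<le> n" "K \<le> l" by (auto simp: P_def)
    have z: "(0::real) < (1/2)^(K+5)" "(1/2::real)^(K+5) \<le> 1" by (auto simp: power_le_one)
    have p4: "(1/2::real)^(K+4) = (1/2)^K / 16" and p5: "(1/2::real)^(K+5) = (1/2)^K / 32"
      by (simp_all add: power_add power_divide)
    have e: "2 * ((1/2::real)^(K+4) + 2 * (1/2)^(K+5)) \<le> (1/2)^K" unfolding p4 p5 by simp
    show "\<exists>s'. P (Suc K) s' \<and> Q K s s'"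
    proof (rule next_stage[OF pl(1,2) z])
      fix m l' mm' g' assume h: "n < m" "l < l'" "place m l' mm' g'" "1 - (1/2)^(K+5) \<le> pwt m l' mm'"
      and h5: "\<And>A. A \<in> carrier_mat (2^l) (2^l) \<Longrightarrow>
        trk m (\<lambda>W. phi m l' mm' g' (blk (2^l') (mlab l) (\<lambda>_. A)) W + (-1) \<cdot>\<^sub>m tj n m (phi n l mm g A) W) \<le> 2 * ((1/2)^(K+4) + 2 * (1/2)^(K+5))"
      and h6: "\<And>x. x \<in> TC n \<Longrightarrow> \<exists>B\<in>carrier_mat (2^l') (2^l').
        trk m (\<lambda>W. phi m l' mm' g' B W + (-1) \<cdot>\<^sub>m tj n m x W) \<le> 2 * ((1/2)^(K+4) + 2 * (1/2)^(K+5))"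
      have "Suc K + 4 = K + 5" by simp
      then have a: "1 - (1/2)^(Suc K + 4) \<le> pwt m l' mm'" using h(4) by (simp only:)
      have "Suc K \<le> m" "Suc K \<le> l'" using h(1,2) pl(3,4) by linarith+
      then have "P (Suc K) (m,l',mm',g')" unfolding P_def prod.case by (intro conjI a h(3))
      moreover have "Q K s (m,l',mm',g')" unfolding Q_def s prod.case
      proof (intro conjI ballI h(1,2))
        show "trk m (\<lambda>W. phi m l' mm' g' (blk (2^l') (mlab l) (\<lambda>_. A)) W + (-1) \<cdot>\<^sub>m tj n m (phi n l mm g A) W) \<le> (1/2)^K"
          if "A \<in> carrier_mat (2^l) (2^l)" for A by (rule order_trans[OF h5[OF that] e])
        fix x assume "x \<in> TC n"
        then obtain B where "B \<in> carrier_mat (2^l') (2^l')"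
          "trk m (\<lambda>W. phi m l' mm' g' B W + (-1) \<cdot>\<^sub>m tj n m x W) \<le> 2 * ((1/2)^(K+4) + 2 * (1/2)^(K+5))" using h6 by blast
        then show "\<exists>B\<in>carrier_mat (2^l') (2^l'). trk m (\<lambda>W. phi m l' mm' g' B W + (-1) \<cdot>\<^sub>m tj n m x W) \<le> (1/2)^K"
          using e by (intro bexI[of _ B] order_trans[OF _ e])
      qed
      ultimately show ?thesis by blast
    qed
  qed
  then obtain f where f: "\<And>K. P K (f K)" "\<And>K. Q K (f K) (f (Suc K))" by blast
  define nn where "nn K = fst (f K)" for K
  define ll where "ll K = fst (snd (f K))" for K
  define ph where "ph K = phi (nn K) (ll K) (fst (snd (snd (f K)))) (snd (snd (snd (f K))))" for K
  have Pf: "place (nn K) (ll K) (fst (snd (snd (f K)))) (snd (snd (snd (f K))))"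
    "1 - (1/2)^(K+4) \<le> pwt (nn K) (ll K) (fst (snd (snd (f K))))" "K \<le> nn K" "K \<le> ll K" for K
    using f(1)[of K] by (auto simp: P_def nn_def ll_def split: prod.splits)
  have q: "nn K < nn (Suc K) \<and> ll K < ll (Suc K) \<and>
     (\<forall>A\<in>carrier_mat (2^ll K) (2^ll K). trk (nn (Suc K)) (\<lambda>W. ph (Suc K) (blk (2^ll (Suc K)) (mlab (ll K)) (\<lambda>_. A)) W +
          (-1) \<cdot>\<^sub>m tj (nn K) (nn (Suc K)) (ph K A) W) \<le> (1/2)^K) \<and>
     (\<forall>x\<in>TC (nn K). \<exists>B\<in>carrier_mat (2^ll (Suc K)) (2^ll (Suc K)).
        trk (nn (Suc K)) (\<lambda>W. ph (Suc K) B W + (-1) \<cdot>\<^sub>m tj (nn K) (nn (Suc K)) x W) \<le> (1/2)^K)" for K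
    using f(2)[of K] unfolding Q_def nn_def ll_def ph_def case_prod_beta .
  note Qf = q[THEN conjunct1] q[THEN conjunct2, THEN conjunct1]
    q[THEN conjunct2, THEN conjunct2, THEN conjunct1, THEN bspec]
    q[THEN conjunct2, THEN conjunct2, THEN conjunct2, THEN bspec]
  note ph_C = phi_C[OF Pf(1), folded ph_def] and ph_hom = phi_hom[OF Pf(1), folded ph_def]
    and ph_rk = phi_rk_approx[OF Pf(1) _ Pf(2), folded ph_def] and ph_one = phi_one_close[OF Pf(1,2), folded ph_def]
  define Dm where "Dm K = {p. p \<in> rcar M.lim_alg \<and> fst p \<le> ll K}" for K
  \<comment> \<open>Elements of the dyadic limit are lifted to the matrix level of stage
    \<open>K\<close> and then placed into its towers.\<close>
  define ps where "ps K p = (nn K, ph K (M.lft (ll K) p))" for K p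
  have lc: "M.lft (ll K) p \<in> carrier_mat (2^ll K) (2^ll K)" if "p \<in> Dm K" for K p
    using that M.lft_C by (auto simp: Dm_def)
  have psc: "ps K p \<in> rcar T.lim_alg" for K p by (simp add: ps_def T.lim_alg_sel ph_C)
  have psc': "(nn K, ph K A) \<in> rcar T.lim_alg" for K A by (simp add: T.lim_alg_sel ph_C)
  interpret MA: rank_alg M.lim_alg by (rule M.rank_alg_lim_alg)
  interpret TA: rank_alg T.lim_alg by (rule T.rank_alg_lim_alg)
  have eq0: "rk_dist T.lim_alg a b = 0" if "a \<in> rcar T.lim_alg" "a = b" for a b using TA.d_refl that by simp
  have dist: "rk_dist T.lim_alg (nn K, x) (nn K, y) = trk (nn K) (\<lambda>W. x W + (-1) \<cdot>\<^sub>m y W)"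
    if "x \<in> TC (nn K)" "y \<in> TC (nn K)" for x y K
    using T.dist_lft[of "(nn K, x)" "(nn K, y)" "nn K"] that by (simp add: T.lim_alg_sel(1))
  have "star_kalg_iso (rk_completion T.lim_alg) (rk_completion M.lim_alg)"
  proof (rule approx_intertwining[where Dm = Dm and ps = ps, OF M.rank_alg_lim_alg T.rank_alg_lim_alg])
    show "Dm K \<subseteq> rcar M.lim_alg" for K by (auto simp: Dm_def)
    show "Dm K \<subseteq> Dm (Suc K)" for K using Qf(2)[of K] by (auto simp: Dm_def)
    show "\<exists>K. x \<in> Dm K" if "x \<in> rcar M.lim_alg" for x using that Pf(4)[of "fst x"] by (auto simp: Dm_def)
    show one: "rone M.lim_alg \<in> Dm K" for K by (auto simp: Dm_def)
    show "radd M.lim_alg x y \<in> Dm K" "rmul M.lim_alg x y \<in> Dm K" if "x \<in> Dm K" "y \<in> Dm K" for K x y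
      using that by (auto simp: Dm_def)
    show "rsmul M.lim_alg c x \<in> Dm K" "rstar M.lim_alg x \<in> Dm K" if "x \<in> Dm K" for K c x
      using that by (auto simp: Dm_def)
    show "ps K x \<in> rcar T.lim_alg" for K x by (rule psc)
    show "rk_dist T.lim_alg (ps K (radd M.lim_alg x y)) (radd T.lim_alg (ps K x) (ps K y)) = 0" if "x \<in> Dm K" "y \<in> Dm K" for K x y
      by (rule eq0[OF psc]) (use ph_hom(1)[OF lc[OF that(1)] lc[OF that(2)]] that in \<open>simp add: ps_def T.lim_alg_sel Dm_def\<close>)
    show "rk_dist T.lim_alg (ps K (rmul M.lim_alg x y)) (rmul T.lim_alg (ps K x) (ps K y)) = 0" if "x \<in> Dm K" "y \<in> Dm K" for K x y
      by (rule eq0[OF psc]) (use ph_hom(2)[OF lc[OF that(1)] lc[OF that(2)]] that in \<open>simp add: ps_def T.lim_alg_sel Dm_def\<close>)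
    show "rk_dist T.lim_alg (ps K (rsmul M.lim_alg c x)) (rsmul T.lim_alg c (ps K x)) = 0" if "x \<in> Dm K" for K c x
      by (rule eq0[OF psc]) (use ph_hom(3)[OF lc[OF that(1)] lc[OF that(1)]] that in \<open>simp add: ps_def T.lim_alg_sel Dm_def\<close>)
    show "rk_dist T.lim_alg (ps K (rstar M.lim_alg x)) (rstar T.lim_alg (ps K x)) = 0" if "x \<in> Dm K" for K x
      by (rule eq0[OF psc]) (use ph_hom(4)[OF lc[OF that(1)] lc[OF that(1)]] that in \<open>simp add: ps_def T.lim_alg_sel Dm_def\<close>)
    show "\<bar>rrk T.lim_alg (ps K x) - rrk M.lim_alg x\<bar> \<le> (1/2)^K" if x: "x \<in> Dm K" for K x
    proof -
      have "rrk M.lim_alg x = Mrk (ll K) (M.lft (ll K) x)" using x M.lft_rk[of x "ll K"] by (simp add: Dm_def M.lim_alg_sel(8))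
      moreover have "rrk T.lim_alg (ps K x) = trk (nn K) (ph K (M.lft (ll K) x))" by (simp add: ps_def T.lim_alg_sel)
      moreover have "(1/2::real)^(K+4) \<le> (1/2)^K" by (rule power_decreasing) auto
      ultimately show ?thesis using ph_rk[OF lc[OF x]] by linarith
    qed
    show "rk_dist T.lim_alg (ps K (rone M.lim_alg)) (rone T.lim_alg) \<le> (1/2)^K" for K
    proof -
      have "rk_dist T.lim_alg (ps K (rone M.lim_alg)) (rone T.lim_alg) = trk (nn K) (\<lambda>W. ph K (1\<^sub>m (2^ll K)) W + (-1) \<cdot>\<^sub>m tone (nn K) W)"
        by (subst T.dist_lft[of _ _ "nn K"]) (use psc' in \<open>auto simp: ps_def\<close>)
      also have "\<dots> \<le> 2 * (1/2)^(K+4)" by (rule ph_one)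
      also have "(1/2::real)^(K+4) = (1/2)^K / 16" by (simp add: power_add power_divide)
      also have "2 * ((1/2::real)^K / 16) \<le> (1/2)^K" by simp
      finally show ?thesis .
    qed
    have lT: "T.lft (nn (Suc K)) (nn K, x) = tj (nn K) (nn (Suc K)) x" if "x \<in> TC (nn K)" for x K
      using lim_lift_tj[OF that] Qf(1)[of K] by simp
    show "rk_dist T.lim_alg (ps K x) (ps (Suc K) x) \<le> (1/2)^K" if x: "x \<in> Dm K" for K x
    proof -
      let ?A = "M.lft (ll K) x"
      have "M.lft (ll (Suc K)) x = M.lft (ll (Suc K)) (ll K, ?A)"
        using lim_lift_lift[of x "ll K" "ll (Suc K)" "\<lambda>_. dbl"] x Qf(2)[of K] by (simp add: Dm_def)
      also have "\<dots> = blk (2^ll (Suc K)) (mlab (ll K)) (\<lambda>_. ?A)"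
        by (rule lim_lift_dbl[OF lc[OF x]]) (use Qf(2)[of K] in simp)
      finally have eq: "M.lft (ll (Suc K)) x = blk (2^ll (Suc K)) (mlab (ll K)) (\<lambda>_. ?A)" .
      have "rk_dist T.lim_alg (ps K x) (ps (Suc K) x) = rk_dist T.lim_alg (ps (Suc K) x) (ps K x)" by (rule TA.d_sym[OF psc psc])
      also have "\<dots> = trk (nn (Suc K)) (\<lambda>W. ph (Suc K) (M.lft (ll (Suc K)) x) W + (-1) \<cdot>\<^sub>m tj (nn K) (nn (Suc K)) (ph K ?A) W)"
        by (subst T.dist_lft[of _ _ "nn (Suc K)"]) (use psc' Qf(1)[of K] lT[OF ph_C] in \<open>auto simp: ps_def\<close>)
      also have "\<dots> \<le> (1/2)^K" unfolding eq by (rule Qf(3)[OF lc[OF x]])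
      finally show ?thesis .
    qed
    show "\<exists>K\<ge>K0. \<exists>x\<in>Dm K. rk_dist T.lim_alg (ps K x) r < e" if r: "r \<in> rcar T.lim_alg" and e: "e > 0" for r K0 and e :: real
    proof -
      obtain k where k: "(1/2::real)^k < e" using real_arch_pow_inv[OF e, of "1/2"] by auto
      define K where "K = max k (max K0 (fst r))"
      have rK: "fst r \<le> nn K" using Pf(3)[of K] by (simp add: K_def)
      have "(1/2::real)^K \<le> (1/2)^k" by (rule power_decreasing) (auto simp: K_def)
      then have Ke: "(1/2::real)^K < e" using k by linarith
      have rC: "T.lft (nn K) r \<in> TC (nn K)" using r rK by simp
      \<comment> \<open>Density: \<open>r\<close>, lifted to the tower level of stage
        \<open>K\<close>, is imitated by a template matrix of the next stage.\<close>
      obtain B where B: "B \<in> carrier_mat (2^ll (Suc K)) (2^ll (Suc K))"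
        "trk (nn (Suc K)) (\<lambda>W. ph (Suc K) B W + (-1) \<cdot>\<^sub>m tj (nn K) (nn (Suc K)) (T.lft (nn K) r) W) \<le> (1/2)^K"
        using Qf(4)[OF rC] by blast
      have l: "tj (nn K) (nn (Suc K)) (T.lft (nn K) r) = T.lft (nn (Suc K)) r"
        using lT[OF rC] lim_lift_lift[of r "nn K" "nn (Suc K)" "\<lambda>n. tj n (Suc n)"] rK Qf(1)[of K] by simp
      have x: "(ll (Suc K), B) \<in> Dm (Suc K)" using B by (simp add: Dm_def M.lim_alg_sel)
      have "rk_dist T.lim_alg (ps (Suc K) (ll (Suc K), B)) r = trk (nn (Suc K)) (\<lambda>W. ph (Suc K) B W + (-1) \<cdot>\<^sub>m T.lft (nn (Suc K)) r W)"
        by (subst T.dist_lft[of _ _ "nn (Suc K)"]) (use psc' Qf(1)[of K] rK r in \<open>auto simp: ps_def\<close>)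
      then have "rk_dist T.lim_alg (ps (Suc K) (ll (Suc K), B)) r < e" using B(2)[unfolded l] Ke by linarith
      then show ?thesis using x by (intro exI[of _ "Suc K"] conjI bexI[of _ "(ll (Suc K), B)"]) (auto simp: K_def)
    qed
  qed
  then show ?thesis unfolding MK_def Minf_eq_lim_alg[OF cj] .
qed

end

context tower_system
begin

interpretation T: rank_system TC "\<lambda>x y W. x W + y W" "\<lambda>x y W. x W * y W" "\<lambda>c x W. c \<cdot>\<^sub>m x W" tone tzero
    "\<lambda>x W. ctrans cj (x W)" trk "\<lambda>n. tj n (Suc n)"
  by (rule rank_system_T)

lemma tower_completion_star_regular:
  assumes pd: "pos_def_inv cj"
  shows "star_regular (rk_completion T.lim_alg)"
proof -
  interpret TA: rank_alg T.lim_alg by (rule T.rank_alg_lim_alg)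
  have "rrk T.lim_alg x \<le> rrk T.lim_alg (rmul T.lim_alg (rstar T.lim_alg x) x)" if x: "x \<in> rcar T.lim_alg" for x
  proof -
    have sx: "snd x \<in> TC (fst x)" using x by (simp add: T.lim_alg_sel)
    have "trk (fst x) (snd x) \<le> trk (fst x) (\<lambda>W. ctrans cj (snd x W) * snd x W)"
      by (rule trk_mono1[OF sx TC_ops(2)[OF TC_ops(4)[OF sx sx] sx]])
         (use mrank_ctrans_mult_self[OF cj pd TC_D(1)[OF sx]] in simp)
    then show ?thesis by (simp add: T.lim_alg_sel)
  qed
  then show ?thesis unfolding star_regular_def
    using TA.Cp_star_ring T.completion_regular TA.Cp_proper by blast
qed

end

text \<open>Countable additivity as an unordered sum, the form in which the sums over towers
  appear.\<close>

lemma (in finite_measure) has_sum_measure_disjoint: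
  assumes I: "countable I" and A: "\<And>i. i \<in> I \<Longrightarrow> A i \<in> sets M"
    and disj: "disjoint_family_on A I"
  shows "((\<lambda>i. measure M (A i)) has_sum measure M (\<Union>i\<in>I. A i)) I"
proof (cases "finite I")
  case True
  then have "measure M (\<Union>i\<in>I. A i) = (\<Sum>i\<in>I. measure M (A i))"
    using A disj by (intro finite_measure_finite_Union) auto
  then show ?thesis using True by (simp add: has_sum_finite)
next
  case False
  let ?f = "from_nat_into I"
  have bij: "bij_betw ?f UNIV I" using bij_betw_from_nat_into[OF I False] .
  have inI: "?f n \<in> I" for n using bij by (auto simp: bij_betw_def)
  have disj': "disjoint_family (\<lambda>n. A (?f n))"
    unfolding disjoint_family_on_def
  proof (intro ballI impI)
    fix m n :: nat assume "m \<noteq> n"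
    then have "?f m \<noteq> ?f n" using bij by (auto simp: bij_betw_def inj_on_def)
    then show "A (?f m) \<inter> A (?f n) = {}" using disj inI by (auto simp: disjoint_family_on_def)
  qed
  have "(\<lambda>n. measure M (A (?f n))) sums measure M (\<Union>n. A (?f n))"
    by (rule finite_measure_UNION[OF _ disj']) (use A inI in auto)
  then have "((\<lambda>n. measure M (A (?f n))) has_sum measure M (\<Union>n. A (?f n))) UNIV"
    by (intro sums_nonneg_imp_has_sum) auto
  moreover have "(\<Union>n. A (?f n)) = (\<Union>i\<in>range ?f. A i)" by auto
  moreover have "range ?f = I" using bij by (simp add: bij_betw_def)
  ultimately show ?thesis using has_sum_reindex_bij_betw[OF bij, of "\<lambda>i. measure M (A i)"] by simp
qed

lemma INFM_shift: "(\<exists>\<^sub>\<infinity>j. Q (Suc j)) \<longleftrightarrow> (\<exists>\<^sub>\<infinity>j. Q j)"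
  unfolding INFM_nat_le
proof (intro iffI allI)
  fix m assume "\<forall>m. \<exists>n\<ge>m. Q (Suc n)"
  then obtain n where "n \<ge> m" "Q (Suc n)" by blast
  then show "\<exists>n\<ge>m. Q n" by (intro exI[of _ "Suc n"]) simp
next
  fix m assume "\<forall>m. \<exists>n\<ge>m. Q n"
  then obtain n where "n \<ge> Suc m" "Q n" by blast
  then show "\<exists>n\<ge>m. Q (Suc n)" by (intro exI[of _ "n - 1"]) simp
qed

section \<open>Cantor systems and ergodic averages\<close>

locale cantor_system =
  fixes T :: "'x::metric_space \<Rightarrow> 'x" and M :: "'x measure" and y :: 'x
    and E :: "nat \<Rightarrow> 'x set" and P :: "nat \<Rightarrow> 'x set set"
  assumes X_compact: "compact (UNIV :: 'x set)"
    and X_infinite: "infinite (UNIV :: 'x set)"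
    and T_homeo: "\<exists>T'. homeomorphism UNIV UNIV T T'"
    and M_borel: "sets M = sets borel"
    and M_prob: "prob_space M"
    and M_full: "\<forall>U. open U \<and> U \<noteq> {} \<longrightarrow> measure M U > 0"
    and M_inv: "\<forall>A\<in>sets borel. measure M (T -` A) = measure M A"
    and M_erg: "\<forall>A\<in>sets borel. T -` A = A \<longrightarrow> measure M A = 0 \<or> measure M A = 1"
    and E_clopen: "\<forall>n. clopen_set (E n)"
    and E_dec: "\<forall>n. E (Suc n) \<subseteq> E n"
    and E_int: "(\<Inter>n. E n) = {y}"
    and P_fin: "\<forall>n. finite (P n)"
    and P_clopen: "\<forall>n. \<forall>Z\<in>P n. Z \<noteq> {} \<and> clopen_set Z"
    and P_disj: "\<forall>n. \<forall>Z\<in>P n. \<forall>Z'\<in>P n. Z \<noteq> Z' \<longrightarrow> Z \<inter> Z' = {}"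
    and P_cover: "\<forall>n. \<Union>(P n) = UNIV - E n"
    and P_refine: "\<forall>n. \<forall>Z\<in>insert (E (Suc n)) (P (Suc n)). \<exists>Z'\<in>insert (E n) (P n). Z \<subseteq> Z'"
    and P_gen: "generate_topology (\<Union>n. insert (E n) (P n)) = open"
begin

sublocale prob_space M by (rule M_prob)

definition Ti :: "'x \<Rightarrow> 'x" where "Ti = Hilbert_Choice.inv T"

lemma T_bij: "bij T"
proof -
  obtain T' where "homeomorphism UNIV UNIV T T'" using T_homeo by blast
  then show ?thesis unfolding homeomorphism_def by (metis UNIV_I bijI' )
qed

lemma Ti_T [simp]: "Ti (T x) = x" and T_Ti [simp]: "T (Ti x) = x"
  using T_bij by (auto simp: Ti_def bij_def inv_f_f surj_f_inv_f)

lemma T_cont: "continuous_on UNIV T" and Ti_cont: "continuous_on UNIV Ti"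
proof -
  obtain T' where T': "homeomorphism UNIV UNIV T T'" using T_homeo by blast
  then show "continuous_on UNIV T" by (simp add: homeomorphism_def)
  have "T' (T x) = x" for x using T' by (simp add: homeomorphism_def)
  then have "T' x = Ti x" for x by (metis T_Ti)
  then have "T' = Ti" by auto
  then show "continuous_on UNIV Ti" using T' by (simp add: homeomorphism_def)
qed

lemma Tp_Tip [simp]: "(T ^^ j) ((Ti ^^ j) x) = x" "(Ti ^^ j) ((T ^^ j) x) = x"
proof -
  show "(T ^^ j) ((Ti ^^ j) x) = x" by (induction j arbitrary: x) (auto simp: funpow_swap1)
  show "(Ti ^^ j) ((T ^^ j) x) = x" by (induction j arbitrary: x) (auto simp: funpow_swap1)
qed

lemma funpow_cont: "continuous_on UNIV f \<Longrightarrow> continuous_on UNIV ((f :: 'x \<Rightarrow> 'x) ^^ j)"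
proof (induction j)
  case (Suc j)
  then have "continuous_on UNIV (f \<circ> (f ^^ j))" by (intro continuous_on_compose) (auto intro: continuous_on_subset)
  then show ?case by simp
qed (simp add: id_def)

lemma Tp_image: "(T ^^ j) ` A = (Ti ^^ j) -` A"
  by (auto simp: image_iff) (metis Tp_Tip(1))

lemma clopen_sets [intro]: "clopen_set A \<Longrightarrow> A \<in> sets M"
  unfolding clopen_set_def M_borel by auto

lemma Tp_commute: "(T ^^ i) ((T ^^ j) x) = (T ^^ j) ((T ^^ i) x)"
  by (metis add.commute comp_apply funpow_add)

lemma Tm: "T \<in> measurable M M" and Tim: "Ti \<in> measurable M M"
  using borel_measurable_continuous_onI[OF T_cont] borel_measurable_continuous_onI[OF Ti_cont] measurable_cong_sets[OF M_borel M_borel] by auto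

lemma space_M [simp]: "space M = UNIV"
  using sets_eq_imp_space_eq[OF M_borel] by simp

lemma prob_UNIV [simp]: "measure M UNIV = 1"
  using prob_space by simp

lemma Tpm: "(T ^^ j) \<in> measurable M M"
  by (induction j) (use Tm in \<open>auto intro: measurable_comp\<close>)

lemma vimage_sets: "A \<in> sets M \<Longrightarrow> T -` A \<in> sets M" "A \<in> sets M \<Longrightarrow> (T ^^ j) -` A \<in> sets M" "A \<in> sets M \<Longrightarrow> (T ^^ j) ` A \<in> sets M"
proof -
  show "A \<in> sets M \<Longrightarrow> T -` A \<in> sets M" using measurable_sets[OF Tm] by auto
  show "A \<in> sets M \<Longrightarrow> (T ^^ j) -` A \<in> sets M" using measurable_sets[OF Tpm] by auto
  have m: "(Ti ^^ j) \<in> measurable M M" by (induction j) (use Tim in \<open>auto intro: measurable_comp\<close>)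
  show "A \<in> sets M \<Longrightarrow> (T ^^ j) ` A \<in> sets M" unfolding Tp_image using measurable_sets[OF m, of A] by simp
qed

lemma measure_vimage: "A \<in> sets M \<Longrightarrow> measure M ((T ^^ j) -` A) = measure M A"
proof (induction j arbitrary: A)
  case (Suc j)
  have "(T ^^ Suc j) -` A = (T ^^ j) -` (T -` A)" by (auto simp: funpow_swap1)
  then show ?case using Suc M_inv M_borel vimage_sets(1) by metis
qed simp

lemma measure_image: "A \<in> sets M \<Longrightarrow> measure M ((T ^^ j) ` A) = measure M A"
proof -
  assume A: "A \<in> sets M"
  have "(T ^^ j) -` ((T ^^ j) ` A) = A" by (auto simp: image_iff) (metis Tp_Tip(2))
  then show ?thesis using measure_vimage[OF vimage_sets(3)[OF A], of j j] by simp
qed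

lemma erg: "A \<in> sets M \<Longrightarrow> T -` A = A \<Longrightarrow> measure M A = 0 \<or> measure M A = 1"
  using M_erg M_borel by auto

lemma distr_T: "distr M M T = M"
proof (rule measure_eqI)
  fix A assume "A \<in> sets (distr M M T)"
  then have A: "A \<in> sets M" by simp
  then have "emeasure (distr M M T) A = emeasure M (T -` A)" using Tm by (simp add: emeasure_distr)
  also have "\<dots> = emeasure M A" using A M_inv M_borel by (simp add: emeasure_eq_measure)
  finally show "emeasure (distr M M T) A = emeasure M A" .
qed simp

lemma integral_T:
  assumes "f \<in> borel_measurable M" shows "(\<integral>x. f (T x) \<partial>M) = (\<integral>x. (f x :: real) \<partial>M)"
  using integral_distr[OF Tm assms] by (simp add: distr_T)

lemma integral_Tp:
  assumes f: "f \<in> borel_measurable M" shows "(\<integral>x. f ((T ^^ j) x) \<partial>M) = (\<integral>x. (f x :: real) \<partial>M)"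
proof (induction j)
  case (Suc j)
  have "(\<lambda>x. f ((T ^^ j) x)) \<in> borel_measurable M" using measurable_compose[OF Tpm f] .
  from integral_T[OF this] Suc show ?case by (simp add: funpow_swap1)
qed simp

text \<open>Each set of positive measure is visited infinitely often, forwards and backwards, by almost
  every point: the corresponding limsup set is T-invariant and not null.\<close>

lemma infinite_visits:
  fixes F :: "nat \<Rightarrow> 'x set"
  assumes F: "\<And>j. F j \<in> sets M" "\<And>j. measure M (F j) = a" and a: "0 < a"
    and invar: "T -` {x. \<exists>\<^sub>\<infinity>j. x \<in> F j} = {x. \<exists>\<^sub>\<infinity>j. x \<in> F j}"
  shows "AE x in M. \<exists>\<^sub>\<infinity>j. x \<in> F j"
proof -
  define A where "A N = (\<Union>j\<in>{N..}. F j)" for N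
  have A: "A N \<in> sets M" for N unfolding A_def using F by auto
  have dec: "decseq A" unfolding A_def decseq_def by (auto intro: order_trans)
  have eq: "{x. \<exists>\<^sub>\<infinity>j. x \<in> F j} = (\<Inter>N. A N)"
    by (auto simp: A_def INFM_nat_le)
  have "(\<lambda>N. measure M (A N)) \<longlonglongrightarrow> measure M (\<Inter>N. A N)"
    by (rule finite_Lim_measure_decseq) (use A dec in auto)
  moreover have "a \<le> measure M (A N)" for N
    using finite_measure_mono[of "F N" "A N"] F A by (auto simp: A_def)
  ultimately have "a \<le> measure M (\<Inter>N. A N)" by (intro LIMSEQ_le_const) auto
  then have "measure M {x. \<exists>\<^sub>\<infinity>j. x \<in> F j} \<noteq> 0" using a eq by simp
  moreover have m: "{x. \<exists>\<^sub>\<infinity>j. x \<in> F j} \<in> sets M" unfolding eq using A by auto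
  ultimately have "measure M {x. \<exists>\<^sub>\<infinity>j. x \<in> F j} = 1" using erg[OF m invar] by simp
  then show ?thesis using prob_eq_1[OF m] by auto
qed

lemma AE_visits:
  assumes A: "A \<in> sets M" "0 < measure M A"
  shows "AE x in M. (\<exists>\<^sub>\<infinity>j. (T ^^ j) x \<in> A) \<and> (\<exists>\<^sub>\<infinity>j. (Ti ^^ j) x \<in> A)"
proof -
  have "AE x in M. \<exists>\<^sub>\<infinity>j. x \<in> (T ^^ j) -` A"
  proof (rule infinite_visits)
    show "T -` {x. \<exists>\<^sub>\<infinity>j. x \<in> (T ^^ j) -` A} = {x. \<exists>\<^sub>\<infinity>j. x \<in> (T ^^ j) -` A}"
    proof -
      have "(\<exists>\<^sub>\<infinity>j. (T ^^ j) (T x) \<in> A) \<longleftrightarrow> (\<exists>\<^sub>\<infinity>j. (T ^^ j) x \<in> A)" for x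
        using INFM_shift[of "\<lambda>j. (T ^^ j) x \<in> A"] by (simp add: funpow_swap1)
      then show ?thesis by auto
    qed
  qed (use A vimage_sets measure_vimage in auto)
  moreover have "AE x in M. \<exists>\<^sub>\<infinity>j. x \<in> (T ^^ j) ` A"
  proof (rule infinite_visits)
    show "T -` {x. \<exists>\<^sub>\<infinity>j. x \<in> (T ^^ j) ` A} = {x. \<exists>\<^sub>\<infinity>j. x \<in> (T ^^ j) ` A}"
    proof -
      have "(\<exists>\<^sub>\<infinity>j. (Ti ^^ j) x \<in> A) \<longleftrightarrow> (\<exists>\<^sub>\<infinity>j. (Ti ^^ j) (T x) \<in> A)" for x
        using INFM_shift[of "\<lambda>j. (Ti ^^ j) (T x) \<in> A"] by (simp add: funpow_swap1)
      then show ?thesis unfolding Tp_image by auto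
    qed
  qed (use A vimage_sets measure_image in auto)
  ultimately show ?thesis by eventually_elim (simp add: Tp_image)
qed

text \<open>\<open>maxsum f n x\<close> is the maximum of the partial sums \<open>bsum f j x\<close>
  for j from 1 to n + 1. The recursive form is the one needed for Garsia's comparison of x with T
  x.\<close>

fun maxsum :: "('x \<Rightarrow> real) \<Rightarrow> nat \<Rightarrow> 'x \<Rightarrow> real" where
  "maxsum f 0 x = f x"
| "maxsum f (Suc n) x = f x + max 0 (maxsum f n (T x))"

definition bsum :: "('x \<Rightarrow> real) \<Rightarrow> nat \<Rightarrow> 'x \<Rightarrow> real" where
  "bsum f n x = (\<Sum>i<n. f ((T ^^ i) x))"

lemma bsum_Suc: "bsum f (Suc n) x = f x + bsum f n (T x)"
  unfolding bsum_def by (subst sum.lessThan_Suc_shift) (simp add: funpow_swap1)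

lemma bsum_le_maxsum: "bsum f (Suc n) x \<le> maxsum f n x"
proof (induction n arbitrary: x)
  case 0 then show ?case by (simp add: bsum_def)
next
  case (Suc n)
  have "bsum f (Suc (Suc n)) x = f x + bsum f (Suc n) (T x)" by (rule bsum_Suc)
  then show ?case using Suc[of "T x"] by simp
qed

lemma maxsum_mono: "maxsum f n x \<le> maxsum f (Suc n) x"
proof (induction n arbitrary: x)
  case (Suc n)
  show ?case unfolding maxsum.simps(2)[of f n x] maxsum.simps(2)[of f "Suc n" x]
    by (intro add_left_mono max.mono order_refl Suc)
qed simp

lemma maxsum_measurable [measurable]: "f \<in> borel_measurable M \<Longrightarrow> maxsum f n \<in> borel_measurable M"
proof (induction n)
  case 0
  have "maxsum f 0 = f" by (rule ext) simp
  then show ?case using 0 by simp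
next
  case (Suc n)
  then have "(\<lambda>x. maxsum f n (T x)) \<in> borel_measurable M" using measurable_compose[OF Tm] by blast
  moreover have "maxsum f (Suc n) = (\<lambda>x. f x + max 0 (maxsum f n (T x)))" by (rule ext) simp
  ultimately show ?case using Suc.prems by simp
qed

lemma maxsum_bound: "(\<And>x. \<bar>f x\<bar> \<le> B) \<Longrightarrow> \<bar>maxsum f n x\<bar> \<le> (real n + 1) * B"
proof (induction n arbitrary: x)
  case (Suc n)
  from Suc.IH[OF Suc.prems, of "T x"] Suc.prems[of x] show ?case by (simp add: algebra_simps abs_le_iff max_def)
qed simp

text \<open>Garsia's argument: on the invariant set where the partial sums are unbounded above, the
  function would have nonnegative integral.\<close>

lemma bsum_bounded_above:
  assumes f: "f \<in> borel_measurable M" and bnd: "\<And>x. \<bar>f x\<bar> \<le> B" and neg: "(\<integral>x. f x \<partial>M) < 0"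
  shows "AE x in M. \<exists>C. \<forall>n. bsum f n x \<le> C"
proof -
  let ?m = "maxsum f"
  \<comment> \<open>The set where the maxima are unbounded. Since \<open>f\<close> is bounded,
    passing from x to T x changes them by a bounded amount, which makes it invariant.\<close>
  define A where "A = {x. \<forall>C::nat. \<exists>n. real C < ?m n x}"
  have B0: "0 \<le> B" using bnd[of undefined] by linarith
  have A: "A \<in> sets M"
  proof -
    note [measurable] = maxsum_measurable[OF f]
    have "A = {x \<in> space M. \<forall>C::nat. \<exists>n. real C < ?m n x}" by (auto simp: A_def)
    also have "\<dots> \<in> sets M" by measurable
    finally show ?thesis .
  qed
  have inv: "T -` A = A"
  proof -
    have "T x \<in> A \<longleftrightarrow> x \<in> A" for x
    proof
      assume a: "T x \<in> A"
      show "x \<in> A" unfolding A_def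
      proof (intro CollectI allI)
        fix C :: nat
        obtain C' :: nat where C': "real C + B < real C'" using reals_Archimedean2 by blast
        obtain n where "real C' < ?m n (T x)" using a by (auto simp: A_def)
        then have "real C < ?m (Suc n) x" using bnd[of x] C' by simp
        then show "\<exists>n. real C < ?m n x" by blast
      qed
    next
      assume a: "x \<in> A"
      show "T x \<in> A" unfolding A_def
      proof (intro CollectI allI)
        fix C :: nat
        obtain C' :: nat where C': "real C + B < real C'" using reals_Archimedean2 by blast
        obtain n where n: "real C' < ?m n x" using a by (auto simp: A_def)
        then have "n \<noteq> 0" using bnd[of x] C' by (cases n) auto
        then obtain k where "n = Suc k" by (cases n) auto
        then have "real C < ?m k (T x)" using n bnd[of x] C' by (simp add: max_def split: if_splits)
        then show "\<exists>n. real C < ?m n (T x)" by blast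
      qed
    qed
    then show ?thesis by auto
  qed
  have "measure M A \<noteq> 1"
  proof
    assume "measure M A = 1"
    then have AE: "AE x in M. x \<in> A" using prob_eq_1[OF A] by simp
    \<comment> \<open>\<open>?g n x\<close> is \<open>f x\<close> plus the negative part of
      \<open>?m n (T x)\<close>. On \<open>A\<close> the maxima become positive, so it converges to
      \<open>f\<close>; its integral is nonnegative because T preserves the measure and the maxima
      increase with n.\<close>
    let ?g = "\<lambda>n x. ?m (Suc n) x - ?m n (T x)"
    have int: "integrable M (?m n)" for n
      by (rule integrable_const_bound[where B = "(real n + 1) * B"]) (use maxsum_bound[OF bnd] maxsum_measurable[OF f] in auto)
    have intT: "integrable M (\<lambda>x. ?m n (T x))" for n
      by (rule integrable_const_bound[where B = "(real n + 1) * B"])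
         (use maxsum_bound[OF bnd] measurable_compose[OF Tm maxsum_measurable[OF f]] in auto)
    have lim: "(\<lambda>n. \<integral>x. ?g n x \<partial>M) \<longlonglongrightarrow> (\<integral>x. f x \<partial>M)"
    proof (rule integral_dominated_convergence[where w = "\<lambda>_. 2 * B"])
      show "f \<in> borel_measurable M" by fact
      show "?g n \<in> borel_measurable M" for n
        by (rule borel_measurable_diff[OF maxsum_measurable[OF f] measurable_compose[OF Tm maxsum_measurable[OF f]]])
      show "integrable M (\<lambda>_. 2 * B)" by simp
      show "AE x in M. norm (?g n x) \<le> 2 * B" for n
      proof (rule AE_I2)
        fix x
        have "?m 0 (T x) \<le> ?m n (T x)" by (rule lift_Suc_mono_le[of "\<lambda>n. ?m n (T x)"]) (use maxsum_mono in auto)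
        then show "norm (?g n x) \<le> 2 * B" using bnd[of x] bnd[of "T x"] by (auto simp: max_def abs_le_iff)
      qed
      show "AE x in M. (\<lambda>n. ?g n x) \<longlonglongrightarrow> f x"
        using AE
      proof eventually_elim
        fix x assume "x \<in> A"
        then have "T x \<in> A" using inv by auto
        then obtain n0 where "real 0 < ?m n0 (T x)" unfolding A_def by blast
        then have "0 < ?m n (T x)" if "n \<ge> n0" for n
          using lift_Suc_mono_le[of "\<lambda>n. ?m n (T x)", OF _ that] maxsum_mono by (smt (verit) of_nat_0)
        then have "\<forall>\<^sub>F n in sequentially. ?g n x = f x"
          by (intro eventually_sequentiallyI[of n0]) (simp add: less_imp_le max_absorb2)
        then show "(\<lambda>n. ?g n x) \<longlonglongrightarrow> f x" by (rule tendsto_eventually)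
      qed
    qed
    have "0 \<le> (\<integral>x. ?g n x \<partial>M)" for n
    proof -
      have 1: "(\<integral>x. ?g n x \<partial>M) = (\<integral>x. ?m (Suc n) x \<partial>M) - (\<integral>x. ?m n (T x) \<partial>M)"
        using int[of "Suc n"] intT[of n] by (rule Bochner_Integration.integral_diff)
      have 2: "(\<integral>x. ?m n (T x) \<partial>M) = (\<integral>x. ?m n x \<partial>M)" by (rule integral_T[OF maxsum_measurable[OF f]])
      have 3: "(\<integral>x. ?m n x \<partial>M) \<le> (\<integral>x. ?m (Suc n) x \<partial>M)"
        by (rule integral_mono[OF int int]) (rule maxsum_mono)
      show ?thesis unfolding 1 2 using 3 by (simp only: diff_ge_0_iff_ge)
    qed
    then have "0 \<le> (\<integral>x. f x \<partial>M)" using LIMSEQ_le_const[OF lim] by blast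
    then show False using neg by simp
  qed
  then have "measure M A = 0" using erg[OF A inv] by simp
  then have "AE x in M. x \<notin> A" using A by (simp add: prob_eq_0)
  then show ?thesis
  proof eventually_elim
    fix x assume "x \<notin> A"
    then obtain C :: nat where C: "\<And>n. ?m n x \<le> real C" by (auto simp: A_def not_less)
    show "\<exists>C. \<forall>n. bsum f n x \<le> C"
    proof (intro exI[of _ "real C"] allI)
      fix n show "bsum f n x \<le> real C"
        using bsum_le_maxsum[of f _ x] C by (cases n) (auto simp: bsum_def intro: order_trans)
    qed
  qed
qed

lemma bsum_measurable: "f \<in> borel_measurable M \<Longrightarrow> bsum f n \<in> borel_measurable M"
  unfolding bsum_def using measurable_compose[OF Tpm] by (intro borel_measurable_sum) auto

lemma bsum_bound: "(\<And>x. \<bar>f x\<bar> \<le> B) \<Longrightarrow> \<bar>bsum f n x\<bar> \<le> real n * B"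
proof -
  assume b: "\<And>x. \<bar>f x\<bar> \<le> B"
  have "\<bar>bsum f n x\<bar> \<le> (\<Sum>i<n. \<bar>f ((T ^^ i) x)\<bar>)" unfolding bsum_def by (rule sum_abs)
  also have "\<dots> \<le> (\<Sum>i<n. B)" by (rule sum_mono) (rule b)
  finally show ?thesis by simp
qed

text \<open>Lowering \<open>f\<close> by a small \<open>d\<close> makes its integral negative, so
  its partial sums are bounded above almost everywhere. Divided by n, their positive parts tend to
  zero in the mean; restoring \<open>d\<close> adds at most \<open>d\<close>.\<close>

lemma mean_positive_part_small:
  assumes f: "f \<in> borel_measurable M" and bnd: "\<And>x. \<bar>f x\<bar> \<le> 1" and zero: "(\<integral>x. f x \<partial>M) = 0" and e: "0 < e"
  obtains L where "0 < L" "(\<integral>x. max 0 (bsum f L x) / real L \<partial>M) < e"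
proof -
  \<comment> \<open>At most e/2 so that both errors fit into \<open>e\<close>, and at most 1 so that
    \<open>f - d\<close> is bounded by 2.\<close>
  define d where "d = min (e/2) 1"
  have d: "0 < d" "d \<le> 1" "d \<le> e/2" using e by (auto simp: d_def)
  let ?f = "\<lambda>x. f x - d"
  have fm: "?f \<in> borel_measurable M" using f by simp
  have fb: "\<bar>?f x\<bar> \<le> 2" for x using bnd[of x] d by (auto simp: abs_le_iff)
  have intf: "integrable M f" by (rule integrable_const_bound[where B = 1]) (use f bnd in auto)
  have "(\<integral>x. ?f x \<partial>M) = (\<integral>x. f x \<partial>M) - (\<integral>x. d \<partial>M)" by (rule Bochner_Integration.integral_diff) (use intf in auto)
  then have neg: "(\<integral>x. ?f x \<partial>M) < 0" using zero d by (simp add: prob_space)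
  have bf: "AE x in M. \<exists>C. \<forall>n. bsum ?f n x \<le> C" by (rule bsum_bounded_above[OF fm fb neg])
  have gm: "(\<lambda>x. max 0 (bsum h n x) / real n) \<in> borel_measurable M" if "h \<in> borel_measurable M" for h n
    using bsum_measurable[OF that] by simp
  have gb: "max 0 (bsum h n x) / real n \<le> B" if "\<And>x. \<bar>h x\<bar> \<le> B" "0 \<le> B" for h n x and B :: real
  proof (cases "n = 0")
    case False
    then show ?thesis using bsum_bound[of h B n x, OF that(1)] that(2) by (simp add: divide_le_eq mult.commute abs_le_iff max_def)
  qed (use that in simp)
  have "(\<lambda>n. \<integral>x. max 0 (bsum ?f n x) / real n \<partial>M) \<longlonglongrightarrow> (\<integral>x. 0 \<partial>M)"
  proof (rule integral_dominated_convergence[where w = "\<lambda>_. 2"])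
    show "AE x in M. (\<lambda>n. max 0 (bsum ?f n x) / real n) \<longlonglongrightarrow> 0"
      using bf
    proof eventually_elim
      fix x assume "\<exists>C. \<forall>n. bsum ?f n x \<le> C"
      then obtain C where C: "\<And>n. bsum ?f n x \<le> C" by blast
      have l: "(\<lambda>n. max 0 C / real n) \<longlonglongrightarrow> 0" by (rule lim_const_over_n)
      show "(\<lambda>n. max 0 (bsum ?f n x) / real n) \<longlonglongrightarrow> 0"
        by (rule tendsto_sandwich[OF _ _ tendsto_const l])
           (use C in \<open>auto intro!: always_eventually divide_right_mono simp: max_def intro: order_trans\<close>)
    qed
    show "AE x in M. norm (max 0 (bsum ?f n x) / real n) \<le> 2" for n
      using gb[of ?f 2 n, OF fb] by (intro AE_I2) (auto simp: abs_of_nonneg)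
  qed (use gm[OF fm] in auto)
  then have "\<forall>\<^sub>F n in sequentially. (\<integral>x. max 0 (bsum ?f n x) / real n \<partial>M) < d"
    using d by (intro order_tendstoD(2)) auto
  then have "\<forall>\<^sub>F n in sequentially. (\<integral>x. max 0 (bsum ?f n x) / real n \<partial>M) < d \<and> 0 < n"
    using eventually_gt_at_top[of 0] by (rule eventually_conj)
  then obtain L where L: "(\<integral>x. max 0 (bsum ?f L x) / real L \<partial>M) < d" "0 < L" by (auto simp: eventually_sequentially)
  have int: "integrable M (\<lambda>x. max 0 (bsum h L x) / real L)" if "h \<in> borel_measurable M" "\<And>x. \<bar>h x\<bar> \<le> B" "0 \<le> B" for h and B :: real
    by (rule integrable_const_bound[where B = B]) (use gm[OF that(1)] gb[of h B L, OF that(2,3)] in \<open>auto simp: abs_of_nonneg\<close>)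
  have "(\<integral>x. max 0 (bsum f L x) / real L \<partial>M) \<le> (\<integral>x. max 0 (bsum ?f L x) / real L + d \<partial>M)"
  proof (rule integral_mono[OF int[OF f bnd]])
    show "integrable M (\<lambda>x. max 0 (bsum ?f L x) / real L + d)" using int[OF fm fb] by simp
    fix x
    have "bsum ?f L x = bsum f L x - real L * d" by (simp add: bsum_def sum_subtractf)
    then have "max 0 (bsum f L x) \<le> max 0 (bsum ?f L x) + real L * d" using d by (auto simp: max_def)
    then have "max 0 (bsum f L x) / real L \<le> (max 0 (bsum ?f L x) + real L * d) / real L" by (rule divide_right_mono) simp
    then show "max 0 (bsum f L x) / real L \<le> max 0 (bsum ?f L x) / real L + d" using L(2) by (simp add: add_divide_distrib)
  qed simp
  also have "\<dots> = (\<integral>x. max 0 (bsum ?f L x) / real L \<partial>M) + d"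
    using int[OF fm fb] by (simp add: prob_space)
  finally show thesis using that[OF L(2)] L(1) d by simp
qed

text \<open>Average the sum of length \<open>k\<close> over \<open>L\<close> shifted starting points
  and interchange the sums: long sums are averages of window sums of length \<open>L\<close>, up to
  end effects.\<close>

lemma bsum_window:
  assumes bnd: "\<And>x. \<bar>f x\<bar> \<le> 1" and L: "0 < L"
  shows "bsum f k x \<le> (\<Sum>i<k. max 0 (bsum f L ((T ^^ i) x)) / real L) + 2 * real L"
proof -
  \<comment> \<open>Each unit shift drops one term and gains one, both bounded by 1, hence the cost
    2.\<close>
  have shift: "bsum f k x \<le> bsum f k ((T ^^ j) x) + 2 * real j" for j
  proof (induction j)
    case (Suc j)
    let ?z = "(T ^^ j) x"
    have "bsum f (Suc k) ?z = f ?z + bsum f k (T ?z)" by (rule bsum_Suc)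
    moreover have "bsum f (Suc k) ?z = bsum f k ?z + f ((T ^^ k) ?z)" by (simp add: bsum_def)
    ultimately have "bsum f k ?z \<le> bsum f k (T ?z) + 2" using bnd[of ?z] bnd[of "(T ^^ k) ?z"] by (simp add: abs_le_iff)
    then show ?case using Suc by simp
  qed simp
  have "real L * bsum f k x = (\<Sum>j<L. bsum f k x)" by simp
  also have "\<dots> \<le> (\<Sum>j<L. bsum f k ((T ^^ j) x) + 2 * real L)"
  proof (rule sum_mono)
    fix j assume "j \<in> {..<L}"
    then show "bsum f k x \<le> bsum f k ((T ^^ j) x) + 2 * real L" using shift[of j] by simp
  qed
  also have "\<dots> = (\<Sum>j<L. bsum f k ((T ^^ j) x)) + real L * (2 * real L)" by (simp add: sum.distrib)
  also have "(\<Sum>j<L. bsum f k ((T ^^ j) x)) = (\<Sum>i<k. bsum f L ((T ^^ i) x))"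
    unfolding bsum_def by (subst sum.swap) (intro sum.cong refl arg_cong[of _ _ f] Tp_commute)
  also have "\<dots> \<le> (\<Sum>i<k. max 0 (bsum f L ((T ^^ i) x)))" by (rule sum_mono) simp
  finally have "bsum f k x \<le> ((\<Sum>i<k. max 0 (bsum f L ((T ^^ i) x))) + real L * (2 * real L)) / real L"
    using L by (simp add: pos_le_divide_eq mult.commute)
  then show ?thesis using L by (simp add: add_divide_distrib sum_divide_distrib)
qed

end

section \<open>Return towers of the dynamical system\<close>

context cantor_system
begin

abbreviation "VV n \<equiv> Vset T E P n"
abbreviation "wl n \<equiv> wlen T E P n"

lemma E_mono: "n \<le> m \<Longrightarrow> E m \<subseteq> E n"
  by (induction rule: dec_induct) (use E_dec in auto)

lemma y_in_E: "y \<in> E n" using E_int by auto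

text \<open>The equivalence relation of the partition \<open>insert (E n) (P n)\<close>; itineraries
  are compared through it.\<close>

definition same :: "nat \<Rightarrow> 'x \<Rightarrow> 'x \<Rightarrow> bool" where
  "same n u v \<longleftrightarrow> (\<forall>A\<in>insert (E n) (P n). u \<in> A \<longleftrightarrow> v \<in> A)"

lemma cell_ex: "\<exists>A\<in>insert (E n) (P n). u \<in> A"
  using P_cover by auto

lemma cell_unique: "A \<in> insert (E n) (P n) \<Longrightarrow> B \<in> insert (E n) (P n) \<Longrightarrow> u \<in> A \<Longrightarrow> u \<in> B \<Longrightarrow> A = B"
  using P_cover P_disj by (metis DiffD2 UnionI disjoint_iff insertE)

lemma sameI: "A \<in> insert (E n) (P n) \<Longrightarrow> u \<in> A \<Longrightarrow> v \<in> A \<Longrightarrow> same n u v"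
  unfolding same_def using cell_unique by blast

lemma same_E: "same n u v \<Longrightarrow> u \<in> E n \<longleftrightarrow> v \<in> E n"
  by (auto simp: same_def)

lemma same_mono: assumes "n \<le> m" "same m u v" shows "same n u v"
  using assms
proof (induction rule: dec_induct)
  case (step m)
  obtain B where B: "B \<in> insert (E (Suc m)) (P (Suc m))" "u \<in> B" using cell_ex by blast
  then have "v \<in> B" using step.prems by (auto simp: same_def)
  obtain A where A: "A \<in> insert (E m) (P m)" "B \<subseteq> A" using P_refine B(1) by blast
  have "same m u v" using sameI[OF A(1), of u v] A(2) B(2) \<open>v \<in> B\<close> by blast
  then show ?case by (rule step.IH)
qed

text \<open>The cells of \<open>P n\<close> avoid \<open>E n\<close>, so \<open>k\<close> is the
  first return time to \<open>E n\<close> of every point of \<open>W\<close>. This is why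
  \<open>wlen\<close> is well defined.\<close>

lemma Wrep_ret:
  assumes "is_Wrep T E P n W k" "x \<in> W"
  shows "1 \<le> k" "x \<in> E n" "(T ^^ k) x \<in> E n" "\<And>i. 1 \<le> i \<Longrightarrow> i < k \<Longrightarrow> (T ^^ i) x \<notin> E n"
proof -
  obtain Z where Z: "1 \<le> k" "\<forall>i\<in>{1..<k}. Z i \<in> P n"
     "W = E n \<inter> (\<Inter>i\<in>{1..<k}. (T ^^ i) -` Z i) \<inter> (T ^^ k) -` E n" using assms(1) by (auto simp: is_Wrep_def)
  show "1 \<le> k" "x \<in> E n" "(T ^^ k) x \<in> E n" using Z assms(2) by auto
  fix i assume "1 \<le> i" "i < k"
  then have "(T ^^ i) x \<in> Z i" "Z i \<in> P n" using Z assms(2) by auto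
  then show "(T ^^ i) x \<notin> E n" using P_cover by blast
qed

lemma Wrep_unique:
  assumes "is_Wrep T E P n W k" "is_Wrep T E P n W k'" "x \<in> W" shows "k = k'"
proof (rule ccontr)
  assume "k \<noteq> k'"
  then consider "k < k'" | "k' < k" by linarith
  then show False
    using Wrep_ret[OF assms(1,3)] Wrep_ret[OF assms(2,3)] by cases auto
qed

lemma VV_ne: "W \<in> VV n \<Longrightarrow> W \<noteq> {}" by (simp add: Vset_def)

lemma wl_is: assumes "W \<in> VV n" shows "is_Wrep T E P n W (wl n W)"
proof -
  obtain k x where k: "is_Wrep T E P n W k" "x \<in> W" using assms by (auto simp: Vset_def)
  show ?thesis unfolding wlen_def
  proof (rule theI)
    show "is_Wrep T E P n W k" by (rule k(1))
    show "k' = k" if "is_Wrep T E P n W k'" for k' by (rule Wrep_unique[OF that k])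
  qed
qed

lemma wl_eq: "is_Wrep T E P n W k \<Longrightarrow> W \<in> VV n \<Longrightarrow> wl n W = k"
  using Wrep_unique[OF wl_is] VV_ne by blast

lemmas VV_ret = Wrep_ret[OF wl_is]

lemma VV_same:
  assumes W: "W \<in> VV n" and x: "x \<in> W" "x' \<in> W" and j: "j \<le> wl n W"
  shows "same n ((T ^^ j) x) ((T ^^ j) x')"
proof -
  obtain Z where Z: "\<forall>i\<in>{1..<wl n W}. Z i \<in> P n"
     "W = E n \<inter> (\<Inter>i\<in>{1..<wl n W}. (T ^^ i) -` Z i) \<inter> (T ^^ wl n W) -` E n" using wl_is[OF W] by (auto simp: is_Wrep_def)
  consider "j = 0" | "j = wl n W" | "j \<in> {1..<wl n W}" using j by fastforce
  then show ?thesis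
  proof cases
    case 1 then show ?thesis using VV_ret(2)[OF W] x by (intro sameI[of "E n"]) auto
  next
    case 2 then show ?thesis using VV_ret(3)[OF W] x by (intro sameI[of "E n"]) auto
  next
    case 3
    have "(T ^^ j) x \<in> Z j" "(T ^^ j) x' \<in> Z j" "Z j \<in> P n" using Z 3 x by blast+
    then show ?thesis by (intro sameI[of "Z j"]) auto
  qed
qed

text \<open>A member of \<open>VV n\<close> consists of all points with one itinerary up to the
  return time, so any of its points determines it.\<close>

lemma VV_char:
  assumes W: "W \<in> VV n" and x: "x \<in> W" and s: "\<And>i. i \<le> wl n W \<Longrightarrow> same n ((T ^^ i) x) ((T ^^ i) x')"
  shows "x' \<in> W"
proof -
  obtain Z where Z: "\<forall>i\<in>{1..<wl n W}. Z i \<in> P n"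
     "W = E n \<inter> (\<Inter>i\<in>{1..<wl n W}. (T ^^ i) -` Z i) \<inter> (T ^^ wl n W) -` E n" using wl_is[OF W] by (auto simp: is_Wrep_def)
  have "x' \<in> E n" using same_E[OF s[of 0]] VV_ret(2)[OF W x] by simp
  moreover have "(T ^^ wl n W) x' \<in> E n" using same_E[OF s[of "wl n W"]] VV_ret(3)[OF W x] by simp
  moreover have "(T ^^ i) x' \<in> Z i" if i: "i \<in> {1..<wl n W}" for i
  proof -
    have "(T ^^ i) x \<in> Z i" "Z i \<in> P n" using Z i x by blast+
    moreover have "same n ((T ^^ i) x) ((T ^^ i) x')" using s i by simp
    ultimately show ?thesis by (auto simp: same_def)
  qed
  ultimately show ?thesis using Z(2) by blast
qed

lemma VV_ex:
  assumes u: "u \<in> E n" and k: "1 \<le> k" "(T ^^ k) u \<in> E n" "\<And>i. 1 \<le> i \<Longrightarrow> i < k \<Longrightarrow> (T ^^ i) u \<notin> E n"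
  shows "\<exists>W\<in>VV n. u \<in> W \<and> wl n W = k"
proof -
  have "\<forall>i\<in>{1..<k}. \<exists>Z. Z \<in> P n \<and> (T ^^ i) u \<in> Z"
  proof
    fix i assume "i \<in> {1..<k}"
    then have "(T ^^ i) u \<in> UNIV - E n" using k(3) by simp
    then show "\<exists>Z. Z \<in> P n \<and> (T ^^ i) u \<in> Z" using P_cover by blast
  qed
  from bchoice[OF this] obtain Z where Z: "\<forall>i\<in>{1..<k}. Z i \<in> P n \<and> (T ^^ i) u \<in> Z i" ..
  define W where "W = E n \<inter> (\<Inter>i\<in>{1..<k}. (T ^^ i) -` Z i) \<inter> (T ^^ k) -` E n"
  have rep: "is_Wrep T E P n W k" unfolding is_Wrep_def W_def using Z k(1) by blast
  have uW: "u \<in> W" using u k Z by (auto simp: W_def)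
  then have "W \<in> VV n" using rep by (auto simp: Vset_def)
  then show ?thesis using uW wl_eq[OF rep] by blast
qed

text \<open>A common point has one return time and one itinerary, and these determine the
  set.\<close>

lemma VV_disj:
  assumes W: "W \<in> VV n" "W' \<in> VV n" and x: "x \<in> W" "x \<in> W'" shows "W = W'"
proof -
  have eq: "wl n W = wl n W'"
  proof (rule ccontr)
    assume "wl n W \<noteq> wl n W'"
    then consider "wl n W < wl n W'" | "wl n W' < wl n W" by linarith
    then show False using VV_ret[OF W(1) x(1)] VV_ret[OF W(2) x(2)] by cases auto
  qed
  show ?thesis
  proof (intro equalityI subsetI)
    fix z assume z: "z \<in> W"
    show "z \<in> W'" by (rule VV_char[OF W(2) x(2)]) (rule VV_same[OF W(1) x(1) z], simp add: eq)
  next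
    fix z assume z: "z \<in> W'"
    show "z \<in> W" by (rule VV_char[OF W(1) x(1)]) (rule VV_same[OF W(2) x(2) z], simp add: eq)
  qed
qed

text \<open>Points of one finer tower run through the same fine cells, hence through the same coarse
  cells: visits to \<open>E n\<close> can be read off from a single point.\<close>

lemma VV_T_E:
  assumes nm: "n \<le> m" and W: "W \<in> VV m" and x: "x \<in> W" and j: "j \<le> wl m W"
  shows "(T ^^ j) x \<in> E n \<longleftrightarrow> (T ^^ j) ` W \<subseteq> E n"
  using same_E[OF same_mono[OF nm VV_same[OF W x _ j]]] x by blast

text \<open>A visit to \<open>E n\<close> starts a copy of a level-n tower that ends at the next
  visit. That copy stays inside the level-m tower because the top returns to \<open>E m\<close>, a
  subset of \<open>E n\<close>.\<close>

lemma VV_block: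
  assumes nm: "n \<le> m" and W: "W \<in> VV m" and j: "j < wl m W" and jE: "(T ^^ j) ` W \<subseteq> E n"
  obtains U where "U \<in> VV n" "(T ^^ j) ` W \<subseteq> U" "j + wl n U \<le> wl m W"
    "\<And>i. j < i \<Longrightarrow> i < j + wl n U \<Longrightarrow> \<not> (T ^^ i) ` W \<subseteq> E n" "(T ^^ (j + wl n U)) ` W \<subseteq> E n"
proof -
  obtain x where x: "x \<in> W" using VV_ne[OF W] by blast
  let ?K = "\<lambda>i. j < i \<and> (T ^^ i) x \<in> E n"
  have wK: "?K (wl m W)" using j VV_ret(3)[OF W x] E_mono[OF nm] by auto
  define k where "k = (LEAST i. ?K i)"
  have k: "?K k" unfolding k_def by (rule LeastI[of ?K, OF wK])
  have kle: "k \<le> wl m W" unfolding k_def by (rule Least_le[of ?K, OF wK])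
  have kmin: "\<not> ?K i" if "i < k" for i using not_less_Least that unfolding k_def by blast
  define u where "u = (T ^^ j) x"
  have Tu: "(T ^^ i) u = (T ^^ (j + i)) x" for i by (metis add.commute comp_apply funpow_add u_def)
  obtain U where U: "U \<in> VV n" "u \<in> U" "wl n U = k - j"
  proof (rule bexE[OF VV_ex[of u n "k - j"]])
    show "u \<in> E n" using jE x by (auto simp: u_def)
    show "1 \<le> k - j" using k by auto
    show "(T ^^ (k - j)) u \<in> E n" using Tu k by simp
    show "(T ^^ i) u \<notin> E n" if "1 \<le> i" "i < k - j" for i using Tu kmin[of "j + i"] that by simp
  qed blast
  show thesis
  proof (rule that[OF U(1)])
    show "(T ^^ j) ` W \<subseteq> U"
    proof (rule image_subsetI)
      fix x' assume x': "x' \<in> W"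
      show "(T ^^ j) x' \<in> U"
      proof (rule VV_char[OF U(1,2)])
        fix i assume "i \<le> wl n U"
        then have "j + i \<le> wl m W" using U(3) kle conjunct1[OF k] by linarith
        from same_mono[OF nm VV_same[OF W x x' this]]
        show "same n ((T ^^ i) u) ((T ^^ i) ((T ^^ j) x'))" unfolding Tu by (metis add.commute comp_apply funpow_add)
      qed
    qed
    show "j + wl n U \<le> wl m W" using U(3) kle conjunct1[OF k] by linarith
    show "\<not> (T ^^ i) ` W \<subseteq> E n" if "j < i" "i < j + wl n U" for i
      using kmin[of i] that U(3) x k by auto
    show "(T ^^ (j + wl n U)) ` W \<subseteq> E n" using VV_T_E[OF nm W x kle] k U(3) by simp
  qed
qed

text \<open>The last visit to \<open>E n\<close> at or before row \<open>p\<close> is the start of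
  the level-n block containing \<open>p\<close>. The level of \<open>W\<close> does not enter, only
  the set itself.\<close>

definition stt :: "nat \<Rightarrow> 'x set \<Rightarrow> nat \<Rightarrow> nat" where
  "stt n W p = Max {j. j \<le> p \<and> (T ^^ j) ` W \<subseteq> E n}"

definition tyy :: "nat \<Rightarrow> 'x set \<Rightarrow> nat \<Rightarrow> 'x set" where
  "tyy n W b = (THE U. U \<in> VV n \<and> (T ^^ b) ` W \<subseteq> U)"

lemma tyy_eq:
  assumes "U \<in> VV n" "(T ^^ b) ` W \<subseteq> U" "W \<noteq> {}" shows "tyy n W b = U"
  unfolding tyy_def
proof (rule the_equality)
  show "U \<in> VV n \<and> (T ^^ b) ` W \<subseteq> U" using assms by blast
  fix U' assume U': "U' \<in> VV n \<and> (T ^^ b) ` W \<subseteq> U'"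
  obtain x where "x \<in> W" using assms(3) by blast
  then have "(T ^^ b) x \<in> U" "(T ^^ b) x \<in> U'" using assms(2) U' by auto
  then show "U' = U" using VV_disj assms(1) U' by blast
qed

lemma stt_props:
  assumes nm: "n \<le> m" and W: "W \<in> VV m"
  shows "stt n W p \<le> p" "(T ^^ stt n W p) ` W \<subseteq> E n" "j \<le> p \<Longrightarrow> (T ^^ j) ` W \<subseteq> E n \<Longrightarrow> j \<le> stt n W p"
proof -
  let ?S = "{j. j \<le> p \<and> (T ^^ j) ` W \<subseteq> E n}"
  have fin: "finite ?S" by simp
  have "0 \<in> ?S" using VV_ret(2)[OF W] E_mono[OF nm] by auto
  then have "Max ?S \<in> ?S" using Max_in[OF fin] by blast
  then show "stt n W p \<le> p" "(T ^^ stt n W p) ` W \<subseteq> E n" by (auto simp: stt_def)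
  show "j \<le> p \<Longrightarrow> (T ^^ j) ` W \<subseteq> E n \<Longrightarrow> j \<le> stt n W p" unfolding stt_def using fin by (intro Max_ge) auto
qed

lemma tyy_block:
  assumes nm: "n \<le> m" and W: "W \<in> VV m" and j: "j < wl m W" and jE: "(T ^^ j) ` W \<subseteq> E n"
  shows "tyy n W j \<in> VV n" "(T ^^ j) ` W \<subseteq> tyy n W j" "j + wl n (tyy n W j) \<le> wl m W"
    "\<And>i. j < i \<Longrightarrow> i < j + wl n (tyy n W j) \<Longrightarrow> \<not> (T ^^ i) ` W \<subseteq> E n" "(T ^^ (j + wl n (tyy n W j))) ` W \<subseteq> E n"
proof -
  obtain U where U: "U \<in> VV n" "(T ^^ j) ` W \<subseteq> U" "j + wl n U \<le> wl m W"
    "\<And>i. j < i \<Longrightarrow> i < j + wl n U \<Longrightarrow> \<not> (T ^^ i) ` W \<subseteq> E n" "(T ^^ (j + wl n U)) ` W \<subseteq> E n"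
    using VV_block[OF assms] by blast
  have "tyy n W j = U" by (rule tyy_eq[OF U(1,2) VV_ne[OF W]])
  then show "tyy n W j \<in> VV n" "(T ^^ j) ` W \<subseteq> tyy n W j" "j + wl n (tyy n W j) \<le> wl m W"
    "\<And>i. j < i \<Longrightarrow> i < j + wl n (tyy n W j) \<Longrightarrow> \<not> (T ^^ i) ` W \<subseteq> E n" "(T ^^ (j + wl n (tyy n W j))) ` W \<subseteq> E n"
    using U by auto
qed

lemma stt_block:
  assumes nm: "n \<le> m" and W: "W \<in> VV m" and p: "p < wl m W"
  shows "tyy n W (stt n W p) \<in> VV n" "(T ^^ stt n W p) ` W \<subseteq> tyy n W (stt n W p)"
    "p < stt n W p + wl n (tyy n W (stt n W p))" "stt n W p + wl n (tyy n W (stt n W p)) \<le> wl m W"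
proof -
  note s = stt_props[OF nm W]
  have lt: "stt n W p < wl m W" using s(1)[of p] p by simp
  note t = tyy_block[OF nm W lt s(2)]
  show "tyy n W (stt n W p) \<in> VV n" "(T ^^ stt n W p) ` W \<subseteq> tyy n W (stt n W p)"
     "stt n W p + wl n (tyy n W (stt n W p)) \<le> wl m W" using t by auto
  have "1 \<le> wl n (tyy n W (stt n W p))" using Wrep_ret(1)[OF wl_is[OF t(1)]] VV_ne[OF t(1)] by blast
  then show "p < stt n W p + wl n (tyy n W (stt n W p))" using s(3)[OF _ t(5), of p] by linarith
qed

lemma stt_eq:
  assumes nm: "n \<le> m" and W: "W \<in> VV m" and j: "j < wl m W" and jE: "(T ^^ j) ` W \<subseteq> E n"
    and p: "j \<le> p" "p < j + wl n (tyy n W j)"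
  shows "stt n W p = j"
proof (rule antisym)
  note t = tyy_block[OF nm W j jE]
  show "j \<le> stt n W p" by (rule stt_props(3)[OF nm W p(1) jE])
  show "stt n W p \<le> j"
  proof (rule ccontr)
    assume "\<not> stt n W p \<le> j"
    then show False using t(4)[of "stt n W p"] stt_props(1,2)[OF nm W, of p] p(2) by auto
  qed
qed

lemma blk_ok_stt:
  assumes nm: "n \<le> m" and W: "W \<in> VV m"
  shows "blk_ok (wl m W) (\<lambda>b. wl n (tyy n W b)) (\<lambda>p. Some (stt n W p, p - stt n W p))"
  unfolding blk_ok_def
proof (intro conjI allI impI)
  fix p b i assume p: "p < wl m W" "Some (stt n W p, p - stt n W p) = Some (b,i)"
  then show "i < wl n (tyy n W b)" using stt_block(3)[OF nm W p(1)] stt_props(1)[OF nm W, of p] by auto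
next
  fix p q assume "Some (stt n W p, p - stt n W p) = Some (stt n W q, q - stt n W q)"
  then show "p = q" using stt_props(1)[OF nm W, of p] stt_props(1)[OF nm W, of q] by auto
next
  fix p b i i' assume p: "p < wl m W" "Some (stt n W p, p - stt n W p) = Some (b,i)" "i' < wl n (tyy n W b)"
  then have b: "b = stt n W p" by simp
  have lt: "b < wl m W" using stt_props(1)[OF nm W, of p] p b by simp
  have bE: "(T ^^ b) ` W \<subseteq> E n" unfolding b by (rule stt_props(2)[OF nm W])
  have "stt n W (b + i') = b" using stt_eq[OF nm W lt bE, of "b + i'"] p(3) by simp
  moreover have "b + i' < wl m W" using tyy_block(3)[OF nm W lt bE] p(3) by simp
  ultimately show "\<exists>q<wl m W. Some (stt n W q, q - stt n W q) = Some (b,i')" by (intro exI[of _ "b + i'"]) simp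
qed

lemma stt_refl: assumes W: "W \<in> VV n" "p < wl n W" shows "stt n W p = 0"
proof -
  obtain x where x: "x \<in> W" using VV_ne[OF W(1)] by blast
  have "(T ^^ stt n W p) x \<in> E n" using stt_props(2)[OF le_refl W(1)] x by blast
  then show ?thesis using VV_ret(4)[OF W(1) x, of "stt n W p"] stt_props(1)[OF le_refl W(1), of p] W(2) by fastforce
qed

lemma tyy_refl: assumes W: "W \<in> VV n" shows "tyy n W 0 = W"
  by (rule tyy_eq[OF W]) (use VV_ne[OF W] in auto)

text \<open>Since \<open>E m\<close> lies in \<open>E n\<close>, the start of a level-m block is
  also a level-n start. So the last level-n start before \<open>p\<close> is found inside the
  level-m block of \<open>p\<close>.\<close>

lemma stt_comp:
  assumes nm: "n \<le> m" and mk: "m \<le> k" and W: "W \<in> VV k" and p: "p < wl k W"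
  defines "b \<equiv> stt m W p" defines "U \<equiv> tyy m W b"
  shows "stt n W p = b + stt n U (p - b)" "tyy n W (stt n W p) = tyy n U (stt n U (p - b))"
proof -
  have nk: "n \<le> k" using nm mk by simp
  have U: "U \<in> VV m" "(T ^^ b) ` W \<subseteq> U" "p < b + wl m U" "b + wl m U \<le> wl k W"
    using stt_block[OF mk W p] by (auto simp: b_def U_def)
  have bp: "b \<le> p" unfolding b_def by (rule stt_props(1)[OF mk W])
  have img: "(T ^^ (b + j)) ` W \<subseteq> (T ^^ j) ` U" for j
  proof -
    have "(T ^^ (b + j)) ` W = (T ^^ j) ` (T ^^ b) ` W" by (simp add: image_comp add.commute flip: funpow_add)
    then show ?thesis using U(2) by blast
  qed
  define c where "c = stt n U (p - b)"
  have c: "c \<le> p - b" "(T ^^ c) ` U \<subseteq> E n" unfolding c_def by (rule stt_props[OF nm U(1)])+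
  have 1: "(T ^^ (b + c)) ` W \<subseteq> E n" using img c(2) by blast
  have le: "b + c \<le> stt n W p" by (rule stt_props(3)[OF nk W _ 1]) (use c bp in simp)
  define s where "s = stt n W p"
  have s: "s \<le> p" "(T ^^ s) ` W \<subseteq> E n" unfolding s_def by (rule stt_props[OF nk W])+
  have sb: "b \<le> s" using le by (simp add: s_def)
  obtain x where x: "x \<in> W" using VV_ne[OF W] by blast
  have "(T ^^ s) x = (T ^^ (s - b)) ((T ^^ b) x)" using sb by (metis comp_apply funpow_add le_add_diff_inverse2)
  then have "(T ^^ (s - b)) ((T ^^ b) x) \<in> E n" using s(2) x by auto
  then have "(T ^^ (s - b)) ` U \<subseteq> E n"
  proof -
    have "s - b \<le> wl m U" using U(3) s(1) by linarith
    moreover have "(T ^^ b) x \<in> U" using U(2) x by blast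
    ultimately have "(T ^^ (s - b)) ((T ^^ b) x) \<in> E n \<longleftrightarrow> (T ^^ (s - b)) ` U \<subseteq> E n"
      by (intro VV_T_E[OF nm U(1)])
    then show ?thesis using \<open>(T ^^ (s - b)) ((T ^^ b) x) \<in> E n\<close> by simp
  qed
  then have "s - b \<le> c" unfolding c_def using s(1) by (intro stt_props(3)[OF nm U(1)]) auto
  then show eq: "stt n W p = b + c" using le sb by (simp add: s_def)
  have "p - b < wl m U" using U(3) bp by simp
  note cb = stt_block[OF nm U(1) this, folded c_def]
  show "tyy n W (stt n W p) = tyy n U c" unfolding eq
    by (rule tyy_eq[OF cb(1) _ VV_ne[OF W]]) (use img cb(2) in blast)
qed

text \<open>Identifies the block starts of type \<open>W\<close> with the set \<open>Jset\<close>
  from the definition of the connecting maps, and the multiplicity with its cardinality.\<close>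

lemma starts_eq:
  assumes nm: "n \<le> m" and W': "W' \<in> VV m" and W: "W \<in> VV n"
  shows "{b. (\<exists>p<wl m W'. b = stt n W' p) \<and> tyy n W' b = W} = {j. j < wl m W' \<and> (T ^^ j) ` W' \<subseteq> W}"
proof (intro equalityI subsetI)
  fix b assume "b \<in> {b. (\<exists>p<wl m W'. b = stt n W' p) \<and> tyy n W' b = W}"
  then obtain p where p: "p < wl m W'" "b = stt n W' p" "tyy n W' b = W" by blast
  then show "b \<in> {j. j < wl m W' \<and> (T ^^ j) ` W' \<subseteq> W}"
    using stt_block(2)[OF nm W' p(1)] stt_props(1)[OF nm W', of p] by auto
next
  fix j assume "j \<in> {j. j < wl m W' \<and> (T ^^ j) ` W' \<subseteq> W}"
  then have j: "j < wl m W'" "(T ^^ j) ` W' \<subseteq> W" by auto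
  have "(T ^^ j) ` W' \<subseteq> E n" using j(2) VV_ret(2)[OF W] by blast
  then have "stt n W' j = j" using stt_props(1)[OF nm W', of j] stt_props(3)[OF nm W', of j j] by simp
  then show "j \<in> {b. (\<exists>p<wl m W'. b = stt n W' p) \<and> tyy n W' b = W}"
    using j tyy_eq[OF W j(2) VV_ne[OF W']] by auto
qed

lemma VV_T_in:
  assumes nm: "n \<le> m" and W': "W' \<in> VV m" and W: "W \<in> VV n" and x: "x \<in> W'" and j: "j < wl m W'"
  shows "(T ^^ j) x \<in> W \<longleftrightarrow> (T ^^ j) ` W' \<subseteq> W"
proof
  assume a: "(T ^^ j) x \<in> W"
  then have "(T ^^ j) ` W' \<subseteq> E n" using VV_T_E[OF nm W' x] VV_ret(2)[OF W a] j by simp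
  note t = tyy_block[OF nm W' j this]
  have "tyy n W' j = W" using VV_disj[OF t(1) W _ a] t(2) x by blast
  then show "(T ^^ j) ` W' \<subseteq> W" using t(2) by simp
qed (use x in blast)

lemma VV_clopen: assumes "W \<in> VV n" shows "clopen_set W"
proof -
  define k where "k = wl n W"
  obtain Z where Z: "\<forall>i\<in>{1..<k}. Z i \<in> P n"
     "W = E n \<inter> (\<Inter>i\<in>{1..<k}. (T ^^ i) -` Z i) \<inter> (T ^^ k) -` E n" using wl_is[OF assms] unfolding k_def is_Wrep_def by blast
  have v: "open ((T ^^ i) -` A)" "closed ((T ^^ i) -` A)" if "clopen_set A" for A i
    using that funpow_cont[OF T_cont, of i] by (auto simp: clopen_set_def open_vimage closed_vimage)
  have "open W" unfolding Z(2) using Z(1) P_clopen E_clopen v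
    by (intro open_Int open_INT) (auto simp: clopen_set_def)
  moreover have "closed W" unfolding Z(2) using Z(1) P_clopen E_clopen v
    by (intro closed_Int closed_INT) (auto simp: clopen_set_def)
  ultimately show ?thesis by (simp add: clopen_set_def)
qed

lemma VV_sets: "W \<in> VV n \<Longrightarrow> W \<in> sets M"
  using VV_clopen clopen_sets by blast

lemma VV_pos: "W \<in> VV n \<Longrightarrow> 0 < measure M W"
  using VV_clopen VV_ne M_full by (auto simp: clopen_set_def)

text \<open>For each return time there are only finitely many itineraries.\<close>

lemma VV_countable: "countable (VV n)"
proof -
  have "VV n \<subseteq> (\<Union>k. (\<lambda>Z. E n \<inter> (\<Inter>i\<in>{1..<k}. (T ^^ i) -` Z i) \<inter> (T ^^ k) -` E n) ` (PiE {1..<k} (\<lambda>_. P n)))"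
  proof
    fix W assume W: "W \<in> VV n"
    define k where "k = wl n W"
    obtain Z where Z: "\<forall>i\<in>{1..<k}. Z i \<in> P n"
      "W = E n \<inter> (\<Inter>i\<in>{1..<k}. (T ^^ i) -` Z i) \<inter> (T ^^ k) -` E n" using wl_is[OF W] unfolding k_def is_Wrep_def by blast
    have "restrict Z {1..<k} \<in> PiE {1..<k} (\<lambda>_. P n)" using Z(1) by auto
    moreover have "W = (\<lambda>Z. E n \<inter> (\<Inter>i\<in>{1..<k}. (T ^^ i) -` Z i) \<inter> (T ^^ k) -` E n) (restrict Z {1..<k})"
      by (subst Z(2)) (simp add: restrict_def)
    ultimately show "W \<in> (\<Union>k. (\<lambda>Z. E n \<inter> (\<Inter>i\<in>{1..<k}. (T ^^ i) -` Z i) \<inter> (T ^^ k) -` E n) ` (PiE {1..<k} (\<lambda>_. P n)))" by blast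
  qed
  moreover have "countable ((\<lambda>Z. E n \<inter> (\<Inter>i\<in>{1..<k}. (T ^^ i) -` Z i) \<inter> (T ^^ k) -` E n) ` (PiE {1..<k} (\<lambda>_. P n)))" for k
  proof (rule countable_finite[OF finite_imageI[OF finite_PiE]])
    show "finite (P n)" using P_fin by blast
  qed simp
  then have "countable (\<Union>k. (\<lambda>Z. E n \<inter> (\<Inter>i\<in>{1..<k}. (T ^^ i) -` Z i) \<inter> (T ^^ k) -` E n) ` (PiE {1..<k} (\<lambda>_. P n)))"
    by (intro countable_UN) auto
  ultimately show ?thesis by (rule countable_subset)
qed

definition tix :: "nat \<Rightarrow> ('x set \<times> nat) set" where
  "tix n = (SIGMA W:VV n. {..<wl n W})"

text \<open>If the same point were at heights j > j' above base points x and x', then x' would be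
  T^(j - j') x, a return of x to \<open>E n\<close> before its return time.\<close>

lemma tower_disjoint:
  assumes W: "W \<in> VV n" "j < wl n W" "W' \<in> VV n" "j' < wl n W'" and z: "z \<in> (T ^^ j) ` W" "z \<in> (T ^^ j') ` W'"
  shows "W = W' \<and> j = j'"
proof -
  obtain x x' where x: "x \<in> W" "z = (T ^^ j) x" and x': "x' \<in> W'" "z = (T ^^ j') x'" using z by blast
  have aux: "j \<le> j'" if W: "W \<in> VV n" "j < wl n W" and x: "x \<in> W" "x' \<in> E n" "(T ^^ j) x = (T ^^ j') x'" for W x x' j j'
  proof (rule ccontr)
    assume lt: "\<not> j \<le> j'"
    then have "(T ^^ j) x = (T ^^ j') ((T ^^ (j - j')) x)" by (metis comp_apply funpow_add le_add_diff_inverse nat_le_linear)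
    then have "x' = (T ^^ (j - j')) x" using x(3) Tp_Tip(2) by metis
    then show False using VV_ret(4)[OF W(1) x(1), of "j - j'"] x(2) lt W(2) by simp
  qed
  have "j = j'"
    using aux[OF W(1,2) x(1) VV_ret(2)[OF W(3) x'(1)]] aux[OF W(3,4) x'(1) VV_ret(2)[OF W(1) x(1)]] x(2) x'(2) by (simp add: antisym)
  then have "x = x'" using x(2) x'(2) Tp_Tip(2) by metis
  then show ?thesis using VV_disj[OF W(1,3) x(1)] x'(1) \<open>j = j'\<close> by blast
qed

lemma tix_disjoint: "disjoint_family_on (\<lambda>(W,j). S \<inter> (T ^^ j) ` W) (tix n)"
  unfolding disjoint_family_on_def tix_def using tower_disjoint by (auto simp: disjoint_iff) blast+

lemma E_pos: "0 < measure M (E n)"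
  using M_full E_clopen y_in_E by (auto simp: clopen_set_def)

text \<open>Almost every point has visits to \<open>E n\<close> in its past and in its future. The
  most recent one is the base point, and the next one determines the tower.\<close>

lemma AE_tower: "AE z in M. \<exists>W j. (W,j) \<in> tix n \<and> z \<in> (T ^^ j) ` W"
  using AE_visits[OF clopen_sets[OF E_clopen[THEN spec]] E_pos[of n]]
proof eventually_elim
  fix z assume z: "(\<exists>\<^sub>\<infinity>j. (T ^^ j) z \<in> E n) \<and> (\<exists>\<^sub>\<infinity>j. (Ti ^^ j) z \<in> E n)"
  then have exb: "\<exists>a. (Ti ^^ a) z \<in> E n" using INFM_EX by blast
  define a where "a = (LEAST a. (Ti ^^ a) z \<in> E n)"
  have a: "(Ti ^^ a) z \<in> E n" unfolding a_def using exb by (rule LeastI_ex)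
  have amin: "(Ti ^^ i) z \<notin> E n" if "i < a" for i using that not_less_Least unfolding a_def by blast
  define u where "u = (Ti ^^ a) z"
  have zu: "z = (T ^^ a) u" by (simp add: u_def)
  obtain c where c: "Suc 0 \<le> c" "(T ^^ c) z \<in> E n" using z unfolding INFM_nat_le by blast
  have "(T ^^ (c + a)) u \<in> E n" using c zu by (simp add: funpow_add)
  then have exk: "\<exists>k. 1 \<le> k \<and> (T ^^ k) u \<in> E n" using c by (intro exI[of _ "c + a"]) simp
  define k where "k = (LEAST k. 1 \<le> k \<and> (T ^^ k) u \<in> E n)"
  have k: "1 \<le> k \<and> (T ^^ k) u \<in> E n" unfolding k_def using exk by (rule LeastI_ex)
  have kmin: "(T ^^ i) u \<notin> E n" if "1 \<le> i" "i < k" for i using that not_less_Least unfolding k_def by blast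
  \<comment> \<open>Otherwise T^k u would be a visit to \<open>E n\<close> at or before z more
    recent than \<open>u\<close>, against the minimality of \<open>a\<close>.\<close>
  have "a < k"
  proof (rule ccontr)
    assume "\<not> a < k"
    then have ka: "k \<le> a" by simp
    have "(Ti ^^ (a - k)) z = (T ^^ k) u"
    proof -
      have "(Ti ^^ a) z = (Ti ^^ k) ((Ti ^^ (a - k)) z)" using ka by (metis comp_apply funpow_add le_add_diff_inverse)
      then show ?thesis by (simp add: u_def)
    qed
    then show False using k amin[of "a - k"] ka by (simp add: Suc_le_eq)
  qed
  obtain W where W: "W \<in> VV n" "u \<in> W" "wl n W = k" using VV_ex[of u n k] a k kmin u_def by blast
  then have "(W, a) \<in> tix n" using \<open>a < k\<close> by (simp add: tix_def)
  then show "\<exists>W j. (W,j) \<in> tix n \<and> z \<in> (T ^^ j) ` W" using W zu by blast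
qed

lemma tix_countable: "countable (tix n)"
  unfolding tix_def using VV_countable by (intro countable_SIGMA) auto

lemma tower_has_sum:
  assumes S: "S \<in> sets M"
  shows "((\<lambda>(W,j). measure M (S \<inter> (T ^^ j) ` W)) has_sum measure M S) (tix n)"
proof -
  have m: "(case p of (W,j) \<Rightarrow> S \<inter> (T ^^ j) ` W) \<in> sets M" if "p \<in> tix n" for p
    using that S VV_sets vimage_sets(3) by (auto simp: tix_def)
  have "((\<lambda>p. measure M (case p of (W,j) \<Rightarrow> S \<inter> (T ^^ j) ` W)) has_sum
      measure M (\<Union>p\<in>tix n. case p of (W,j) \<Rightarrow> S \<inter> (T ^^ j) ` W)) (tix n)"
    by (rule has_sum_measure_disjoint[OF tix_countable m tix_disjoint])
  moreover have "measure M (\<Union>p\<in>tix n. case p of (W,j) \<Rightarrow> S \<inter> (T ^^ j) ` W) = measure M S"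
  proof (rule finite_measure_eq_AE)
    show "(\<Union>p\<in>tix n. case p of (W,j) \<Rightarrow> S \<inter> (T ^^ j) ` W) \<in> sets M"
      using m tix_countable by (intro sets.countable_UN') auto
    show "AE z in M. (z \<in> (\<Union>p\<in>tix n. case p of (W,j) \<Rightarrow> S \<inter> (T ^^ j) ` W)) = (z \<in> S)"
      using AE_tower[of n] by eventually_elim blast
  qed (rule S)
  ultimately show ?thesis by (simp add: case_prod_unfold)
qed

text \<open>Kac's return time formula: the floors partition the space up to a null set, and all
  floors of a tower have the measure of its base.\<close>

lemma kac: "((\<lambda>W. measure M W * real (wl n W)) has_sum 1) (VV n)"
proof -
  have "((\<lambda>(W,j). measure M (UNIV \<inter> (T ^^ j) ` W)) has_sum measure M UNIV) (tix n)"
    by (rule tower_has_sum) (metis sets.top space_M)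
  then have "((\<lambda>(W,j). measure M (UNIV \<inter> (T ^^ j) ` W)) has_sum 1) (SIGMA W:VV n. {..<wl n W})" by (simp add: tix_def)
  then show ?thesis
  proof (rule has_sum_SigmaD)
    fix W assume W: "W \<in> VV n"
    have "((\<lambda>j. measure M W) has_sum (\<Sum>j<wl n W. measure M W)) {..<wl n W}" by (rule has_sum_finite) simp
    then show "((\<lambda>j. case (W,j) of (W,j) \<Rightarrow> measure M (UNIV \<inter> (T ^^ j) ` W)) has_sum measure M W * real (wl n W)) {..<wl n W}"
      using measure_image[OF VV_sets[OF W]] by (simp add: mult.commute)
  qed
qed

text \<open>Cut \<open>W\<close> by the floors of the level-m towers. Each floor lies inside
  \<open>W\<close> or misses it, and those inside are the starts of blocks of type
  \<open>W\<close>.\<close>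

lemma weight_balance:
  assumes nm: "n \<le> m" and W: "W \<in> VV n"
  shows "((\<lambda>W'. measure M W' * real (card {b. (\<exists>p<wl m W'. b = stt n W' p) \<and> tyy n W' b = W})) has_sum measure M W) (VV m)"
proof -
  have "((\<lambda>(W',j). measure M (W \<inter> (T ^^ j) ` W')) has_sum measure M W) (SIGMA W':VV m. {..<wl m W'})"
    using tower_has_sum[OF VV_sets[OF W], of m] by (simp add: tix_def)
  then show ?thesis
  proof (rule has_sum_SigmaD)
    fix W' assume W': "W' \<in> VV m"
    let ?J = "{j. j < wl m W' \<and> (T ^^ j) ` W' \<subseteq> W}"
    have e: "measure M (W \<inter> (T ^^ j) ` W') = (if j \<in> ?J then measure M W' else 0)" if j: "j < wl m W'" for j
    proof (cases "j \<in> ?J")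
      case True
      then have "W \<inter> (T ^^ j) ` W' = (T ^^ j) ` W'" by blast
      then show ?thesis using True measure_image[OF VV_sets[OF W']] by simp
    next
      case False
      then have "W \<inter> (T ^^ j) ` W' = {}" using VV_T_in[OF nm W' W _ j] j by blast
      then show ?thesis using False by auto
    qed
    have "((\<lambda>j. measure M (W \<inter> (T ^^ j) ` W')) has_sum (\<Sum>j<wl m W'. measure M (W \<inter> (T ^^ j) ` W'))) {..<wl m W'}"
      by (rule has_sum_finite) simp
    also have "(\<Sum>j<wl m W'. measure M (W \<inter> (T ^^ j) ` W')) = (\<Sum>j<wl m W'. if j \<in> ?J then measure M W' else 0)"
      by (rule sum.cong) (use e in auto)
    also have "\<dots> = measure M W' * real (card ({..<wl m W'} \<inter> ?J))" by (subst sum.inter_restrict[symmetric]) (auto simp: mult.commute)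
    also have "{..<wl m W'} \<inter> ?J = {b. (\<exists>p<wl m W'. b = stt n W' p) \<and> tyy n W' b = W}"
      unfolding starts_eq[OF nm W' W] by auto
    finally show "((\<lambda>j. case (W',j) of (W',j) \<Rightarrow> measure M (W \<inter> (T ^^ j) ` W')) has_sum
        measure M W' * real (card {b. (\<exists>p<wl m W'. b = stt n W' p) \<and> tyy n W' b = W})) {..<wl m W'}" by simp
  qed
qed

lemma tower_system_cantor:
  assumes "field_involution (cj :: 'k::field \<Rightarrow> 'k)"
  shows "tower_system cj VV wl (measure M) (\<lambda>n m. stt n) (\<lambda>n m. tyy n)"
proof
  show "field_involution cj" by fact
  show "0 < measure M W" if "W \<in> VV n" for W n using VV_pos that .
  show "0 < wl n W" if "W \<in> VV n" for W n using Wrep_ret(1)[OF wl_is[OF that]] VV_ne[OF that] by fastforce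
  show "((\<lambda>W. measure M W * real (wl n W)) has_sum 1) (VV n)" for n by (rule kac)
  show "blk_ok (wl m W') (\<lambda>b. wl n (tyy n W' b)) (\<lambda>p. Some (stt n W' p, p - stt n W' p))" if "n \<le> m" "W' \<in> VV m" for n m W'
    using blk_ok_stt that .
  show "stt n W' p \<le> p" if "n \<le> m" "W' \<in> VV m" "p < wl m W'" for n m W' p using stt_props(1) that by blast
  show "tyy n W' (stt n W' p) \<in> VV n" if "n \<le> m" "W' \<in> VV m" "p < wl m W'" for n m W' p using stt_block(1) that .
  show "stt n W p = 0" if "W \<in> VV n" "p < wl n W" for n W p using stt_refl that .
  show "tyy n W 0 = W" if "W \<in> VV n" for n W using tyy_refl that .
  show "stt n W p = stt m W p + stt n (tyy m W (stt m W p)) (p - stt m W p)"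
    "tyy n W (stt n W p) = tyy n (tyy m W (stt m W p)) (stt n (tyy m W (stt m W p)) (p - stt m W p))"
    if "n \<le> m" "W \<in> VV (Suc m)" "p < wl (Suc m) W" for n m W p
    using stt_comp[OF that(1) _ that(2,3)] by auto
  show "((\<lambda>W'. measure M W' * real (card {b. (\<exists>p<wl (Suc n) W'. b = stt n W' p) \<and> tyy n W' b = W})) has_sum measure M W) (VV (Suc n))"
    if "W \<in> VV n" for W n using weight_balance[OF _ that, of "Suc n"] by simp
qed

end

section \<open>Shrinking bases, equidistribution in towers, and the connecting maps\<close>

context cantor_system
begin

text \<open>If \<open>y\<close> were an atom, all points of its orbit would have the same mass, so
  the orbit would be finite and invariant, of measure 1 by ergodicity. Its complement is open and
  nonempty in an infinite space, which contradicts fullness.\<close>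

lemma measure_y: "measure M {y} = 0"
proof (rule ccontr)
  assume "measure M {y} \<noteq> 0"
  then have a: "0 < measure M {y}" by (simp add: less_le)
  have ys: "{y} \<in> sets M" unfolding M_borel by simp
  define Orb where "Orb = range (\<lambda>i. (T ^^ i) y)"
  have "finite Orb"
  proof (rule ccontr)
    assume inf: "infinite Orb"
    obtain N :: nat where N: "1 / measure M {y} < real N" using reals_Archimedean2 by blast
    obtain F where F: "F \<subseteq> Orb" "finite F" "card F = N" using infinite_arbitrarily_large[OF inf] by blast
    have m: "measure M {z} = measure M {y}" if z: "z \<in> F" for z
    proof -
      obtain i where "z = (T ^^ i) y" using F(1) z by (auto simp: Orb_def)
      then show ?thesis using measure_image[OF ys, of i] by simp
    qed
    have "measure M F = (\<Sum>z\<in>F. measure M {z})"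
      using F(2) by (intro finite_measure_eq_sum_singleton) (auto simp: M_borel)
    also have "\<dots> = real N * measure M {y}" using m F(3) by simp
    finally have "1 < measure M F" using N a by (simp add: divide_less_eq)
    then show False using prob_le_1[of F] by simp
  qed
  then have "\<not> inj (\<lambda>i. (T ^^ i) y)" unfolding Orb_def using finite_imageD infinite_UNIV_nat by blast
  then obtain i j where "i < j" "(T ^^ i) y = (T ^^ j) y" unfolding inj_on_def by (metis linorder_neqE_nat)
  then have "(T ^^ i) y = (T ^^ i) ((T ^^ (j - i)) y)" by (metis comp_apply funpow_add le_add_diff_inverse less_imp_le_nat)
  then have per: "(T ^^ (j - i)) y = y" by (metis Tp_Tip(2))
  obtain k where k: "j - i = Suc k" using \<open>i < j\<close> by (metis Suc_diff_Suc)
  have "T -` Orb = Orb"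
  proof (intro equalityI subsetI)
    fix z assume "z \<in> T -` Orb"
    then obtain l where l: "T z = (T ^^ l) y" by (auto simp: Orb_def)
    show "z \<in> Orb"
    proof (cases l)
      case 0
      then have "T z = T ((T ^^ k) y)" using l per k by simp
      then have "z = (T ^^ k) y" by (metis Ti_T)
      then show ?thesis by (auto simp: Orb_def)
    next
      case (Suc r)
      then have "z = (T ^^ r) y" using l by (metis Ti_T comp_apply funpow.simps(2))
      then show ?thesis by (auto simp: Orb_def)
    qed
  next
    fix z assume "z \<in> Orb"
    then obtain l where "z = (T ^^ l) y" by (auto simp: Orb_def)
    then have "T z = (T ^^ Suc l) y" by simp
    then show "z \<in> T -` Orb" unfolding Orb_def by (simp only: vimage_eq) blast
  qed
  moreover have Os: "Orb \<in> sets M" unfolding M_borel using \<open>finite Orb\<close> by (simp add: finite_imp_closed borel_closed)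
  moreover have "y \<in> Orb" unfolding Orb_def by (rule range_eqI[of _ _ 0]) simp
  then have "measure M {y} \<le> measure M Orb" using Os by (intro finite_measure_mono) auto
  ultimately have "measure M Orb = 1" using erg[OF Os] a by linarith
  then have "measure M (- Orb) = 0" using prob_compl[OF Os] by (simp add: Compl_eq_Diff_UNIV)
  moreover have "open (- Orb)" using \<open>finite Orb\<close> by (simp add: open_Compl finite_imp_closed)
  moreover have "- Orb \<noteq> {}" using \<open>finite Orb\<close> X_infinite by (metis Compl_empty_eq double_compl)
  ultimately show False using M_full by (metis less_irrefl)
qed

lemma measure_E: "(\<lambda>n. measure M (E n)) \<longlonglongrightarrow> 0"
proof -
  have "(\<lambda>n. measure M (E n)) \<longlonglongrightarrow> measure M (\<Inter>n. E n)"
    by (rule finite_Lim_measure_decseq) (use E_clopen clopen_sets E_mono in \<open>auto simp: decseq_def\<close>)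
  then show ?thesis using E_int measure_y by simp
qed

lemma sum_wt_le_E:
  assumes F: "finite F" "F \<subseteq> VV m" shows "(\<Sum>W\<in>F. measure M W) \<le> measure M (E m)"
proof -
  have "(\<Sum>W\<in>F. measure M W) = measure M (\<Union>W\<in>F. W)"
  proof (rule finite_measure_finite_Union[symmetric, of F "\<lambda>W. W"])
    show "disjoint_family_on (\<lambda>W. W) F" using F(2) VV_disj by (auto simp: disjoint_family_on_def) blast+
  qed (use F VV_sets in auto)
  also have "\<dots> \<le> measure M (E m)"
    by (rule finite_measure_mono) (use F VV_ret(2) clopen_sets E_clopen in blast)+
  finally show ?thesis .
qed

text \<open>For \<open>f\<close> equal to the mean of \<open>W\<close> minus its indicator, the sum
  of \<open>f\<close> along a tower is the shortage of copies of \<open>W\<close>.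
  \<open>bsum_window\<close> replaces it by values on the floors of a function \<open>G\<close> with
  small integral, plus 2 * L per tower. The floors are disjoint, so the total is at most the
  integral of \<open>G\<close> plus 2 * L times the measure of \<open>E m\<close>.\<close>

lemma ergodic_tower_system_cantor:
  assumes "field_involution (cj :: 'k::field \<Rightarrow> 'k)"
  shows "ergodic_tower_system cj VV wl (measure M) (\<lambda>n m. stt n) (\<lambda>n m. tyy n)"
proof -
  interpret TS: tower_system cj VV wl "measure M" "\<lambda>n m. stt n" "\<lambda>n m. tyy n"
    using assms by (rule tower_system_cantor)
  have wts: "measure M summable_on VV m" for m
    using TS.wsummable[of m "\<lambda>_. 1" 1] TS.sz_pos[of _ m] by (simp add: Suc_leI)
  show ?thesis
  proof
    show "(\<lambda>m. \<Sum>\<^sub>\<infinity>W\<in>VV m. measure M W) \<longlonglongrightarrow> 0"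
    proof (rule tendsto_sandwich[OF _ _ tendsto_const measure_E])
      show "\<forall>\<^sub>F m in sequentially. 0 \<le> (\<Sum>\<^sub>\<infinity>W\<in>VV m. measure M W)" by (intro always_eventually allI infsum_nonneg) simp
      show "\<forall>\<^sub>F m in sequentially. (\<Sum>\<^sub>\<infinity>W\<in>VV m. measure M W) \<le> measure M (E m)"
        by (intro always_eventually allI infsum_le_finite_sums wts sum_wt_le_E)
    qed
    fix W n assume W: "W \<in> VV n"
    define a where "a = measure M W"
    define f where "f z = a - indicator W z" for z :: 'x
    have Ws: "W \<in> sets M" using VV_sets[OF W] .
    have fm: "f \<in> borel_measurable M" unfolding f_def using Ws by simp
    have fb: "\<bar>f z\<bar> \<le> 1" for z
    proof -
      have "0 \<le> a" "a \<le> 1" by (auto simp: a_def)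
      then show ?thesis by (auto simp: f_def indicator_def)
    qed
    have "(\<integral>z. f z \<partial>M) = (\<integral>z. a \<partial>M) - (\<integral>z. indicator W z \<partial>M)"
      unfolding f_def by (rule Bochner_Integration.integral_diff) (use Ws in \<open>auto intro!: integrable_real_indicator simp: emeasure_eq_measure\<close>)
    then have fz: "(\<integral>z. f z \<partial>M) = 0" using Ws by (simp add: a_def)
    let ?d = "\<lambda>m W'. max 0 (a * real (wl m W') - real (TS.cnt n m W W'))"
    let ?D = "\<lambda>m. \<Sum>\<^sub>\<infinity>W'\<in>VV m. measure M W' * ?d m W'"
    have D0: "0 \<le> ?D m" for m by (rule infsum_nonneg) simp
    have bound: "?D m \<le> (\<integral>z. max 0 (bsum f L z) / real L \<partial>M) + 2 * real L * measure M (E m)"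
      if nm: "n \<le> m" and L: "0 < L" for m L
    proof (rule infsum_le_finite_sums)
      show "(\<lambda>W'. measure M W' * ?d m W') summable_on VV m"
      proof (rule TS.wsummable[where K = 1])
        fix W' assume "W' \<in> VV m"
        have "a * real (wl m W') \<le> 1 * real (wl m W')" by (rule mult_right_mono) (auto simp: a_def)
        then show "?d m W' \<le> 1 * real (wl m W')" by simp
      qed simp
      fix F assume F: "finite F" "F \<subseteq> VV m"
      define G where "G z = max 0 (bsum f L z) / real L" for z
      have Gm: "G \<in> borel_measurable M" unfolding G_def using bsum_measurable[OF fm, of L] by simp
      have G0: "0 \<le> G z" for z by (simp add: G_def)
      have G1: "G z \<le> 1" for z using bsum_bound[of f 1 L z, OF fb] L by (simp add: G_def divide_le_eq abs_le_iff)
      have Gi: "integrable M G" by (rule integrable_const_bound[where B = 1]) (use Gm G0 G1 in auto)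
      have iG: "integrable M (\<lambda>z. indicator S z * G z)" if "S \<in> sets M" for S
        by (rule integrable_const_bound[where B = 1]) (use Gm G0 G1 that in \<open>auto simp: indicator_def\<close>)
      have one: "measure M W' * ?d m W' \<le> (\<Sum>i<wl m W'. \<integral>z. indicator ((T ^^ i) ` W') z * G z \<partial>M) + 2 * real L * measure M W'"
        if W': "W' \<in> VV m" for W'
      proof -
        have W's: "W' \<in> sets M" using VV_sets[OF W'] .
        let ?k = "wl m W'"
        have pw: "?d m W' \<le> (\<Sum>i<?k. G ((T ^^ i) x)) + 2 * real L" if x: "x \<in> W'" for x
        proof -
          have "(\<Sum>i<?k. indicator W ((T ^^ i) x)) = (\<Sum>i<?k. if (T ^^ i) ` W' \<subseteq> W then 1 else (0::real))"
            by (rule sum.cong) (use VV_T_in[OF nm W' W x] in \<open>auto simp: indicator_def\<close>)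
          also have "\<dots> = real (card ({..<?k} \<inter> {i. (T ^^ i) ` W' \<subseteq> W}))" by (simp add: sum.If_cases)
          also have "{..<?k} \<inter> {i. (T ^^ i) ` W' \<subseteq> W} = {i. i < ?k \<and> (T ^^ i) ` W' \<subseteq> W}" by auto
          finally have "bsum f ?k x = a * real ?k - real (TS.cnt n m W W')"
            unfolding bsum_def f_def TS.cnt_def starts_eq[OF nm W' W] by (simp add: sum_subtractf mult.commute)
          moreover have "0 \<le> (\<Sum>i<?k. G ((T ^^ i) x)) + 2 * real L" using G0 by (intro add_nonneg_nonneg sum_nonneg) auto
          ultimately show ?thesis using bsum_window[of f L ?k x, OF fb L] by (simp add: G_def)
        qed
        have iGT: "integrable M (\<lambda>x. indicator W' x * G ((T ^^ i) x))" for i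
          by (rule integrable_const_bound[where B = 1])
             (use measurable_compose[OF Tpm Gm] G0 G1 W's in \<open>auto simp: indicator_def\<close>)
        have iW: "integrable M (\<lambda>x. indicator W' x * c)" for c :: real
          using W's by (intro integrable_mult_left integrable_real_indicator) (auto simp: emeasure_eq_measure)
        have "measure M W' * ?d m W' = (\<integral>x. indicator W' x * ?d m W' \<partial>M)" using W's by simp
        also have "\<dots> \<le> (\<integral>x. (\<Sum>i<?k. indicator W' x * G ((T ^^ i) x)) + indicator W' x * (2 * real L) \<partial>M)"
        proof (rule integral_mono[OF iW])
          show "integrable M (\<lambda>x. (\<Sum>i<?k. indicator W' x * G ((T ^^ i) x)) + indicator W' x * (2 * real L))"
            by (intro Bochner_Integration.integrable_add Bochner_Integration.integrable_sum iGT iW)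
          fix x show "indicator W' x * ?d m W' \<le> (\<Sum>i<?k. indicator W' x * G ((T ^^ i) x)) + indicator W' x * (2 * real L)"
            using pw[of x] by (cases "x \<in> W'") auto
        qed
        also have "\<dots> = (\<Sum>i<?k. \<integral>x. indicator W' x * G ((T ^^ i) x) \<partial>M) + measure M W' * (2 * real L)"
        proof -
          have 1: "(\<integral>x. (\<Sum>i<?k. indicator W' x * G ((T ^^ i) x)) + indicator W' x * (2 * real L) \<partial>M) =
             (\<integral>x. (\<Sum>i<?k. indicator W' x * G ((T ^^ i) x)) \<partial>M) + (\<integral>x. indicator W' x * (2 * real L) \<partial>M)"
            by (rule Bochner_Integration.integral_add[OF Bochner_Integration.integrable_sum[OF iGT] iW])
          have 2: "(\<integral>x. (\<Sum>i<?k. indicator W' x * G ((T ^^ i) x)) \<partial>M) = (\<Sum>i<?k. \<integral>x. indicator W' x * G ((T ^^ i) x) \<partial>M)"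
            by (rule Bochner_Integration.integral_sum[OF iGT])
          have 3: "(\<integral>x. indicator W' x * (2 * real L) \<partial>M) = measure M W' * (2 * real L)" using W's by simp
          show ?thesis unfolding 1 2 3 ..
        qed
        also have "(\<Sum>i<?k. \<integral>x. indicator W' x * G ((T ^^ i) x) \<partial>M) = (\<Sum>i<?k. \<integral>z. indicator ((T ^^ i) ` W') z * G z \<partial>M)"
        proof (rule sum.cong[OF refl])
          fix i
          have "indicator W' x = (indicator ((T ^^ i) ` W') ((T ^^ i) x) :: real)" for x
            unfolding Tp_image by (simp add: indicator_def)
          then have "(\<integral>x. indicator W' x * G ((T ^^ i) x) \<partial>M) = (\<integral>x. (\<lambda>z. indicator ((T ^^ i) ` W') z * G z) ((T ^^ i) x) \<partial>M)" by simp
          also have "\<dots> = (\<integral>z. indicator ((T ^^ i) ` W') z * G z \<partial>M)"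
            by (rule integral_Tp) (use Gm vimage_sets(3)[OF W's] in simp)
          finally show "(\<integral>x. indicator W' x * G ((T ^^ i) x) \<partial>M) = (\<integral>z. indicator ((T ^^ i) ` W') z * G z \<partial>M)" .
        qed
        finally show ?thesis by (simp add: mult.commute)
      qed
      have "(\<Sum>W'\<in>F. measure M W' * ?d m W') \<le> (\<Sum>W'\<in>F. (\<Sum>i<wl m W'. \<integral>z. indicator ((T ^^ i) ` W') z * G z \<partial>M) + 2 * real L * measure M W')"
        by (rule sum_mono) (use one F in blast)
      also have "\<dots> = (\<Sum>W'\<in>F. \<Sum>i<wl m W'. \<integral>z. indicator ((T ^^ i) ` W') z * G z \<partial>M) + 2 * real L * (\<Sum>W'\<in>F. measure M W')"
        by (simp add: sum.distrib sum_distrib_left)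
      also have "(\<Sum>W'\<in>F. \<Sum>i<wl m W'. \<integral>z. indicator ((T ^^ i) ` W') z * G z \<partial>M) = (\<Sum>p\<in>(SIGMA W':F. {..<wl m W'}). \<integral>z. indicator ((T ^^ snd p) ` fst p) z * G z \<partial>M)"
        using F(1) by (subst sum.Sigma) (auto simp: case_prod_beta)
      also have "\<dots> = (\<integral>z. (\<Sum>p\<in>(SIGMA W':F. {..<wl m W'}). indicator ((T ^^ snd p) ` fst p) z * G z) \<partial>M)"
        by (rule Bochner_Integration.integral_sum[symmetric]) (use iG F VV_sets vimage_sets(3) in auto)
      also have "\<dots> \<le> (\<integral>z. G z \<partial>M)"
      proof (rule integral_mono[OF _ Gi])
        show "integrable M (\<lambda>z. \<Sum>p\<in>(SIGMA W':F. {..<wl m W'}). indicator ((T ^^ snd p) ` fst p) z * G z)"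
          by (rule Bochner_Integration.integrable_sum) (use iG F VV_sets vimage_sets(3) in auto)
        fix z
        let ?I = "SIGMA W':F. {..<wl m W'}"
        have finI: "finite ?I" using F(1) by simp
        \<comment> \<open>A point lies on at most one floor, so the indicators add up to at most 1
          and the floor integrals to at most the integral of \<open>G\<close>.\<close>
        have "(\<Sum>p\<in>?I. indicator ((T ^^ snd p) ` fst p) z) \<le> (1::real)"
        proof (cases "\<exists>p\<in>?I. z \<in> (T ^^ snd p) ` fst p")
          case True
          then obtain p where p: "p \<in> ?I" "z \<in> (T ^^ snd p) ` fst p" by blast
          have "(\<Sum>q\<in>?I. indicator ((T ^^ snd q) ` fst q) z) = (\<Sum>q\<in>?I. if q = p then 1 else (0::real))"
          proof (rule sum.cong[OF refl])
            fix q assume q: "q \<in> ?I"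
            have h: "fst q \<in> VV m" "snd q < wl m (fst q)" "fst p \<in> VV m" "snd p < wl m (fst p)" using p(1) q F(2) by auto
            have qp: "q = p" if "z \<in> (T ^^ snd q) ` fst q"
              using tower_disjoint[OF h that p(2)] by (simp add: prod_eq_iff)
            show "indicator ((T ^^ snd q) ` fst q) z = (if q = p then 1 else (0::real))"
            proof (cases "q = p")
              case True
              then show ?thesis using p(2) by (simp only: indicator_simps simp_thms if_True)
            next
              case False
              then have "z \<notin> (T ^^ snd q) ` fst q" using qp by blast
              then show ?thesis using False by (simp only: indicator_simps simp_thms if_False)
            qed
          qed
          also have "\<dots> = 1" using finI p(1) by simp
          finally show ?thesis by simp
        next
          case False
          then have "(\<Sum>p\<in>?I. indicator ((T ^^ snd p) ` fst p) z) = (0::real)" by (intro sum.neutral) (auto simp: indicator_def)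
          then show ?thesis by simp
        qed
        from mult_right_mono[OF this G0] show "(\<Sum>p\<in>?I. indicator ((T ^^ snd p) ` fst p) z * G z) \<le> G z"
          by (simp add: sum_distrib_right)
      qed
      finally have "(\<Sum>W'\<in>F. measure M W' * ?d m W') \<le> (\<integral>z. G z \<partial>M) + 2 * real L * (\<Sum>W'\<in>F. measure M W')" by simp
      also have "\<dots> \<le> (\<integral>z. G z \<partial>M) + 2 * real L * measure M (E m)"
        using sum_wt_le_E[OF F] by (intro add_left_mono mult_left_mono) auto
      finally show "(\<Sum>W'\<in>F. measure M W' * ?d m W') \<le> (\<integral>z. max 0 (bsum f L z) / real L \<partial>M) + 2 * real L * measure M (E m)"
        by (simp add: G_def)
    qed
    have "?D \<longlonglongrightarrow> 0"
    proof (rule LIMSEQ_I)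
      fix e :: real assume e: "0 < e"
      \<comment> \<open>The window length is fixed first; afterwards \<open>m\<close> is taken so
        large that the end effects 2 * L * measure M (E m) are small.\<close>
      obtain L where L: "0 < L" "(\<integral>z. max 0 (bsum f L z) / real L \<partial>M) < e/2"
        using mean_positive_part_small[OF fm fb fz, of "e/2"] e by auto
      have "(\<lambda>m. 2 * real L * measure M (E m)) \<longlonglongrightarrow> 2 * real L * 0" by (intro tendsto_intros measure_E)
      then have "(\<lambda>m. 2 * real L * measure M (E m)) \<longlonglongrightarrow> 0" by simp
      then have "\<forall>\<^sub>F m in sequentially. 2 * real L * measure M (E m) < e/2" by (rule order_tendstoD(2)) (use e in simp)
      then obtain N where N: "\<And>m. m \<ge> N \<Longrightarrow> 2 * real L * measure M (E m) < e/2" by (auto simp: eventually_sequentially)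
      show "\<exists>no. \<forall>m\<ge>no. norm (?D m - 0) < e"
      proof (intro exI[of _ "max N n"] allI impI)
        fix m assume m: "max N n \<le> m"
        then have "N \<le> m" "n \<le> m" by auto
        then have "?D m < e" using bound[OF \<open>n \<le> m\<close> L(1)] L(2) N[OF \<open>N \<le> m\<close>] by linarith
        then show "norm (?D m - 0) < e" using D0[of m] by simp
      qed
    qed
    then show "(\<lambda>m. \<Sum>\<^sub>\<infinity>W'\<in>VV m. measure M W' * max 0 (measure M W * real (wl m W') - real (TS.cnt n m W W'))) \<longlonglongrightarrow> 0"
      by (simp add: a_def)
  qed
qed

text \<open>In the double sum defining an entry of \<open>jmap\<close>, the range conditions single
  out the one block that starts at \<open>stt n W' p\<close>, and the entry vanishes unless column q
  belongs to the same block.\<close>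

lemma jmap_eq_tj:
  assumes cj: "field_involution (cj :: 'k::field \<Rightarrow> 'k)"
  shows "(jmap T E P n :: ('x set \<Rightarrow> 'k mat) \<Rightarrow> _) = tower_system.tj VV wl (\<lambda>n m. stt n) (\<lambda>n m. tyy n) n (Suc n)"
proof -
  interpret TS: tower_system cj VV wl "measure M" "\<lambda>n m. stt n" "\<lambda>n m. tyy n"
    using cj by (rule tower_system_cantor)
  have "jmap T E P n x W' = TS.tj n (Suc n) x W'" for x :: "'x set \<Rightarrow> 'k mat" and W'
  proof (cases "W' \<in> VV (Suc n)")
    case True
    let ?N = "wl (Suc n) W'"
    have nm: "n \<le> Suc n" by simp
    show ?thesis
    proof (rule eq_matI)
      fix p q assume "p < dim_row (TS.tj n (Suc n) x W')" "q < dim_col (TS.tj n (Suc n) x W')"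
      then have pq: "p < ?N" "q < ?N" using True by (auto simp: TS.tj_def)
      let ?S = "{W \<in> VV n. Jset T E P n W W' \<noteq> {}}"
      let ?SS = "SIGMA W:?S. Jset T E P n W W'"
      have J: "Jset T E P n W W' = {b. (\<exists>p<?N. b = stt n W' p) \<and> tyy n W' b = W}" if "W \<in> VV n" for W
        unfolding Jset_def starts_eq[OF nm True that] ..
      have "?S \<subseteq> tyy n W' ` stt n W' ` {..<?N}" using J by auto
      then have finS: "finite ?S" using finite_subset by blast
      have finJ: "finite (Jset T E P n W W')" for W unfolding Jset_def by simp
      let ?b = "stt n W' p"
      have b: "tyy n W' ?b \<in> VV n" using stt_block(1)[OF nm True pq(1)] .
      have in_blk: "j' \<le> r \<and> r < j' + wl n W \<longleftrightarrow> j' = stt n W' r" if W: "W \<in> VV n" "j' \<in> Jset T E P n W W'" and r: "r < ?N" for W j' r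
      proof -
        have j': "j' < ?N" "(T ^^ j') ` W' \<subseteq> W" "tyy n W' j' = W" using W J[OF W(1)] by (auto simp: Jset_def)
        have jE: "(T ^^ j') ` W' \<subseteq> E n" using j'(2) VV_ret(2)[OF W(1)] by blast
        show ?thesis
        proof
          assume "j' \<le> r \<and> r < j' + wl n W"
          then show "j' = stt n W' r" using stt_eq[OF nm True j'(1) jE, of r] j'(3) by simp
        next
          assume "j' = stt n W' r"
          then show "j' \<le> r \<and> r < j' + wl n W" using stt_block(3)[OF nm True r] stt_props(1)[OF nm True, of r] j'(3) by simp
        qed
      qed
      have "jmap T E P n x W' $$ (p,q) = (\<Sum>W\<in>?S. \<Sum>j'\<in>Jset T E P n W W'.
          (if j' \<le> p \<and> p < j' + wl n W \<and> j' \<le> q \<and> q < j' + wl n W then x W $$ (p - j', q - j') else 0))"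
        using True pq by (simp add: jmap_def)
      also have "\<dots> = (\<Sum>(W,j')\<in>?SS. (if j' \<le> p \<and> p < j' + wl n W \<and> j' \<le> q \<and> q < j' + wl n W then x W $$ (p - j', q - j') else 0))"
        by (rule sum.Sigma) (use finS finJ in auto)
      also have "\<dots> = (\<Sum>pr\<in>?SS. if pr = (tyy n W' ?b, ?b) then (if ?b = stt n W' q then x (tyy n W' ?b) $$ (p - ?b, q - ?b) else 0) else 0)"
      proof (rule sum.cong[OF refl])
        fix pr assume pr: "pr \<in> ?SS"
        obtain W j' where e: "pr = (W,j')" by (cases pr)
        have W: "W \<in> VV n" "j' \<in> Jset T E P n W W'" using pr e by auto
        have "tyy n W' j' = W" using W J[OF W(1)] by simp
        then show "(case pr of (W,j') \<Rightarrow> if j' \<le> p \<and> p < j' + wl n W \<and> j' \<le> q \<and> q < j' + wl n W then x W $$ (p - j', q - j') else 0) =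
          (if pr = (tyy n W' ?b, ?b) then (if ?b = stt n W' q then x (tyy n W' ?b) $$ (p - ?b, q - ?b) else 0) else 0)"
          unfolding e prod.case using in_blk[OF W pq(1)] in_blk[OF W pq(2)] by auto
      qed
      also have "\<dots> = (if ?b = stt n W' q then x (tyy n W' ?b) $$ (p - ?b, q - ?b) else 0)"
      proof -
        have fin: "finite ?SS" using finS finJ by auto
        have "?b \<in> Jset T E P n (tyy n W' ?b) W'" unfolding J[OF b] using pq(1) by blast
        then have "(tyy n W' ?b, ?b) \<in> ?SS" using b by auto
        then show ?thesis using fin by (simp add: sum.delta)
      qed
      also have "\<dots> = TS.tj n (Suc n) x W' $$ (p,q)" by (simp add: TS.tj_def blk_index TS.tlab_def True pq)
      finally show "jmap T E P n x W' $$ (p,q) = TS.tj n (Suc n) x W' $$ (p,q)" .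
    qed (use True in \<open>auto simp: TS.tj_def jmap_def\<close>)
  qed (auto simp: TS.tj_def jmap_def)
  then show ?thesis by blast
qed

end

section \<open>Monomials f t^i of the crossed product\<close>

definition mo :: "int \<Rightarrow> ('x \<Rightarrow> 'k) \<Rightarrow> (int \<Rightarrow> 'x \<Rightarrow> 'k::field)" where
  "mo i f = (\<lambda>j x. if j = i then f x else 0)"

text \<open>\<open>cp_mul\<close> sums over the exact support of its left factor, so the case that
  the coefficient at \<open>i0\<close> vanishes is treated apart.\<close>

lemma cp_mul_supp:
  assumes "{i. a i \<noteq> (\<lambda>_. 0)} \<subseteq> {i0}"
  shows "cp_mul T a b k x = a i0 x * b (k - i0) (Tpow T (- i0) x)"
proof (cases "a i0 = (\<lambda>_. 0)")
  case True
  then have e: "{i. a i \<noteq> (\<lambda>_. 0)} = {}" using assms by blast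
  show ?thesis unfolding cp_mul_def e using True by simp
next
  case False
  then have e: "{i. a i \<noteq> (\<lambda>_. 0)} = {i0}" using assms by blast
  show ?thesis unfolding cp_mul_def e by simp
qed

lemma cp_mul_mo: "cp_mul T (mo i f) b = (\<lambda>k x. f x * b (k - i) (Tpow T (- i) x))"
proof (intro ext)
  fix k x
  have "{j. mo i f j \<noteq> (\<lambda>_. 0)} \<subseteq> {i}" by (auto simp: mo_def)
  from cp_mul_supp[OF this] show "cp_mul T (mo i f) b k x = f x * b (k - i) (Tpow T (- i) x)" by (simp add: mo_def)
qed

lemma cp_mul_mo_mo: "cp_mul T (mo i f) (mo j g) = mo (i + j) (\<lambda>x. f x * g (Tpow T (- i) x))"
  unfolding cp_mul_mo by (intro ext) (auto simp: mo_def)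

lemma Tpow_simps: "Tpow T 0 x = x" "Tpow T 1 x = T x" "Tpow T (- 1) x = Hilbert_Choice.inv T x"
  "Tpow T (int n) x = (T ^^ n) x" "Tpow T (- int n) x = (Hilbert_Choice.inv T ^^ n) x"
  by (auto simp: Tpow_def)

lemma cp_star_mo: "cj 0 = 0 \<Longrightarrow> cp_star T cj (mo i f) = mo (- i) (\<lambda>x. cj (f (Tpow T i x)))"
  by (intro ext) (auto simp: cp_star_def mo_def)

lemma cp_t_mo: "cp_t = mo 1 (\<lambda>_. 1)" and cp_chi_mo: "cp_chi S = mo 0 (\<lambda>x. if x \<in> S then 1 else 0)"
  by (auto simp: cp_t_def cp_chi_def mo_def fun_eq_iff)

lemma loc_const_const: "loc_const (\<lambda>_. c)"
  unfolding loc_const_def by blast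

lemma loc_const_compose:
  fixes h :: "'x::topological_space \<Rightarrow> 'x"
  assumes "loc_const f" "continuous_on UNIV h" shows "loc_const (\<lambda>x. g (f (h x)))"
  unfolding loc_const_def
proof
  fix x
  obtain U where U: "open U" "h x \<in> U" "\<forall>z\<in>U. f z = f (h x)" using assms(1) unfolding loc_const_def by blast
  show "\<exists>U. open U \<and> x \<in> U \<and> (\<forall>z\<in>U. g (f (h z)) = g (f (h x)))"
  proof (intro exI[of _ "h -` U"] conjI ballI)
    show "open (h -` U)" by (rule open_vimage[OF U(1) assms(2)])
    show "x \<in> h -` U" using U(2) by simp
    fix z assume "z \<in> h -` U"
    then have "f (h z) = f (h x)" using U(3) by blast
    then show "g (f (h z)) = g (f (h x))" by (rule arg_cong)
  qed
qed

section \<open>Locally constant functions and their images in the tower matrices\<close>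

context cantor_system
begin

definition level_fun :: "nat \<Rightarrow> ('x \<Rightarrow> 'k) \<Rightarrow> bool" where
  "level_fun n f \<longleftrightarrow> (\<forall>u v. same n u v \<longrightarrow> f u = f v)"

lemma same_refl: "same n u u" by (simp add: same_def)

lemma same_trans: "same n u v \<Longrightarrow> same n v w \<Longrightarrow> same n u w" by (auto simp: same_def)

text \<open>Induction on the generated topology; for an intersection the larger level works because
  the partitions are nested.\<close>

lemma open_cells:
  assumes "open U" "x \<in> U" shows "\<exists>n. \<forall>v. same n x v \<longrightarrow> v \<in> U"
proof -
  have "generate_topology (\<Union>n. insert (E n) (P n)) U" using assms(1) P_gen by simp
  then have "\<forall>x\<in>U. \<exists>n. \<forall>v. same n x v \<longrightarrow> v \<in> U"
  proof (induction rule: generate_topology.induct)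
    case UNIV then show ?case by simp
  next
    case (Int a b)
    show ?case
    proof
      fix x assume "x \<in> a \<inter> b"
      then obtain n m where nm: "\<forall>v. same n x v \<longrightarrow> v \<in> a" "\<forall>v. same m x v \<longrightarrow> v \<in> b" using Int.IH by blast
      have "\<forall>v. same (max n m) x v \<longrightarrow> v \<in> a \<inter> b"
        using nm same_mono[of n "max n m" x] same_mono[of m "max n m" x] by simp
      then show "\<exists>n. \<forall>v. same n x v \<longrightarrow> v \<in> a \<inter> b" by blast
    qed
  next
    case (UN K) then show ?case by blast
  next
    case (Basis s)
    then obtain n where n: "s \<in> insert (E n) (P n)" by blast
    then show ?case by (intro ballI exI[of _ n]) (auto simp: same_def)
  qed
  then show ?thesis using assms(2) by blast
qed

lemma cell_open: "open {v. same n x v}"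
proof -
  obtain A where A: "A \<in> insert (E n) (P n)" "x \<in> A" using cell_ex by blast
  have "{v. same n x v} = A"
  proof (intro equalityI subsetI)
    fix v assume "v \<in> {v. same n x v}"
    then show "v \<in> A" using A unfolding same_def by blast
  next
    fix v assume "v \<in> A"
    then show "v \<in> {v. same n x v}" using sameI[OF A] by simp
  qed
  moreover have "open A" using A(1) E_clopen P_clopen by (auto simp: clopen_set_def)
  ultimately show ?thesis by simp
qed

text \<open>By compactness finitely many cells on which \<open>f\<close> is constant cover the
  space, and the largest of their levels serves everywhere.\<close>

lemma loc_const_level:
  assumes "loc_const f" shows "\<exists>n. level_fun n f"
proof -
  have "\<exists>n. \<forall>v. same n x v \<longrightarrow> f v = f x" for x
  proof -
    obtain U where U: "open U" "x \<in> U" "\<forall>z\<in>U. f z = f x" using assms unfolding loc_const_def by blast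
    then show ?thesis using open_cells[OF U(1,2)] by blast
  qed
  then obtain N where N: "\<And>x v. same (N x) x v \<Longrightarrow> f v = f x" by metis
  have "UNIV \<subseteq> (\<Union>x\<in>UNIV. {v. same (N x) x v})" using same_refl by blast
  note cover = compactE_image[OF X_compact cell_open this]
  obtain C where C: "finite C" "UNIV \<subseteq> (\<Union>x\<in>C. {v. same (N x) x v})" by (rule cover)
  have "level_fun (Max (N ` C)) f" unfolding level_fun_def
  proof (intro allI impI)
    fix u v assume uv: "same (Max (N ` C)) u v"
    obtain x where x: "x \<in> C" "same (N x) x u" using C(2) by blast
    have Nx: "N x \<le> Max (N ` C)" using C(1) x(1) by simp
    have "same (N x) x v" by (rule same_trans[OF x(2) same_mono[OF Nx uv]])
    then show "f u = f v" using N[of x v] N[OF x(2)] by simp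
  qed
  then show ?thesis by blast
qed

text \<open>The indicator of \<open>Z\<close> is g g* for the generator g given by \<open>Z\<close>
  and t. Together with the constants these indicators span the functions of level \<open>n\<close>,
  the indicator of \<open>E n\<close> being the complement.\<close>

lemma mo_level_in_An:
  assumes cj: "field_involution (cj :: 'k::field \<Rightarrow> 'k)" and f: "level_fun n (f :: 'x \<Rightarrow> 'k)"
  shows "mo 0 f \<in> An T cj P n"
  unfolding An_def gen_star_subalg_def
proof (rule InterI, elim CollectE conjE)
  fix B :: "(int \<Rightarrow> 'x \<Rightarrow> 'k) set"
  let ?C = "cp_alg T cj"
  assume gen: "{cp_mul T (cp_chi Z) cp_t | Z. Z \<in> P n} \<subseteq> B" and one: "rone ?C \<in> B"
    and ops: "\<forall>x\<in>B. \<forall>y\<in>B. radd ?C x y \<in> B \<and> rmul ?C x y \<in> B" and sm: "\<forall>c. \<forall>x\<in>B. rsmul ?C c x \<in> B"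
    and star: "\<forall>x\<in>B. rstar ?C x \<in> B"
  note cjs = field_involutionD[OF cj]
  have add: "(\<lambda>i x. a i x + b i x) \<in> B" if "a \<in> B" "b \<in> B" for a b using ops that by (simp add: cp_alg_def)
  have scal: "(\<lambda>i x. c * a i x) \<in> B" if "a \<in> B" for a c using sm that by (simp add: cp_alg_def)
  have chi: "mo 0 (\<lambda>x. if x \<in> Z then 1 else 0) \<in> B" if Z: "Z \<in> P n" for Z
  proof -
    let ?g = "cp_mul T (cp_chi Z) cp_t"
    have g: "?g \<in> B" using gen Z by blast
    have g1: "?g = mo 1 (\<lambda>x. if x \<in> Z then 1 else 0)"
      unfolding cp_chi_mo cp_t_mo cp_mul_mo_mo by (simp add: mo_def fun_eq_iff)
    have "cp_mul T ?g (cp_star T cj ?g) \<in> B" using ops star g by (simp add: cp_alg_def)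
    also have "cp_mul T ?g (cp_star T cj ?g) = mo 0 (\<lambda>x. if x \<in> Z then 1 else 0)"
      unfolding g1 cp_star_mo[of cj, OF cjs(4)] cp_mul_mo_mo using T_Ti by (auto simp: mo_def fun_eq_iff Tpow_simps cjs Ti_def)
    finally show ?thesis .
  qed
  have const: "mo 0 (\<lambda>_. c) \<in> B" for c
  proof -
    have "(\<lambda>i x. c * (if i = 0 then 1 else 0)) \<in> B" using scal[OF one[unfolded cp_alg_def, simplified]] .
    also have "(\<lambda>i x. c * (if i = 0 then 1 else 0)) = mo 0 (\<lambda>_. c)" by (auto simp: mo_def fun_eq_iff)
    finally show ?thesis .
  qed
  \<comment> \<open>\<open>y\<close> lies in \<open>E n\<close>, so the constant \<open>f y\<close>
    is already right there; each \<open>Z\<close> adds the difference to its own value.\<close>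
  define d where "d Z = f (SOME z. z \<in> Z) - f y" for Z
  have "mo 0 (\<lambda>x. f y + (\<Sum>Z\<in>S. d Z * (if x \<in> Z then 1 else 0))) \<in> B" if "finite S" "S \<subseteq> P n" for S
    using that
  proof (induction S rule: finite_induct)
    case empty then show ?case using const by simp
  next
    case (insert Z S)
    have "(\<lambda>i x. d Z * mo 0 (\<lambda>x. if x \<in> Z then 1 else 0) i x) \<in> B" using insert.prems by (intro scal chi) simp
    from add[OF this insert.IH] insert.prems
    have "(\<lambda>i x. d Z * mo 0 (\<lambda>x. if x \<in> Z then 1 else 0) i x + mo 0 (\<lambda>x. f y + (\<Sum>Z\<in>S. d Z * (if x \<in> Z then 1 else 0))) i x) \<in> B" by simp
    also have "(\<lambda>i x. d Z * mo 0 (\<lambda>x. if x \<in> Z then 1 else 0) i x + mo 0 (\<lambda>x. f y + (\<Sum>Z\<in>S. d Z * (if x \<in> Z then 1 else 0))) i x)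
       = mo 0 (\<lambda>x. f y + (\<Sum>Z\<in>insert Z S. d Z * (if x \<in> Z then 1 else 0)))"
      using insert.hyps by (auto simp: mo_def fun_eq_iff)
    finally show ?case .
  qed
  from this[of "P n"] have "mo 0 (\<lambda>x. f y + (\<Sum>Z\<in>P n. d Z * (if x \<in> Z then 1 else 0))) \<in> B" using P_fin by blast
  also have "(\<lambda>x. f y + (\<Sum>Z\<in>P n. d Z * (if x \<in> Z then 1 else 0))) = f"
  proof
    fix x
    show "f y + (\<Sum>Z\<in>P n. d Z * (if x \<in> Z then 1 else 0)) = f x"
    proof (cases "x \<in> E n")
      case True
      then have "(\<Sum>Z\<in>P n. d Z * (if x \<in> Z then 1 else 0)) = 0" using P_cover by (intro sum.neutral) auto
      moreover have "same n x y" using True y_in_E by (intro sameI[of "E n"]) auto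
      ultimately show ?thesis using f by (simp add: level_fun_def)
    next
      case False
      then obtain Z where Z: "Z \<in> P n" "x \<in> Z" using P_cover by blast
      have "(\<Sum>Z'\<in>P n. d Z' * (if x \<in> Z' then 1 else 0)) = (\<Sum>Z'\<in>P n. if Z' = Z then d Z else 0)"
      proof (rule sum.cong[OF refl])
        fix Z' assume "Z' \<in> P n"
        then have "x \<in> Z' \<longleftrightarrow> Z' = Z" using cell_unique[of Z' n Z x] Z by blast
        then show "d Z' * (if x \<in> Z' then 1 else 0) = (if Z' = Z then d Z else 0)" by auto
      qed
      also have "\<dots> = d Z" using Z(1) P_fin by simp
      finally have "(\<Sum>Z'\<in>P n. d Z' * (if x \<in> Z' then 1 else 0)) = d Z" .
      moreover have "(SOME z. z \<in> Z) \<in> Z" using Z(2) by (rule someI)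
      then have "same n (SOME z. z \<in> Z) x" using Z by (intro sameI[of Z]) auto
      then have "f (SOME z. z \<in> Z) = f x" using f unfolding level_fun_def by blast
      ultimately show ?thesis by (simp add: d_def)
    qed
  qed
  finally show "mo 0 f \<in> B" .
qed

lemma s_el_mo: "s_el T E n = mo 1 (\<lambda>x. if x \<notin> E n then 1 else 0)"
  unfolding s_el_def cp_chi_mo cp_t_mo cp_mul_mo_mo by (auto simp: mo_def fun_eq_iff)

text \<open>The p-th power of s_n is t^p cut down to points whose last p steps avoid
  \<open>E n\<close>. On floor \<open>p\<close> over \<open>W\<close> this holds automatically, as
  floors 1 to p of a tower avoid \<open>E n\<close>.\<close>

lemma pow_s_chi:
  assumes W: "W \<in> VV n" and p: "p < wl n W"
  shows "cp_mul T (cp_pow T (s_el T E n) p) (cp_chi W) = (mo (int p) (\<lambda>x. if x \<in> (T ^^ p) ` W then 1 else 0) :: int \<Rightarrow> 'x \<Rightarrow> 'k::field)"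
proof -
  define g where "g q x = (\<Prod>i<q. if (Ti ^^ i) x \<notin> E n then 1 else (0::'k))" for q x
  have pw: "cp_pow T (s_el T E n) q = mo (int q) (g q)" for q
  proof (induction q)
    case 0 then show ?case by (auto simp: cp_pow_def mo_def g_def fun_eq_iff)
  next
    case (Suc q)
    have "cp_pow T (s_el T E n) (Suc q) = cp_mul T (s_el T E n) (cp_pow T (s_el T E n) q)" by (simp add: cp_pow_def)
    also have "\<dots> = mo (1 + int q) (\<lambda>x. (if x \<notin> E n then 1 else 0) * g q (Tpow T (- 1) x))"
      unfolding Suc unfolding s_el_mo cp_mul_mo_mo ..
    also have "(\<lambda>x. (if x \<notin> E n then 1 else 0) * g q (Tpow T (- 1) x)) = g (Suc q)"
    proof
      fix x
      show "(if x \<notin> E n then 1 else 0) * g q (Tpow T (- 1) x) = g (Suc q) x"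
        unfolding g_def Tpow_simps Ti_def[symmetric] prod.lessThan_Suc_shift by (simp add: funpow_swap1)
    qed
    finally show ?case by simp
  qed
  have "(\<lambda>x. g p x * (if Tpow T (- int p) x \<in> W then 1 else 0)) = (\<lambda>x. if x \<in> (T ^^ p) ` W then 1 else 0)"
  proof
    fix x
    show "g p x * (if Tpow T (- int p) x \<in> W then 1 else 0) = (if x \<in> (T ^^ p) ` W then 1 else 0)"
    proof (cases "(Ti ^^ p) x \<in> W")
      case True
      define u where "u = (Ti ^^ p) x"
      have x: "x = (T ^^ p) u" by (simp add: u_def)
      have "(Ti ^^ i) x \<notin> E n" if "i < p" for i
      proof -
        have "x = (T ^^ i) ((T ^^ (p - i)) u)" unfolding x using that by (metis comp_apply funpow_add le_add_diff_inverse less_imp_le)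
        then have "(Ti ^^ i) x = (T ^^ (p - i)) u" using Tp_Tip(2) by metis
        then show ?thesis using VV_ret(4)[OF W, of u "p - i"] True p that by (simp add: u_def)
      qed
      then have "g p x = 1" by (simp add: g_def)
      then show ?thesis using True by (simp add: Tpow_simps Ti_def[symmetric] Tp_image)
    next
      case False
      then show ?thesis by (simp add: Tpow_simps Ti_def[symmetric] Tp_image)
    qed
  qed
  then show ?thesis unfolding pw cp_chi_mo cp_mul_mo_mo by simp
qed

text \<open>The power of the adjoint asks that the next q iterates of a base point avoid
  \<open>E n\<close>, which is true because q is below the return time. So the matrix unit is the
  indicator of floor \<open>p\<close> times t^(p - q).\<close>

lemma e_el_mo:
  assumes cj: "field_involution (cj :: 'k::field \<Rightarrow> 'k)" and W: "W \<in> VV n" and p: "p < wl n W" and q: "q < wl n W"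
  shows "e_el T cj E n W p q = mo (int p - int q) (\<lambda>x. if x \<in> (T ^^ p) ` W then 1 else 0)"
proof -
  note cjs = field_involutionD[OF cj]
  define g where "g r x = (\<Prod>i<r. if (T ^^ Suc i) x \<notin> E n then 1 else (0::'k))" for r x
  have st: "cp_star T cj (s_el T E n) = mo (- 1) (\<lambda>x. if T x \<notin> E n then 1 else 0)"
    unfolding s_el_mo cp_star_mo[of cj, OF cjs(4)] by (auto simp: mo_def fun_eq_iff Tpow_simps cjs)
  have pw: "cp_pow T (cp_star T cj (s_el T E n)) r = mo (- int r) (g r)" for r
  proof (induction r)
    case 0 then show ?case by (auto simp: cp_pow_def mo_def g_def fun_eq_iff)
  next
    case (Suc r)
    have "cp_pow T (cp_star T cj (s_el T E n)) (Suc r) = cp_mul T (cp_star T cj (s_el T E n)) (cp_pow T (cp_star T cj (s_el T E n)) r)"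
      by (simp add: cp_pow_def)
    also have "\<dots> = mo (- 1 + - int r) (\<lambda>x. (if T x \<notin> E n then 1 else 0) * g r (Tpow T (- (- 1)) x))"
      unfolding Suc unfolding st cp_mul_mo_mo ..
    also have "(\<lambda>x. (if T x \<notin> E n then 1 else 0) * g r (Tpow T (- (- 1)) x)) = g (Suc r)"
    proof
      fix x
      show "(if T x \<notin> E n then 1 else 0) * g r (Tpow T (- (- 1)) x) = g (Suc r) x"
        unfolding g_def prod.lessThan_Suc_shift by (simp add: funpow_swap1 Tpow_simps)
    qed
    finally show ?case by simp
  qed
  have "(\<lambda>x. (if x \<in> (T ^^ p) ` W then 1 else 0) * g q (Tpow T (- int p) x)) = (\<lambda>x. if x \<in> (T ^^ p) ` W then 1 else 0)"
  proof
    fix x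
    show "(if x \<in> (T ^^ p) ` W then 1 else 0) * g q (Tpow T (- int p) x) = (if x \<in> (T ^^ p) ` W then 1 else 0)"
    proof (cases "x \<in> (T ^^ p) ` W")
      case True
      then have u: "(Ti ^^ p) x \<in> W" by (simp add: Tp_image)
      have "(T ^^ Suc i) ((Ti ^^ p) x) \<notin> E n" if "i < q" for i
        using VV_ret(4)[OF W u, of "Suc i"] that q by simp
      then have "g q ((Ti ^^ p) x) = 1" unfolding g_def by (intro prod.neutral) (simp del: funpow.simps)
      then show ?thesis by (simp add: Tpow_simps Ti_def[symmetric])
    qed simp
  qed
  then show ?thesis unfolding e_el_def pow_s_chi[OF W p] pw cp_mul_mo_mo by simp
qed

text \<open>On floor \<open>p\<close> the power t^i occurs in only one matrix unit, the one with
  column p - i. Comparing coefficients shows that \<open>X\<close> satisfies the equation in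
  \<open>piN\<close> and is the only matrix to do so, which evaluates the description
  operator.\<close>

lemma piN_eq:
  assumes cj: "field_involution (cj :: 'k::field \<Rightarrow> 'k)" and W: "W \<in> VV n"
    and X: "X \<in> carrier_mat (wl n W) (wl n W)"
    and a: "\<And>p u i. p < wl n W \<Longrightarrow> u \<in> W \<Longrightarrow>
       a i ((T ^^ p) u) = (if 0 \<le> int p - i \<and> int p - i < int (wl n W) then X $$ (p, nat (int p - i)) else 0)"
  shows "piN T cj E P n a W = X"
proof -
  let ?N = "wl n W"
  let ?rhs = "\<lambda>x i z. \<Sum>p<?N. \<Sum>q<?N. x $$ (p, q) * e_el T cj E n W p q i z"
  have rhs: "?rhs x i ((T ^^ p) u) = (if 0 \<le> int p - i \<and> int p - i < int ?N then x $$ (p, nat (int p - i)) else 0)"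
    if p: "p < ?N" and u: "u \<in> W" for x :: "'k mat" and p u i
  proof -
    have z: "(T ^^ p) u \<in> (T ^^ p') ` W \<longleftrightarrow> p' = p" if "p' < ?N" for p'
      using tower_disjoint[OF W p W that, of "(T ^^ p) u"] u by blast
    have "?rhs x i ((T ^^ p) u) = (\<Sum>p'<?N. \<Sum>q<?N. if p' = p then (if i = int p - int q then x $$ (p, q) else 0) else 0)"
      by (intro sum.cong refl) (auto simp: e_el_mo[OF cj W] mo_def z)
    also have "\<dots> = (\<Sum>p'<?N. if p' = p then (\<Sum>q<?N. if i = int p - int q then x $$ (p, q) else 0) else 0)"
      by (intro sum.cong refl) simp
    also have "\<dots> = (\<Sum>q<?N. if i = int p - int q then x $$ (p, q) else 0)" using p by simp
    also have "\<dots> = (if 0 \<le> int p - i \<and> int p - i < int ?N then x $$ (p, nat (int p - i)) else 0)"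
    proof (cases "0 \<le> int p - i \<and> int p - i < int ?N")
      case True
      have "(\<Sum>q<?N. if i = int p - int q then x $$ (p, q) else 0) = (\<Sum>q<?N. if q = nat (int p - i) then x $$ (p, q) else 0)"
        by (intro sum.cong refl) (use True in auto)
      also have "\<dots> = x $$ (p, nat (int p - i))" using True by (simp add: nat_less_iff)
      finally show ?thesis using True by simp
    next
      case False
      have "(\<Sum>q<?N. if i = int p - int q then x $$ (p, q) else 0) = 0"
        by (intro sum.neutral) (use False in auto)
      then show ?thesis using False by auto
    qed
    finally show ?thesis .
  qed
  have rhs0: "?rhs x i z = 0" if "\<And>p. p < ?N \<Longrightarrow> z \<notin> (T ^^ p) ` W" for x :: "'k mat" and i z
    by (intro sum.neutral ballI) (use that in \<open>simp add: e_el_mo[OF cj W] mo_def\<close>)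
  have hs: "{i. h_el T E P n W i \<noteq> (\<lambda>_. 0::'k)} \<subseteq> {0}"
  proof -
    have "h_el T E P n W i = (\<lambda>_. 0::'k)" if "i \<noteq> 0" for i using that by (simp add: h_el_def cp_chi_def fun_eq_iff)
    then show ?thesis by blast
  qed
  have lhs: "cp_mul T (h_el T E P n W) a i z = h_el T E P n W 0 z * a i z" for i z
    using cp_mul_supp[OF hs, of T a i z] by (simp add: Tpow_simps)
  have h1: "h_el T E P n W 0 ((T ^^ p) u) = (1::'k)" if p: "p < ?N" and u: "u \<in> W" for p u
  proof -
    have "h_el T E P n W 0 ((T ^^ p) u) = (\<Sum>l<?N. if l = p then 1 else (0::'k))"
      unfolding h_el_def cp_chi_def
    proof (intro sum.cong refl)
      fix l assume "l \<in> {..<?N}"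
      then show "(if 0 = (0::int) \<and> (T ^^ p) u \<in> (T ^^ l) ` W then 1 else 0) = (if l = p then 1 else (0::'k))"
        using tower_disjoint[OF W p W, of l "(T ^^ p) u"] u by auto
    qed
    then show ?thesis using p by simp
  qed
  have h0: "h_el T E P n W 0 z = (0::'k)" if "\<And>p. p < ?N \<Longrightarrow> z \<notin> (T ^^ p) ` W" for z
    unfolding h_el_def cp_chi_def by (intro sum.neutral) (use that in auto)
  have sol: "cp_mul T (h_el T E P n W) a = ?rhs X"
  proof (intro ext)
    fix i z
    show "cp_mul T (h_el T E P n W) a i z = ?rhs X i z"
    proof (cases "\<exists>p<?N. z \<in> (T ^^ p) ` W")
      case True
      then obtain p u where p: "p < ?N" "u \<in> W" "z = (T ^^ p) u" by blast
      show ?thesis unfolding lhs p(3) h1[OF p(1,2)] rhs[OF p(1,2)] a[OF p(1,2)] by simp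
    next
      case False
      then show ?thesis using h0[of z] rhs0[of z X i] lhs by simp
    qed
  qed
  have "(THE x. x \<in> carrier_mat ?N ?N \<and> cp_mul T (h_el T E P n W) a = ?rhs x) = X"
  proof (rule the_equality)
    show "X \<in> carrier_mat ?N ?N \<and> cp_mul T (h_el T E P n W) a = ?rhs X" using X sol by blast
    fix x assume x: "x \<in> carrier_mat ?N ?N \<and> cp_mul T (h_el T E P n W) a = ?rhs x"
    then have eq: "?rhs x i z = ?rhs X i z" for i z using sol by metis
    obtain u where u: "u \<in> W" using VV_ne[OF W] by blast
    show "x = X"
    proof (rule eq_matI)
      fix p q assume "p < dim_row X" "q < dim_col X"
      then have pq: "p < ?N" "q < ?N" using X by auto
      show "x $$ (p,q) = X $$ (p,q)"
        using eq[of "int p - int q" "(T ^^ p) u"] rhs[OF pq(1) u, of x "int p - int q"] rhs[OF pq(1) u, of X "int p - int q"] pq(2) by simp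
    qed (use x X in auto)
  qed
  then show ?thesis using W by (simp add: piN_def)
qed

lemma piN_fun:
  assumes cj: "field_involution (cj :: 'k::field \<Rightarrow> 'k)" and f: "level_fun n (f :: 'x \<Rightarrow> 'k)"
  shows "piN T cj E P n (mo 0 f) = (\<lambda>W. if W \<in> VV n then
     mat (wl n W) (wl n W) (\<lambda>(p,q). if p = q then f ((T ^^ p) (SOME u. u \<in> W)) else 0) else 0\<^sub>m 0 0)"
proof
  fix W
  show "piN T cj E P n (mo 0 f) W = (if W \<in> VV n then
     mat (wl n W) (wl n W) (\<lambda>(p,q). if p = q then f ((T ^^ p) (SOME u. u \<in> W)) else 0) else 0\<^sub>m 0 0)"
  proof (cases "W \<in> VV n")
    case True
    have su: "(SOME u. u \<in> W) \<in> W" using VV_ne[OF True] some_in_eq by blast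
    have "piN T cj E P n (mo 0 f) W = mat (wl n W) (wl n W) (\<lambda>(p,q). if p = q then f ((T ^^ p) (SOME u. u \<in> W)) else 0)"
    proof (rule piN_eq[OF cj True])
      fix p u i assume p: "p < wl n W" and u: "u \<in> W"
      have "f ((T ^^ p) u) = f ((T ^^ p) (SOME u. u \<in> W))"
        using VV_same[OF True u su, of p] p f by (simp add: level_fun_def)
      then show "mo 0 f i ((T ^^ p) u) = (if 0 \<le> int p - i \<and> int p - i < int (wl n W) then
        mat (wl n W) (wl n W) (\<lambda>(p,q). if p = q then f ((T ^^ p) (SOME u. u \<in> W)) else 0) $$ (p, nat (int p - i)) else 0)"
        using p by (auto simp: mo_def nat_less_iff)
    qed simp
    then show ?thesis using True by simp
  qed (simp add: piN_def)
qed

text \<open>The coefficient of t is 1 on every floor except the base, which lies in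
  \<open>E n\<close>: the truncated shift.\<close>

lemma piN_s:
  assumes cj: "field_involution (cj :: 'k::field \<Rightarrow> 'k)"
  shows "piN T cj E P n (s_el T E n) = (\<lambda>W. if W \<in> VV n then
     mat (wl n W) (wl n W) (\<lambda>(p,q). if p = Suc q then 1 else 0) else 0\<^sub>m 0 0)"
proof
  fix W
  show "piN T cj E P n (s_el T E n) W = (if W \<in> VV n then
     mat (wl n W) (wl n W) (\<lambda>(p,q). if p = Suc q then 1 else 0) else 0\<^sub>m 0 0)"
  proof (cases "W \<in> VV n")
    case True
    have "piN T cj E P n (s_el T E n) W = mat (wl n W) (wl n W) (\<lambda>(p,q). if p = Suc q then 1 else 0)"
    proof (rule piN_eq[OF cj True])
      fix p u i assume p: "p < wl n W" and u: "u \<in> W"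
      have "(T ^^ p) u \<notin> E n \<longleftrightarrow> p \<noteq> 0"
        using VV_ret(4)[OF True u, of p] VV_ret(2)[OF True u] p by (cases "p = 0") auto
      then show "s_el T E n i ((T ^^ p) u) = (if 0 \<le> int p - i \<and> int p - i < int (wl n W) then
        mat (wl n W) (wl n W) (\<lambda>(p,q). if p = Suc q then 1 else 0) $$ (p, nat (int p - i)) else (0::'k))"
        using p by (auto simp: s_el_mo mo_def nat_less_iff)
    qed simp
    then show ?thesis using True by simp
  qed (simp add: piN_def)
qed

end

lemma is_star_ringD:
  assumes "is_star_ring R" "x \<in> rcar R"
  shows "rmul R (rone R) x = x" "rmul R x (rone R) = x" "rstar R (rstar R x) = x" "rstar R x \<in> rcar R"
    and "w \<in> rcar R \<Longrightarrow> rstar R (radd R x w) = radd R (rstar R x) (rstar R w)"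
    and "w \<in> rcar R \<Longrightarrow> rstar R (rmul R x w) = rmul R (rstar R w) (rstar R x)"
    and "w \<in> rcar R \<Longrightarrow> z \<in> rcar R \<Longrightarrow> rmul R (rmul R x w) z = rmul R x (rmul R w z)"
proof -
  note c = assms(1)[unfolded is_star_ring_def, THEN conjunct2, THEN conjunct2, THEN conjunct2]
  note c2 = c[THEN conjunct2, THEN conjunct2, THEN conjunct2]
  note one = c2[THEN conjunct1, THEN bspec, OF assms(2), THEN conjunct2, THEN conjunct2]
  show "rmul R (rone R) x = x" by (rule one[THEN conjunct1])
  show "rmul R x (rone R) = x" by (rule one[THEN conjunct2])
  show "rstar R (rstar R x) = x" by (rule c2[THEN conjunct2, THEN conjunct2, THEN bspec, OF assms(2)])
  show "rstar R x \<in> rcar R" by (rule c[THEN conjunct1, THEN bspec, OF assms(2), THEN conjunct2])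
  note star = c2[THEN conjunct2, THEN conjunct1, THEN bspec, OF assms(2), THEN bspec]
  show "rstar R (radd R x w) = radd R (rstar R x) (rstar R w)" if "w \<in> rcar R" by (rule star[OF that, THEN conjunct1])
  show "rstar R (rmul R x w) = rmul R (rstar R w) (rstar R x)" if "w \<in> rcar R" by (rule star[OF that, THEN conjunct2])
  show "rmul R (rmul R x w) z = rmul R x (rmul R w z)" if "w \<in> rcar R" "z \<in> rcar R"
    by (rule c[THEN conjunct2, THEN conjunct1, THEN bspec, OF assms(2), THEN bspec, OF that(1), THEN bspec, OF that(2),
      THEN conjunct2, THEN conjunct1])
qed

lemma star_kalg_iso_imp_kalg_iso: "star_kalg_iso R S \<Longrightarrow> kalg_iso R S"
  unfolding star_kalg_iso_def kalg_iso_def by (elim exE conjE) (rule exI, intro conjI; assumption)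

section \<open>The crossed product\<close>

locale cantor_algebra = cantor_system T M y E P
  for T :: "'x::metric_space \<Rightarrow> 'x" and M y E P +
  fixes cj :: "'k::field \<Rightarrow> 'k"
  assumes cj_inv: "field_involution cj"
begin

sublocale TS: ergodic_tower_system cj VV wl "measure M" "\<lambda>n m. stt n" "\<lambda>n m. tyy n"
  by (rule ergodic_tower_system_cantor[OF cj_inv])

sublocale RS: rank_system TS.TC "\<lambda>x y W. x W + y W" "\<lambda>x y W. x W * y W" "\<lambda>c x W. c \<cdot>\<^sub>m x W" TS.tone TS.tzero
    "\<lambda>x W. ctrans cj (x W)" TS.trk "\<lambda>n. TS.tj n (Suc n)"
  by (rule TS.rank_system_T)

lemma Rinf_eq_lim_alg: "Rinf T cj M E P = RS.lim_alg"
proof -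
  have l: "Rlift T E P m p = lim_lift (\<lambda>n. TS.tj n (Suc n)) m p" for m and p :: "nat \<times> ('x set \<Rightarrow> 'k mat)"
    unfolding Rlift_def lim_lift_def jmap_eq_tj[OF cj_inv] ..
  have c: "Rn_car T E P n = TS.TC n" for n unfolding Rn_car_def TS.TC_def ..
  show ?thesis
    unfolding RS.lim_alg_def Rinf_def l c TS.tone_def TS.tzero_def TS.trk_def ..
qed

sublocale RA: rank_alg "Rinf T cj M E P"
  unfolding Rinf_eq_lim_alg by (rule RS.rank_alg_lim_alg)

lemma iso_MK: "star_kalg_iso (Rrk T cj M E P) (MK cj)"
  unfolding Rrk_def Rinf_eq_lim_alg by (rule TS.tower_completion_iso)

lemma star_regular_Rrk: "pos_def_inv cj \<Longrightarrow> star_regular (Rrk T cj M E P)"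
  unfolding Rrk_def Rinf_eq_lim_alg by (rule TS.tower_completion_star_regular)

lemmas cjs = field_involutionD[OF cj_inv]

abbreviation "CP \<equiv> cp_alg T cj"

lemma Tpow_cont: "continuous_on UNIV (Tpow T i)"
  using funpow_cont[OF T_cont, of "nat i"] funpow_cont[OF Ti_cont, of "nat (- i)"] by (simp add: Tpow_def Ti_def)

lemma mo_car: assumes "loc_const f" shows "mo i f \<in> rcar CP"
proof -
  have "{j. mo i f j \<noteq> (\<lambda>_. 0)} \<subseteq> {i}" by (auto simp: mo_def)
  then have "finite {j. mo i f j \<noteq> (\<lambda>_. 0)}" by (rule finite_subset) simp
  moreover have "loc_const (mo i f j)" for j
    using assms loc_const_const[of 0] by (cases "j = i") (simp_all add: mo_def)
  ultimately show ?thesis by (simp add: cp_alg_def)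
qed

lemma star_car: assumes "a \<in> rcar CP" shows "cp_star T cj a \<in> rcar CP"
proof -
  have a: "finite {i. a i \<noteq> (\<lambda>_. 0)}" "\<And>i. loc_const (a i)" using assms by (auto simp: cp_alg_def)
  have "{k. cp_star T cj a k \<noteq> (\<lambda>_. 0)} \<subseteq> uminus ` {i. a i \<noteq> (\<lambda>_. 0)}"
  proof
    fix k assume k: "k \<in> {k. cp_star T cj a k \<noteq> (\<lambda>_. 0)}"
    have "a (- k) \<noteq> (\<lambda>_. 0)"
    proof
      assume "a (- k) = (\<lambda>_. 0)"
      then have "cp_star T cj a k = (\<lambda>_. 0)" by (simp add: cp_star_def cjs)
      then show False using k by simp
    qed
    then show "k \<in> uminus ` {i. a i \<noteq> (\<lambda>_. 0)}" by (intro image_eqI[of _ _ "- k"]) auto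
  qed
  then have "finite {k. cp_star T cj a k \<noteq> (\<lambda>_. 0)}" by (rule finite_subset) (use a(1) in simp)
  moreover have "loc_const (cp_star T cj a k)" for k
    unfolding cp_star_def by (rule loc_const_compose[OF a(2) Tpow_cont])
  ultimately show ?thesis by (simp add: cp_alg_def)
qed

abbreviation "sN n \<equiv> piN T cj E P n (s_el T E n)"

lemma sN_TC: "sN n \<in> TS.TC n"
  unfolding piN_s[OF cj_inv] by (rule TS.TC_I) auto

text \<open>In each tower the truncated shift fails to be an isometry only at the top floor, a
  defect of rank one. The total defect is the measure of the bases, at most that of
  \<open>E n\<close>.\<close>

lemma sN_isometry:
  "rk_dist (Rinf T cj M E P) (rmul (Rinf T cj M E P) (rstar (Rinf T cj M E P) (n, sN n)) (n, sN n)) (rone (Rinf T cj M E P))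
     \<le> measure M (E n)"
proof -
  have c: "(n, sN n) \<in> rcar RS.lim_alg" using sN_TC by (simp add: RS.lim_alg_sel)
  have c2: "rstar RS.lim_alg (n, sN n) \<in> rcar RS.lim_alg" using c by simp
  have "rk_dist RS.lim_alg (rmul RS.lim_alg (rstar RS.lim_alg (n, sN n)) (n, sN n)) (rone RS.lim_alg)
     = TS.trk n (\<lambda>W. ctrans cj (sN n W) * sN n W + (-1) \<cdot>\<^sub>m TS.tone n W)"
    using c c2 by (subst RS.dist_lft[of _ _ n]) auto
  also have "\<dots> \<le> (\<Sum>\<^sub>\<infinity>W\<in>VV n. measure M W * 1)"
  proof (rule TS.trk_le_wsum)
    have o: "TS.tone n \<in> TS.TC n" by (auto simp: TS.TC_def TS.tone_def)
    show "(\<lambda>W. ctrans cj (sN n W) * sN n W + (-1) \<cdot>\<^sub>m TS.tone n W) \<in> TS.TC n"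
      by (rule TS.TC_ops(1)[OF TS.TC_ops(2)[OF TS.TC_ops(4)[OF sN_TC sN_TC] sN_TC] TS.TC_ops(3)[OF o o]])
    show "(\<lambda>W. measure M W * 1) summable_on VV n" using TS.wt_summable by simp
    fix W assume W: "W \<in> VV n"
    let ?N = "wl n W"
    define S where "S = mat ?N ?N (\<lambda>(p,q). if p = Suc q then 1 else (0::'k))"
    have S: "S \<in> carrier_mat ?N ?N" by (simp add: S_def)
    have sW: "sN n W = S" using W by (simp add: piN_s[OF cj_inv] S_def)
    have ix: "(ctrans cj S * S) $$ (p,q) = (if Suc q < ?N \<and> p = q then 1 else 0)" if pq: "p < ?N" "q < ?N" for p q
    proof -
      have "(ctrans cj S * S) $$ (p,q) = (\<Sum>r\<in>{0..<?N}. cj (S $$ (r,p)) * S $$ (r,q))"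
        using S pq by (auto simp: scalar_prod_def)
      also have "\<dots> = (\<Sum>r\<in>{0..<?N}. if r = Suc q then (if p = q then 1 else 0) else 0)"
        by (rule sum.cong) (use pq in \<open>auto simp: S_def cjs\<close>)
      also have "\<dots> = (if Suc q < ?N \<and> p = q then 1 else 0)" by simp
      finally show ?thesis .
    qed
    have "mrank (ctrans cj S * S + (-1) \<cdot>\<^sub>m 1\<^sub>m ?N) \<le> card {?N - 1}"
    proof (rule mrank_le_card_cols[of _ _ ?N])
      show "ctrans cj S * S + (-1) \<cdot>\<^sub>m 1\<^sub>m ?N \<in> carrier_mat ?N ?N" using S by auto
      fix p q assume pq: "p < ?N" "q < ?N" "q \<notin> {?N - 1}"
      then have "Suc q < ?N" by auto
      then show "(ctrans cj S * S + (-1) \<cdot>\<^sub>m 1\<^sub>m ?N) $$ (p,q) = 0"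
        using S pq ix[OF pq(1,2)] by (simp del: index_mult_mat(1))
    qed simp
    then show "real (mrank (ctrans cj (sN n W) * sN n W + (-1) \<cdot>\<^sub>m TS.tone n W)) \<le> 1"
      using W by (simp add: sW TS.tone_def)
  qed
  also have "\<dots> = (\<Sum>\<^sub>\<infinity>W\<in>VV n. measure M W)" by simp
  also have "\<dots> \<le> measure M (E n)" by (rule infsum_le_finite_sums[OF TS.wt_summable sum_wt_le_E])
  finally show ?thesis unfolding Rinf_eq_lim_alg .
qed

lemma embed_star:
  assumes "x \<in> TS.TC n"
  shows "rk_embed (Rinf T cj M E P) (n, \<lambda>W. ctrans cj (x W)) = rstar RA.Cp (rk_embed (Rinf T cj M E P) (n, x))"
proof -
  have c: "(n, x) \<in> rcar (Rinf T cj M E P)" unfolding Rinf_eq_lim_alg using assms by (simp add: RS.lim_alg_sel)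
  have "rstar (Rinf T cj M E P) (n, x) = (n, \<lambda>W. ctrans cj (x W))" unfolding Rinf_eq_lim_alg by (simp add: RS.lim_alg_sel)
  then show ?thesis unfolding rk_embed_def using RA.Cp_star[OF RA.cau_const[OF c]] by simp
qed

text \<open>It suffices to treat monomials. A locally constant function has a finite level, where
  \<open>Phi\<close> is given by matrices and respects the involution exactly. For t, the limit of
  the truncated shifts shows that Phi(t) is an isometry; being invertible it is unitary, so its
  adjoint is the image of t^(-1).\<close>

lemma Phi_star_hom:
  fixes Phi :: "(int \<Rightarrow> 'x \<Rightarrow> 'k) \<Rightarrow> (nat \<Rightarrow> nat \<times> ('x set \<Rightarrow> 'k mat)) set"
  assumes into: "\<forall>a\<in>rcar CP. Phi a \<in> rcar (Rrk T cj M E P)"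
    and add: "\<forall>a\<in>rcar CP. \<forall>b\<in>rcar CP. Phi (radd CP a b) = radd (Rrk T cj M E P) (Phi a) (Phi b)"
    and mul: "\<forall>a\<in>rcar CP. \<forall>b\<in>rcar CP. Phi (rmul CP a b) = rmul (Rrk T cj M E P) (Phi a) (Phi b)"
    and one: "Phi (rone CP) = rone (Rrk T cj M E P)"
    and ext: "\<forall>n. \<forall>a\<in>An T cj P n. Phi a = rk_embed (Rinf T cj M E P) (n, piN T cj E P n a)"
    and t: "(\<lambda>n. rrk (Rrk T cj M E P) (radd (Rrk T cj M E P) (Phi cp_t)
                     (rsmul (Rrk T cj M E P) (-1) (rk_embed (Rinf T cj M E P) (n, sN n))))) \<longlonglongrightarrow> 0"
    and a: "a \<in> rcar CP"
  shows "Phi (rstar CP a) = rstar (Rrk T cj M E P) (Phi a)"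
proof -
  let ?R = "Rinf T cj M E P"
  let ?C = "RA.Cp"
  define H where "H b \<longleftrightarrow> Phi (cp_star T cj b) = rstar ?C (Phi b)" for b
  have pin: "Phi b \<in> rcar ?C" if "b \<in> rcar CP" for b using into that by (simp add: Rrk_def)
  have padd: "Phi (\<lambda>i x. b i x + c i x) = radd ?C (Phi b) (Phi c)" if "b \<in> rcar CP" "c \<in> rcar CP" for b c
    using add that by (simp add: Rrk_def cp_alg_def)
  have pmul: "Phi (cp_mul T b c) = rmul ?C (Phi b) (Phi c)" if "b \<in> rcar CP" "c \<in> rcar CP" for b c
    using mul that by (simp add: Rrk_def cp_alg_def)
  have one_mo: "rone CP = mo 0 (\<lambda>_. 1)" by (simp add: cp_alg_def mo_def)
  have pone: "Phi (mo 0 (\<lambda>_. 1)) = rone ?C" using one by (simp add: one_mo Rrk_def)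
  note SR = is_star_ringD[OF RA.Cp_star_ring]
  note R_assoc = SR(7) and R_one = SR(1-4) and R_star = SR(5,6)
  have lc1: "loc_const (\<lambda>_::'x. 1::'k)" by (rule loc_const_const)
  have star1: "cp_star T cj (mo i (\<lambda>_. 1)) = mo (- i) (\<lambda>_. 1)" for i unfolding cp_star_mo[of cj, OF cjs(4)] by (simp add: cjs)
  have Hmul: "H (cp_mul T b c)" if "b \<in> rcar CP" "c \<in> rcar CP" "H b" "H c"
    "cp_star T cj (cp_mul T b c) = cp_mul T (cp_star T cj c) (cp_star T cj b)" for b c
    using that pmul star_car R_star(2) pin by (simp add: H_def)
  have Hf: "H (mo 0 f)" if f: "loc_const f" for f
  proof -
    obtain n where n: "level_fun n f" using loc_const_level[OF f] ..
    have n': "level_fun n (\<lambda>x. cj (f x))" unfolding level_fun_def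
    proof (intro allI impI)
      fix u v assume "same n u v"
      then have "f u = f v" by (rule n[unfolded level_fun_def, rule_format])
      then show "cj (f u) = cj (f v)" by simp
    qed
    have st: "cp_star T cj (mo 0 f) = mo 0 (\<lambda>x. cj (f x))" unfolding cp_star_mo[of cj, OF cjs(4)] by (simp add: Tpow_simps)
    have TC: "piN T cj E P n (mo 0 f) \<in> TS.TC n" unfolding piN_fun[OF cj_inv n] by (rule TS.TC_I) auto
    have "piN T cj E P n (mo 0 (\<lambda>x. cj (f x))) = (\<lambda>W. ctrans cj (piN T cj E P n (mo 0 f) W))"
      unfolding piN_fun[OF cj_inv n] piN_fun[OF cj_inv n'] by (rule HOL.ext) (auto intro!: eq_matI simp: cjs)
    then show ?thesis unfolding H_def st
      using ext mo_level_in_An[OF cj_inv n] mo_level_in_An[OF cj_inv n'] embed_star[OF TC] by simp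
  qed
  have t_car: "cp_t \<in> rcar CP" "mo (- 1) (\<lambda>_. 1) \<in> rcar CP" unfolding cp_t_mo by (rule mo_car[OF lc1])+
  \<comment> \<open>Approximate a representative of Phi(t) by a truncated shift. The product
    estimate costs twice the distance, and \<open>sN_isometry\<close> adds the measure of
    \<open>E n\<close>; both tend to zero.\<close>
  have tt: "rmul ?C (rstar ?C (Phi cp_t)) (Phi cp_t) = rone ?C"
  proof -
    obtain s where s: "RA.cau s" "Phi cp_t = RA.cl s" using RA.Cp_cases[OF pin[OF t_car(1)]] by blast
    have sc: "s k \<in> rcar ?R" for k using RA.cau_car[OF s(1)] .
    have zc: "(n, sN n) \<in> rcar ?R" for n unfolding Rinf_eq_lim_alg using sN_TC by (simp add: RS.lim_alg_sel)
    define del where "del n = rrk ?C (radd ?C (Phi cp_t) (rsmul ?C (-1) (rk_embed ?R (n, sN n))))" for n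
    have del0: "del \<longlonglongrightarrow> 0" using t unfolding del_def Rrk_def .
    have lim: "(\<lambda>k. rk_dist ?R (s k) (n, sN n)) \<longlonglongrightarrow> del n" for n
    proof -
      have cz: "RA.cau (\<lambda>_. (n, sN n))" by (rule RA.cau_const[OF zc])
      have "del n = rrk ?C (RA.cl (\<lambda>k. radd ?R (s k) (rsmul ?R (-1) (n, sN n))))"
        unfolding del_def s(2) rk_embed_def RA.Cp_smul[OF cz] RA.Cp_add[OF s(1) RA.cau_smul[OF cz]] ..
      then show ?thesis using RA.Cp_rk[OF RA.cau_add[OF s(1) RA.cau_smul[OF cz]]] unfolding rk_dist_def by simp
    qed
    have "rk_equiv ?R (\<lambda>k. rmul ?R (rstar ?R (s k)) (s k)) (\<lambda>_. rone ?R)"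
      unfolding rk_equiv_def
    proof (rule LIMSEQ_I)
      fix e :: real assume e: "0 < e"
      have "\<forall>\<^sub>F n in sequentially. del n < e/4" using del0 by (rule order_tendstoD(2)) (use e in simp)
      moreover have "\<forall>\<^sub>F n in sequentially. measure M (E n) < e/4" using measure_E by (rule order_tendstoD(2)) (use e in simp)
      ultimately have "\<forall>\<^sub>F n in sequentially. del n < e/4 \<and> measure M (E n) < e/4" by (rule eventually_conj)
      then obtain n where n: "del n < e/4" "measure M (E n) < e/4" by (auto simp: eventually_sequentially)
      have "\<forall>\<^sub>F k in sequentially. rk_dist ?R (s k) (n, sN n) < e/4" using lim n(1) by (rule order_tendstoD(2))
      then obtain k0 where k0: "\<And>k. k \<ge> k0 \<Longrightarrow> rk_dist ?R (s k) (n, sN n) < e/4" by (auto simp: eventually_sequentially)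
      show "\<exists>no. \<forall>k\<ge>no. norm (rk_dist ?R (rmul ?R (rstar ?R (s k)) (s k)) (rone ?R) - 0) < e"
      proof (intro exI[of _ k0] allI impI)
        fix k assume k: "k0 \<le> k"
        let ?z = "(n, sN n)"
        note cs = RA.car_star[OF sc[of k]] and czs = RA.car_star[OF zc[of n]]
        note c1 = RA.car_mul[OF cs sc[of k]] and c2 = RA.car_mul[OF czs zc[of n]]
        have "rk_dist ?R (rmul ?R (rstar ?R (s k)) (s k)) (rmul ?R (rstar ?R ?z) ?z) \<le> 2 * rk_dist ?R (s k) ?z"
          using RA.d_mul[OF cs czs sc[of k] zc[of n]] RA.d_star[OF sc[of k] zc[of n]] by linarith
        then have "rk_dist ?R (rmul ?R (rstar ?R (s k)) (s k)) (rone ?R) < e"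
          using RA.d_tri[OF c1 c2 RA.car_one] sN_isometry[of n] n(2) k0[OF k] e by linarith
        then show "norm (rk_dist ?R (rmul ?R (rstar ?R (s k)) (s k)) (rone ?R) - 0) < e"
          using RA.d_ge0[OF c1 RA.car_one] by simp
      qed
    qed
    then show ?thesis unfolding s(2) RA.Cp_star[OF s(1)] RA.Cp_mul[OF RA.cau_star[OF s(1)] s(1)] RA.Cp_one
      using RA.cls_eq_iff[OF RA.cau_mul[OF RA.cau_star[OF s(1)] s(1)] RA.cau_const[OF RA.car_one]] by simp
  qed
  \<comment> \<open>The image of t^(-1) is a right inverse of Phi(t), and by \<open>tt\<close> the
    adjoint is a left inverse, so they coincide.\<close>
  have inv: "Phi (mo (- 1) (\<lambda>_. 1)) = rstar ?C (Phi cp_t)"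
  proof -
    let ?a = "Phi cp_t" and ?b = "Phi (mo (- 1) (\<lambda>_. 1))"
    have "cp_mul T cp_t (mo (- 1) (\<lambda>_. 1)) = (mo 0 (\<lambda>_. 1) :: int \<Rightarrow> 'x \<Rightarrow> 'k)" unfolding cp_t_mo cp_mul_mo_mo by simp
    then have ab: "rmul ?C ?a ?b = rone ?C" using pmul[OF t_car] pone by simp
    note ac = pin[OF t_car(1)] and bc = pin[OF t_car(2)]
    note sa = R_one(4)[OF ac]
    have "rstar ?C ?a = rmul ?C (rstar ?C ?a) (rmul ?C ?a ?b)" unfolding ab by (rule R_one(2)[OF sa, symmetric])
    also have "\<dots> = rmul ?C (rmul ?C (rstar ?C ?a) ?a) ?b" by (rule R_assoc[OF sa ac bc, symmetric])
    also have "\<dots> = ?b" unfolding tt by (rule R_one(1)[OF bc])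
    finally show ?thesis by simp
  qed
  have H1: "H (mo 1 (\<lambda>_. 1))" unfolding H_def star1 using inv by (simp add: cp_t_mo)
  have Hm1: "H (mo (- 1) (\<lambda>_. 1))" unfolding H_def star1 inv using R_one(3)[OF pin[OF t_car(1)]] by (simp add: cp_t_mo)
  have Hp: "H (mo (int n) (\<lambda>_. 1))" for n
  proof (induction n)
    case 0 then show ?case using Hf[OF lc1] by simp
  next
    case (Suc n)
    have e: "cp_mul T (mo (int n) (\<lambda>_. 1)) (mo 1 (\<lambda>_. 1)) = (mo (int (Suc n)) (\<lambda>_. 1) :: int \<Rightarrow> 'x \<Rightarrow> 'k)"
      unfolding cp_mul_mo_mo by (simp add: add.commute)
    have "H (cp_mul T (mo (int n) (\<lambda>_. 1)) (mo 1 (\<lambda>_. 1)))"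
      by (rule Hmul[OF mo_car[OF lc1] mo_car[OF lc1] Suc H1]) (unfold e star1 cp_mul_mo_mo, simp add: star1 algebra_simps)
    then show ?case unfolding e .
  qed
  have Hn: "H (mo (- int n) (\<lambda>_. 1))" for n
  proof (induction n)
    case 0 then show ?case using Hf[OF lc1] by simp
  next
    case (Suc n)
    have e: "cp_mul T (mo (- int n) (\<lambda>_. 1)) (mo (- 1) (\<lambda>_. 1)) = (mo (- int (Suc n)) (\<lambda>_. 1) :: int \<Rightarrow> 'x \<Rightarrow> 'k)"
      unfolding cp_mul_mo_mo by (simp add: algebra_simps)
    have "H (cp_mul T (mo (- int n) (\<lambda>_. 1)) (mo (- 1) (\<lambda>_. 1)))"
      by (rule Hmul[OF mo_car[OF lc1] mo_car[OF lc1] Suc Hm1]) (unfold e star1 cp_mul_mo_mo, simp add: star1 algebra_simps)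
    then show ?case unfolding e .
  qed
  have Hi: "H (mo i (\<lambda>_. 1))" for i
  proof (cases "0 \<le> i")
    case True then show ?thesis using Hp[of "nat i"] by simp
  next
    case False then show ?thesis using Hn[of "nat (- i)"] by simp
  qed
  have Hmo: "H (mo i f)" if f: "loc_const f" for i f
  proof -
    have e: "cp_mul T (mo 0 f) (mo i (\<lambda>_. 1)) = mo i f" unfolding cp_mul_mo_mo by simp
    have "H (cp_mul T (mo 0 f) (mo i (\<lambda>_. 1)))"
    proof (rule Hmul[OF mo_car[OF f] mo_car[OF lc1] Hf[OF f] Hi])
      show "cp_star T cj (cp_mul T (mo 0 f) (mo i (\<lambda>_. 1))) = cp_mul T (cp_star T cj (mo i (\<lambda>_. 1))) (cp_star T cj (mo 0 f))"
        unfolding e star1 unfolding cp_star_mo[of cj, OF cjs(4)] cp_mul_mo_mo by (simp add: Tpow_simps)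
    qed
    then show ?thesis unfolding e .
  qed
  have sup: "finite {i. a i \<noteq> (\<lambda>_. 0)}" and lc: "loc_const (a i)" for i using a by (auto simp: cp_alg_def)
  \<comment> \<open>Partial sums over a finite set of degrees; membership in the carrier is carried
    along because additivity of \<open>Phi\<close> is known only there.\<close>
  have "(\<lambda>i x. if i \<in> S then a i x else 0) \<in> rcar CP \<and> H (\<lambda>i x. if i \<in> S then a i x else 0)" if "finite S" for S
    using that
  proof (induction S rule: finite_induct)
    case empty
    have "(\<lambda>i x. if i \<in> {} then a i x else 0) = mo 0 (\<lambda>_. 0)" by (auto simp: mo_def)
    then show ?case using Hf[OF loc_const_const[of 0]] mo_car[OF loc_const_const[of 0]] by simp
  next
    case (insert j S)
    let ?b = "mo j (a j)" and ?c = "\<lambda>i x. if i \<in> S then a i x else 0"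
    have bc: "?b \<in> rcar CP" "?c \<in> rcar CP" "H ?b" "H ?c" using mo_car[OF lc] Hmo[OF lc] insert.IH by auto
    have e: "(\<lambda>i x. if i \<in> insert j S then a i x else 0) = (\<lambda>i x. ?b i x + ?c i x)"
      using insert.hyps by (auto simp: mo_def fun_eq_iff)
    have st: "cp_star T cj (\<lambda>i x. ?b i x + ?c i x) = (\<lambda>i x. cp_star T cj ?b i x + cp_star T cj ?c i x)"
      by (auto simp: cp_star_def cjs fun_eq_iff)
    have "Phi (cp_star T cj (\<lambda>i x. ?b i x + ?c i x)) = radd ?C (Phi (cp_star T cj ?b)) (Phi (cp_star T cj ?c))"
      unfolding st by (rule padd[OF star_car[OF bc(1)] star_car[OF bc(2)]])
    also have "\<dots> = radd ?C (rstar ?C (Phi ?b)) (rstar ?C (Phi ?c))" using bc(3,4) by (simp add: H_def)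
    also have "\<dots> = rstar ?C (radd ?C (Phi ?b) (Phi ?c))" by (rule R_star(1)[OF pin[OF bc(1)] pin[OF bc(2)], symmetric])
    also have "radd ?C (Phi ?b) (Phi ?c) = Phi (\<lambda>i x. ?b i x + ?c i x)" by (rule padd[OF bc(1,2), symmetric])
    finally have "H (\<lambda>i x. ?b i x + ?c i x)" unfolding H_def .
    moreover have "(\<lambda>i x. if i \<in> insert j S then a i x else 0) \<in> rcar CP"
    proof -
      have "{i. (\<lambda>x. if i \<in> insert j S then a i x else 0) \<noteq> (\<lambda>_. 0)} \<subseteq> insert j S" by auto
      then have "finite {i. (\<lambda>x. if i \<in> insert j S then a i x else 0) \<noteq> (\<lambda>_. 0)}" by (rule finite_subset) (use insert.hyps in simp)
      moreover have "loc_const (\<lambda>x. if i \<in> insert j S then a i x else 0)" for i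
        using lc[of i] loc_const_const[of 0] by (cases "i \<in> insert j S") simp_all
      ultimately show ?thesis by (simp add: cp_alg_def)
    qed
    ultimately show ?case unfolding e by simp
  qed
  from this[OF sup] have "H (\<lambda>i x. if i \<in> {i. a i \<noteq> (\<lambda>_. 0)} then a i x else 0)" by simp
  also have "(\<lambda>i x. if i \<in> {i. a i \<noteq> (\<lambda>_. 0)} then a i x else 0) = a"
  proof (intro HOL.ext)
    fix i x show "(if i \<in> {i. a i \<noteq> (\<lambda>_. 0)} then a i x else 0) = a i x" by (cases "a i = (\<lambda>_. 0)") simp_all
  qed
  finally show ?thesis unfolding H_def by (simp add: cp_alg_def Rrk_def)
qed

end

theorem theorem4p9:
  fixes T :: "'x::metric_space \<Rightarrow> 'x"
    and cj :: "'k::field \<Rightarrow> 'k"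
    and M :: "'x measure"
    and y :: 'x
    and E :: "nat \<Rightarrow> 'x set"
    and P :: "nat \<Rightarrow> 'x set set"
    and Phi :: "(int \<Rightarrow> 'x \<Rightarrow> 'k) \<Rightarrow> (nat \<Rightarrow> nat \<times> ('x set \<Rightarrow> 'k mat)) set"
  assumes X_compact: "compact (UNIV :: 'x set)"
    and X_infinite: "infinite (UNIV :: 'x set)"
    and X_tot_disc: "\<forall>x::'x. connected_component_set UNIV x = {x}"
    and T_homeo: "\<exists>T'. homeomorphism UNIV UNIV T T'"
    and cj_inv: "field_involution cj"
    and M_borel: "sets M = sets borel"
    and M_prob: "prob_space M"
    and M_full: "\<forall>U. open U \<and> U \<noteq> {} \<longrightarrow> measure M U > 0"
    and M_inv: "\<forall>A\<in>sets borel. measure M (T -` A) = measure M A"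
    and M_erg: "\<forall>A\<in>sets borel. T -` A = A \<longrightarrow> measure M A = 0 \<or> measure M A = 1"
    and E_clopen: "\<forall>n. clopen_set (E n)"
    and E_dec: "\<forall>n. E (Suc n) \<subseteq> E n"
    and E_int: "(\<Inter>n. E n) = {y}"
    and P_fin: "\<forall>n. finite (P n)"
    and P_clopen: "\<forall>n. \<forall>Z\<in>P n. Z \<noteq> {} \<and> clopen_set Z"
    and P_disj: "\<forall>n. \<forall>Z\<in>P n. \<forall>Z'\<in>P n. Z \<noteq> Z' \<longrightarrow> Z \<inter> Z' = {}"
    and P_cover: "\<forall>n. \<Union>(P n) = UNIV - E n"
    and P_refine: "\<forall>n. \<forall>Z\<in>insert (E (Suc n)) (P (Suc n)). \<exists>Z'\<in>insert (E n) (P n). Z \<subseteq> Z'"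
    and P_gen: "generate_topology (\<Union>n. insert (E n) (P n)) = open"
    and Phi_into: "\<forall>a\<in>rcar (cp_alg T cj). Phi a \<in> rcar (Rrk T cj M E P)"
    and Phi_add: "\<forall>a\<in>rcar (cp_alg T cj). \<forall>b\<in>rcar (cp_alg T cj).
                    Phi (radd (cp_alg T cj) a b) = radd (Rrk T cj M E P) (Phi a) (Phi b)"
    and Phi_mul: "\<forall>a\<in>rcar (cp_alg T cj). \<forall>b\<in>rcar (cp_alg T cj).
                    Phi (rmul (cp_alg T cj) a b) = rmul (Rrk T cj M E P) (Phi a) (Phi b)"
    and Phi_one: "Phi (rone (cp_alg T cj)) = rone (Rrk T cj M E P)"
    and Phi_ext: "\<forall>n. \<forall>a\<in>An T cj P n. Phi a = rk_embed (Rinf T cj M E P) (n, piN T cj E P n a)"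
    and Phi_t: "(\<lambda>n. rrk (Rrk T cj M E P)
                   (radd (Rrk T cj M E P) (Phi cp_t)
                     (rsmul (Rrk T cj M E P) (-1)
                       (rk_embed (Rinf T cj M E P) (n, piN T cj E P n (s_el T E n))))))
                 \<longlonglongrightarrow> 0"
  shows "kalg_iso (Rrk T cj M E P) (MK cj) \<and>
         (pos_def_inv cj \<longrightarrow>
            star_regular (Rrk T cj M E P) \<and>
            (\<forall>a\<in>rcar (cp_alg T cj). Phi (rstar (cp_alg T cj) a) = rstar (Rrk T cj M E P) (Phi a)) \<and>
            star_kalg_iso (Rrk T cj M E P) (MK cj))"
proof -
  have "cantor_algebra T M y E P cj"
    by (intro cantor_algebra.intro cantor_system.intro cantor_algebra_axioms.intro; fact)
  then interpret cantor_algebra T M y E P cj .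
  show ?thesis
  proof (intro conjI impI ballI)
    show "kalg_iso (Rrk T cj M E P) (MK cj)" by (rule star_kalg_iso_imp_kalg_iso[OF iso_MK])
    show "star_kalg_iso (Rrk T cj M E P) (MK cj)" by (rule iso_MK)
    show "star_regular (Rrk T cj M E P)" if "pos_def_inv cj" by (rule star_regular_Rrk[OF that])
    show "Phi (rstar (cp_alg T cj) a) = rstar (Rrk T cj M E P) (Phi a)" if "a \<in> rcar (cp_alg T cj)" for a
      by (rule Phi_star_hom[OF Phi_into Phi_add Phi_mul Phi_one Phi_ext Phi_t that])
  qed
qed

end
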